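(* Suppose the semigroup $S$ embeds into a group $G$. Then $\Lambda_0:C^*_0(I_l(S))\to C^*_{r,0}(I_l(S))$ is an isomorphism if and only if the Fell bundle $\{B_g\}_{g\in G}$ over $G$ given by $$B_g=\overline{\mathrm{span}\{\lambda_{t_1}^*\lambda_{s_1}\cdots\lambda_{t_n}^*\lambda_{s_n}: n\in\mathbb{N},\ s_i,t_i\in S,\ t_1^{-1}s_1\cdots t_n^{-1}s_n=g \text{ in } G\}}\subset C^*_0(I_l(S))$$ is amenable.
   Context: A semigroup means a set with associative product and identity element $1$; homomorphisms preserve identities. $S$ is viewed as a subsemigroup of the discrete group $G$. For $s\in S$ let $\lambda_s:S\to sS$, $\lambda_s(t)=st$. $I(S)$ is the inverse semigroup of all partially defined bijections of $S$ (product $fg$ is composition on $g^{-1}(\mathrm{dom} f)$; $f^*$ is the inverse map; the empty map is the zero $0$). $I_l(S)$ is the inverse subsemigroup of $I(S)$ generated by $\{\lambda_s\}_{s\in S}$. For an inverse semigroup $P$, $C^*(P)$ is the enveloping $C^*$-algebra of the convolution algebra $\ell^1(P)$, universal for representations of $P$ by partial isometries. With canonical basis $\{\delta_q\}_{q\in P}$ of $\ell^2(P)$, $\Lambda(p)\delta_q=\delta_{pq}$ if $p^*pq=q$ and $0$ otherwise; $C^*_r(P)$ is the closed span of $\Lambda(P)$ in $B(\ell^2(P))$, and $\Lambda$ extends to $\Lambda:C^*(P)\to C^*_r(P)$. For $P=I_l(S)$: if the empty map $0$ is in $P$, $C^*_0(P)=C^*(P)/\mathbb{C}0$ and $C^*_{r,0}(P)=C^*_r(P)/\mathbb{C}\Lambda(0)$;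 otherwise $C^*_0(P)=C^*(P)$ and $C^*_{r,0}(P)=C^*_r(P)$. $\Lambda_0$ is the $*$-homomorphism induced by $\Lambda$. Elements of $I_l(S)$ are identified with their images in $C^*_0(I_l(S))$. With the multiplication and involution of $C^*_0(I_l(S))$, $\{B_g\}_{g\in G}$ is a Fell bundle over $G$. A Fell bundle over a discrete group is amenable (in the sense of Exel) if the canonical map from its full cross-sectional $C^*$-algebra onto its reduced cross-sectional $C^*$-algebra is an isomorphism. *)

theory Defs
  imports "HOL-Analysis.Infinite_Sum" "HOL-Algebra.QuotRing" "HOL-Algebra.Module"
begin

section \<open>Normed star-algebras with explicit carrier\<close>

text \<open>
  The C*-algebras below depend on \<open>S\<close> and \<open>G\<close>, so they are records with a carrier, built on the
  ring and module records of HOL-Algebra. All algebras that occur are unital.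
\<close>

record 'a star_algebra = "(complex, 'a) module" +
  star :: "'a \<Rightarrow> 'a"
  nrm :: "'a \<Rightarrow> real"

definition complex_alg :: "complex star_algebra" where
  "complex_alg = \<lparr>carrier = UNIV, mult = (*), one = 1, zero = 0, add = (+), smult = (*),
     star = cnj, nrm = cmod\<rparr>"

definition converges :: "'a star_algebra \<Rightarrow> (nat \<Rightarrow> 'a) \<Rightarrow> 'a \<Rightarrow> bool" where
  "converges A x l \<longleftrightarrow> (\<lambda>n. nrm A (x n \<ominus>\<^bsub>A\<^esub> l)) \<longlonglongrightarrow> 0"

text \<open>Unconditional convergence of a family, as in \<^const>\<open>has_sum\<close>.\<close>

definition has_sum_in :: "'a star_algebra \<Rightarrow> ('i \<Rightarrow> 'a) \<Rightarrow> 'i set \<Rightarrow> 'a \<Rightarrow> bool" where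
  "has_sum_in A f I s \<longleftrightarrow> s \<in> carrier A \<and>
     ((\<lambda>F. nrm A (finsum A f F \<ominus>\<^bsub>A\<^esub> s)) \<longlongrightarrow> 0) (finite_subsets_at_top I)"

definition infsum_in :: "'a star_algebra \<Rightarrow> ('i \<Rightarrow> 'a) \<Rightarrow> 'i set \<Rightarrow> 'a" where
  "infsum_in A f I = (THE s. has_sum_in A f I s)"

inductive_set lin_span :: "'a star_algebra \<Rightarrow> 'a set \<Rightarrow> 'a set" for A X where
  zero: "\<zero>\<^bsub>A\<^esub> \<in> lin_span A X"
| base: "x \<in> X \<Longrightarrow> x \<in> lin_span A X"
| add: "x \<in> lin_span A X \<Longrightarrow> y \<in> lin_span A X \<Longrightarrow> x \<oplus>\<^bsub>A\<^esub> y \<in> lin_span A X"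
| smult: "x \<in> lin_span A X \<Longrightarrow> c \<odot>\<^bsub>A\<^esub> x \<in> lin_span A X"

definition closed_span :: "'a star_algebra \<Rightarrow> 'a set \<Rightarrow> 'a set" where
  "closed_span A X =
     {a \<in> carrier A. \<forall>e>0. \<exists>x \<in> lin_span A X. nrm A (a \<ominus>\<^bsub>A\<^esub> x) < e}"

definition star_iso :: "'a star_algebra \<Rightarrow> 'b star_algebra \<Rightarrow> ('a \<Rightarrow> 'b) \<Rightarrow> bool" where
  "star_iso A C h \<longleftrightarrow> h \<in> ring_iso A C \<and>
     (\<forall>c. \<forall>a \<in> carrier A. h (c \<odot>\<^bsub>A\<^esub> a) = c \<odot>\<^bsub>C\<^esub> h a) \<and>
     (\<forall>a \<in> carrier A. h (star A a) = star C (h a))"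

definition quot :: "'a star_algebra \<Rightarrow> 'a set \<Rightarrow> 'a set star_algebra" where
  "quot A J = \<lparr>carrier = carrier (A Quot J), mult = mult (A Quot J), one = one (A Quot J),
     zero = zero (A Quot J), add = add (A Quot J),
     smult = (\<lambda>c X. \<Union>x\<in>X. J +>\<^bsub>A\<^esub> (c \<odot>\<^bsub>A\<^esub> x)),
     star = (\<lambda>X. \<Union>x\<in>X. J +>\<^bsub>A\<^esub> star A x),
     nrm = (\<lambda>X. Inf (nrm A ` X))\<rparr>"

section \<open>Completion and enveloping C*-algebra\<close>

text \<open>
  The Hausdorff completion of a seminormed star-algebra is the algebra of Cauchy sequences,
  seminormed by the limit of the seminorms, modulo the null sequences.
\<close>

definition cauchy_seqs :: "'a star_algebra \<Rightarrow> (nat \<Rightarrow> 'a) star_algebra" where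
  "cauchy_seqs A = \<lparr>
     carrier = {x. (\<forall>n. x n \<in> carrier A) \<and>
       (\<forall>e>0. \<exists>N. \<forall>m\<ge>N. \<forall>n\<ge>N. nrm A (x m \<ominus>\<^bsub>A\<^esub> x n) < e)},
     mult = (\<lambda>x y n. x n \<otimes>\<^bsub>A\<^esub> y n), one = (\<lambda>n. \<one>\<^bsub>A\<^esub>), zero = (\<lambda>n. \<zero>\<^bsub>A\<^esub>),
     add = (\<lambda>x y n. x n \<oplus>\<^bsub>A\<^esub> y n), smult = (\<lambda>c x n. c \<odot>\<^bsub>A\<^esub> x n),
     star = (\<lambda>x n. star A (x n)), nrm = (\<lambda>x. lim (\<lambda>n. nrm A (x n)))\<rparr>"

definition null_seqs :: "'a star_algebra \<Rightarrow> (nat \<Rightarrow> 'a) set" where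
  "null_seqs A = {x \<in> carrier (cauchy_seqs A). (\<lambda>n. nrm A (x n)) \<longlonglongrightarrow> 0}"

definition completion :: "'a star_algebra \<Rightarrow> (nat \<Rightarrow> 'a) set star_algebra" where
  "completion A = quot (cauchy_seqs A) (null_seqs A)"

definition to_completion :: "'a star_algebra \<Rightarrow> 'a \<Rightarrow> (nat \<Rightarrow> 'a) set" where
  "to_completion A a = null_seqs A +>\<^bsub>cauchy_seqs A\<^esub> (\<lambda>n. a)"

definition cstar_seminorm :: "'a star_algebra \<Rightarrow> ('a \<Rightarrow> real) \<Rightarrow> bool" where
  "cstar_seminorm A p \<longleftrightarrow> (\<forall>a \<in> carrier A. \<forall>b \<in> carrier A. \<forall>c.
     0 \<le> p a \<and> p (a \<oplus>\<^bsub>A\<^esub> b) \<le> p a + p b \<and> p (c \<odot>\<^bsub>A\<^esub> a) = cmod c * p a \<and>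
     p (a \<otimes>\<^bsub>A\<^esub> b) \<le> p a * p b \<and> p (star A a \<otimes>\<^bsub>A\<^esub> a) = (p a)\<^sup>2)"

text \<open>
  The bound \<open>p \<le> nrm A\<close> is automatic on a Banach star-algebra with isometric involution and on
  the algebra of finitely supported sections of a Fell bundle with its \<open>\<ell>\<^sup>1\<close>-norm.
  As C*-seminorms are the norms pulled back along star-homomorphisms to C*-algebras, completing
  for the largest one gives the universal C*-algebra.
\<close>

definition universal_norm :: "'a star_algebra \<Rightarrow> 'a \<Rightarrow> real" where
  "universal_norm A a =
     Sup {p a |p. cstar_seminorm A p \<and> (\<forall>x \<in> carrier A. p x \<le> nrm A x)}"

definition envelope :: "'a star_algebra \<Rightarrow> (nat \<Rightarrow> 'a) set star_algebra" where
  "envelope A = completion (A\<lparr>nrm := universal_norm A\<rparr>)"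

definition to_envelope :: "'a star_algebra \<Rightarrow> 'a \<Rightarrow> (nat \<Rightarrow> 'a) set" where
  "to_envelope A = to_completion (A\<lparr>nrm := universal_norm A\<rparr>)"

text \<open>
  Continuous extension to \<^term>\<open>envelope A\<close> of a star-homomorphism \<open>h\<close> from \<open>A\<close> to a C*-algebra
  \<open>C\<close>: the class of a Cauchy sequence \<open>x\<close> is sent to the limit of \<open>h (x n)\<close>.
\<close>

definition extend_hom :: "'b star_algebra \<Rightarrow> ('a \<Rightarrow> 'b) \<Rightarrow> (nat \<Rightarrow> 'a) set \<Rightarrow> 'b" where
  "extend_hom C h X = (THE T. T \<in> carrier C \<and> (\<forall>x\<in>X. converges C (\<lambda>n. h (x n)) T))"

section \<open>Hilbert modules of square-summable sections\<close>

text \<open>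
  For a family of closed subspaces \<open>B i\<close> of a C*-algebra \<open>A\<close>, the sections \<open>\<xi>\<close> for which the sum of
  \<open>\<xi>(i)* \<xi>(i)\<close> converges unconditionally. With \<^const>\<open>complex_alg\<close> this is the Hilbert space
  \<open>\<ell>\<^sup>2(I)\<close>; for a Fell bundle it is Exel's right Hilbert module over the unit fibre.
  Inner products are conjugate-linear in the first variable.
\<close>

definition ell2 :: "'a star_algebra \<Rightarrow> 'i set \<Rightarrow> ('i \<Rightarrow> 'a set) \<Rightarrow> ('i \<Rightarrow> 'a) set" where
  "ell2 A I B = {\<xi>. (\<forall>i\<in>I. \<xi> i \<in> B i) \<and> (\<forall>i. i \<notin> I \<longrightarrow> \<xi> i = \<zero>\<^bsub>A\<^esub>) \<and>
     (\<exists>s. has_sum_in A (\<lambda>i. star A (\<xi> i) \<otimes>\<^bsub>A\<^esub> \<xi> i) I s)}"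

definition ell2_inner :: "'a star_algebra \<Rightarrow> 'i set \<Rightarrow> ('i \<Rightarrow> 'a) \<Rightarrow> ('i \<Rightarrow> 'a) \<Rightarrow> 'a" where
  "ell2_inner A I \<xi> \<eta> = infsum_in A (\<lambda>i. star A (\<xi> i) \<otimes>\<^bsub>A\<^esub> \<eta> i) I"

definition ell2_norm :: "'a star_algebra \<Rightarrow> 'i set \<Rightarrow> ('i \<Rightarrow> 'a) \<Rightarrow> real" where
  "ell2_norm A I \<xi> = sqrt (nrm A (ell2_inner A I \<xi> \<xi>))"

definition is_adjoint :: "'a star_algebra \<Rightarrow> 'i set \<Rightarrow> ('i \<Rightarrow> 'a set) \<Rightarrow>
    (('i \<Rightarrow> 'a) \<Rightarrow> ('i \<Rightarrow> 'a)) \<Rightarrow> (('i \<Rightarrow> 'a) \<Rightarrow> ('i \<Rightarrow> 'a)) \<Rightarrow> bool" where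
  "is_adjoint A I B T T' \<longleftrightarrow> T' \<in> ell2 A I B \<rightarrow>\<^sub>E ell2 A I B \<and>
     (\<forall>\<xi> \<in> ell2 A I B. \<forall>\<eta> \<in> ell2 A I B. ell2_inner A I (T \<xi>) \<eta> = ell2_inner A I \<xi> (T' \<eta>))"

definition bounded_linear_on :: "'a star_algebra \<Rightarrow> 'i set \<Rightarrow> ('i \<Rightarrow> 'a set) \<Rightarrow>
    (('i \<Rightarrow> 'a) \<Rightarrow> ('i \<Rightarrow> 'a)) \<Rightarrow> bool" where
  "bounded_linear_on A I B T \<longleftrightarrow>
     (\<forall>\<xi> \<in> ell2 A I B. \<forall>\<eta> \<in> ell2 A I B.
        T (\<lambda>i. \<xi> i \<oplus>\<^bsub>A\<^esub> \<eta> i) = (\<lambda>i. T \<xi> i \<oplus>\<^bsub>A\<^esub> T \<eta> i)) \<and>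
     (\<forall>c. \<forall>\<xi> \<in> ell2 A I B. T (\<lambda>i. c \<odot>\<^bsub>A\<^esub> \<xi> i) = (\<lambda>i. c \<odot>\<^bsub>A\<^esub> T \<xi> i)) \<and>
     (\<exists>K. \<forall>\<xi> \<in> ell2 A I B. ell2_norm A I (T \<xi>) \<le> K * ell2_norm A I \<xi>)"

text \<open>
  The C*-algebra of adjointable operators. On a Hilbert space every bounded operator is adjointable.
\<close>

definition operators :: "'a star_algebra \<Rightarrow> 'i set \<Rightarrow> ('i \<Rightarrow> 'a set) \<Rightarrow>
    (('i \<Rightarrow> 'a) \<Rightarrow> ('i \<Rightarrow> 'a)) star_algebra" where
  "operators A I B = \<lparr>
     carrier = {T \<in> ell2 A I B \<rightarrow>\<^sub>E ell2 A I B.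
       bounded_linear_on A I B T \<and> (\<exists>T'. is_adjoint A I B T T')},
     mult = (\<lambda>T U. \<lambda>\<xi> \<in> ell2 A I B. T (U \<xi>)),
     one = (\<lambda>\<xi> \<in> ell2 A I B. \<xi>),
     zero = (\<lambda>\<xi> \<in> ell2 A I B. (\<lambda>i. \<zero>\<^bsub>A\<^esub>)),
     add = (\<lambda>T U. \<lambda>\<xi> \<in> ell2 A I B. (\<lambda>i. T \<xi> i \<oplus>\<^bsub>A\<^esub> U \<xi> i)),
     smult = (\<lambda>c T. \<lambda>\<xi> \<in> ell2 A I B. (\<lambda>i. c \<odot>\<^bsub>A\<^esub> T \<xi> i)),
     star = (\<lambda>T. THE T'. is_adjoint A I B T T'),
     nrm = (\<lambda>T. Sup {ell2_norm A I (T \<xi>) |\<xi>. \<xi> \<in> ell2 A I B \<and> ell2_norm A I \<xi> \<le> 1})\<rparr>"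

section \<open>C*-algebras of inverse semigroups\<close>

record 'p inverse_semigroup = "'p monoid" +
  sinv :: "'p \<Rightarrow> 'p"

definition delta :: "'p \<Rightarrow> 'p \<Rightarrow> complex" where
  "delta p = (\<lambda>q. if q = p then 1 else 0)"

definition ell1 :: "'p inverse_semigroup \<Rightarrow> ('p \<Rightarrow> complex) star_algebra" where
  "ell1 P = \<lparr>
     carrier = {f. (\<forall>p. p \<notin> carrier P \<longrightarrow> f p = 0) \<and> f abs_summable_on carrier P},
     mult = (\<lambda>f h r. \<Sum>\<^sub>\<infinity>(p, q) \<in> {(p, q) \<in> carrier P \<times> carrier P. p \<otimes>\<^bsub>P\<^esub> q = r}. f p * h q),
     one = delta \<one>\<^bsub>P\<^esub>, zero = (\<lambda>p. 0), add = (\<lambda>f h p. f p + h p),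
     smult = (\<lambda>c f p. c * f p),
     star = (\<lambda>f p. if p \<in> carrier P then cnj (f (sinv P p)) else 0),
     nrm = (\<lambda>f. \<Sum>\<^sub>\<infinity>p \<in> carrier P. cmod (f p))\<rparr>"

definition cstar :: "'p inverse_semigroup \<Rightarrow> (nat \<Rightarrow> 'p \<Rightarrow> complex) set star_algebra" where
  "cstar P = envelope (ell1 P)"

definition hilb :: "'p inverse_semigroup \<Rightarrow> ('p \<Rightarrow> complex) set" where
  "hilb P = ell2 complex_alg (carrier P) (\<lambda>_. UNIV)"

definition B_hilb :: "'p inverse_semigroup \<Rightarrow>
    (('p \<Rightarrow> complex) \<Rightarrow> ('p \<Rightarrow> complex)) star_algebra" where
  "B_hilb P = operators complex_alg (carrier P) (\<lambda>_. UNIV)"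

text \<open>
  The coordinate at \<open>r\<close> of the sum of \<open>\<xi>(q) \<Lambda>(p) \<delta>\<^sub>q\<close> over \<open>q\<close>; at most one \<open>q\<close> contributes,
  namely \<open>q = p* r\<close>.
\<close>

definition Lam :: "'p inverse_semigroup \<Rightarrow> 'p \<Rightarrow> ('p \<Rightarrow> complex) \<Rightarrow> ('p \<Rightarrow> complex)" where
  "Lam P p = (\<lambda>\<xi> \<in> hilb P. (\<lambda>r.
     \<Sum>q \<in> {q \<in> carrier P. sinv P p \<otimes>\<^bsub>P\<^esub> p \<otimes>\<^bsub>P\<^esub> q = q \<and> p \<otimes>\<^bsub>P\<^esub> q = r}. \<xi> q))"

lemma Lam_delta:
  assumes "monoid P" "p \<in> carrier P" "sinv P p \<in> carrier P" "q \<in> carrier P" "delta q \<in> hilb P"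
  shows "Lam P p (delta q) =
    (if sinv P p \<otimes>\<^bsub>P\<^esub> p \<otimes>\<^bsub>P\<^esub> q = q then delta (p \<otimes>\<^bsub>P\<^esub> q) else (\<lambda>r. 0))"
proof -
  interpret monoid P by fact
  let ?Q = "\<lambda>r. {q' \<in> carrier P. sinv P p \<otimes>\<^bsub>P\<^esub> p \<otimes>\<^bsub>P\<^esub> q' = q' \<and> p \<otimes>\<^bsub>P\<^esub> q' = r}"
  have "?Q r \<subseteq> {sinv P p \<otimes>\<^bsub>P\<^esub> r}" for r
    using assms by (auto simp: m_assoc)
  then have fin: "finite (?Q r)" for r
    by (meson finite.emptyI finite.insertI finite_subset)
  have "(\<Sum>q' \<in> ?Q r. delta q q') = (if q \<in> ?Q r then 1 else 0)" for r
    unfolding delta_def using fin[of r] by (rule sum.delta)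
  then show ?thesis
    using assms by (auto simp: Lam_def delta_def fun_eq_iff)
qed

definition Lam_ell1 :: "'p inverse_semigroup \<Rightarrow>
    ('p \<Rightarrow> complex) \<Rightarrow> ('p \<Rightarrow> complex) \<Rightarrow> ('p \<Rightarrow> complex)" where
  "Lam_ell1 P f = (\<lambda>\<xi> \<in> hilb P. (\<lambda>r. \<Sum>\<^sub>\<infinity>p \<in> carrier P. f p * Lam P p \<xi> r))"

definition cstar_r :: "'p inverse_semigroup \<Rightarrow>
    (('p \<Rightarrow> complex) \<Rightarrow> ('p \<Rightarrow> complex)) star_algebra" where
  "cstar_r P = (B_hilb P)\<lparr>carrier := closed_span (B_hilb P) (Lam P ` carrier P)\<rparr>"

definition Lambda :: "'p inverse_semigroup \<Rightarrow> (nat \<Rightarrow> 'p \<Rightarrow> complex) set \<Rightarrow>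
    (('p \<Rightarrow> complex) \<Rightarrow> ('p \<Rightarrow> complex))" where
  "Lambda P = extend_hom (cstar_r P) (Lam_ell1 P)"

section \<open>The left inverse hull of a semigroup\<close>

definition left_mult :: "('a, 'm) monoid_scheme \<Rightarrow> 'a \<Rightarrow> ('a \<rightharpoonup> 'a)" where
  "left_mult S s = (\<lambda>t. if t \<in> carrier S then Some (s \<otimes>\<^bsub>S\<^esub> t) else None)"

definition inv_map :: "('a \<rightharpoonup> 'a) \<Rightarrow> ('a \<rightharpoonup> 'a)" where
  "inv_map f = (\<lambda>y. if y \<in> ran f then Some (THE x. f x = Some y) else None)"

inductive_set left_hull :: "('a, 'm) monoid_scheme \<Rightarrow> ('a \<rightharpoonup> 'a) set" for S where
  gen: "s \<in> carrier S \<Longrightarrow> left_mult S s \<in> left_hull S"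
| prod: "f \<in> left_hull S \<Longrightarrow> g \<in> left_hull S \<Longrightarrow> f \<circ>\<^sub>m g \<in> left_hull S"
| inv: "f \<in> left_hull S \<Longrightarrow> inv_map f \<in> left_hull S"

definition I_l :: "('a, 'm) monoid_scheme \<Rightarrow> ('a \<rightharpoonup> 'a) inverse_semigroup" where
  "I_l S = \<lparr>carrier = left_hull S, mult = (\<circ>\<^sub>m), one = left_mult S \<one>\<^bsub>S\<^esub>, sinv = inv_map\<rparr>"

text \<open>
  The zero that is divided out is the empty map, and not any zero element of the semigroup: for
  trivial \<open>S\<close> the identity is a zero of \<^term>\<open>I_l S\<close>. If the empty map does not occur, the quotient
  is taken by the zero ideal, so that both cases have the same type.
\<close>

definition zero_ideal :: "('a \<rightharpoonup> 'a) inverse_semigroup \<Rightarrow>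
    (nat \<Rightarrow> ('a \<rightharpoonup> 'a) \<Rightarrow> complex) set set" where
  "zero_ideal P = (if Map.empty \<in> carrier P
     then {c \<odot>\<^bsub>cstar P\<^esub> to_envelope (ell1 P) (delta Map.empty) |c. True}
     else {\<zero>\<^bsub>cstar P\<^esub>})"

definition zero_ideal_r :: "('a \<rightharpoonup> 'a) inverse_semigroup \<Rightarrow>
    ((('a \<rightharpoonup> 'a) \<Rightarrow> complex) \<Rightarrow> (('a \<rightharpoonup> 'a) \<Rightarrow> complex)) set" where
  "zero_ideal_r P = (if Map.empty \<in> carrier P
     then {c \<odot>\<^bsub>cstar_r P\<^esub> Lam P Map.empty |c. True}
     else {\<zero>\<^bsub>cstar_r P\<^esub>})"

definition cstar0 :: "('a \<rightharpoonup> 'a) inverse_semigroup \<Rightarrow>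
    (nat \<Rightarrow> ('a \<rightharpoonup> 'a) \<Rightarrow> complex) set set star_algebra" where
  "cstar0 P = quot (cstar P) (zero_ideal P)"

definition cstar_r0 :: "('a \<rightharpoonup> 'a) inverse_semigroup \<Rightarrow>
    ((('a \<rightharpoonup> 'a) \<Rightarrow> complex) \<Rightarrow> (('a \<rightharpoonup> 'a) \<Rightarrow> complex)) set star_algebra" where
  "cstar_r0 P = quot (cstar_r P) (zero_ideal_r P)"

definition Lambda0 :: "('a \<rightharpoonup> 'a) inverse_semigroup \<Rightarrow>
    (nat \<Rightarrow> ('a \<rightharpoonup> 'a) \<Rightarrow> complex) set set \<Rightarrow>
    ((('a \<rightharpoonup> 'a) \<Rightarrow> complex) \<Rightarrow> (('a \<rightharpoonup> 'a) \<Rightarrow> complex)) set" where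
  "Lambda0 P X = (\<Union>x\<in>X. zero_ideal_r P +>\<^bsub>cstar_r P\<^esub> Lambda P x)"

definition to_cstar0 :: "('a \<rightharpoonup> 'a) inverse_semigroup \<Rightarrow> ('a \<rightharpoonup> 'a) \<Rightarrow>
    (nat \<Rightarrow> ('a \<rightharpoonup> 'a) \<Rightarrow> complex) set set" where
  "to_cstar0 P p = zero_ideal P +>\<^bsub>cstar P\<^esub> to_envelope (ell1 P) (delta p)"

section \<open>Fell bundles\<close>

text \<open>
  A Fell bundle is given here as a family of closed subspaces \<open>B g\<close> of a C*-algebra \<open>A\<close>,
  with \<open>B g B h \<subseteq> B (g h)\<close> and \<open>(B g)* = B (g\<^sup>-\<^sup>1)\<close>, whose operations are those of \<open>A\<close>, and with
  the unit of \<open>A\<close> in the unit fibre.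
\<close>

definition conv :: "'a star_algebra \<Rightarrow> ('g, 'n) monoid_scheme \<Rightarrow>
    ('g \<Rightarrow> 'a) \<Rightarrow> ('g \<Rightarrow> 'a) \<Rightarrow> ('g \<Rightarrow> 'a)" where
  "conv A G f \<xi> = (\<lambda>g. if g \<in> carrier G
     then \<Oplus>\<^bsub>A\<^esub>k \<in> {k \<in> carrier G. f k \<noteq> \<zero>\<^bsub>A\<^esub>}. f k \<otimes>\<^bsub>A\<^esub> \<xi> (inv\<^bsub>G\<^esub> k \<otimes>\<^bsub>G\<^esub> g)
     else \<zero>\<^bsub>A\<^esub>)"

definition finite_sections :: "'a star_algebra \<Rightarrow> ('g, 'n) monoid_scheme \<Rightarrow> ('g \<Rightarrow> 'a set) \<Rightarrow>
    ('g \<Rightarrow> 'a) star_algebra" where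
  "finite_sections A G B = \<lparr>
     carrier = {f. (\<forall>g \<in> carrier G. f g \<in> B g) \<and> (\<forall>g. g \<notin> carrier G \<longrightarrow> f g = \<zero>\<^bsub>A\<^esub>) \<and>
       finite {g. f g \<noteq> \<zero>\<^bsub>A\<^esub>}},
     mult = conv A G,
     one = (\<lambda>g. if g = \<one>\<^bsub>G\<^esub> then \<one>\<^bsub>A\<^esub> else \<zero>\<^bsub>A\<^esub>),
     zero = (\<lambda>g. \<zero>\<^bsub>A\<^esub>),
     add = (\<lambda>f h g. f g \<oplus>\<^bsub>A\<^esub> h g),
     smult = (\<lambda>c f g. c \<odot>\<^bsub>A\<^esub> f g),
     star = (\<lambda>f g. if g \<in> carrier G then star A (f (inv\<^bsub>G\<^esub> g)) else \<zero>\<^bsub>A\<^esub>),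
     nrm = (\<lambda>f. \<Sum>g | f g \<noteq> \<zero>\<^bsub>A\<^esub>. nrm A (f g))\<rparr>"

definition full_cross_sectional :: "'a star_algebra \<Rightarrow> ('g, 'n) monoid_scheme \<Rightarrow>
    ('g \<Rightarrow> 'a set) \<Rightarrow> (nat \<Rightarrow> 'g \<Rightarrow> 'a) set star_algebra" where
  "full_cross_sectional A G B = envelope (finite_sections A G B)"

definition left_regular :: "'a star_algebra \<Rightarrow> ('g, 'n) monoid_scheme \<Rightarrow> ('g \<Rightarrow> 'a set) \<Rightarrow>
    ('g \<Rightarrow> 'a) \<Rightarrow> ('g \<Rightarrow> 'a) \<Rightarrow> ('g \<Rightarrow> 'a)" where
  "left_regular A G B f = (\<lambda>\<xi> \<in> ell2 A (carrier G) B. conv A G f \<xi>)"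

definition reduced_cross_sectional :: "'a star_algebra \<Rightarrow> ('g, 'n) monoid_scheme \<Rightarrow>
    ('g \<Rightarrow> 'a set) \<Rightarrow> (('g \<Rightarrow> 'a) \<Rightarrow> ('g \<Rightarrow> 'a)) star_algebra" where
  "reduced_cross_sectional A G B = (operators A (carrier G) B)
     \<lparr>carrier := closed_span (operators A (carrier G) B)
        (left_regular A G B ` carrier (finite_sections A G B))\<rparr>"

definition amenable :: "'a star_algebra \<Rightarrow> ('g, 'n) monoid_scheme \<Rightarrow> ('g \<Rightarrow> 'a set) \<Rightarrow> bool" where
  "amenable A G B \<longleftrightarrow> star_iso (full_cross_sectional A G B) (reduced_cross_sectional A G B)
     (extend_hom (reduced_cross_sectional A G B) (left_regular A G B))"

text \<open>
  A list \<open>[(t\<^sub>1, s\<^sub>1), \<dots>, (t\<^sub>n, s\<^sub>n)]\<close> encodes the word \<open>t\<^sub>1, s\<^sub>1, \<dots>, t\<^sub>n, s\<^sub>n\<close>.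
\<close>

definition word_map :: "('a, 'm) monoid_scheme \<Rightarrow> ('a \<times> 'a) list \<Rightarrow> ('a \<rightharpoonup> 'a)" where
  "word_map S w = foldr (\<lambda>(t, s) f. inv_map (left_mult S t) \<otimes>\<^bsub>I_l S\<^esub> left_mult S s \<otimes>\<^bsub>I_l S\<^esub> f)
     w \<one>\<^bsub>I_l S\<^esub>"

definition word_value :: "('g, 'n) monoid_scheme \<Rightarrow> ('a \<Rightarrow> 'g) \<Rightarrow> ('a \<times> 'a) list \<Rightarrow> 'g" where
  "word_value G \<phi> w = foldr (\<lambda>(t, s) g. inv\<^bsub>G\<^esub> (\<phi> t) \<otimes>\<^bsub>G\<^esub> \<phi> s \<otimes>\<^bsub>G\<^esub> g) w \<one>\<^bsub>G\<^esub>"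

definition hull_bundle :: "('a, 'm) monoid_scheme \<Rightarrow> ('g, 'n) monoid_scheme \<Rightarrow> ('a \<Rightarrow> 'g) \<Rightarrow> 'g \<Rightarrow>
    (nat \<Rightarrow> ('a \<rightharpoonup> 'a) \<Rightarrow> complex) set set set" where
  "hull_bundle S G \<phi> g = closed_span (cstar0 (I_l S))
     {to_cstar0 (I_l S) (word_map S w) |w.
        w \<in> lists (carrier S \<times> carrier S) \<and> word_value G \<phi> w = g}"

end

theory Submission
  imports Defs "HOL-Analysis.L2_Norm"
begin

text \<open>
  Let \<open>A\<close> be \<open>C*\<^sub>0(I\<^sub>l(S))\<close>. A nonempty element of \<open>I\<^sub>l(S)\<close> is the translation by one element of
  \<open>G\<close>, its degree, restricted to its domain. Hence \<open>f \<mapsto> \<Sum> f(g)\<close> maps the finite sections of the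
  bundle onto a dense star-subalgebra of \<open>A\<close>, and both canonical maps of the theorem are completions
  of this one map; it remains to compare norms.

  Full norms: a C*-seminorm on the finite sections is pulled back to \<open>\<ell>\<^sup>1(I\<^sub>l(S))\<close> along the map that
  places \<open>q\<close> in the fibre over its degree. So the universal norm of \<open>f\<close> is the norm of \<open>\<Sum> f(g)\<close> in \<open>A\<close>.

  Reduced norms: an element of \<open>I\<^sub>l(S)\<close> is determined by its domain and its degree, and left
  multiplication preserves the domain as long as it does not shrink it. So \<open>\<ell>\<^sup>2(I\<^sub>l(S))\<close>, without the
  empty map, is the orthogonal sum of invariant subspaces, one for each nonempty domain \<open>x\<close>, in
  which the degree is injective. The unit fibre is commutative and normed by the characters
  \<open>d \<mapsto> \<langle>\<delta>\<^sub>x, d \<delta>\<^sub>x\<rangle>\<close>, and localising Exel's Hilbert module at these characters gives the same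
  subspaces. So the two regular representations have the same norm.
\<close>

section \<open>Star-algebras and C*-seminorms\<close>

text \<open>Two obstacles shape the proof. An element of \<open>\<ell>\<^sup>1\<close> may charge
  infinitely many degrees, while a finite section lives over finitely many group elements; so the
  seminorm on sections is pulled back to finitely supported functions only and extended by density.
  And membership in Exel's module means norm convergence of a sum in the unit fibre. The characters
  translate this into scalar \<open>\<ell>\<^sup>2\<close> tails that are small uniformly over all
  characters; the Hilbert space \<open>\<ell>\<^sup>2\<close> is the case of a single character, so
  the operators on both are built once. The characters norm the unit fibre because it is spanned by
  commuting projections: cutting by finitely many of them and their complements leaves orthogonal
  pieces, and the C*-identity iterated over the powers \<open>2 ^ n\<close> bounds the norm of an
  orthogonal sum by the larger norm. The empty map enters through a projection \<open>z\<close>, its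
  image or zero if it does not occur. The quotient by the span of \<open>z\<close> is isometric to
  the corner of \<open>1 - z\<close>. The empty map is a translation by every group element, so its
  degree is a convention; this does no harm, as its image in \<open>A\<close> vanishes.\<close>

locale star_alg = ring A for A :: "'a star_algebra" (structure) +
  assumes smult_closed [simp, intro]: "a \<in> carrier A ==> c \<odot> a \<in> carrier A"
    and smult_r_distr: "a \<in> carrier A ==> b \<in> carrier A ==> c \<odot> (a \<oplus> b) = c \<odot> a \<oplus> c \<odot> b"
    and smult_l_distr: "a \<in> carrier A ==> (c + d) \<odot> a = c \<odot> a \<oplus> d \<odot> a"
    and smult_smult [simp]: "a \<in> carrier A ==> c \<odot> (d \<odot> a) = (c * d) \<odot> a"
    and smult_1 [simp]: "a \<in> carrier A ==> 1 \<odot> a = a"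
    and mult_smult_l: "a \<in> carrier A ==> b \<in> carrier A ==> (c \<odot> a) \<otimes> b = c \<odot> (a \<otimes> b)"
    and mult_smult_r: "a \<in> carrier A ==> b \<in> carrier A ==> a \<otimes> (c \<odot> b) = c \<odot> (a \<otimes> b)"
    and star_closed [simp, intro]: "a \<in> carrier A ==> star A a \<in> carrier A"
    and star_add: "a \<in> carrier A ==> b \<in> carrier A ==> star A (a \<oplus> b) = star A a \<oplus> star A b"
    and star_smult: "a \<in> carrier A ==> star A (c \<odot> a) = cnj c \<odot> star A a"
    and star_mult: "a \<in> carrier A ==> b \<in> carrier A ==> star A (a \<otimes> b) = star A b \<otimes> star A a"
    and star_star [simp]: "a \<in> carrier A ==> star A (star A a) = a"
begin

lemma smult_0 [simp]: "a \<in> carrier A ==> 0 \<odot> a = \<zero>"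
  using smult_l_distr[of a 0 0] by (metis add.r_cancel_one add_0 smult_closed)

lemma smult_zero [simp]: "c \<odot> \<zero> = \<zero>"
  using smult_smult[of \<zero> c 0] by (metis mult_zero_right smult_0 zero_closed)

lemma a_inv_smult: "a \<in> carrier A ==> \<ominus> a = (-1) \<odot> a"
  using smult_l_distr[of a "-1" 1] by (metis add.inv_equality add.left_inverse smult_0 smult_1 smult_closed)

lemma minus_smult: "a \<in> carrier A ==> b \<in> carrier A ==> a \<ominus> b = a \<oplus> (-1) \<odot> b"
  by (simp add: a_minus_def a_inv_smult)

lemma smult_minus_r: "a \<in> carrier A ==> b \<in> carrier A ==> c \<odot> (a \<ominus> b) = c \<odot> a \<ominus> c \<odot> b"
  by (simp add: minus_smult smult_r_distr)

lemma star_zero [simp]: "star A \<zero> = \<zero>"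
  using star_smult[of \<zero> 0] by simp

lemma star_minus: "a \<in> carrier A ==> b \<in> carrier A ==> star A (a \<ominus> b) = star A a \<ominus> star A b"
  by (simp add: minus_smult star_add star_smult)

lemma star_one [simp]: "star A \<one> = \<one>"
proof -
  have "star A \<one> = star A \<one> \<otimes> star A (star A \<one>)" by simp
  also have "\<dots> = star A (star A \<one> \<otimes> \<one>)" by (subst star_mult) auto
  finally show ?thesis by simp
qed

lemma r_minus_distr: "a \<in> carrier A ==> b \<in> carrier A ==> c \<in> carrier A ==> c \<otimes> (a \<ominus> b) = c \<otimes> a \<ominus> c \<otimes> b"
  by (simp add: minus_smult r_distr mult_smult_r)

lemma l_minus_distr: "a \<in> carrier A ==> b \<in> carrier A ==> c \<in> carrier A ==> (a \<ominus> b) \<otimes> c = a \<otimes> c \<ominus> b \<otimes> c"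
  by (simp add: minus_smult l_distr mult_smult_l)

lemma minus_add_cancel [simp]: "a \<in> carrier A ==> b \<in> carrier A ==> (a \<ominus> b) \<oplus> b = a"
  by (simp add: a_minus_def a_assoc l_neg)

lemma minus_trans: "a \<in> carrier A ==> b \<in> carrier A ==> c \<in> carrier A ==> a \<ominus> c = (a \<ominus> b) \<oplus> (b \<ominus> c)"
  by (metis a_minus_def a_assoc add.inv_closed minus_closed minus_add_cancel)

lemma minus_add_minus: "a \<in> carrier A ==> b \<in> carrier A ==> c \<in> carrier A ==> d \<in> carrier A ==>
  (a \<oplus> b) \<ominus> (c \<oplus> d) = (a \<ominus> c) \<oplus> (b \<ominus> d)"
  by (simp add: minus_smult smult_r_distr a_ac)

lemma minus_mult_minus: "a \<in> carrier A ==> b \<in> carrier A ==> c \<in> carrier A ==> d \<in> carrier A ==>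
  a \<otimes> b \<ominus> c \<otimes> d = (a \<ominus> c) \<otimes> b \<oplus> c \<otimes> (b \<ominus> d)"
  using minus_trans[of "a \<otimes> b" "c \<otimes> b" "c \<otimes> d"] by (simp add: r_minus_distr l_minus_distr)

lemma finsum_smult: "f \<in> F \<rightarrow> carrier A ==> finsum A (\<lambda>i. c \<odot> f i) F = c \<odot> finsum A f F"
  by (induction F rule: infinite_finite_induct) (auto simp: smult_r_distr Pi_def)

lemma finsum_star: "f \<in> F \<rightarrow> carrier A ==> finsum A (\<lambda>i. star A (f i)) F = star A (finsum A f F)"
  by (induction F rule: infinite_finite_induct) (auto simp: star_add Pi_def)

lemma finsum_mult_l: "f \<in> F \<rightarrow> carrier A ==> a \<in> carrier A ==> a \<otimes> finsum A f F = finsum A (\<lambda>i. a \<otimes> f i) F"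
  by (induction F rule: infinite_finite_induct) (auto simp: r_distr Pi_def)

lemma finsum_mult_r: "f \<in> F \<rightarrow> carrier A ==> a \<in> carrier A ==> finsum A f F \<otimes> a = finsum A (\<lambda>i. f i \<otimes> a) F"
  by (induction F rule: infinite_finite_induct) (auto simp: l_distr Pi_def)

lemma finsum_swap:
  assumes "finite F" "finite K" "!!i j. i \<in> F ==> j \<in> K ==> f i j \<in> carrier A"
  shows "finsum A (\<lambda>i. finsum A (f i) K) F = finsum A (\<lambda>j. finsum A (\<lambda>i. f i j) F) K"
  using assms(1,3)
proof (induction F)
  case empty
  then show ?case by (simp add: finsum_zero)
next
  case (insert x F)
  have "finsum A (\<lambda>i. finsum A (f i) K) (insert x F) = finsum A (f x) K \<oplus> finsum A (\<lambda>j. finsum A (\<lambda>i. f i j) F) K"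
    using insert by (subst finsum_insert) (auto simp: Pi_def)
  also have "\<dots> = finsum A (\<lambda>j. f x j \<oplus> finsum A (\<lambda>i. f i j) F) K"
    using insert by (subst finsum_addf) (auto simp: Pi_def)
  also have "\<dots> = finsum A (\<lambda>j. finsum A (\<lambda>i. f i j) (insert x F)) K"
    using insert by (intro finsum_cong' refl) (auto simp: Pi_def)
  finally show ?case .
qed

lemma finsum_eq_superset:
  assumes "finite K" "F \<subseteq> K" "f \<in> K \<rightarrow> carrier A" "!!i. i \<in> K - F ==> f i = \<zero>"
  shows "finsum A f F = finsum A f K"
  using assms by (intro add.finprod_mono_neutral_cong_left) auto

lemma lin_span_closed: "X \<subseteq> carrier A ==> a \<in> lin_span A X ==> a \<in> carrier A"
  by (rotate_tac 1, induction rule: lin_span.induct) auto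

end

text \<open>Additive inverses enter through the scalar \<open>-1\<close>, so a concrete record is
  verified by closure conditions and equations alone.\<close>

lemma star_algI:
  fixes A :: "'a star_algebra" (structure)
  assumes "!!a b. a \<in> carrier A ==> b \<in> carrier A ==> a \<oplus> b \<in> carrier A"
    "\<zero> \<in> carrier A" "\<one> \<in> carrier A"
    "!!a b. a \<in> carrier A ==> b \<in> carrier A ==> a \<otimes> b \<in> carrier A"
    "!!a c. a \<in> carrier A ==> c \<odot> a \<in> carrier A"
    "!!a. a \<in> carrier A ==> star A a \<in> carrier A"
    "!!a b c. a \<in> carrier A ==> b \<in> carrier A ==> c \<in> carrier A ==> (a \<oplus> b) \<oplus> c = a \<oplus> (b \<oplus> c)"
    "!!a b. a \<in> carrier A ==> b \<in> carrier A ==> a \<oplus> b = b \<oplus> a"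
    "!!a. a \<in> carrier A ==> \<zero> \<oplus> a = a"
    "!!a. a \<in> carrier A ==> (-1) \<odot> a \<oplus> a = \<zero>"
    "!!a b c. a \<in> carrier A ==> b \<in> carrier A ==> c \<in> carrier A ==> (a \<otimes> b) \<otimes> c = a \<otimes> (b \<otimes> c)"
    "!!a. a \<in> carrier A ==> \<one> \<otimes> a = a" "!!a. a \<in> carrier A ==> a \<otimes> \<one> = a"
    "!!a b c. a \<in> carrier A ==> b \<in> carrier A ==> c \<in> carrier A ==> (a \<oplus> b) \<otimes> c = a \<otimes> c \<oplus> b \<otimes> c"
    "!!a b c. a \<in> carrier A ==> b \<in> carrier A ==> c \<in> carrier A ==> c \<otimes> (a \<oplus> b) = c \<otimes> a \<oplus> c \<otimes> b"
    "!!a b c. a \<in> carrier A ==> b \<in> carrier A ==> c \<odot> (a \<oplus> b) = c \<odot> a \<oplus> c \<odot> b"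
    "!!a c d. a \<in> carrier A ==> (c + d) \<odot> a = c \<odot> a \<oplus> d \<odot> a"
    "!!a c d. a \<in> carrier A ==> c \<odot> (d \<odot> a) = (c * d) \<odot> a"
    "!!a. a \<in> carrier A ==> 1 \<odot> a = a"
    "!!a b c. a \<in> carrier A ==> b \<in> carrier A ==> (c \<odot> a) \<otimes> b = c \<odot> (a \<otimes> b)"
    "!!a b c. a \<in> carrier A ==> b \<in> carrier A ==> a \<otimes> (c \<odot> b) = c \<odot> (a \<otimes> b)"
    "!!a b. a \<in> carrier A ==> b \<in> carrier A ==> star A (a \<oplus> b) = star A a \<oplus> star A b"
    "!!a c. a \<in> carrier A ==> star A (c \<odot> a) = cnj c \<odot> star A a"
    "!!a b. a \<in> carrier A ==> b \<in> carrier A ==> star A (a \<otimes> b) = star A b \<otimes> star A a"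
    "!!a. a \<in> carrier A ==> star A (star A a) = a"
  shows "star_alg A"
proof -
  have "ring A"
  proof (rule ringI)
    show "abelian_group A"
    proof (rule abelian_groupI)
      show "\<exists>b\<in>carrier A. b \<oplus> a = \<zero>" if "a \<in> carrier A" for a
        using assms(5)[OF that] assms(10)[OF that] by (rule bexI[rotated])
    qed (rule assms; assumption)+
    show "monoid A"
      by (rule monoidI) (rule assms; assumption)+
  qed (rule assms; assumption)+
  then show ?thesis
    by (intro star_alg.intro star_alg_axioms.intro) (assumption | (rule assms; assumption))+
qed

lemmas (in star_alg) star_alg_laws = m_assoc a_ac l_distr r_distr smult_r_distr smult_l_distr
  mult_smult_l mult_smult_r star_add star_smult star_mult l_neg r_neg

lemma (in star_alg) star_alg_nrm_update: "star_alg (A\<lparr>nrm := p\<rparr>)"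
  by (rule star_algI) (simp_all add: star_alg_laws flip: a_inv_smult)

lemma (in star_alg) minus_nrm_update:
  "a \<in> carrier A ==> b \<in> carrier A ==> a \<ominus>\<^bsub>A\<lparr>nrm := p\<rparr>\<^esub> b = a \<ominus> b"
proof -
  interpret u: star_alg "A\<lparr>nrm := p\<rparr>" by (rule star_alg_nrm_update)
  show "a \<in> carrier A ==> b \<in> carrier A ==> a \<ominus>\<^bsub>A\<lparr>nrm := p\<rparr>\<^esub> b = a \<ominus> b"
    using u.minus_smult[of a b] by (simp add: minus_smult)
qed

section \<open>Star-homomorphisms and transport of the algebra laws\<close>

definition star_hom :: "'a star_algebra => 'b star_algebra => ('a => 'b) => bool" where
  "star_hom A C h \<longleftrightarrow> h \<in> ring_hom A C \<and>
     (\<forall>c. \<forall>a \<in> carrier A. h (c \<odot>\<^bsub>A\<^esub> a) = c \<odot>\<^bsub>C\<^esub> h a) \<and>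
     (\<forall>a \<in> carrier A. h (star A a) = star C (h a))"

lemma star_iso_iff: "star_iso A C h \<longleftrightarrow> star_hom A C h \<and> bij_betw h (carrier A) (carrier C)"
  by (auto simp: star_iso_def star_hom_def ring_iso_def)

lemma star_homI:
  assumes "!!a. a \<in> carrier A ==> h a \<in> carrier C"
    "!!a b. a \<in> carrier A ==> b \<in> carrier A ==> h (a \<otimes>\<^bsub>A\<^esub> b) = h a \<otimes>\<^bsub>C\<^esub> h b"
    "!!a b. a \<in> carrier A ==> b \<in> carrier A ==> h (a \<oplus>\<^bsub>A\<^esub> b) = h a \<oplus>\<^bsub>C\<^esub> h b"
    "h \<one>\<^bsub>A\<^esub> = \<one>\<^bsub>C\<^esub>"
    "!!a c. a \<in> carrier A ==> h (c \<odot>\<^bsub>A\<^esub> a) = c \<odot>\<^bsub>C\<^esub> h a"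
    "!!a. a \<in> carrier A ==> h (star A a) = star C (h a)"
  shows "star_hom A C h"
  using assms by (auto simp: star_hom_def ring_hom_def)

lemma star_homD:
  assumes "star_hom A C h"
  shows "a \<in> carrier A ==> h a \<in> carrier C"
    "a \<in> carrier A ==> b \<in> carrier A ==> h (a \<otimes>\<^bsub>A\<^esub> b) = h a \<otimes>\<^bsub>C\<^esub> h b"
    "a \<in> carrier A ==> b \<in> carrier A ==> h (a \<oplus>\<^bsub>A\<^esub> b) = h a \<oplus>\<^bsub>C\<^esub> h b"
    "h \<one>\<^bsub>A\<^esub> = \<one>\<^bsub>C\<^esub>"
    "a \<in> carrier A ==> h (c \<odot>\<^bsub>A\<^esub> a) = c \<odot>\<^bsub>C\<^esub> h a"
    "a \<in> carrier A ==> h (star A a) = star C (h a)"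
  using assms by (auto simp: star_hom_def ring_hom_def)

lemma star_hom_compose: "star_hom A C h ==> star_hom C E k ==> star_hom A E (\<lambda>a. k (h a))"
  by (rule star_homI) (simp_all add: star_homD)

lemma star_hom_minus:
  assumes "star_alg A" "star_alg C" "star_hom A C h" "a \<in> carrier A" "b \<in> carrier A"
  shows "h (a \<ominus>\<^bsub>A\<^esub> b) = h a \<ominus>\<^bsub>C\<^esub> h b"
  using assms by (simp add: star_alg.minus_smult star_homD star_alg.smult_closed)

lemma star_hom_zero:
  assumes "star_alg A" "star_alg C" "star_hom A C h"
  shows "h \<zero>\<^bsub>A\<^esub> = \<zero>\<^bsub>C\<^esub>"
proof -
  interpret A: star_alg A by fact
  interpret C: star_alg C by fact
  show ?thesis using star_homD(5)[OF assms(3), of "\<zero>\<^bsub>A\<^esub>" 0] star_homD(1)[OF assms(3), of "\<zero>\<^bsub>A\<^esub>"] by simp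
qed

text \<open>Each element of \<open>C\<close> is some \<open>h a\<close>, so each law of
  \<open>C\<close> is the image of a law of \<open>A\<close>. That zero goes to zero is a
  hypothesis, because deriving it would take laws of \<open>C\<close> that are still to be
  proved.\<close>

lemma star_alg_image:
  assumes A: "star_alg A" and h: "star_hom A C h" and surj: "carrier C = h ` carrier A" and z: "\<zero>\<^bsub>C\<^esub> = h \<zero>\<^bsub>A\<^esub>"
  shows "star_alg C"
proof -
  interpret star_alg A by fact
  note hs = star_homD(2,3,5,6)[OF h, symmetric] star_homD(4)[OF h, symmetric] z
  show ?thesis
    by (rule star_algI) (auto simp: surj hs star_alg_laws simp flip: a_inv_smult)
qed

lemma (in star_alg) star_alg_carrier_update:
  assumes "X \<subseteq> carrier A" "\<zero> \<in> X" "\<one> \<in> X" "!!a b. a \<in> X ==> b \<in> X ==> a \<oplus> b \<in> X"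
    "!!a b. a \<in> X ==> b \<in> X ==> a \<otimes> b \<in> X" "!!a c. a \<in> X ==> c \<odot> a \<in> X" "!!a. a \<in> X ==> star A a \<in> X"
  shows "star_alg (A\<lparr>carrier := X\<rparr>)"
  using assms(1) by (intro star_algI) (simp_all add: assms(2-) subset_iff star_alg_laws flip: a_inv_smult)

section \<open>C*-seminorms and norm convergence\<close>

locale seminormed = star_alg A for A :: "'a star_algebra" (structure) and p :: "'a => real" +
  assumes seminorm: "cstar_seminorm A p"
begin

lemma
  assumes "a \<in> carrier A"
  shows p_nonneg [simp]: "0 \<le> p a"
    and p_add: "b \<in> carrier A ==> p (a \<oplus> b) \<le> p a + p b"
    and p_smult: "p (c \<odot> a) = cmod c * p a"
    and p_mult: "b \<in> carrier A ==> p (a \<otimes> b) \<le> p a * p b"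
    and p_star_mult: "p (star A a \<otimes> a) = (p a)\<^sup>2"
  using seminorm assms by (auto simp: cstar_seminorm_def)

lemma p_zero [simp]: "p \<zero> = 0"
  using p_smult[of \<zero> 0] by simp

text \<open>The C*-identity and submultiplicativity give
  \<open>(p b)\<^sup>2 \<le> p (star A b) * p b\<close>, hence
  \<open>p b \<le> p (star A b)\<close>; applied to \<open>star A b\<close> this is the converse
  inequality.\<close>

lemma p_star [simp]:
  assumes a: "a \<in> carrier A" shows "p (star A a) = p a"
proof -
  have le: "p b \<le> p (star A b)" if b: "b \<in> carrier A" for b
  proof (cases "p b = 0")
    case False
    have "p b * p b \<le> p (star A b) * p b"
      using p_star_mult[OF b] p_mult[of "star A b" b] b by (simp add: power2_eq_square)
    then show ?thesis using False p_nonneg[OF b] by (simp add: mult_le_cancel_right)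
  qed (use b in simp)
  show ?thesis using le[OF a] le[of "star A a"] a by simp
qed

lemma p_minus_commute: "a \<in> carrier A ==> b \<in> carrier A ==> p (a \<ominus> b) = p (b \<ominus> a)"
proof -
  assume ab: "a \<in> carrier A" "b \<in> carrier A"
  then have "a \<ominus> b = (-1) \<odot> (b \<ominus> a)" by (simp add: minus_smult smult_r_distr a_ac)
  then show ?thesis using ab by (simp add: p_smult)
qed

lemma p_triangle: "a \<in> carrier A ==> b \<in> carrier A ==> c \<in> carrier A ==> p (a \<ominus> c) \<le> p (a \<ominus> b) + p (b \<ominus> c)"
  using minus_trans[of a b c] p_add[of "a \<ominus> b" "b \<ominus> c"] by simp

lemma p_diff:
  assumes "a \<in> carrier A" "b \<in> carrier A" shows "\<bar>p a - p b\<bar> \<le> p (a \<ominus> b)"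
  using p_add[of "a \<ominus> b" b] p_add[of "b \<ominus> a" a] assms p_minus_commute[of a b] by auto

lemma p_minus_zero: "a \<in> carrier A ==> p (a \<ominus> \<zero>) = p a"
  by (simp add: minus_smult)

lemma p_minus_self [simp]: "a \<in> carrier A ==> p (a \<ominus> a) = 0"
  by (simp add: a_minus_def r_neg)

lemma p_cross: "a \<in> carrier A ==> b \<in> carrier A ==> c \<in> carrier A ==> d \<in> carrier A ==>
  p (a \<otimes> b \<ominus> c \<otimes> d) \<le> p (a \<ominus> c) * p b + p c * p (b \<ominus> d)"
  using p_add[of "(a \<ominus> c) \<otimes> b" "c \<otimes> (b \<ominus> d)"] p_mult[of "a \<ominus> c" b] p_mult[of c "b \<ominus> d"]
  by (simp add: minus_mult_minus)

lemma p_minus_add: "a \<in> carrier A ==> b \<in> carrier A ==> c \<in> carrier A ==> d \<in> carrier A ==>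
  p ((a \<oplus> b) \<ominus> (c \<oplus> d)) \<le> p (a \<ominus> c) + p (b \<ominus> d)"
  by (simp add: minus_add_minus p_add)

lemma p_finsum: "f \<in> F \<rightarrow> carrier A ==> p (finsum A f F) \<le> (\<Sum>i\<in>F. p (f i))"
proof (induction F rule: infinite_finite_induct)
  case (insert x F)
  then have "p (finsum A f (insert x F)) \<le> p (f x) + p (finsum A f F)" by (auto simp: Pi_def intro!: p_add)
  with insert show ?case by (auto simp: Pi_def)
qed auto

end

lemma seminormedI_pullback:
  assumes A: "star_alg A" and C: "seminormed C q" and h: "star_hom A C h"
  shows "seminormed A (\<lambda>a. q (h a))"
proof -
  interpret A: star_alg A by fact
  interpret C: seminormed C q by fact
  show ?thesis
    by unfold_locales (simp add: cstar_seminorm_def star_homD[OF h] C.p_add C.p_smult C.p_mult C.p_star_mult)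
qed

text \<open>The common ground of C*-algebras and of what they are completed from: Cauchy sequences
  with the limit norm, and a star-algebra with its universal norm.\<close>

locale cstar_pre = seminormed A "nrm A" for A :: "'a star_algebra" (structure)
begin

lemma converges_const: "a \<in> carrier A ==> converges A (\<lambda>n. a) a"
  by (simp add: converges_def)

lemma converges_dominated:
  assumes "!!n. nrm A (x n \<ominus> l) \<le> f n" "f \<longlonglongrightarrow> 0" "!!n. x n \<in> carrier A" "l \<in> carrier A"
  shows "converges A x l"
  unfolding converges_def by (rule tendsto_sandwich[OF _ _ tendsto_const assms(2)]) (use assms in auto)

lemma converges_nrm:
  assumes "converges A x l" "!!n. x n \<in> carrier A" "l \<in> carrier A"
  shows "(\<lambda>n. nrm A (x n)) \<longlonglongrightarrow> nrm A l"
proof -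
  have "(\<lambda>n. \<bar>nrm A (x n) - nrm A l\<bar>) \<longlonglongrightarrow> 0"
    by (rule tendsto_sandwich[OF _ _ tendsto_const assms(1)[unfolded converges_def]])
      (use assms(2,3) p_diff in auto)
  then show ?thesis by (simp add: tendsto_rabs_zero_iff LIM_zero_iff)
qed

lemma converges_add:
  assumes "converges A x l" "converges A y k" "!!n. x n \<in> carrier A" "!!n. y n \<in> carrier A" "l \<in> carrier A" "k \<in> carrier A"
  shows "converges A (\<lambda>n. x n \<oplus> y n) (l \<oplus> k)"
  by (rule converges_dominated[where f = "\<lambda>n. nrm A (x n \<ominus> l) + nrm A (y n \<ominus> k)"])
    (use assms tendsto_add[OF assms(1,2)[unfolded converges_def]] p_minus_add in auto)

lemma converges_smult:
  assumes "converges A x l" "!!n. x n \<in> carrier A" "l \<in> carrier A"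
  shows "converges A (\<lambda>n. c \<odot> x n) (c \<odot> l)"
  by (rule converges_dominated[where f = "\<lambda>n. cmod c * nrm A (x n \<ominus> l)"])
    (use assms tendsto_mult_right_zero[OF assms(1)[unfolded converges_def], of "cmod c"]
      in \<open>auto simp: p_smult smult_minus_r[symmetric]\<close>)

lemma converges_minus:
  assumes "converges A x l" "converges A y k" "!!n. x n \<in> carrier A" "!!n. y n \<in> carrier A" "l \<in> carrier A" "k \<in> carrier A"
  shows "converges A (\<lambda>n. x n \<ominus> y n) (l \<ominus> k)"
  using converges_add[OF assms(1) converges_smult[OF assms(2,4,6)], of "-1"] assms by (simp add: minus_smult)

lemma converges_star:
  assumes "converges A x l" "!!n. x n \<in> carrier A" "l \<in> carrier A"
  shows "converges A (\<lambda>n. star A (x n)) (star A l)"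
  using assms by (simp add: converges_def star_minus[symmetric])

lemma converges_mult:
  assumes "converges A x l" "converges A y k" "!!n. x n \<in> carrier A" "!!n. y n \<in> carrier A" "l \<in> carrier A" "k \<in> carrier A"
  shows "converges A (\<lambda>n. x n \<otimes> y n) (l \<otimes> k)"
proof (rule converges_dominated)
  show "nrm A (x n \<otimes> y n \<ominus> l \<otimes> k) \<le> nrm A (x n \<ominus> l) * nrm A (y n) + nrm A l * nrm A (y n \<ominus> k)" for n
    using assms by (simp add: p_cross)
  show "(\<lambda>n. nrm A (x n \<ominus> l) * nrm A (y n) + nrm A l * nrm A (y n \<ominus> k)) \<longlonglongrightarrow> 0"
    using tendsto_add[OF tendsto_mult[OF assms(1)[unfolded converges_def] converges_nrm[OF assms(2,4,6)]]
      tendsto_mult_right_zero[OF assms(2)[unfolded converges_def], of "nrm A l"]] by simp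
qed (use assms in auto)

text \<open>The norm may have a kernel at this stage, so two limits are only known to be at distance
  zero.\<close>

lemma converges_unique_nrm:
  assumes "converges A x l" "converges A x k" "!!n. x n \<in> carrier A" "l \<in> carrier A" "k \<in> carrier A"
  shows "nrm A (l \<ominus> k) = 0"
proof -
  have "converges A (\<lambda>n. x n \<ominus> x n) (l \<ominus> k)" using assms by (intro converges_minus)
  from converges_nrm[OF this] assms have "(\<lambda>n. 0) \<longlonglongrightarrow> nrm A (l \<ominus> k)" by simp
  then show ?thesis by (simp add: LIMSEQ_const_iff)
qed

section \<open>The algebra of Cauchy sequences\<close>

abbreviation Cau where "Cau \<equiv> cauchy_seqs A"

lemma cauchyD: "x \<in> carrier Cau ==> x n \<in> carrier A"
  "x \<in> carrier Cau ==> e > 0 ==> \<exists>N. \<forall>m\<ge>N. \<forall>n\<ge>N. nrm A (x m \<ominus> x n) < e"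
  by (auto simp: cauchy_seqs_def)

lemma cauchyI: "(!!n. x n \<in> carrier A) ==> (!!e. e > 0 ==> \<exists>N. \<forall>m\<ge>N. \<forall>n\<ge>N. nrm A (x m \<ominus> x n) < e) ==>
  x \<in> carrier Cau"
  by (auto simp: cauchy_seqs_def)

text \<open>One estimate for all pointwise operations: \<open>K\<close> absorbs a scalar, or the
  bounds on the two factors of a product. For a unary operation \<open>y\<close> is taken constantly
  zero.\<close>

lemma cauchy_dominated:
  assumes "x \<in> carrier Cau" "y \<in> carrier Cau" "!!n. z n \<in> carrier A" "K > 0"
    "!!m n. nrm A (z m \<ominus> z n) \<le> K * nrm A (x m \<ominus> x n) + K * nrm A (y m \<ominus> y n)"
  shows "z \<in> carrier Cau"
proof (rule cauchyI)
  fix e :: real assume "e > 0"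
  then have e: "e / (2*K) > 0" using \<open>K > 0\<close> by simp
  obtain N1 N2 where N: "!!m n. m \<ge> N1 ==> n \<ge> N1 ==> nrm A (x m \<ominus> x n) < e / (2*K)"
    "!!m n. m \<ge> N2 ==> n \<ge> N2 ==> nrm A (y m \<ominus> y n) < e / (2*K)"
    using cauchyD(2)[OF assms(1) e] cauchyD(2)[OF assms(2) e] by blast
  have "nrm A (z m \<ominus> z n) < e" if "m \<ge> max N1 N2" "n \<ge> max N1 N2" for m n
  proof -
    have "K * nrm A (x m \<ominus> x n) + K * nrm A (y m \<ominus> y n) < K * (e / (2*K)) + K * (e / (2*K))"
      using N(1)[of m n] N(2)[of m n] that \<open>K > 0\<close> by (intro add_strict_mono mult_strict_left_mono) auto
    also have "\<dots> = e" using \<open>K > 0\<close> by simp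
    finally show ?thesis using assms(5)[of m n] by linarith
  qed
  then show "\<exists>N. \<forall>m\<ge>N. \<forall>n\<ge>N. nrm A (z m \<ominus> z n) < e" by blast
qed (rule assms)

lemma converges_cauchy:
  assumes "converges A x l" "!!n. x n \<in> carrier A" "l \<in> carrier A"
  shows "x \<in> carrier Cau"
proof (rule cauchyI)
  fix e :: real assume "e > 0"
  then have "\<forall>\<^sub>F n in sequentially. nrm A (x n \<ominus> l) < e/2"
    using order_tendstoD(2)[OF assms(1)[unfolded converges_def], of "e/2"] by simp
  then obtain N where N: "!!n. n \<ge> N ==> nrm A (x n \<ominus> l) < e/2" by (auto simp: eventually_sequentially)
  have "nrm A (x m \<ominus> x n) < e" if "m \<ge> N" "n \<ge> N" for m n
    using p_triangle[of "x m" l "x n"] N[OF that(1)] N[OF that(2)] assms p_minus_commute[of "x n" l] by auto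
  then show "\<exists>N. \<forall>m\<ge>N. \<forall>n\<ge>N. nrm A (x m \<ominus> x n) < e" by blast
qed fact

lemma cauchy_nrm_tendsto:
  assumes "x \<in> carrier Cau"
  shows "(\<lambda>n. nrm A (x n)) \<longlonglongrightarrow> nrm Cau x"
proof -
  have "Cauchy (\<lambda>n. nrm A (x n))"
  proof (rule CauchyI)
    fix e :: real assume "0 < e"
    then obtain N where "\<forall>m\<ge>N. \<forall>n\<ge>N. nrm A (x m \<ominus> x n) < e" using cauchyD(2)[OF assms] by blast
    then show "\<exists>M. \<forall>m\<ge>M. \<forall>n\<ge>M. norm (nrm A (x m) - nrm A (x n)) < e"
      using p_diff cauchyD(1)[OF assms] by (metis (no_types) order_le_less_trans real_norm_def)
  qed
  then show ?thesis by (simp add: Cauchy_convergent_iff convergent_LIMSEQ_iff cauchy_seqs_def)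
qed

lemma cauchy_bounded:
  assumes "x \<in> carrier Cau"
  obtains K where "K > 0" "!!n. nrm A (x n) \<le> K"
proof -
  have "Bseq (\<lambda>n. nrm A (x n))" using cauchy_nrm_tendsto[OF assms] by (meson convergentI convergent_imp_Bseq)
  then obtain K where "K > 0" "\<forall>n. norm (nrm A (x n)) \<le> K" by (auto simp: Bseq_def)
  then show ?thesis by (intro that) (auto simp: abs_le_iff)
qed

lemma cauchy_add: "x \<in> carrier Cau ==> y \<in> carrier Cau ==> (\<lambda>n. x n \<oplus> y n) \<in> carrier Cau"
  by (rule cauchy_dominated[where K=1, of x y]) (use p_minus_add cauchyD(1) in auto)

lemma cauchy_const: "a \<in> carrier A ==> (\<lambda>n. a) \<in> carrier Cau"
  using converges_cauchy[OF converges_const] by simp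

lemma cauchy_smult: "x \<in> carrier Cau ==> (\<lambda>n. c \<odot> x n) \<in> carrier Cau"
  \<comment> \<open>\<open>K\<close> has to be positive, and \<open>cmod c\<close> may
    vanish.\<close>
  by (rule cauchy_dominated[where K="cmod c + 1" and x = x and y = "\<lambda>n. \<zero>"])
    (use cauchyD(1) cauchy_const in \<open>auto simp: smult_minus_r[symmetric] p_smult mult_right_mono add_nonneg_pos\<close>)

lemma cauchy_star: "x \<in> carrier Cau ==> (\<lambda>n. star A (x n)) \<in> carrier Cau"
  by (rule cauchy_dominated[where K=1 and x = x and y = "\<lambda>n. \<zero>"])
    (use cauchyD(1) cauchy_const in \<open>auto simp: star_minus[symmetric]\<close>)

lemma cauchy_mult:
  assumes xy: "x \<in> carrier Cau" "y \<in> carrier Cau"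
  shows "(\<lambda>n. x n \<otimes> y n) \<in> carrier Cau"
proof -
  obtain K L where K: "K > 0" "!!n. nrm A (x n) \<le> K" and L: "L > 0" "!!n. nrm A (y n) \<le> L"
    using cauchy_bounded xy by metis
  show ?thesis
  proof (rule cauchy_dominated[OF xy, where K = "max K L"])
    fix m n
    have "nrm A (x m \<otimes> y m \<ominus> x n \<otimes> y n) \<le> nrm A (x m \<ominus> x n) * nrm A (y m) + nrm A (x n) * nrm A (y m \<ominus> y n)"
      using cauchyD(1)[OF xy(1)] cauchyD(1)[OF xy(2)] by (simp add: p_cross)
    also have "\<dots> \<le> nrm A (x m \<ominus> x n) * max K L + max K L * nrm A (y m \<ominus> y n)"
      using cauchyD(1)[OF xy(1)] cauchyD(1)[OF xy(2)] K(2)[of n] L(2)[of m] K(1) by (intro add_mono mult_mono) auto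
    finally show "nrm A (x m \<otimes> y m \<ominus> x n \<otimes> y n) \<le> max K L * nrm A (x m \<ominus> x n) + max K L * nrm A (y m \<ominus> y n)"
      by (simp add: mult.commute)
  qed (use K cauchyD(1)[OF xy(1)] cauchyD(1)[OF xy(2)] in auto)
qed

lemma cauchy_seqs_ops:
  "add Cau = (\<lambda>x y n. x n \<oplus> y n)" "mult Cau = (\<lambda>x y n. x n \<otimes> y n)"
  "one Cau = (\<lambda>n. \<one>)" "zero Cau = (\<lambda>n. \<zero>)"
  "smult Cau = (\<lambda>c x n. c \<odot> x n)" "star Cau = (\<lambda>x n. star A (x n))"
  by (simp_all add: cauchy_seqs_def)

lemma star_alg_cauchy_seqs: "star_alg Cau"
  by (rule star_algI, unfold cauchy_seqs_ops)
    (simp_all add: cauchyD(1) cauchy_add cauchy_mult cauchy_const cauchy_smult cauchy_star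
    star_alg_laws flip: a_inv_smult)

lemma cstar_pre_cauchy_seqs: "cstar_pre Cau"
proof -
  interpret c: star_alg "Cau" by (rule star_alg_cauchy_seqs)
  note T = cauchy_nrm_tendsto
  show ?thesis
  proof (unfold_locales, unfold cstar_seminorm_def, intro ballI allI conjI)
    fix x y c assume x: "x \<in> carrier Cau" and y: "y \<in> carrier Cau"
    note C = cauchyD(1)[OF x] cauchyD(1)[OF y]
    show "0 \<le> nrm Cau x"
      by (rule LIMSEQ_le_const[OF T[OF x]]) (use C in auto)
    show "nrm Cau (x \<oplus>\<^bsub>Cau\<^esub> y) \<le> nrm Cau x + nrm Cau y"
      by (rule LIMSEQ_le[OF T[OF c.a_closed[OF x y]] tendsto_add[OF T[OF x] T[OF y]]])
        (use C in \<open>auto simp: cauchy_seqs_ops p_add\<close>)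
    show "nrm Cau (c \<odot>\<^bsub>Cau\<^esub> x) = cmod c * nrm Cau x"
      by (rule LIMSEQ_unique[OF T[OF c.smult_closed[OF x]]])
        (use C tendsto_mult_left[OF T[OF x], of "cmod c"] in \<open>simp add: cauchy_seqs_ops p_smult\<close>)
    show "nrm Cau (x \<otimes>\<^bsub>Cau\<^esub> y) \<le> nrm Cau x * nrm Cau y"
      by (rule LIMSEQ_le[OF T[OF c.m_closed[OF x y]] tendsto_mult[OF T[OF x] T[OF y]]])
        (use C in \<open>auto simp: cauchy_seqs_ops p_mult\<close>)
    show "nrm Cau (star Cau x \<otimes>\<^bsub>Cau\<^esub> x) = (nrm Cau x)\<^sup>2"
      by (rule LIMSEQ_unique[OF T[OF c.m_closed[OF c.star_closed[OF x] x]]])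
        (use C tendsto_power[OF T[OF x], of 2] in \<open>simp add: cauchy_seqs_ops p_star_mult\<close>)
  qed
qed

end

section \<open>Complete algebras, and quotients by the kernel of a seminorm\<close>

locale cstar_alg = cstar_pre A for A :: "'a star_algebra" (structure) +
  assumes definite: "a \<in> carrier A ==> nrm A a = 0 ==> a = \<zero>"
    and complete: "x \<in> carrier (cauchy_seqs A) ==> \<exists>l\<in>carrier A. converges A x l"
begin

lemma eqI: "a \<in> carrier A ==> b \<in> carrier A ==> nrm A (a \<ominus> b) = 0 ==> a = b"
  using definite[of "a \<ominus> b"] by (metis minus_closed minus_add_cancel l_zero)

lemma converges_unique:
  assumes "converges A x l" "converges A x k" "!!n. x n \<in> carrier A" "l \<in> carrier A" "k \<in> carrier A"
  shows "l = k"
  using converges_unique_nrm[OF assms] eqI assms by blast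

end

text \<open>The quotient norm is an infimum over a coset, and in both quotients that occur it is
  explicit: modulo null sequences the norm is constant on a coset, and modulo a one-dimensional
  ideal the infimum is the norm of the component in the complementary corner. \<open>N\<close> is
  this value and \<open>J\<close> its kernel.\<close>

locale kernel_quotient = seminormed A N for A :: "'a star_algebra" (structure) and N +
  fixes J
  assumes J_eq: "J = {x \<in> carrier A. N x = 0}"
    and Inf_coset: "!!x. x \<in> carrier A ==> Inf (nrm A ` (J +> x)) = N x"
begin

lemma ideal_J: "ideal J A"
proof (rule idealI[OF ring_axioms])
  show "subgroup J (add_monoid A)"
  proof (rule add.subgroupI)
    show "a \<oplus> b \<in> J" if "a \<in> J" "b \<in> J" for a b
      using that p_add[of a b] by (auto simp: J_eq intro: antisym)
    show "\<ominus> a \<in> J" if "a \<in> J" for a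
      using that by (auto simp: J_eq a_inv_smult p_smult)
    show "J \<noteq> {}" using p_zero by (auto simp: J_eq)
  qed (auto simp: J_eq)
  show "x \<otimes> a \<in> J" if "a \<in> J" "x \<in> carrier A" for a x
    using that p_mult[of x a] by (auto simp: J_eq intro: antisym)
  show "a \<otimes> x \<in> J" if "a \<in> J" "x \<in> carrier A" for a x
    using that p_mult[of a x] by (auto simp: J_eq intro: antisym)
qed

lemma coset_self: "x \<in> carrier A ==> x \<in> J +> x"
proof -
  interpret J: ideal J A by (rule ideal_J)
  show "x \<in> carrier A ==> x \<in> J +> x" by (rule J.a_rcos_self)
qed

lemma coset_eq_iff:
  assumes "x \<in> carrier A" "y \<in> carrier A" shows "J +> x = J +> y \<longleftrightarrow> N (x \<ominus> y) = 0"
  using quotient_eq_iff_same_a_r_cos[OF ideal_J assms] assms by (auto simp: J_eq)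

lemma J_closed: "j \<in> J ==> j \<in> carrier A"
  by (simp add: J_eq)

lemma coset_mem:
  assumes "y \<in> J +> x" "x \<in> carrier A" shows "y \<in> carrier A" "J +> y = J +> x"
proof -
  obtain j where j: "j \<in> J" "y = j \<oplus> x" using assms(1) unfolding a_r_coset_def' by blast
  show "y \<in> carrier A" unfolding j(2) by (rule a_closed[OF J_closed[OF j(1)] assms(2)])
  interpret J: ideal J A by (rule ideal_J)
  show "J +> y = J +> x" by (rule J.a_repr_independence'[OF assms, symmetric])
qed

lemma carrier_quot: "carrier (quot A J) = (\<lambda>x. J +> x) ` carrier A"
  by (auto simp: quot_def FactRing_def A_RCOSETS_def')

text \<open>Scalar multiples and adjoints in \<open>quot\<close> are unions over all
  representatives. When the result is independent of the representative, the union collapses to one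
  coset.\<close>

lemma union_coset:
  assumes "x \<in> carrier A" "!!y. y \<in> J +> x ==> f y = f x"
  shows "(\<Union>y\<in>J +> x. f y) = f x"
  using assms coset_self by blast

lemma star_hom_coset: "star_hom A (quot A J) (\<lambda>x. J +> x)"
proof (rule star_homI)
  fix a b c assume a: "a \<in> carrier A"
  show "J +> a \<in> carrier (quot A J)" using a by (simp add: carrier_quot)
  show "J +> (c \<odot> a) = c \<odot>\<^bsub>quot A J\<^esub> (J +> a)"
  proof -
    have "J +> (c \<odot> y) = J +> (c \<odot> a)" if "y \<in> J +> a" for y
      using coset_mem[OF that a] a by (simp add: coset_eq_iff smult_minus_r[symmetric] p_smult)
    from union_coset[of a "\<lambda>y. J +> (c \<odot> y)", OF a this] show ?thesis by (simp add: quot_def)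
  qed
  show "J +> (star A a) = star (quot A J) (J +> a)"
  proof -
    have "J +> (star A y) = J +> (star A a)" if "y \<in> J +> a" for y
      using coset_mem[OF that a] a by (simp add: coset_eq_iff star_minus[symmetric])
    from union_coset[of a "\<lambda>y. J +> (star A y)", OF a this] show ?thesis by (simp add: quot_def)
  qed
  assume b: "b \<in> carrier A"
  show "J +> (a \<otimes> b) = (J +> a) \<otimes>\<^bsub>quot A J\<^esub> (J +> b)"
    using a b by (simp add: quot_def FactRing_def ideal.rcoset_mult_add[OF ideal_J])
  show "J +> (a \<oplus> b) = (J +> a) \<oplus>\<^bsub>quot A J\<^esub> (J +> b)"
    using a b by (simp add: quot_def FactRing_def ideal.a_rcos_sum[OF ideal_J])
qed (simp add: quot_def FactRing_def)

lemma zero_quot: "\<zero>\<^bsub>quot A J\<^esub> = J +> \<zero>"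
  using J_eq by (auto simp: quot_def FactRing_def a_r_coset_def')

lemma star_alg_quot: "star_alg (quot A J)"
  by (rule star_alg_image[OF star_alg_axioms star_hom_coset carrier_quot zero_quot])

lemma nrm_quot: "x \<in> carrier A ==> nrm (quot A J) (J +> x) = N x"
  using Inf_coset by (simp add: quot_def)

lemma cstar_pre_quot: "cstar_pre (quot A J)"
proof -
  interpret q: star_alg "quot A J" by (rule star_alg_quot)
  note h = refl star_homD(2,3)[OF star_hom_coset, symmetric] star_homD(4)[OF star_hom_coset, symmetric] star_homD(5,6)[OF star_hom_coset, symmetric]
  show ?thesis
    by unfold_locales (auto simp: cstar_seminorm_def carrier_quot nrm_quot h(2-) p_add p_smult p_mult p_star_mult)
qed

lemma minus_quot: "x \<in> carrier A ==> y \<in> carrier A ==> (J +> x) \<ominus>\<^bsub>quot A J\<^esub> (J +> y) = J +> (x \<ominus> y)"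
  using star_hom_minus[OF star_alg_axioms star_alg_quot star_hom_coset] by simp

lemma definite_quot: "X \<in> carrier (quot A J) ==> nrm (quot A J) X = 0 ==> X = \<zero>\<^bsub>quot A J\<^esub>"
  using coset_eq_iff[of _ \<zero>] by (fastforce simp: carrier_quot nrm_quot zero_quot p_minus_zero simp del: p_zero)

end

section \<open>Completions and enveloping C*-algebras\<close>

context cstar_pre
begin

abbreviation Com where "Com \<equiv> completion A"
abbreviation emb where "emb \<equiv> to_completion A"

text \<open>Adding an element of norm zero does not change the norm, so all members of a coset
  attain the infimum.\<close>

lemma kernel_quotient_nrm:
  assumes "J = {x \<in> carrier A. nrm A x = 0}" shows "kernel_quotient A (nrm A) J"
proof (intro kernel_quotient.intro kernel_quotient_axioms.intro seminormed_axioms)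
  fix x assume x: "x \<in> carrier A"
  have eq: "nrm A y = nrm A x" if y: "y \<in> J +> x" for y
  proof -
    obtain j where j: "j \<in> carrier A" "nrm A j = 0" "y = j \<oplus> x" using y unfolding a_r_coset_def' assms by blast
    have "x = (-1) \<odot> j \<oplus> y" using j(1,3) x by (simp add: a_assoc[symmetric] l_neg flip: a_inv_smult)
    then have "nrm A x \<le> nrm A y" using p_add[of "(-1) \<odot> j" y] j x by (simp add: p_smult)
    moreover have "nrm A y \<le> nrm A x" using p_add[OF j(1) x] j by simp
    ultimately show ?thesis by simp
  qed
  have "\<zero> \<oplus> x \<in> J +> x" unfolding a_r_coset_def' assms by auto
  then have "x \<in> J +> x" using x by simp
  from imageI[OF this] show "Inf (nrm A ` (J +> x)) = nrm A x"
    by (rule cInf_eq_minimum) (erule imageE, simp add: eq)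
qed (rule assms)

lemma null_seqs_eq: "null_seqs A = {x \<in> carrier Cau. nrm Cau x = 0}"
  using cauchy_nrm_tendsto LIMSEQ_unique unfolding null_seqs_def by fastforce

lemma kernel_quotient_null_seqs: "kernel_quotient Cau (nrm Cau) (null_seqs A)"
  by (rule cstar_pre.kernel_quotient_nrm[OF cstar_pre_cauchy_seqs null_seqs_eq])

definition cls :: "(nat => 'a) => (nat => 'a) set" where
  "cls x = null_seqs A +>\<^bsub>Cau\<^esub> x"

lemma carrier_completion: "carrier Com = cls ` carrier Cau"
  unfolding completion_def cls_def by (rule kernel_quotient.carrier_quot[OF kernel_quotient_null_seqs])

lemma cls_hom: "star_hom Cau Com cls"
  using kernel_quotient.star_hom_coset[OF kernel_quotient_null_seqs] unfolding completion_def cls_def[abs_def] .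

lemma to_completion_cls: "emb a = cls (\<lambda>n. a)"
  by (simp add: to_completion_def cls_def)

lemma cstar_pre_completion: "cstar_pre Com"
  unfolding completion_def by (rule kernel_quotient.cstar_pre_quot[OF kernel_quotient_null_seqs])

lemma star_alg_completion: "star_alg Com"
  using cstar_pre_completion by (simp add: cstar_pre_def seminormed_def)

lemma nrm_cls: "x \<in> carrier Cau ==> nrm Com (cls x) = nrm Cau x"
  unfolding completion_def cls_def by (rule kernel_quotient.nrm_quot[OF kernel_quotient_null_seqs])

lemma nrm_cls_tendsto: "x \<in> carrier Cau ==> (\<lambda>n. nrm A (x n)) \<longlonglongrightarrow> nrm Com (cls x)"
  using cauchy_nrm_tendsto nrm_cls by simp

lemma minus_cauchy_seqs:
  assumes "x \<in> carrier Cau" "y \<in> carrier Cau"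
  shows "x \<ominus>\<^bsub>Cau\<^esub> y = (\<lambda>n. x n \<ominus> y n)"
  using star_alg.minus_smult[OF star_alg_cauchy_seqs assms] cauchyD(1)[OF assms(1)] cauchyD(1)[OF assms(2)]
  by (simp add: cauchy_seqs_ops minus_smult)

lemma cauchy_minus:
  assumes x: "x \<in> carrier Cau" and y: "y \<in> carrier Cau"
  shows "(\<lambda>n. x n \<ominus> y n) \<in> carrier Cau"
  using cauchy_add[OF x cauchy_smult[OF y, of "-1"]] by (simp add: minus_smult cauchyD(1)[OF x] cauchyD(1)[OF y])

lemma minus_cls: "x \<in> carrier Cau ==> y \<in> carrier Cau ==>
  cls x \<ominus>\<^bsub>Com\<^esub> cls y = cls (\<lambda>n. x n \<ominus> y n)"
  by (simp only: star_hom_minus[OF star_alg_cauchy_seqs star_alg_completion cls_hom, symmetric] minus_cauchy_seqs)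

lemma cls_mem:
  assumes "y \<in> cls x" "x \<in> carrier Cau"
  shows "y \<in> carrier Cau" "(\<lambda>n. nrm A (y n \<ominus> x n)) \<longlonglongrightarrow> 0"
proof -
  note k = kernel_quotient.coset_mem[OF kernel_quotient_null_seqs assms[unfolded cls_def]]
  show y: "y \<in> carrier Cau" by (rule k)
  have "nrm Cau (\<lambda>n. y n \<ominus> x n) = 0"
    using k(2) kernel_quotient.coset_eq_iff[OF kernel_quotient_null_seqs y assms(2)] minus_cauchy_seqs[OF y assms(2)] by simp
  then show "(\<lambda>n. nrm A (y n \<ominus> x n)) \<longlonglongrightarrow> 0"
    using cauchy_nrm_tendsto[OF cauchy_minus[OF y assms(2)]] by simp
qed

lemma cls_self: "x \<in> carrier Cau ==> x \<in> cls x"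
  unfolding cls_def by (rule kernel_quotient.coset_self[OF kernel_quotient_null_seqs])

lemma to_completion_hom: "star_hom A Com emb"
proof -
  have "star_hom A Cau (\<lambda>a n. a)"
    by (rule star_homI) (auto simp: cauchy_const cauchy_seqs_ops)
  from star_hom_compose[OF this cls_hom] show ?thesis by (simp add: to_completion_cls[abs_def])
qed

lemma nrm_to_completion: "a \<in> carrier A ==> nrm Com (emb a) = nrm A a"
  using nrm_cls_tendsto[OF cauchy_const] by (simp add: to_completion_cls LIMSEQ_const_iff)

text \<open>Beyond the index of the Cauchy condition, the constant sequence \<open>x n\<close> is
  close to every later entry of \<open>x\<close>, hence its class is close to
  \<open>cls x\<close>.\<close>

lemma converges_cls:
  assumes x: "x \<in> carrier Cau"
  shows "converges Com (\<lambda>n. emb (x n)) (cls x)"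
  unfolding converges_def
proof (rule LIMSEQ_I)
  fix r :: real assume "0 < r"
  then obtain N where N: "!!m n. m \<ge> N ==> n \<ge> N ==> nrm A (x n \<ominus> x m) < r/2"
    using cauchyD(2)[OF x, of "r/2"] by auto
  have "norm (nrm Com (emb (x n) \<ominus>\<^bsub>Com\<^esub> cls x) - 0) < r" if "n \<ge> N" for n
  proof -
    have xn: "(\<lambda>_. x n) \<in> carrier Cau" using cauchyD(1)[OF x] by (rule cauchy_const)
    note d = nrm_cls_tendsto[OF cauchy_minus[OF xn x], folded minus_cls[OF xn x]]
    have "nrm Com (cls (\<lambda>_. x n) \<ominus>\<^bsub>Com\<^esub> cls x) \<le> r/2"
      by (rule LIMSEQ_le_const2[OF d]) (use N[OF _ that] less_imp_le in blast)
    moreover have "0 \<le> nrm Com (cls (\<lambda>_. x n) \<ominus>\<^bsub>Com\<^esub> cls x)"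
      by (rule LIMSEQ_le_const[OF d]) (use cauchyD(1)[OF x] in auto)
    ultimately show ?thesis using \<open>0 < r\<close> by (simp add: to_completion_cls)
  qed
  then show "\<exists>no. \<forall>n\<ge>no. norm (nrm Com (emb (x n) \<ominus>\<^bsub>Com\<^esub> cls x) - 0) < r" by blast
qed

lemma completion_approx:
  assumes "X \<in> carrier Com"
  obtains x where "x \<in> carrier Cau" "X = cls x" "converges Com (\<lambda>n. emb (x n)) X"
  using assms converges_cls by (auto simp: carrier_completion)

text \<open>Diagonal argument: the \<open>n\<close>-th class is replaced by a constant
  \<open>y n\<close> at distance below \<open>1 / (n + 1)\<close>. The sequence \<open>y\<close> is
  then Cauchy in \<open>A\<close>, and its class is the limit.\<close>

lemma cstar_alg_completion: "cstar_alg Com"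
proof -
  interpret c: cstar_pre "Com" by (rule cstar_pre_completion)
  note ih = to_completion_hom
  have ic: "emb a \<in> carrier Com" if "a \<in> carrier A" for a
    by (rule star_homD(1)[OF ih that])
  show ?thesis
  proof
    show "X = \<zero>\<^bsub>Com\<^esub>" if "X \<in> carrier Com" "nrm Com X = 0" for X
      using kernel_quotient.definite_quot[OF kernel_quotient_null_seqs] that unfolding completion_def by blast
    fix X assume X: "X \<in> carrier (cauchy_seqs Com)"
    have "\<exists>y\<in>carrier A. nrm Com (X n \<ominus>\<^bsub>Com\<^esub> emb y) < 1 / real (Suc n)" for n
    proof -
      obtain x where x: "x \<in> carrier Cau" "converges Com (\<lambda>n. emb (x n)) (X n)"
        using completion_approx c.cauchyD(1)[OF X] by metis
      have "\<forall>\<^sub>F m in sequentially. nrm Com (emb (x m) \<ominus>\<^bsub>Com\<^esub> X n) < 1 / real (Suc n)"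
        using order_tendstoD(2)[OF x(2)[unfolded converges_def]] by simp
      then obtain m where "nrm Com (emb (x m) \<ominus>\<^bsub>Com\<^esub> X n) < 1 / real (Suc n)"
        by (auto simp: eventually_sequentially)
      then show ?thesis using cauchyD(1)[OF x(1), of m] c.p_minus_commute[OF ic c.cauchyD(1)[OF X]] by auto
    qed
    then obtain y where y: "!!n. y n \<in> carrier A"
      "!!n. nrm Com (X n \<ominus>\<^bsub>Com\<^esub> emb (y n)) < 1 / real (Suc n)" by metis
    have near: "(\<lambda>n. nrm Com (X n \<ominus>\<^bsub>Com\<^esub> emb (y n))) \<longlonglongrightarrow> 0"
      by (rule tendsto_sandwich[OF _ _ tendsto_const LIMSEQ_Suc[OF lim_1_over_n]])
        (use y ic c.cauchyD(1)[OF X] less_imp_le in \<open>auto simp: less_imp_le\<close>)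
    have yc: "y \<in> carrier Cau"
    proof (rule cauchyI[OF y(1)])
      fix e :: real assume "e > 0"
      obtain N1 where N1: "!!m n. m \<ge> N1 ==> n \<ge> N1 ==> nrm Com (X m \<ominus>\<^bsub>Com\<^esub> X n) < e/3"
        using c.cauchyD(2)[OF X, of "e/3"] \<open>e > 0\<close> by auto
      obtain N2 where N2: "!!n. n \<ge> N2 ==> nrm Com (X n \<ominus>\<^bsub>Com\<^esub> emb (y n)) < e/3"
        using order_tendstoD(2)[OF near, of "e/3"] \<open>e > 0\<close> by (auto simp: eventually_sequentially)
      have "nrm A (y m \<ominus> y n) < e" if mn: "m \<ge> max N1 N2" "n \<ge> max N1 N2" for m n
      proof -
        let ?i = "\<lambda>n. emb (y n)"
        have "nrm A (y m \<ominus> y n) = nrm Com (?i m \<ominus>\<^bsub>Com\<^esub> ?i n)"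
          using y(1) star_hom_minus[OF star_alg_axioms star_alg_completion ih, of "y m" "y n"]
            nrm_to_completion[of "y m \<ominus> y n"] by simp
        also have "\<dots> \<le> nrm Com (?i m \<ominus>\<^bsub>Com\<^esub> X m) + (nrm Com (X m \<ominus>\<^bsub>Com\<^esub> X n)
             + nrm Com (X n \<ominus>\<^bsub>Com\<^esub> ?i n))"
          using c.p_triangle[of "?i m" "X m" "?i n"] c.p_triangle[of "X m" "X n" "?i n"] ic[OF y(1)] c.cauchyD(1)[OF X]
          by (smt (verit))
        also have "\<dots> < e"
          using N1[of m n] N2[of m] N2[of n] mn c.p_minus_commute[OF ic[OF y(1), of m] c.cauchyD(1)[OF X, of m]] by simp
        finally show ?thesis .
      qed
      then show "\<exists>N. \<forall>m\<ge>N. \<forall>n\<ge>N. nrm A (y m \<ominus> y n) < e" by blast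
    qed
    have lc: "cls y \<in> carrier Com" using yc by (simp add: carrier_completion)
    have "converges Com X (cls y)"
    proof (rule c.converges_dominated)
      show "nrm Com (X n \<ominus>\<^bsub>Com\<^esub> cls y) \<le> nrm Com (X n \<ominus>\<^bsub>Com\<^esub> emb (y n))
        + nrm Com (emb (y n) \<ominus>\<^bsub>Com\<^esub> cls y)" for n
        using c.cauchyD(1)[OF X] ic[OF y(1)] lc by (rule c.p_triangle)
      show "(\<lambda>n. nrm Com (X n \<ominus>\<^bsub>Com\<^esub> emb (y n))
        + nrm Com (emb (y n) \<ominus>\<^bsub>Com\<^esub> cls y)) \<longlonglongrightarrow> 0"
        using tendsto_add[OF near converges_cls[OF yc, unfolded converges_def]] by simp
    qed (use c.cauchyD(1)[OF X] lc in auto)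
    with lc show "\<exists>l\<in>carrier Com. converges Com X l" by blast
  qed
qed

end

section \<open>Contractive homomorphisms and their continuous extension\<close>

locale contraction = A: cstar_pre A + C: cstar_alg C
  for A :: "'a star_algebra" and C :: "'b star_algebra" and h :: "'a => 'b" +
  assumes hom: "star_hom A C h" and contractive: "a \<in> carrier A ==> nrm C (h a) \<le> nrm A a"
begin

lemma hom_minus: "a \<in> carrier A ==> b \<in> carrier A ==> h (a \<ominus>\<^bsub>A\<^esub> b) = h a \<ominus>\<^bsub>C\<^esub> h b"
  by (rule star_hom_minus[OF A.star_alg_axioms C.star_alg_axioms hom])

lemmas hom_closed = star_homD(1)[OF hom]

lemma hom_dist: "a \<in> carrier A ==> b \<in> carrier A ==> nrm C (h a \<ominus>\<^bsub>C\<^esub> h b) \<le> nrm A (a \<ominus>\<^bsub>A\<^esub> b)"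
  using contractive[of "a \<ominus>\<^bsub>A\<^esub> b"] by (simp add: hom_minus)

lemma hom_converges: "converges A x l ==> (!!n. x n \<in> carrier A) ==> l \<in> carrier A ==> converges C (\<lambda>n. h (x n)) (h l)"
  by (rule C.converges_dominated[where f = "\<lambda>n. nrm A (x n \<ominus>\<^bsub>A\<^esub> l)"]) (auto simp: hom_dist hom_closed converges_def)

lemma hom_cauchy:
  assumes "x \<in> carrier (cauchy_seqs A)" shows "(\<lambda>n. h (x n)) \<in> carrier (cauchy_seqs C)"
  using A.cauchyD[OF assms] hom_dist hom_closed by (intro C.cauchyI) (auto, meson le_less_trans)

text \<open>The \<open>THE\<close> in \<open>extend_hom\<close> speaks of all representatives at
  once. It is meaningful because two of them differ by a null sequence, which a contraction sends to
  a null sequence, and because limits in \<open>C\<close> are unique.\<close>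

lemma extend_hom_limit:
  assumes x: "x \<in> carrier (cauchy_seqs A)"
  shows "extend_hom C h (A.cls x) \<in> carrier C" "converges C (\<lambda>n. h (x n)) (extend_hom C h (A.cls x))"
proof -
  note xc = A.cauchyD(1)[OF x]
  obtain T where T: "T \<in> carrier C" "converges C (\<lambda>n. h (x n)) T" using C.complete[OF hom_cauchy[OF x]] by blast
  have all: "converges C (\<lambda>n. h (y n)) T" if "y \<in> A.cls x" for y
  proof (rule C.converges_dominated)
    note y = A.cls_mem[OF that x]
    note yc = A.cauchyD(1)[OF y(1)]
    show "nrm C (h (y n) \<ominus>\<^bsub>C\<^esub> T) \<le> nrm A (y n \<ominus>\<^bsub>A\<^esub> x n) + nrm C (h (x n) \<ominus>\<^bsub>C\<^esub> T)" for n
      using C.p_triangle[OF hom_closed[OF yc] hom_closed[OF xc] T(1), of n n] hom_dist[OF yc xc, of n n] by simp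
    show "(\<lambda>n. nrm A (y n \<ominus>\<^bsub>A\<^esub> x n) + nrm C (h (x n) \<ominus>\<^bsub>C\<^esub> T)) \<longlonglongrightarrow> 0"
      using tendsto_add[OF y(2) T(2)[unfolded converges_def]] by simp
  qed (use that A.cls_mem[OF that x] A.cauchyD(1) hom_closed T in auto)
  have "extend_hom C h (A.cls x) = T"
    unfolding extend_hom_def
  proof (rule the_equality)
    show "T' = T" if "T' \<in> carrier C \<and> (\<forall>x\<in>A.cls x. converges C (\<lambda>n. h (x n)) T')" for T'
      using C.converges_unique[of "\<lambda>n. h (x n)" T' T] that A.cls_self[OF x] T hom_closed[OF xc] by blast
  qed (use all T in blast)
  with T show "extend_hom C h (A.cls x) \<in> carrier C" "converges C (\<lambda>n. h (x n)) (extend_hom C h (A.cls x))" by auto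
qed

lemma extend_hom_eqI:
  assumes "x \<in> carrier (cauchy_seqs A)" "T \<in> carrier C" "converges C (\<lambda>n. h (x n)) T"
  shows "extend_hom C h (A.cls x) = T"
  using C.converges_unique[OF extend_hom_limit(2)[OF assms(1)] assms(3)] extend_hom_limit(1)[OF assms(1)] assms hom_closed A.cauchyD(1)
  by blast

lemma extend_hom_to_completion: "a \<in> carrier A ==> extend_hom C h (to_completion A a) = h a"
  unfolding A.to_completion_cls by (rule extend_hom_eqI) (auto simp: A.cauchy_const hom_closed C.converges_const)

lemma star_hom_extend_hom: "star_hom (completion A) C (extend_hom C h)"
proof (rule star_homI)
  note L = extend_hom_limit
  fix X c assume "X \<in> carrier (completion A)"
  then obtain x where x: "x \<in> carrier (cauchy_seqs A)" "X = A.cls x" by (auto simp: A.carrier_completion)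
  note xc = A.cauchyD(1)[OF x(1)]
  show "extend_hom C h X \<in> carrier C" using L x by simp
  show "extend_hom C h (c \<odot>\<^bsub>completion A\<^esub> X) = c \<odot>\<^bsub>C\<^esub> extend_hom C h X"
    using x C.converges_smult[OF L(2)[OF x(1)], of c] L(1)[OF x(1)] xc hom_closed[OF xc]
    by (simp add: star_homD(5)[OF A.cls_hom, symmetric] A.cauchy_seqs_ops)
      (intro extend_hom_eqI, auto simp: A.cauchy_smult star_homD(5)[OF hom])
  show "extend_hom C h (star (completion A) X) = star C (extend_hom C h X)"
    using x C.converges_star[OF L(2)[OF x(1)]] L(1)[OF x(1)] xc hom_closed[OF xc]
    by (simp add: star_homD(6)[OF A.cls_hom, symmetric] A.cauchy_seqs_ops)
      (intro extend_hom_eqI, auto simp: A.cauchy_star star_homD(6)[OF hom])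
  fix Y assume "Y \<in> carrier (completion A)"
  then obtain y where y: "y \<in> carrier (cauchy_seqs A)" "Y = A.cls y" by (auto simp: A.carrier_completion)
  note yc = A.cauchyD(1)[OF y(1)]
  show "extend_hom C h (X \<oplus>\<^bsub>completion A\<^esub> Y) = extend_hom C h X \<oplus>\<^bsub>C\<^esub> extend_hom C h Y"
    using x y C.converges_add[OF L(2)[OF x(1)] L(2)[OF y(1)]] L(1)[OF x(1)] L(1)[OF y(1)] xc yc hom_closed[OF xc] hom_closed[OF yc]
    by (simp add: star_homD(3)[OF A.cls_hom, symmetric] A.cauchy_seqs_ops)
      (intro extend_hom_eqI, auto simp: A.cauchy_add star_homD(3)[OF hom])
  show "extend_hom C h (X \<otimes>\<^bsub>completion A\<^esub> Y) = extend_hom C h X \<otimes>\<^bsub>C\<^esub> extend_hom C h Y"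
    using x y C.converges_mult[OF L(2)[OF x(1)] L(2)[OF y(1)]] L(1)[OF x(1)] L(1)[OF y(1)] xc yc hom_closed[OF xc] hom_closed[OF yc]
    by (simp add: star_homD(2)[OF A.cls_hom, symmetric] A.cauchy_seqs_ops)
      (intro extend_hom_eqI, auto simp: A.cauchy_mult star_homD(2)[OF hom])
next
  show "extend_hom C h \<one>\<^bsub>completion A\<^esub> = \<one>\<^bsub>C\<^esub>"
    using extend_hom_to_completion[of "\<one>\<^bsub>A\<^esub>"] star_homD(4)[OF A.to_completion_hom] star_homD(4)[OF hom] by simp
qed

lemma nrm_extend_hom:
  assumes "X \<in> carrier (completion A)" shows "nrm C (extend_hom C h X) \<le> nrm (completion A) X"
proof -
  obtain x where x: "x \<in> carrier (cauchy_seqs A)" "X = A.cls x" using assms by (auto simp: A.carrier_completion)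
  note xc = A.cauchyD(1)[OF x(1)]
  show ?thesis unfolding x(2)
    by (rule LIMSEQ_le[OF C.converges_nrm[OF extend_hom_limit(2)[OF x(1)]] A.nrm_cls_tendsto[OF x(1)]])
      (use xc hom_closed extend_hom_limit(1)[OF x(1)] contractive in auto)
qed

lemma contraction_extend_hom: "contraction (completion A) C (extend_hom C h)"
  by (intro contraction.intro contraction_axioms.intro A.cstar_pre_completion C.cstar_alg_axioms
    star_hom_extend_hom nrm_extend_hom)

end

section \<open>The universal norm and the enveloping C*-algebra\<close>

locale prenormed_star_alg = star_alg A for A :: "'a star_algebra" (structure) +
  assumes nrm_nonneg: "a \<in> carrier A ==> 0 \<le> nrm A a"
begin

text \<open>This competitor makes the supremum in \<open>universal_norm\<close> one over a nonempty
  set; \<open>nrm_nonneg\<close> places it below \<open>nrm A\<close>.\<close>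

lemma seminorm_zero: "cstar_seminorm A (\<lambda>_. 0)"
  by (simp add: cstar_seminorm_def)

lemma universal_norm_upper:
  assumes "cstar_seminorm A p" "\<forall>x\<in>carrier A. p x \<le> nrm A x" "a \<in> carrier A"
  shows "p a \<le> universal_norm A a"
  unfolding universal_norm_def by (rule cSup_upper) (use assms in \<open>auto intro!: bdd_aboveI[of _ "nrm A a"]\<close>)

lemma universal_norm_least:
  assumes "!!p. cstar_seminorm A p ==> \<forall>x\<in>carrier A. p x \<le> nrm A x ==> p a \<le> K"
  shows "universal_norm A a \<le> K"
  unfolding universal_norm_def
proof (rule cSup_least)
  show "{p a |p. cstar_seminorm A p \<and> (\<forall>x\<in>carrier A. p x \<le> nrm A x)} \<noteq> {}"
    using seminorm_zero nrm_nonneg by (auto intro!: exI[of _ "\<lambda>_. 0"])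
qed (use assms in blast)

lemma universal_norm_le: "a \<in> carrier A ==> universal_norm A a \<le> nrm A a"
  by (rule universal_norm_least) simp

text \<open>A pointwise supremum of C*-seminorms is one again: every law holds for each competitor
  \<open>p\<close>, and bounding the right-hand side by suprema leaves a bound independent of
  \<open>p\<close>.\<close>

lemma seminormed_universal_norm: "seminormed A (universal_norm A)"
proof (unfold_locales, unfold cstar_seminorm_def, intro ballI allI conjI)
  fix a b c assume a: "a \<in> carrier A" and b: "b \<in> carrier A"
  let ?U = "universal_norm A"
  have pos: "0 \<le> ?U a" if "a \<in> carrier A" for a
    using universal_norm_upper[OF seminorm_zero _ that] nrm_nonneg by simp
  show "0 \<le> ?U a" by (rule pos[OF a])
  show "?U (a \<oplus> b) \<le> ?U a + ?U b"
  proof (rule universal_norm_least)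
    fix p assume p: "cstar_seminorm A p" "\<forall>x\<in>carrier A. p x \<le> nrm A x"
    interpret p: seminormed A p by unfold_locales fact
    show "p (a \<oplus> b) \<le> ?U a + ?U b"
      using p.p_add[OF a b] universal_norm_upper[OF p a] universal_norm_upper[OF p b] by simp
  qed
  show "?U (a \<otimes> b) \<le> ?U a * ?U b"
  proof (rule universal_norm_least)
    fix p assume p: "cstar_seminorm A p" "\<forall>x\<in>carrier A. p x \<le> nrm A x"
    interpret p: seminormed A p by unfold_locales fact
    show "p (a \<otimes> b) \<le> ?U a * ?U b"
      using p.p_mult[OF a b] mult_mono[OF universal_norm_upper[OF p a] universal_norm_upper[OF p b] pos[OF a] p.p_nonneg[OF b]] by simp
  qed
  have le: "?U (c \<odot> a) \<le> cmod c * ?U a" if "a \<in> carrier A" for a c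
  proof (rule universal_norm_least)
    fix p assume p: "cstar_seminorm A p" "\<forall>x\<in>carrier A. p x \<le> nrm A x"
    interpret p: seminormed A p by unfold_locales fact
    show "p (c \<odot> a) \<le> cmod c * ?U a"
      using p.p_smult[OF that, of c] mult_left_mono[OF universal_norm_upper[OF p that], of "cmod c"] by simp
  qed
  show "?U (c \<odot> a) = cmod c * ?U a"
  proof (cases "c = 0")
    case True
    then show ?thesis using le[OF a, of c] pos[of "c \<odot> a"] a by simp
  next
    case False
    \<comment> \<open>A supremum yields only \<open>\<le>\<close>. The converse is the same
      inequality for the scalar \<open>1 / c\<close> and the element
      \<open>c \<odot> a\<close>.\<close>
    then have "?U a \<le> cmod (1 / c) * ?U (c \<odot> a)" using le[of "c \<odot> a" "1 / c"] a by simp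
    then have "cmod c * ?U a \<le> ?U (c \<odot> a)" using False by (simp add: norm_divide field_simps)
    then show ?thesis using le[OF a, of c] by simp
  qed
  show "?U (star A a \<otimes> a) = (?U a)\<^sup>2"
  proof (rule antisym)
    show "?U (star A a \<otimes> a) \<le> (?U a)\<^sup>2"
    proof (rule universal_norm_least)
      fix p assume p: "cstar_seminorm A p" "\<forall>x\<in>carrier A. p x \<le> nrm A x"
      interpret p: seminormed A p by unfold_locales fact
      show "p (star A a \<otimes> a) \<le> (?U a)\<^sup>2"
        using p.p_star_mult[OF a] power_mono[OF universal_norm_upper[OF p a] p.p_nonneg[OF a]] by simp
    qed
    \<comment> \<open>\<open>universal_norm_least\<close> bounds the values \<open>p a\<close> and
      not their squares, hence the square root.\<close>
    have "?U a \<le> sqrt (?U (star A a \<otimes> a))"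
    proof (rule universal_norm_least)
      fix p assume p: "cstar_seminorm A p" "\<forall>x\<in>carrier A. p x \<le> nrm A x"
      interpret p: seminormed A p by unfold_locales fact
      have "(p a)\<^sup>2 \<le> ?U (star A a \<otimes> a)"
        using p.p_star_mult[OF a] universal_norm_upper[OF p, of "star A a \<otimes> a"] a by simp
      then show "p a \<le> sqrt (?U (star A a \<otimes> a))" by (rule real_le_rsqrt)
    qed
    then show "(?U a)\<^sup>2 \<le> ?U (star A a \<otimes> a)"
      using pos[OF a] pos[of "star A a \<otimes> a"] a by (metis m_closed star_closed power_mono real_sqrt_pow2)
  qed
qed

lemma cstar_pre_universal: "cstar_pre (A\<lparr>nrm := universal_norm A\<rparr>)"
proof -
  interpret u: star_alg "A\<lparr>nrm := universal_norm A\<rparr>" by (rule star_alg_nrm_update)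
  interpret U: seminormed A "universal_norm A" by (rule seminormed_universal_norm)
  show ?thesis using U.seminorm by unfold_locales (simp add: cstar_seminorm_def)
qed

lemma to_envelope_hom: "star_hom A (envelope A) (to_envelope A)"
  using cstar_pre.to_completion_hom[OF cstar_pre_universal]
  unfolding envelope_def to_envelope_def star_hom_def ring_hom_def by simp

lemma nrm_to_envelope: "a \<in> carrier A ==> nrm (envelope A) (to_envelope A a) = universal_norm A a"
  using cstar_pre.nrm_to_completion[OF cstar_pre_universal, of a] by (simp add: envelope_def to_envelope_def)

lemma cstar_alg_envelope: "cstar_alg (envelope A)"
  unfolding envelope_def by (rule cstar_pre.cstar_alg_completion[OF cstar_pre_universal])

lemma envelope_approx:
  assumes "X \<in> carrier (envelope A)"
  obtains x where "!!n. x n \<in> carrier A" "converges (envelope A) (\<lambda>n. to_envelope A (x n)) X"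
proof -
  interpret u: cstar_pre "A\<lparr>nrm := universal_norm A\<rparr>" by (rule cstar_pre_universal)
  obtain x where x: "x \<in> carrier (cauchy_seqs (A\<lparr>nrm := universal_norm A\<rparr>))"
    "converges (completion (A\<lparr>nrm := universal_norm A\<rparr>)) (\<lambda>n. to_completion (A\<lparr>nrm := universal_norm A\<rparr>) (x n)) X"
    using u.completion_approx assms unfolding envelope_def by blast
  have "x n \<in> carrier A" for n using u.cauchyD(1)[OF x(1), of n] by simp
  then show ?thesis using x(2) that unfolding envelope_def to_envelope_def by blast
qed

text \<open>The norm of \<open>C\<close> pulled back along \<open>h\<close> is one of the seminorms
  whose supremum is the universal norm.\<close>

lemma contraction_universal:
  assumes C: "cstar_alg C" and h: "star_hom A C h" and le: "!!a. a \<in> carrier A ==> nrm C (h a) \<le> nrm A a"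
  shows "contraction (A\<lparr>nrm := universal_norm A\<rparr>) C h"
proof -
  interpret C: cstar_alg C by fact
  have "seminormed A (\<lambda>a. nrm C (h a))"
    by (rule seminormedI_pullback[OF star_alg_axioms C.seminormed_axioms h])
  then have "nrm C (h a) \<le> universal_norm A a" if "a \<in> carrier A" for a
    using universal_norm_upper[of "\<lambda>a. nrm C (h a)" a] le that by (auto simp: seminormed.seminorm)
  moreover have "star_hom (A\<lparr>nrm := universal_norm A\<rparr>) C h"
    using h by (simp add: star_hom_def ring_hom_def)
  ultimately show ?thesis
    by (intro contraction.intro contraction_axioms.intro cstar_pre_universal C) auto
qed

lemma
  assumes "cstar_alg C" "star_hom A C h" "!!a. a \<in> carrier A ==> nrm C (h a) \<le> nrm A a"
  shows contraction_envelope: "contraction (envelope A) C (extend_hom C h)"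
    and extend_hom_to_envelope: "a \<in> carrier A ==> extend_hom C h (to_envelope A a) = h a"
  using contraction.contraction_extend_hom[OF contraction_universal[OF assms]]
    contraction.extend_hom_to_completion[OF contraction_universal[OF assms], of a]
  by (simp_all add: envelope_def to_envelope_def)

end

context star_alg
begin

lemma minus_self: "a \<in> carrier A ==> a \<ominus> a = \<zero>"
  by (simp add: a_minus_def r_neg)

lemma minus_zero: "a \<in> carrier A ==> a \<ominus> \<zero> = a"
  by (simp add: minus_smult)

end

section \<open>Closed linear spans\<close>

context cstar_pre
begin

lemma closed_span_lin_span: "X \<subseteq> carrier A ==> a \<in> lin_span A X ==> a \<in> closed_span A X"
  by (auto simp: closed_span_def lin_span_closed intro!: bexI[of _ a])

lemma closed_span_base: "X \<subseteq> carrier A ==> a \<in> X ==> a \<in> closed_span A X"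
  by (intro closed_span_lin_span lin_span.base)

lemma closed_span_subset: "closed_span A X \<subseteq> carrier A"
  by (auto simp: closed_span_def)

lemma closed_span_approx:
  assumes "a \<in> closed_span A X" "X \<subseteq> carrier A"
  obtains x where "!!n. x n \<in> lin_span A X" "converges A x a"
proof -
  have "\<exists>x\<in>lin_span A X. nrm A (a \<ominus> x) < 1 / real (Suc n)" for n
    using assms(1) unfolding closed_span_def by simp
  then obtain x where x: "!!n. x n \<in> lin_span A X" "!!n. nrm A (a \<ominus> x n) < 1 / real (Suc n)" by metis
  have a: "a \<in> carrier A" using assms(1) by (simp add: closed_span_def)
  have xc: "x n \<in> carrier A" for n using lin_span_closed[OF assms(2) x(1)] .
  have "converges A x a"
    by (rule converges_dominated[OF _ LIMSEQ_Suc[OF lim_1_over_n] xc a])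
      (use x(2) p_minus_commute[OF a xc] less_imp_le in metis)
  with x show ?thesis using that by blast
qed

lemma closed_span_limit:
  assumes "!!n. x n \<in> closed_span A X" "converges A x a" "a \<in> carrier A" "X \<subseteq> carrier A"
  shows "a \<in> closed_span A X"
  unfolding closed_span_def
proof (intro CollectI conjI allI impI assms(3))
  fix e :: real assume "e > 0"
  then obtain n where n: "nrm A (x n \<ominus> a) < e/2"
    using order_tendstoD(2)[OF assms(2)[unfolded converges_def], of "e/2"] by (auto simp: eventually_sequentially)
  have "\<exists>y\<in>lin_span A X. nrm A (x n \<ominus> y) < e/2"
    using assms(1)[of n] half_gt_zero[OF \<open>e > 0\<close>] unfolding closed_span_def by blast
  then obtain y where y: "y \<in> lin_span A X" "nrm A (x n \<ominus> y) < e/2" by blast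
  have c: "x n \<in> carrier A" "y \<in> carrier A" using closed_span_subset assms(1) lin_span_closed[OF assms(4) y(1)] by blast+
  have "nrm A (a \<ominus> y) < e"
    using p_triangle[OF assms(3) c] p_minus_commute[OF c(1) assms(3)] n y by simp
  with y show "\<exists>x\<in>lin_span A X. nrm A (a \<ominus> x) < e" by blast
qed

text \<open>With the case of sequential limits, a property that is linear and continuous needs to be
  computed on generators only.\<close>

lemma closed_span_induct [consumes 2, case_names zero base add smult limit]:
  assumes "a \<in> closed_span A X" "X \<subseteq> carrier A" "P \<zero>" "!!x. x \<in> X ==> P x"
    and add: "!!x y. x \<in> carrier A ==> y \<in> carrier A ==> P x ==> P y ==> P (x \<oplus> y)"
    and smult: "!!x c. x \<in> carrier A ==> P x ==> P (c \<odot> x)"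
    and limit: "!!x a. (!!n. x n \<in> carrier A) ==> (!!n. P (x n)) ==> a \<in> carrier A ==> converges A x a ==> P a"
  shows "P a"
proof -
  have "P x" if "x \<in> lin_span A X" for x
    using that by induction (use assms lin_span_closed[OF assms(2)] in auto)
  then show ?thesis using closed_span_approx[OF assms(1,2)] limit lin_span_closed[OF assms(2)] closed_span_subset assms(1)
    by (metis subsetD)
qed

lemma closed_span_add:
  assumes "a \<in> closed_span A X" "b \<in> closed_span A X" "X \<subseteq> carrier A"
  shows "a \<oplus> b \<in> closed_span A X"
proof -
  obtain x y where xy: "!!n. x n \<in> lin_span A X" "converges A x a" "!!n. y n \<in> lin_span A X" "converges A y b"
    using closed_span_approx[OF assms(1,3)] closed_span_approx[OF assms(2,3)] by metis
  note c = lin_span_closed[OF assms(3)] subsetD[OF closed_span_subset assms(1)] subsetD[OF closed_span_subset assms(2)]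
  show ?thesis
    by (rule closed_span_limit[OF _ converges_add[OF xy(2,4)] _ assms(3)])
      (use xy c assms(3) in \<open>auto intro: closed_span_lin_span lin_span.add\<close>)
qed

lemma closed_span_smult:
  assumes "a \<in> closed_span A X" "X \<subseteq> carrier A"
  shows "c \<odot> a \<in> closed_span A X"
proof -
  obtain x where x: "!!n. x n \<in> lin_span A X" "converges A x a" using closed_span_approx[OF assms] by metis
  note c = lin_span_closed[OF assms(2)] subsetD[OF closed_span_subset assms(1)]
  show ?thesis
    by (rule closed_span_limit[OF _ converges_smult[OF x(2)] _ assms(2)])
      (use x c assms(2) in \<open>auto intro: closed_span_lin_span lin_span.smult\<close>)
qed

lemma closed_span_zero: "X \<subseteq> carrier A ==> \<zero> \<in> closed_span A X"
  by (intro closed_span_lin_span lin_span.zero)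

text \<open>Continuity is used in one factor at a time: the left factor is first a generator while
  the right one varies, then the right one is fixed in its closed span and the left one
  varies.\<close>

lemma closed_span_mult:
  assumes ab: "a \<in> closed_span A X" "b \<in> closed_span A Y" and X: "X \<subseteq> carrier A" and Y: "Y \<subseteq> carrier A"
    and Z: "Z \<subseteq> carrier A" and mult: "!!x y. x \<in> X ==> y \<in> Y ==> x \<otimes> y \<in> closed_span A Z"
  shows "a \<otimes> b \<in> closed_span A Z"
proof -
  have b: "b \<in> carrier A" using ab closed_span_subset by blast
  have xb: "x \<otimes> b \<in> closed_span A Z" if x: "x \<in> X" for x
    using ab(2) Y
  proof (induction rule: closed_span_induct)
    case (limit y l)
    show ?case by (rule closed_span_limit[OF limit.IH converges_mult[OF converges_const]]) (use limit x X Z in auto)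
  qed (use x X Z mult in \<open>auto simp: closed_span_zero r_distr mult_smult_r subset_iff intro: closed_span_add closed_span_smult\<close>)
  show ?thesis
    using ab(1) X
  proof (induction rule: closed_span_induct)
    case (limit y l)
    show ?case by (rule closed_span_limit[OF limit.IH converges_mult[OF _ converges_const]]) (use limit b Z in auto)
  qed (use b X Z xb in \<open>auto simp: closed_span_zero l_distr mult_smult_l subset_iff intro: closed_span_add closed_span_smult\<close>)
qed

lemma closed_span_star:
  assumes a: "a \<in> closed_span A X" and X: "X \<subseteq> carrier A"
    and Z: "Z \<subseteq> carrier A" and star: "!!x. x \<in> X ==> star A x \<in> closed_span A Z"
  shows "star A a \<in> closed_span A Z"
  using a X
proof (induction rule: closed_span_induct)
  case (limit y l)
  show ?case by (rule closed_span_limit[OF limit.IH converges_star]) (use limit Z in auto)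
qed (use X Z star in \<open>auto simp: closed_span_zero star_add star_smult subset_iff intro: closed_span_add closed_span_smult\<close>)

end

lemma (in contraction) closed_span_image:
  assumes a: "a \<in> closed_span A X" and X: "X \<subseteq> carrier A" shows "h a \<in> closed_span C (h ` X)"
proof -
  have hX: "h ` X \<subseteq> carrier C" using X hom_closed by auto
  show ?thesis using a X
  proof (induction rule: A.closed_span_induct)
    case zero then show ?case
      using star_hom_zero[OF A.star_alg_axioms C.star_alg_axioms hom] C.closed_span_zero[OF hX] by simp
  next
    case (limit y l)
    show ?case by (rule C.closed_span_limit[OF limit.IH hom_converges]) (use limit hX hom_closed in auto)
  qed (use X hX in \<open>auto simp: star_homD[OF hom] intro: C.closed_span_base C.closed_span_add C.closed_span_smult\<close>)
qed

section \<open>Closed subalgebras, and transfer of bijectivity between completions\<close>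

lemma (in cstar_alg) cstar_alg_carrier_update:
  assumes Y: "Y \<subseteq> carrier A" "\<zero> \<in> Y" "\<one> \<in> Y" "!!a b. a \<in> Y ==> b \<in> Y ==> a \<oplus> b \<in> Y"
    "!!a b. a \<in> Y ==> b \<in> Y ==> a \<otimes> b \<in> Y" "!!a c. a \<in> Y ==> c \<odot> a \<in> Y" "!!a. a \<in> Y ==> star A a \<in> Y"
    and limit: "!!x l. (!!n. x n \<in> Y) ==> l \<in> carrier A ==> converges A x l ==> l \<in> Y"
  shows "cstar_alg (A\<lparr>carrier := Y\<rparr>)" "a \<in> Y ==> b \<in> Y ==> a \<ominus>\<^bsub>A\<lparr>carrier := Y\<rparr>\<^esub> b = a \<ominus> b"
proof -
  interpret u: star_alg "A\<lparr>carrier := Y\<rparr>" by (rule star_alg_carrier_update) (rule Y; assumption)+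
  have minus: "a \<ominus>\<^bsub>A\<lparr>carrier := Y\<rparr>\<^esub> b = a \<ominus> b" if "a \<in> Y" "b \<in> Y" for a b
    using u.minus_smult[of a b] that Y(1) by (simp add: subset_iff minus_smult)
  then show "a \<in> Y ==> b \<in> Y ==> a \<ominus>\<^bsub>A\<lparr>carrier := Y\<rparr>\<^esub> b = a \<ominus> b" .
  have sn: "cstar_seminorm (A\<lparr>carrier := Y\<rparr>) (nrm (A\<lparr>carrier := Y\<rparr>))"
    using seminorm Y(1) by (auto simp: cstar_seminorm_def)
  interpret u: cstar_pre "A\<lparr>carrier := Y\<rparr>" by unfold_locales (rule sn)
  show "cstar_alg (A\<lparr>carrier := Y\<rparr>)"
  proof
    show "a = \<zero>\<^bsub>A\<lparr>carrier := Y\<rparr>\<^esub>" if "a \<in> carrier (A\<lparr>carrier := Y\<rparr>)" "nrm (A\<lparr>carrier := Y\<rparr>) a = 0" for a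
      using definite[of a] that Y(1) by auto
    fix x assume x: "x \<in> carrier (cauchy_seqs (A\<lparr>carrier := Y\<rparr>))"
    have xY: "x n \<in> Y" for n using u.cauchyD(1)[OF x, of n] by simp
    have "x \<in> carrier (cauchy_seqs A)"
    proof (rule cauchyI)
      show "x n \<in> carrier A" for n using xY Y(1) by blast
      show "\<exists>N. \<forall>m\<ge>N. \<forall>n\<ge>N. nrm A (x m \<ominus> x n) < e" if "e > 0" for e
        using u.cauchyD(2)[OF x that] minus[OF xY xY] by simp
    qed
    then obtain l where l: "l \<in> carrier A" "converges A x l" using complete by blast
    then have "l \<in> Y" using limit xY by blast
    moreover from this have "converges (A\<lparr>carrier := Y\<rparr>) x l" using l(2) minus[OF xY] by (simp add: converges_def)
    ultimately show "\<exists>l\<in>carrier (A\<lparr>carrier := Y\<rparr>). converges (A\<lparr>carrier := Y\<rparr>) x l" by auto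
  qed
qed

text \<open>The two maps out of \<open>F\<close> induce the same distances, so convergence in
  \<open>E\<close> makes the images in \<open>C\<close> a Cauchy sequence, and \<open>C\<close> is
  complete.\<close>

lemma limit_transfer:
  assumes F: "star_alg F" and C: "cstar_alg C" and E: "cstar_pre E" and d: "star_hom F C d" and e: "star_hom F E e"
    and iso: "!!x. x \<in> carrier F ==> nrm C (d x) = nrm E (e x)"
    and x: "!!n. x n \<in> carrier F" and l: "l \<in> carrier E" "converges E (\<lambda>n. e (x n)) l"
  shows "\<exists>l\<in>carrier C. converges C (\<lambda>n. d (x n)) l"
proof -
  interpret F: star_alg F by fact
  interpret C: cstar_alg C by fact
  interpret E: cstar_pre E by fact
  note dc = star_homD(1)[OF d] and ec = star_homD(1)[OF e]
  have dist: "nrm C (d (x m) \<ominus>\<^bsub>C\<^esub> d (x n)) = nrm E (e (x m) \<ominus>\<^bsub>E\<^esub> e (x n))" for m n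
    using iso[of "x m \<ominus>\<^bsub>F\<^esub> x n"] x
    by (simp add: star_hom_minus[OF F C.star_alg_axioms d] star_hom_minus[OF F E.star_alg_axioms e])
  show ?thesis
  proof (rule C.complete[OF C.cauchyI])
    show "\<exists>N. \<forall>m\<ge>N. \<forall>n\<ge>N. nrm C (d (x m) \<ominus>\<^bsub>C\<^esub> d (x n)) < r" if "r > 0" for r
      using E.cauchyD(2)[OF E.converges_cauchy[OF l(2) _ l(1)] that] x ec dist by simp
  qed (use x dc in auto)
qed

text \<open>Completeness suffices here: the argument does not use that injective star-homomorphisms are isometric.\<close>

lemma bij_transfer:
  assumes F: "star_alg F" and h1: "contraction A1 C1 h1" and h2: "contraction A2 C2 h2"
    and A1: "cstar_alg A1" and A2: "cstar_alg A2"
    and d1: "star_hom F A1 d1" and d2: "star_hom F A2 d2"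
    and iso: "!!x. x \<in> carrier F ==> nrm A1 (d1 x) = nrm A2 (d2 x)"
    and iso': "!!x. x \<in> carrier F ==> nrm C1 (h1 (d1 x)) = nrm C2 (h2 (d2 x))"
    and dense1: "!!a. a \<in> carrier A1 ==> \<exists>x. (\<forall>n. x n \<in> carrier F) \<and> converges A1 (\<lambda>n. d1 (x n)) a"
    and dense2: "!!a. a \<in> carrier A2 ==> \<exists>x. (\<forall>n. x n \<in> carrier F) \<and> converges A2 (\<lambda>n. d2 (x n)) a"
    and dense: "!!c. c \<in> carrier C2 ==> \<exists>x. (\<forall>n. x n \<in> carrier F) \<and> converges C2 (\<lambda>n. h2 (d2 (x n))) c"
    and bij: "bij_betw h1 (carrier A1) (carrier C1)"
  shows "bij_betw h2 (carrier A2) (carrier C2)"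
proof -
  interpret F: star_alg F by fact
  interpret A1: cstar_alg A1 by fact
  interpret A2: cstar_alg A2 by fact
  interpret h1: contraction A1 C1 h1 by fact
  interpret h2: contraction A2 C2 h2 by fact
  note d1c = star_homD(1)[OF d1] and d2c = star_homD(1)[OF d2]
  note d1m = star_hom_minus[OF F A1.star_alg_axioms d1] and d2m = star_hom_minus[OF F A2.star_alg_axioms d2]
  note hd1 = star_hom_compose[OF d1 h1.hom] and hd2 = star_hom_compose[OF d2 h2.hom]
  note lim21 = limit_transfer[OF F A1 A2.cstar_pre_axioms d1 d2 iso]
    and lim12 = limit_transfer[OF F A2 A1.cstar_pre_axioms d2 d1 iso[symmetric]]
    and limC = limit_transfer[OF F h1.C.cstar_alg_axioms h2.C.cstar_pre_axioms hd1 hd2 iso']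
  have "inj_on h2 (carrier A2)"
  proof (rule inj_onI)
    fix a b assume ab: "a \<in> carrier A2" "b \<in> carrier A2" "h2 a = h2 b"
    let ?c = "a \<ominus>\<^bsub>A2\<^esub> b"
    have c: "?c \<in> carrier A2" using ab by simp
    have hc: "nrm C2 (h2 ?c) = 0" using ab by (simp add: h2.hom_minus h2.hom_closed)
    obtain x where x: "!!n. x n \<in> carrier F" "converges A2 (\<lambda>n. d2 (x n)) ?c" using dense2[OF c] by blast
    \<comment> \<open>\<open>l\<close> stands for \<open>?c\<close> in \<open>A1\<close>. The
      approximants have equal norms on both sides, before and after the homomorphisms, so
      \<open>h1 l\<close> vanishes, thus \<open>l\<close> does, and \<open>?c\<close> has norm
      zero.\<close>
    obtain l where l: "l \<in> carrier A1" "converges A1 (\<lambda>n. d1 (x n)) l" using lim21[of x, OF _ x(1) c x(2)] by blast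
    have "(\<lambda>n. nrm C1 (h1 (d1 (x n)))) \<longlonglongrightarrow> nrm C1 (h1 l)"
      using h1.C.converges_nrm[OF h1.hom_converges[OF l(2)]] x d1c l h1.hom_closed by simp
    moreover have "(\<lambda>n. nrm C2 (h2 (d2 (x n)))) \<longlonglongrightarrow> nrm C2 (h2 ?c)"
      using h2.C.converges_nrm[OF h2.hom_converges[OF x(2)]] x d2c c h2.hom_closed by simp
    ultimately have "nrm C1 (h1 l) = 0" using iso'[OF x(1)] hc LIMSEQ_unique by simp
    then have "h1 l = \<zero>\<^bsub>C1\<^esub>" using h1.C.definite h1.hom_closed l by blast
    then have "h1 l = h1 \<zero>\<^bsub>A1\<^esub>" using star_hom_zero[OF A1.star_alg_axioms h1.C.star_alg_axioms h1.hom] by simp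
    then have l0: "l = \<zero>\<^bsub>A1\<^esub>" using bij l by (auto simp: bij_betw_def dest: inj_onD)
    have "(\<lambda>n. nrm A1 (d1 (x n))) \<longlonglongrightarrow> 0" using A1.converges_nrm[OF l(2)] x d1c l l0 by simp
    moreover have "(\<lambda>n. nrm A2 (d2 (x n))) \<longlonglongrightarrow> nrm A2 ?c" using A2.converges_nrm[OF x(2)] x d2c c by simp
    ultimately have "nrm A2 ?c = 0" using iso[OF x(1)] LIMSEQ_unique by simp
    then show "a = b" using A2.eqI ab by blast
  qed
  moreover have "h2 ` carrier A2 = carrier C2"
  proof (intro equalityI subsetI)
    fix c assume c: "c \<in> carrier C2"
    obtain x where x: "!!n. x n \<in> carrier F" "converges C2 (\<lambda>n. h2 (d2 (x n))) c" using dense[OF c] by blast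
    obtain z where z: "z \<in> carrier C1" "converges C1 (\<lambda>n. h1 (d1 (x n))) z" using limC[of x, OF _ x(1) c x(2)] by blast
    have "z \<in> h1 ` carrier A1" using bij z(1) by (simp add: bij_betw_def)
    then obtain a1 where a1: "a1 \<in> carrier A1" "h1 a1 = z" by blast
    \<comment> \<open>The elements \<open>d1 (x n)\<close> need not converge. Instead the preimage
      \<open>a1\<close> of the limit \<open>z\<close> is approximated by a new sequence
      \<open>y\<close>, and after the homomorphisms \<open>x\<close> and \<open>y\<close> have the
      same limit.\<close>
    obtain y where y: "!!n. y n \<in> carrier F" "converges A1 (\<lambda>n. d1 (y n)) a1" using dense1[OF a1(1)] by blast
    obtain a2 where a2: "a2 \<in> carrier A2" "converges A2 (\<lambda>n. d2 (y n)) a2" using lim12[of y, OF _ y(1) a1(1) y(2)] by blast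
    have hy: "converges C1 (\<lambda>n. h1 (d1 (y n))) z" using h1.hom_converges[OF y(2)] y d1c a1 by simp
    have isod: "nrm C1 (h1 (d1 (x n)) \<ominus>\<^bsub>C1\<^esub> h1 (d1 (y n))) = nrm C2 (h2 (d2 (x n)) \<ominus>\<^bsub>C2\<^esub> h2 (d2 (y n)))" for n
      using iso'[of "x n \<ominus>\<^bsub>F\<^esub> y n"] x y by (simp add: d1m d2m h1.hom_minus h2.hom_minus d1c d2c)
    have "converges C1 (\<lambda>n. h1 (d1 (x n)) \<ominus>\<^bsub>C1\<^esub> h1 (d1 (y n))) (z \<ominus>\<^bsub>C1\<^esub> z)"
      using h1.C.converges_minus[OF z(2) hy] x y d1c h1.hom_closed z by simp
    from h1.C.converges_nrm[OF this] have "(\<lambda>n. nrm C2 (h2 (d2 (x n)) \<ominus>\<^bsub>C2\<^esub> h2 (d2 (y n)))) \<longlonglongrightarrow> 0"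
      using isod x y d1c h1.hom_closed z by simp
    moreover have "converges C2 (\<lambda>n. h2 (d2 (x n)) \<ominus>\<^bsub>C2\<^esub> h2 (d2 (y n))) (c \<ominus>\<^bsub>C2\<^esub> h2 a2)"
      using h2.C.converges_minus[OF x(2) h2.hom_converges[OF a2(2)]] x y d2c h2.hom_closed c a2 by simp
    from h2.C.converges_nrm[OF this] have "(\<lambda>n. nrm C2 (h2 (d2 (x n)) \<ominus>\<^bsub>C2\<^esub> h2 (d2 (y n)))) \<longlonglongrightarrow> nrm C2 (c \<ominus>\<^bsub>C2\<^esub> h2 a2)"
      using x y d2c h2.hom_closed c a2 by simp
    ultimately have "nrm C2 (c \<ominus>\<^bsub>C2\<^esub> h2 a2) = 0" using LIMSEQ_unique by blast
    then have "c = h2 a2" using h2.C.eqI c a2 h2.hom_closed by blast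
    then show "c \<in> h2 ` carrier A2" using a2 by blast
  qed (use h2.hom_closed in auto)
  ultimately show ?thesis by (simp add: bij_betw_def)
qed

section \<open>Quotients by a one-dimensional ideal\<close>

locale one_dim_ideal = cstar_alg A for A :: "'a star_algebra" (structure) +
  fixes z
  assumes z [simp]: "z \<in> carrier A" "star A z = z" "z \<otimes> z = z"
    and z_absorb: "a \<in> carrier A ==> \<exists>c. z \<otimes> a = c \<odot> z \<and> a \<otimes> z = c \<odot> z"
begin

text \<open>The complementary projection. It is central, and \<open>A\<close> is the orthogonal sum
  of the corner of \<open>w\<close> and the multiples of \<open>z\<close>. With
  \<open>z = \<zero>\<close> the ideal is trivial and the corner is all of \<open>A\<close>.\<close>

definition w where "w = \<one> \<ominus> z"

definition ideal where "ideal = {c \<odot> z |c. True}"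

lemma w [simp]: "w \<in> carrier A" "star A w = w" "w \<otimes> w = w" "w \<otimes> z = \<zero>" "z \<otimes> w = \<zero>"
  by (simp_all add: w_def star_minus r_minus_distr l_minus_distr minus_self minus_zero)

lemma w_central: "a \<in> carrier A ==> w \<otimes> a = a \<otimes> w"
  using z_absorb[of a] by (auto simp: w_def r_minus_distr l_minus_distr)

lemma nrm_w: "nrm A w \<le> 1"
  using p_star_mult[of w] by (auto simp: power2_eq_square)

lemma nrm_w_mult: "a \<in> carrier A ==> nrm A (w \<otimes> a) \<le> nrm A a"
  using p_mult[of w a] nrm_w mult_right_mono[of "nrm A w" 1 "nrm A a"] by simp

text \<open>Multiplication by a central projection respects products and adjoints, and the norm is
  pulled back along it.\<close>

lemma seminormed_w: "seminormed A (\<lambda>a. nrm A (w \<otimes> a))"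
proof (unfold_locales, unfold cstar_seminorm_def, intro ballI allI conjI)
  fix a b c assume a: "a \<in> carrier A" and b: "b \<in> carrier A"
  show "0 \<le> nrm A (w \<otimes> a)" using a by simp
  show "nrm A (w \<otimes> (a \<oplus> b)) \<le> nrm A (w \<otimes> a) + nrm A (w \<otimes> b)" using a b by (simp add: r_distr p_add)
  show "nrm A (w \<otimes> (c \<odot> a)) = cmod c * nrm A (w \<otimes> a)" using a by (simp add: mult_smult_r p_smult)
  have wab: "w \<otimes> (x \<otimes> y) = (w \<otimes> x) \<otimes> (w \<otimes> y)" if "x \<in> carrier A" "y \<in> carrier A" for x y
  proof -
    have "(w \<otimes> x) \<otimes> (w \<otimes> y) = w \<otimes> ((x \<otimes> w) \<otimes> y)" using that by (simp add: m_assoc)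
    also have "\<dots> = w \<otimes> ((w \<otimes> x) \<otimes> y)" by (simp only: w_central[OF that(1)])
    also have "\<dots> = (w \<otimes> w) \<otimes> (x \<otimes> y)" using that by (simp add: m_assoc del: w(3))
    finally show ?thesis by simp
  qed
  show "nrm A (w \<otimes> (a \<otimes> b)) \<le> nrm A (w \<otimes> a) * nrm A (w \<otimes> b)" using a b by (simp add: wab p_mult)
  have "star A (w \<otimes> a) = w \<otimes> star A a" using a by (simp add: star_mult w_central)
  then show "nrm A (w \<otimes> (star A a \<otimes> a)) = (nrm A (w \<otimes> a))\<^sup>2"
    using a p_star_mult[of "w \<otimes> a"] by (simp add: wab)
qed

lemma decompose: "a \<in> carrier A ==> a = (w \<otimes> a) \<oplus> (z \<otimes> a)"
  by (simp add: w_def l_minus_distr)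

lemma ideal_eq: "ideal = {a \<in> carrier A. nrm A (w \<otimes> a) = 0}"
proof (intro equalityI subsetI)
  fix a assume "a \<in> {a \<in> carrier A. nrm A (w \<otimes> a) = 0}"
  then have a: "a \<in> carrier A" "w \<otimes> a = \<zero>" using definite by auto
  then have "a = z \<otimes> a" using decompose[of a] by simp
  then show "a \<in> ideal" using z_absorb[OF a(1)] unfolding ideal_def by auto
qed (auto simp: ideal_def mult_smult_r)

text \<open>All members of the coset of \<open>x\<close> have the same product with
  \<open>w\<close>, so none has smaller norm than \<open>w \<otimes> x\<close>; and
  \<open>w \<otimes> x\<close> lies in the coset, since it differs from \<open>x\<close> by a
  multiple of \<open>z\<close>.\<close>

lemma kernel_quotient_ideal: "kernel_quotient A (\<lambda>a. nrm A (w \<otimes> a)) ideal"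
proof (intro kernel_quotient.intro kernel_quotient_axioms.intro seminormed_w)
  fix x assume x: "x \<in> carrier A"
  have le: "nrm A (w \<otimes> x) \<le> nrm A y" if yx: "y \<in> ideal +> x" for y
  proof -
    obtain c where y: "y = c \<odot> z \<oplus> x" using yx unfolding a_r_coset_def' ideal_def by blast
    then have "w \<otimes> y = w \<otimes> x" "y \<in> carrier A" using x by (simp_all add: r_distr mult_smult_r)
    then show ?thesis using nrm_w_mult[of y] by simp
  qed
  obtain c where c: "z \<otimes> x = c \<odot> z" using z_absorb[OF x] by blast
  have "w \<otimes> x = x \<ominus> c \<odot> z" using x c by (simp add: w_def l_minus_distr)
  also have "\<dots> = (-c) \<odot> z \<oplus> x" using x by (simp add: minus_smult a_comm)
  finally have "w \<otimes> x = (-c) \<odot> z \<oplus> x" .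
  then have "w \<otimes> x \<in> ideal +> x" unfolding a_r_coset_def' ideal_def by blast
  from imageI[OF this] show "Inf (nrm A ` (ideal +> x)) = nrm A (w \<otimes> x)"
    by (rule cInf_eq_minimum) (erule imageE, simp add: le)
qed (rule ideal_eq)

sublocale q: kernel_quotient A "\<lambda>a. nrm A (w \<otimes> a)" ideal
  by (rule kernel_quotient_ideal)

text \<open>A Cauchy sequence of cosets has Cauchy representatives in the corner of
  \<open>w\<close>; their limit in \<open>A\<close> represents the limit.\<close>

lemma cstar_alg_quot: "cstar_alg (quot A ideal)"
proof -
  interpret Q: cstar_pre "quot A ideal" by (rule q.cstar_pre_quot)
  show ?thesis
  proof
    fix X assume X: "X \<in> carrier (cauchy_seqs (quot A ideal))"
    have "\<exists>x\<in>carrier A. X n = ideal +> x" for n using Q.cauchyD(1)[OF X, of n] by (auto simp: q.carrier_quot)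
    then obtain x where x: "!!n. x n \<in> carrier A" "!!n. X n = ideal +> x n" by metis
    have dist: "nrm (quot A ideal) ((ideal +> a) \<ominus>\<^bsub>quot A ideal\<^esub> (ideal +> b)) = nrm A (w \<otimes> a \<ominus> w \<otimes> b)"
      if "a \<in> carrier A" "b \<in> carrier A" for a b
      using that by (simp add: q.minus_quot q.nrm_quot r_minus_distr)
    have "(\<lambda>n. w \<otimes> x n) \<in> carrier (cauchy_seqs A)"
    proof (rule cauchyI)
      show "\<exists>N. \<forall>m\<ge>N. \<forall>n\<ge>N. nrm A (w \<otimes> x m \<ominus> w \<otimes> x n) < e" if "e > 0" for e
        using Q.cauchyD(2)[OF X that] dist[OF x(1) x(1)] x(2) by simp
    qed (use x in simp)
    then obtain l where l: "l \<in> carrier A" "converges A (\<lambda>n. w \<otimes> x n) l" using complete by blast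
    have "converges A (\<lambda>n. w \<otimes> (w \<otimes> x n)) (w \<otimes> l)"
      by (rule converges_mult[OF converges_const l(2)]) (use x l in auto)
    then have "converges A (\<lambda>n. w \<otimes> x n) (w \<otimes> l)" using x by (simp add: m_assoc[symmetric])
    then have "converges (quot A ideal) X (ideal +> l)"
      using dist[OF x(1) l(1)] x(2) by (simp add: converges_def)
    then show "\<exists>l\<in>carrier (quot A ideal). converges (quot A ideal) X l" using l by (auto simp: q.carrier_quot)
  qed (rule q.definite_quot)
qed

end

text \<open>Closure under products and adjoints is asked of the generators and passes to the closed
  span by continuity. The second claim is stated because subtraction in a record depends on its
  carrier.\<close>

lemma (in cstar_alg) closed_subalgebra:
  assumes X: "X \<subseteq> carrier A" "\<one> \<in> X" and mult: "!!x y. x \<in> X ==> y \<in> X ==> x \<otimes> y \<in> X"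
    and star: "!!x. x \<in> X ==> star A x \<in> X"
  shows "cstar_alg (A\<lparr>carrier := closed_span A X\<rparr>)"
    "a \<in> closed_span A X ==> b \<in> closed_span A X ==> a \<ominus>\<^bsub>A\<lparr>carrier := closed_span A X\<rparr>\<^esub> b = a \<ominus> b"
proof -
  note base = closed_span_base[OF X(1)]
  note rules = closed_span_subset closed_span_zero[OF X(1)] base[OF X(2)] closed_span_add[OF _ _ X(1)]
    closed_span_mult[OF _ _ X(1) X(1) X(1) base[OF mult]] closed_span_smult[OF _ X(1)]
    closed_span_star[OF _ X(1) X(1) base[OF star]] closed_span_limit[OF _ _ _ X(1)]
  show "cstar_alg (A\<lparr>carrier := closed_span A X\<rparr>)"
    by (rule cstar_alg_carrier_update(1)) (assumption | rule rules)+
  show "a \<in> closed_span A X ==> b \<in> closed_span A X ==> a \<ominus>\<^bsub>A\<lparr>carrier := closed_span A X\<rparr>\<^esub> b = a \<ominus> b"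
    by (rule cstar_alg_carrier_update(2)) (assumption | rule rules)+
qed

text \<open>Each generator fixes \<open>z\<close>, so a linear combination multiplies it by the sum
  of its coefficients. In a limit these scalars form a Cauchy sequence, because
  \<open>nrm A z > 0\<close>; if \<open>z\<close> vanishes, every scalar will do.\<close>

lemma (in cstar_alg) absorb_closed_span:
  assumes z: "z \<in> carrier A" and X: "X \<subseteq> carrier A" and zX: "!!x. x \<in> X ==> z \<otimes> x = z \<and> x \<otimes> z = z"
    and a: "a \<in> closed_span A X"
  shows "\<exists>c. z \<otimes> a = c \<odot> z \<and> a \<otimes> z = c \<odot> z"
  using a X
proof (induction rule: closed_span_induct)
  case zero
  then show ?case using z by (intro exI[of _ 0]) simp
next
  case (base x)
  then show ?case using zX z by (intro exI[of _ 1]) simp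
next
  case (add x y)
  then obtain c d where "z \<otimes> x = c \<odot> z" "x \<otimes> z = c \<odot> z" "z \<otimes> y = d \<odot> z" "y \<otimes> z = d \<odot> z" by blast
  then show ?case using add z by (intro exI[of _ "c + d"]) (simp add: r_distr l_distr smult_l_distr)
next
  case (smult x c)
  then obtain d where "z \<otimes> x = d \<odot> z" "x \<otimes> z = d \<odot> z" by blast
  then show ?case using smult z by (intro exI[of _ "c * d"]) (simp add: mult_smult_l mult_smult_r)
next
  case (limit x l)
  obtain c where c: "!!n. z \<otimes> x n = c n \<odot> z" "!!n. x n \<otimes> z = c n \<odot> z" using limit.IH by metis
  show ?case
  proof (cases "nrm A z = 0")
    case True
    then have "z = \<zero>" using definite z by blast
    then show ?thesis using limit by simp
  next
    case False
    then have pos: "nrm A z > 0" using p_nonneg[OF z] by simp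
    have conv: "converges A (\<lambda>n. c n \<odot> z) (z \<otimes> l)" "converges A (\<lambda>n. c n \<odot> z) (l \<otimes> z)"
      using converges_mult[OF converges_const[OF z] limit.hyps(3)] converges_mult[OF limit.hyps(3) converges_const[OF z]]
        limit z c by simp_all
    have "Cauchy c"
    proof (rule CauchyI)
      fix e :: real assume "0 < e"
      then have "e * nrm A z > 0" using pos by simp
      moreover have "(\<lambda>n. c n \<odot> z) \<in> carrier (cauchy_seqs A)"
        by (rule converges_cauchy[OF conv(1)]) (use z limit in auto)
      ultimately obtain N where N: "\<forall>m\<ge>N. \<forall>n\<ge>N. nrm A (c m \<odot> z \<ominus> c n \<odot> z) < e * nrm A z"
        using cauchyD(2) by blast
      have "norm (c m - c n) < e" if "m \<ge> N" "n \<ge> N" for m n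
      proof -
        have "c m \<odot> z \<ominus> c n \<odot> z = (c m - c n) \<odot> z"
          using z smult_l_distr[of z "c m" "- c n"] by (simp add: minus_smult)
        moreover have "nrm A (c m \<odot> z \<ominus> c n \<odot> z) < e * nrm A z" using N that by blast
        ultimately have "cmod (c m - c n) * nrm A z < e * nrm A z" using p_smult[OF z] by simp
        then show ?thesis using pos by simp
      qed
      then show "\<exists>M. \<forall>m\<ge>M. \<forall>n\<ge>M. norm (c m - c n) < e" by blast
    qed
    then obtain d where d: "c \<longlonglongrightarrow> d" by (auto simp: Cauchy_convergent_iff convergent_def)
    have "converges A (\<lambda>n. c n \<odot> z) (d \<odot> z)"
    proof (rule converges_dominated)
      show "nrm A (c n \<odot> z \<ominus> d \<odot> z) \<le> cmod (c n - d) * nrm A z" for n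
        using z smult_l_distr[of z "c n" "- d"] by (simp add: minus_smult p_smult[symmetric])
      show "(\<lambda>n. cmod (c n - d) * nrm A z) \<longlonglongrightarrow> 0"
        using d by (intro tendsto_mult_left_zero) (simp add: LIM_zero tendsto_norm_zero)
    qed (use z in auto)
    then have "z \<otimes> l = d \<odot> z" "l \<otimes> z = d \<odot> z"
      using conv z limit by (auto intro: converges_unique)
    then show ?thesis by blast
  qed
qed

section \<open>Hilbert modules of square-summable sections\<close>

context cstar_alg
begin

lemma has_sum_in_eventually:
  assumes "has_sum_in A f I s" "e > 0"
  shows "\<exists>K. finite K \<and> K \<subseteq> I \<and> (\<forall>F. finite F \<and> K \<subseteq> F \<and> F \<subseteq> I --> nrm A (finsum A f F \<ominus> s) < e)"
proof -
  have "\<forall>\<^sub>F F in finite_subsets_at_top I. nrm A (finsum A f F \<ominus> s) < e"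
    using assms unfolding has_sum_in_def by (intro order_tendstoD(2)) auto
  then show ?thesis unfolding eventually_finite_subsets_at_top .
qed

text \<open>Replaces the net of finite sets by a sequence, so that the limit laws for
  \<open>converges\<close> apply. Prescribing \<open>F0\<close> allows monotone estimates from a
  given partial sum on.\<close>

lemma has_sum_in_seq:
  assumes "has_sum_in A f I s" "finite F0" "F0 \<subseteq> I" "f \<in> I \<rightarrow> carrier A"
  obtains F where "!!n. finite (F n)" "!!n. F0 \<subseteq> F n" "!!n. F n \<subseteq> I" "converges A (\<lambda>n. finsum A f (F n)) s"
proof -
  have s: "s \<in> carrier A" using assms(1) by (simp add: has_sum_in_def)
  have "\<exists>F. finite F \<and> F0 \<subseteq> F \<and> F \<subseteq> I \<and> nrm A (finsum A f F \<ominus> s) < 1 / real (Suc n)" for n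
  proof -
    obtain K where K: "finite K" "K \<subseteq> I" "\<forall>F. finite F \<and> K \<subseteq> F \<and> F \<subseteq> I --> nrm A (finsum A f F \<ominus> s) < 1 / real (Suc n)"
      using has_sum_in_eventually[OF assms(1), of "1 / real (Suc n)"] by auto
    show ?thesis
      by (rule exI[of _ "K \<union> F0"]) (use K(1,2) assms(2,3) K(3)[rule_format, of "K \<union> F0"] in simp)
  qed
  then obtain F where F: "!!n. finite (F n)" "!!n. F0 \<subseteq> F n" "!!n. F n \<subseteq> I" "!!n. nrm A (finsum A f (F n) \<ominus> s) < 1 / real (Suc n)"
    by metis
  have c: "finsum A f (F n) \<in> carrier A" for n using assms(4) F(3)[of n] by (intro finsum_closed) auto
  have "converges A (\<lambda>n. finsum A f (F n)) s"
    by (rule converges_dominated[OF _ LIMSEQ_Suc[OF lim_1_over_n] c s]) (use F(4) less_imp_le in blast)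
  with F show ?thesis using that by blast
qed

lemma has_sum_in_nrm_le:
  assumes "has_sum_in A f I s" "f \<in> I \<rightarrow> carrier A" "!!F. finite F ==> F \<subseteq> I ==> nrm A (finsum A f F) \<le> K"
  shows "nrm A s \<le> K"
proof -
  have s: "s \<in> carrier A" using assms(1) by (simp add: has_sum_in_def)
  obtain F where F: "!!n. finite (F n)" "!!n. F n \<subseteq> I" "converges A (\<lambda>n. finsum A f (F n)) s"
    using has_sum_in_seq[OF assms(1) finite.emptyI empty_subsetI assms(2)] by metis
  have c: "finsum A f (F n) \<in> carrier A" for n using assms(2) F(2)[of n] by (intro finsum_closed) auto
  show ?thesis by (rule LIMSEQ_le_const2[OF converges_nrm[OF F(3) c s]]) (use assms(3)[OF F(1,2)] in simp)
qed

lemma has_sum_in_lincomb: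
  assumes f: "has_sum_in A f I s" "f \<in> I \<rightarrow> carrier A" and g: "has_sum_in A g I t" "g \<in> I \<rightarrow> carrier A"
  shows "has_sum_in A (\<lambda>i. f i \<oplus> c \<odot> g i) I (s \<oplus> c \<odot> t)"
proof -
  have st: "s \<in> carrier A" "t \<in> carrier A" using f g by (simp_all add: has_sum_in_def)
  have le: "nrm A (finsum A (\<lambda>i. f i \<oplus> c \<odot> g i) F \<ominus> (s \<oplus> c \<odot> t))
    \<le> nrm A (finsum A f F \<ominus> s) + cmod c * nrm A (finsum A g F \<ominus> t)" if F: "F \<subseteq> I" for F
  proof -
    have m: "f \<in> F \<rightarrow> carrier A" "g \<in> F \<rightarrow> carrier A" "(\<lambda>i. c \<odot> g i) \<in> F \<rightarrow> carrier A" using f g F by auto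
    have "finsum A (\<lambda>i. f i \<oplus> c \<odot> g i) F = finsum A f F \<oplus> c \<odot> finsum A g F"
      using m by (simp add: finsum_addf finsum_smult)
    then have "finsum A (\<lambda>i. f i \<oplus> c \<odot> g i) F \<ominus> (s \<oplus> c \<odot> t) = (finsum A f F \<ominus> s) \<oplus> c \<odot> (finsum A g F \<ominus> t)"
      using m st finsum_closed[of f F] finsum_closed[of g F] by (simp add: minus_add_minus smult_minus_r)
    then show ?thesis using p_add[of "finsum A f F \<ominus> s" "c \<odot> (finsum A g F \<ominus> t)"] m st finsum_closed[of f F] finsum_closed[of g F]
      by (simp add: p_smult)
  qed
  have "((\<lambda>F. nrm A (finsum A f F \<ominus> s) + cmod c * nrm A (finsum A g F \<ominus> t)) \<longlongrightarrow> 0 + cmod c * 0) (finite_subsets_at_top I)"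
    using f g unfolding has_sum_in_def by (intro tendsto_intros) auto
  then have lim: "((\<lambda>F. nrm A (finsum A f F \<ominus> s) + cmod c * nrm A (finsum A g F \<ominus> t)) \<longlongrightarrow> 0) (finite_subsets_at_top I)" by simp
  have "((\<lambda>F. nrm A (finsum A (\<lambda>i. f i \<oplus> c \<odot> g i) F \<ominus> (s \<oplus> c \<odot> t))) \<longlongrightarrow> 0) (finite_subsets_at_top I)"
  proof (rule tendsto_sandwich[OF _ _ tendsto_const lim])
    show "\<forall>\<^sub>F F in finite_subsets_at_top I. 0 \<le> nrm A (finsum A (\<lambda>i. f i \<oplus> c \<odot> g i) F \<ominus> (s \<oplus> c \<odot> t))"
      using f g st by (intro eventually_finite_subsets_at_top_weakI p_nonneg minus_closed finsum_closed) (auto simp: Pi_iff subset_iff)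
    show "\<forall>\<^sub>F F in finite_subsets_at_top I. nrm A (finsum A (\<lambda>i. f i \<oplus> c \<odot> g i) F \<ominus> (s \<oplus> c \<odot> t))
      \<le> nrm A (finsum A f F \<ominus> s) + cmod c * nrm A (finsum A g F \<ominus> t)"
      using le by (intro eventually_finite_subsets_at_top_weakI)
  qed
  then show ?thesis using st by (simp add: has_sum_in_def)
qed

lemma has_sum_in_star:
  assumes f: "has_sum_in A f I s" "f \<in> I \<rightarrow> carrier A"
  shows "has_sum_in A (\<lambda>i. star A (f i)) I (star A s)"
proof -
  have s: "s \<in> carrier A" using f by (simp add: has_sum_in_def)
  have eq: "nrm A (finsum A (\<lambda>i. star A (f i)) F \<ominus> star A s) = nrm A (finsum A f F \<ominus> s)" if "F \<subseteq> I" for F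
  proof -
    have m: "f \<in> F \<rightarrow> carrier A" using that f(2) by auto
    show ?thesis using p_star[of "finsum A f F \<ominus> s"] m s by (simp add: finsum_star star_minus)
  qed
  have ev: "\<forall>\<^sub>F F in finite_subsets_at_top I. nrm A (finsum A (\<lambda>i. star A (f i)) F \<ominus> star A s) = nrm A (finsum A f F \<ominus> s)"
    by (rule eventually_finite_subsets_at_top_weakI[OF eq])
  have "((\<lambda>F. nrm A (finsum A (\<lambda>i. star A (f i)) F \<ominus> star A s)) \<longlongrightarrow> 0) (finite_subsets_at_top I)"
    using f(1) by (simp add: has_sum_in_def tendsto_cong[OF ev])
  then show ?thesis using s by (simp add: has_sum_in_def)
qed

lemma has_sum_in_unique:
  assumes "has_sum_in A f I s" "has_sum_in A f I t" "f \<in> I \<rightarrow> carrier A"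
  shows "s = t"
proof -
  have st: "s \<in> carrier A" "t \<in> carrier A" using assms by (simp_all add: has_sum_in_def)
  have "has_sum_in A (\<lambda>i. f i \<oplus> (-1) \<odot> f i) I (s \<oplus> (-1) \<odot> t)" by (rule has_sum_in_lincomb[OF assms(1,3,2,3)])
  from has_sum_in_nrm_le[OF this] have "nrm A (s \<ominus> t) \<le> 0"
  proof -
    have "finsum A (\<lambda>i. f i \<oplus> (-1) \<odot> f i) F = \<zero>" if "F \<subseteq> I" for F
    proof -
      have "finsum A (\<lambda>i. f i \<oplus> (-1) \<odot> f i) F = finsum A (\<lambda>i. \<zero>) F"
        using that assms(3) by (intro finsum_cong') (auto simp: Pi_iff r_neg simp flip: a_inv_smult)
      then show ?thesis by simp
    qed
    then show ?thesis using has_sum_in_nrm_le[OF \<open>has_sum_in A (\<lambda>i. f i \<oplus> (-1) \<odot> f i) I (s \<oplus> (-1) \<odot> t)\<close>, of 0] assms(3) st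
      by (auto simp: minus_smult)
  qed
  then have "nrm A (s \<ominus> t) = 0" using st by (intro antisym) simp_all
  then show ?thesis using eqI[OF st] by simp
qed

lemma infsum_in_eqI: "has_sum_in A f I s ==> f \<in> I \<rightarrow> carrier A ==> infsum_in A f I = s"
  unfolding infsum_in_def by (rule the_equality) (auto intro: has_sum_in_unique)

lemma finsum_Diff:
  assumes "finite F" "G \<subseteq> F" "f \<in> F \<rightarrow> carrier A"
  shows "finsum A f F = finsum A f (F - G) \<oplus> finsum A f G"
proof -
  have "finsum A f ((F - G) \<union> G) = finsum A f (F - G) \<oplus> finsum A f G"
    by (rule finsum_Un_disjoint) (use assms in \<open>auto intro: finite_subset\<close>)
  moreover have "(F - G) \<union> G = F" using assms(2) by blast
  ultimately show ?thesis by simp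
qed

lemma has_sum_in_tail:
  assumes "has_sum_in A f I s" "f \<in> I \<rightarrow> carrier A" "e > 0"
  obtains F0 where "finite F0" "F0 \<subseteq> I" "!!F. finite F ==> F \<subseteq> I - F0 ==> nrm A (finsum A f F) < e"
proof -
  have s: "s \<in> carrier A" using assms(1) by (simp add: has_sum_in_def)
  obtain K where K: "finite K" "K \<subseteq> I" and KF: "\<forall>F. finite F \<and> K \<subseteq> F \<and> F \<subseteq> I --> nrm A (finsum A f F \<ominus> s) < e/2"
    using has_sum_in_eventually[OF assms(1) half_gt_zero[OF assms(3)]] by auto
  have "nrm A (finsum A f F) < e" if F: "finite F" "F \<subseteq> I - K" for F
  proof -
    have c: "finsum A f F \<in> carrier A" "finsum A f K \<in> carrier A" using F K assms(2) by (auto intro!: finsum_closed)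
    have "finsum A f (F \<union> K) = finsum A f F \<oplus> finsum A f K"
      by (rule finsum_Un_disjoint) (use F K assms(2) in auto)
    then have "finsum A f F = finsum A f (F \<union> K) \<ominus> finsum A f K"
      using c by (simp add: minus_eq a_assoc r_neg)
    moreover have "finsum A f (F \<union> K) \<in> carrier A" using F K assms(2) by (auto intro!: finsum_closed)
    ultimately have "nrm A (finsum A f F) \<le> nrm A (finsum A f (F \<union> K) \<ominus> s) + nrm A (s \<ominus> finsum A f K)"
      using c s p_triangle by metis
    moreover have "nrm A (finsum A f (F \<union> K) \<ominus> s) < e/2" "nrm A (finsum A f K \<ominus> s) < e/2"
      using KF[rule_format, of "F \<union> K"] KF[rule_format, of K] K F by blast+
    ultimately show ?thesis using p_minus_commute[OF s c(2)] by simp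
  qed
  with K(1,2) show ?thesis using that by blast
qed

text \<open>Cauchy criterion. The increasing unions \<open>G n\<close> of the control sets for
  \<open>1 / (n + 1)\<close> have Cauchy partial sums, and the sum over any larger finite set is
  within \<open>1 / (n + 1)\<close> of the sum over \<open>G n\<close>.\<close>

lemma has_sum_in_Cauchy:
  assumes f: "f \<in> I \<rightarrow> carrier A"
    and tail: "!!e. e > 0 ==> \<exists>F0. finite F0 \<and> F0 \<subseteq> I \<and> (\<forall>F. finite F --> F \<subseteq> I - F0 --> nrm A (finsum A f F) < e)"
  shows "\<exists>s. has_sum_in A f I s"
proof -
  have "\<exists>F0. finite F0 \<and> F0 \<subseteq> I \<and> (\<forall>F. finite F --> F \<subseteq> I - F0 --> nrm A (finsum A f F) < 1 / real (Suc n))" for n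
    by (rule tail) simp
  then obtain F0 where F0: "!!n. finite (F0 n)" "!!n. F0 n \<subseteq> I"
    "!!n F. finite F ==> F \<subseteq> I - F0 n ==> nrm A (finsum A f F) < 1 / real (Suc n)" by metis
  define G where "G n = (\<Union>k\<le>n. F0 k)" for n
  have G: "finite (G n)" "G n \<subseteq> I" "F0 n \<subseteq> G n" for n using F0 by (auto simp: G_def)
  have Gmono: "G n \<subseteq> G m" if "n \<le> m" for n m using that by (auto simp: G_def intro: order_trans)
  have Gc: "finsum A f F \<in> carrier A" if "F \<subseteq> I" for F using that f by (intro finsum_closed) auto
  have dist: "nrm A (finsum A f F \<ominus> finsum A f (G n)) < 1 / real (Suc n)" if F: "finite F" "F \<subseteq> I" "G n \<subseteq> F" for F n
  proof -
    have "finsum A f F = finsum A f (F - G n) \<oplus> finsum A f (G n)" by (rule finsum_Diff) (use F f in auto)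
    then have "finsum A f F \<ominus> finsum A f (G n) = finsum A f (F - G n)"
      using Gc[of "F - G n"] Gc[OF G(2)] F by (simp add: minus_eq a_assoc r_neg subset_iff)
    moreover have "F - G n \<subseteq> I - F0 n" using F G(3)[of n] by blast
    ultimately show ?thesis using F0(3)[of "F - G n" n] F(1) by simp
  qed
  have small: "\<exists>N. \<forall>n\<ge>N. 1 / real (Suc n) < e" if "e > 0" for e :: real
    using order_tendstoD(2)[OF LIMSEQ_Suc[OF lim_1_over_n] that] by (auto simp: eventually_sequentially)
  have "(\<lambda>n. finsum A f (G n)) \<in> carrier (cauchy_seqs A)"
  proof (rule cauchyI)
    fix e :: real assume "e > 0"
    then obtain N where N: "!!n. n \<ge> N ==> 1 / real (Suc n) < e" using small by blast
    have "nrm A (finsum A f (G m) \<ominus> finsum A f (G n)) < e" if "m \<ge> N" "n \<ge> N" for m n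
    proof (cases "m \<ge> n")
      case True then show ?thesis using dist[OF G(1,2) Gmono[OF True]] N[OF that(2)] by simp
    next
      case False
      then have "n \<ge> m" by simp
      then show ?thesis using dist[OF G(1,2) Gmono[of m n]] N[OF that(1)]
          p_minus_commute[OF Gc[OF G(2)[of m]] Gc[OF G(2)[of n]]] by simp
    qed
    then show "\<exists>N. \<forall>m\<ge>N. \<forall>n\<ge>N. nrm A (finsum A f (G m) \<ominus> finsum A f (G n)) < e" by blast
  qed (use Gc G in blast)
  then obtain s where s: "s \<in> carrier A" "converges A (\<lambda>n. finsum A f (G n)) s" using complete by blast
  have "((\<lambda>F. nrm A (finsum A f F \<ominus> s)) \<longlongrightarrow> 0) (finite_subsets_at_top I)"
  proof (rule tendstoI)
    fix e :: real assume "e > 0"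
    then obtain N where N: "!!n. n \<ge> N ==> 1 / real (Suc n) < e/2" using small[of "e/2"] by auto
    obtain M where M: "!!n. n \<ge> M ==> nrm A (finsum A f (G n) \<ominus> s) < e/2"
      using order_tendstoD(2)[OF s(2)[unfolded converges_def], of "e/2"] \<open>e > 0\<close> by (auto simp: eventually_sequentially)
    define n where "n = max N M"
    have "dist (nrm A (finsum A f F \<ominus> s)) 0 < e" if F: "finite F" "G n \<subseteq> F" "F \<subseteq> I" for F
      using p_triangle[OF Gc[OF F(3)] Gc[OF G(2), of n] s(1)] dist[OF F(1,3,2)] N[of n] M[of n]
        p_nonneg[of "finsum A f F \<ominus> s"] Gc[OF F(3)] s(1) by (simp add: n_def)
    then show "\<forall>\<^sub>F F in finite_subsets_at_top I. dist (nrm A (finsum A f F \<ominus> s)) 0 < e"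
      unfolding eventually_finite_subsets_at_top using G(1,2)[of n] by blast
  qed
  then show ?thesis using s(1) by (auto simp: has_sum_in_def)
qed

end

text \<open>
  The characters \<open>ch x\<close> of \<open>D\<close> localise the Hilbert module: they embed it isometrically into the
  bounded families, indexed by \<open>X\<close>, of square-summable scalar functions on \<open>I\<close>.
\<close>

locale section_module = cstar_alg A for A :: "'a star_algebra" (structure) +
  fixes I :: "'i set" and B :: "'i => 'a set" and X :: "'x set"
    and coeff :: "'x => 'i => 'a => complex" and ch :: "'x => 'a => complex" and D :: "'a set"
  assumes B_closed: "i \<in> I ==> b \<in> B i ==> b \<in> carrier A"
    and B_zero: "i \<in> I ==> \<zero> \<in> B i"
    and B_add: "i \<in> I ==> b \<in> B i ==> b' \<in> B i ==> b \<oplus> b' \<in> B i"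
    and B_smult: "i \<in> I ==> b \<in> B i ==> c \<odot> b \<in> B i"
    and B_limit: "i \<in> I ==> (!!n. y n \<in> B i) ==> l \<in> carrier A ==> converges A y l ==> l \<in> B i"
    and D_closed: "d \<in> D ==> d \<in> carrier A"
    and D_zero: "\<zero> \<in> D"
    and D_add: "d \<in> D ==> d' \<in> D ==> d \<oplus> d' \<in> D"
    and D_mult: "i \<in> I ==> b \<in> B i ==> b' \<in> B i ==> star A b \<otimes> b' \<in> D"
    and ch_add: "x \<in> X ==> d \<in> D ==> d' \<in> D ==> ch x (d \<oplus> d') = ch x d + ch x d'"
    and ch_mult: "x \<in> X ==> i \<in> I ==> b \<in> B i ==> b' \<in> B i ==> ch x (star A b \<otimes> b') = cnj (coeff x i b) * coeff x i b'"
    and coeff_add: "x \<in> X ==> i \<in> I ==> b \<in> B i ==> b' \<in> B i ==> coeff x i (b \<oplus> b') = coeff x i b + coeff x i b'"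
    and coeff_smult: "x \<in> X ==> i \<in> I ==> b \<in> B i ==> coeff x i (c \<odot> b) = c * coeff x i b"
    and ch_le: "x \<in> X ==> d \<in> D ==> cmod (ch x d) \<le> nrm A d"
    and nrm_le: "d \<in> D ==> 0 \<le> K ==> (!!x. x \<in> X ==> cmod (ch x d) \<le> K) ==> nrm A d \<le> K"
begin

section \<open>Square-summable sections and their inner product\<close>

definition L :: "('i => 'a) => 'x => 'i set => real" where
  "L u x F = L2_set (\<lambda>i. cmod (coeff x i (u i))) F"

definition sect :: "('i => 'a) => bool" where
  "sect u \<longleftrightarrow> (\<forall>i\<in>I. u i \<in> B i) \<and> (\<forall>i. i \<notin> I --> u i = \<zero>)"

text \<open>Norm convergence of the sum of \<open>star A (u i) \<otimes> u i\<close>, read through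
  the characters. The finite set \<open>F0\<close> may not depend on \<open>x\<close>:
  square-summability of each localisation by itself would be a weaker condition.\<close>

definition tail :: "('i => 'a) => bool" where
  "tail u \<longleftrightarrow> (\<forall>e>0. \<exists>F0. finite F0 \<and> F0 \<subseteq> I \<and> (\<forall>F. finite F --> F \<subseteq> I - F0 --> (\<forall>x\<in>X. L u x F \<le> e)))"

abbreviation E where "E \<equiv> ell2 A I B"
abbreviation ip where "ip \<equiv> ell2_inner A I"
abbreviation N where "N \<equiv> ell2_norm A I"

abbreviation pr where "pr u v \<equiv> \<lambda>i. star A (u i) \<otimes> v i"
abbreviation lc where "lc c u v \<equiv> \<lambda>i. u i \<oplus> c \<odot> v i"
abbreviation dN where "dN u v \<equiv> N (\<lambda>i. u i \<ominus> v i)"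

lemma L_nonneg [simp]: "0 \<le> L u x F"
  by (simp add: L_def L2_set_nonneg)

lemma sectD: "sect u ==> i \<in> I ==> u i \<in> B i" "sect u ==> u i \<in> carrier A"
  unfolding sect_def using B_closed by (blast, metis zero_closed)

lemma sect_lincomb: "sect u ==> sect v ==> sect (lc c u v)"
  by (auto simp: sect_def B_add B_smult)

lemma L_lincomb:
  assumes "sect u" "sect v" "F \<subseteq> I" "x \<in> X"
  shows "L (lc c u v) x F \<le> L u x F + cmod c * L v x F"
proof -
  have "L (lc c u v) x F \<le> L2_set (\<lambda>i. cmod (coeff x i (u i)) + cmod c * cmod (coeff x i (v i))) F"
    unfolding L_def
  proof (rule L2_set_mono)
    fix i assume "i \<in> F"
    then have i: "i \<in> I" using assms by blast
    show "cmod (coeff x i (u i \<oplus> c \<odot> v i)) \<le> cmod (coeff x i (u i)) + cmod c * cmod (coeff x i (v i))"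
      using sectD(1)[OF assms(1) i] sectD(1)[OF assms(2) i] assms(4) i norm_triangle_ineq[of "coeff x i (u i)" "c * coeff x i (v i)"]
      by (simp add: coeff_add coeff_smult B_smult norm_mult)
  qed auto
  also have "\<dots> \<le> L u x F + cmod c * L v x F"
    unfolding L_def using L2_set_triangle_ineq[of "\<lambda>i. cmod (coeff x i (u i))" "\<lambda>i. cmod c * cmod (coeff x i (v i))" F]
    by (simp add: L2_set_right_distrib)
  finally show ?thesis .
qed

lemma finsum_D:
  assumes "!!i. i \<in> F ==> f i \<in> D" "x \<in> X"
  shows "finsum A f F \<in> D" "ch x (finsum A f F) = (\<Sum>i\<in>F. ch x (f i))"
proof -
  have z: "ch x \<zero> = 0" using ch_add[OF assms(2) D_zero D_zero] by simp
  have "finsum A f F \<in> D \<and> ch x (finsum A f F) = (\<Sum>i\<in>F. ch x (f i))"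
    using assms(1) by (induction F rule: infinite_finite_induct) (auto simp: z D_zero D_add D_closed ch_add assms(2) Pi_def)
  then show "finsum A f F \<in> D" "ch x (finsum A f F) = (\<Sum>i\<in>F. ch x (f i))" by auto
qed

lemma finsum_D': "(!!i. i \<in> F ==> f i \<in> D) ==> finsum A f F \<in> D"
  by (induction F rule: infinite_finite_induct) (auto simp: D_zero D_add D_closed Pi_def)

lemma prod_closed: "sect u ==> sect v ==> (pr u v) \<in> F \<rightarrow> carrier A"
  by (auto simp: sectD)

lemma ch_finsum:
  assumes "sect u" "sect v" "F \<subseteq> I" "x \<in> X"
  shows "ch x (finsum A (pr u v) F) = (\<Sum>i\<in>F. cnj (coeff x i (u i)) * coeff x i (v i))"
proof -
  have "ch x (finsum A (pr u v) F) = (\<Sum>i\<in>F. ch x (star A (u i) \<otimes> v i))"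
    by (rule finsum_D(2)) (use assms sectD(1) D_mult in blast)+
  also have "\<dots> = (\<Sum>i\<in>F. cnj (coeff x i (u i)) * coeff x i (v i))"
    by (rule sum.cong) (use assms sectD(1) ch_mult in blast)+
  finally show ?thesis .
qed

lemma finsum_mem_D: "sect u ==> sect v ==> F \<subseteq> I ==> finsum A (pr u v) F \<in> D"
  by (rule finsum_D') (use sectD(1) D_mult in blast)

lemma ch_finsum_le:
  assumes "sect u" "sect v" "F \<subseteq> I" "x \<in> X"
  shows "cmod (ch x (finsum A (pr u v) F)) \<le> L u x F * L v x F"
proof -
  have "cmod (ch x (finsum A (pr u v) F)) \<le> (\<Sum>i\<in>F. cmod (cnj (coeff x i (u i)) * coeff x i (v i)))"
    unfolding ch_finsum[OF assms] by (rule norm_sum)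
  also have "\<dots> \<le> L u x F * L v x F"
    unfolding L_def using L2_set_mult_ineq[of "\<lambda>i. cmod (coeff x i (u i))" "\<lambda>i. cmod (coeff x i (v i))" F] by (simp add: norm_mult)
  finally show ?thesis .
qed

lemma ch_finsum_self:
  assumes "sect u" "F \<subseteq> I" "x \<in> X"
  shows "cmod (ch x (finsum A (pr u u) F)) = (L u x F)\<^sup>2"
proof -
  have "ch x (finsum A (pr u u) F) = complex_of_real (\<Sum>i\<in>F. (cmod (coeff x i (u i)))\<^sup>2)"
    unfolding ch_finsum[OF assms(1,1,2,3)] of_real_sum
    by (rule sum.cong[OF refl]) (metis complex_norm_square mult.commute of_real_power)
  also have "cmod \<dots> = (\<Sum>i\<in>F. (cmod (coeff x i (u i)))\<^sup>2)"
    by (subst norm_of_real) (simp add: sum_nonneg)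
  finally show ?thesis by (simp add: L_def L2_set_def sum_nonneg)
qed

lemma L_sq_le: "sect u ==> F \<subseteq> I ==> x \<in> X ==> (L u x F)\<^sup>2 \<le> nrm A (finsum A (pr u u) F)"
  using ch_le[OF _ finsum_mem_D, of x u u F] ch_finsum_self[of u F x] by simp

text \<open>The scalar Cauchy-Schwarz inequality at each character; \<open>nrm_le\<close> then
  returns to the norm of \<open>A\<close>.\<close>

lemma nrm_finsum_le:
  assumes "sect u" "sect v" "F \<subseteq> I" "0 \<le> a" "0 \<le> b" "!!x. x \<in> X ==> L u x F \<le> a" "!!x. x \<in> X ==> L v x F \<le> b"
  shows "nrm A (finsum A (pr u v) F) \<le> a * b"
proof (rule nrm_le[OF finsum_mem_D[OF assms(1-3)]])
  fix x assume x: "x \<in> X"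
  show "cmod (ch x (finsum A (pr u v) F)) \<le> a * b"
    using ch_finsum_le[OF assms(1-3) x] mult_mono[OF assms(6)[OF x] assms(7)[OF x] assms(4)] by simp
qed (use assms in simp)

lemma L_mono: "F \<subseteq> F' ==> finite F' ==> L u x F \<le> L u x F'"
  unfolding L_def L2_set_def by (intro real_sqrt_le_mono sum_mono2) auto

lemma has_sum_prod:
  assumes "sect u" "tail u" "sect v" "tail v"
  shows "\<exists>s. has_sum_in A (pr u v) I s"
proof (rule has_sum_in_Cauchy[OF prod_closed[OF assms(1,3)]])
  fix e :: real assume "e > 0"
  \<comment> \<open>The product of the two tails is at most \<open>d * d\<close>, which has to stay
    below \<open>e\<close>.\<close>
  define d where "d = sqrt (e/2)"
  have d: "d > 0" "d * d < e" using \<open>e > 0\<close> by (simp_all add: d_def)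
  obtain F1 where F1: "finite F1" "F1 \<subseteq> I" "!!F x. finite F ==> F \<subseteq> I - F1 ==> x \<in> X ==> L u x F \<le> d"
    using assms(2) d(1) unfolding tail_def by metis
  obtain F2 where F2: "finite F2" "F2 \<subseteq> I" "!!F x. finite F ==> F \<subseteq> I - F2 ==> x \<in> X ==> L v x F \<le> d"
    using assms(4) d(1) unfolding tail_def by metis
  have "nrm A (finsum A (pr u v) F) < e" if F: "finite F" "F \<subseteq> I - (F1 \<union> F2)" for F
    using nrm_finsum_le[OF assms(1,3), of F d d] F1(3)[of F] F2(3)[of F] F d by (smt (verit) Diff_subset Diff_mono Un_upper1 Un_upper2 order_refl order_trans)
  then show "\<exists>F0. finite F0 \<and> F0 \<subseteq> I \<and> (\<forall>F. finite F --> F \<subseteq> I - F0 --> nrm A (finsum A (pr u v) F) < e)"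
    using F1(1,2) F2(1,2) by (intro exI[of _ "F1 \<union> F2"]) auto
qed

text \<open>Turns membership in the Hilbert module into a scalar condition, under which closure
  under sums is Minkowski's inequality at each character.\<close>

lemma ell2_iff: "u \<in> E \<longleftrightarrow> sect u \<and> tail u"
proof
  assume u: "u \<in> E"
  then have s: "sect u" by (simp add: ell2_def sect_def)
  obtain t where t: "has_sum_in A (pr u u) I t" using u by (auto simp: ell2_def)
  have "tail u" unfolding tail_def
  proof (intro allI impI)
    fix e :: real assume "e > 0"
    then have "e\<^sup>2 > 0" by simp
    then obtain F0 where F0: "finite F0" "F0 \<subseteq> I" "!!F. finite F ==> F \<subseteq> I - F0 ==> nrm A (finsum A (pr u u) F) < e\<^sup>2"
      using has_sum_in_tail[OF t prod_closed[OF s s]] by metis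
    have "L u x F \<le> e" if F: "finite F" "F \<subseteq> I - F0" "x \<in> X" for F x
    proof -
      have "F \<subseteq> I" using F by blast
      then have "(L u x F)\<^sup>2 \<le> e\<^sup>2" using L_sq_le[OF s _ F(3), of F] F0(3)[OF F(1,2)] by simp
      then show ?thesis using \<open>e > 0\<close> by (simp add: power2_le_iff_abs_le)
    qed
    then show "\<exists>F0. finite F0 \<and> F0 \<subseteq> I \<and> (\<forall>F. finite F --> F \<subseteq> I - F0 --> (\<forall>x\<in>X. L u x F \<le> e))" using F0(1,2) by blast
  qed
  with s show "sect u \<and> tail u" by simp
next
  assume "sect u \<and> tail u"
  then show "u \<in> E" using has_sum_prod[of u u] by (auto simp: ell2_def sect_def)
qed

lemma E_sect: "u \<in> E ==> sect u"
  by (simp add: ell2_iff)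

lemma has_sum_ip:
  assumes "u \<in> E" "v \<in> E" shows "has_sum_in A (pr u v) I (ip u v)"
  using has_sum_prod[of u v] infsum_in_eqI[OF _ prod_closed] assms unfolding ell2_iff ell2_inner_def by metis

lemma ip_closed: "u \<in> E ==> v \<in> E ==> ip u v \<in> carrier A"
  using has_sum_ip by (simp add: has_sum_in_def)

lemma ip_eqI:
  assumes "has_sum_in A (pr u v) I s" "sect u" "sect v"
  shows "ip u v = s"
  unfolding ell2_inner_def by (rule infsum_in_eqI[OF assms(1) prod_closed[OF assms(2,3)]])

lemma N_nonneg [simp]: "u \<in> E ==> 0 \<le> N u"
  by (simp add: ell2_norm_def ip_closed)

lemma N_square: "u \<in> E ==> (N u)\<^sup>2 = nrm A (ip u u)"
  by (simp add: ell2_norm_def ip_closed)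

text \<open>The square of \<open>L\<close> grows with the index set and is bounded by the norm of
  the partial sum, so the bound survives the passage to the full sum.\<close>

lemma L_le_N:
  assumes "u \<in> E" "finite F" "F \<subseteq> I" "x \<in> X" shows "L u x F \<le> N u"
proof -
  note s = E_sect[OF assms(1)]
  obtain G where G: "!!n. finite (G n)" "!!n. F \<subseteq> G n" "!!n. G n \<subseteq> I"
    "converges A (\<lambda>n. finsum A (pr u u) (G n)) (ip u u)"
    using has_sum_in_seq[OF has_sum_ip[OF assms(1,1)] assms(2,3) prod_closed[OF s s]] by metis
  have "(L u x F)\<^sup>2 \<le> nrm A (finsum A (pr u u) (G n))" for n
    by (rule order_trans[OF power_mono[OF L_mono[OF G(2) G(1)] L_nonneg] L_sq_le[OF s G(3) assms(4)]])
  then have "(L u x F)\<^sup>2 \<le> nrm A (ip u u)"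
    by (intro LIMSEQ_le_const[OF converges_nrm[OF G(4)]]) (auto intro!: finsum_closed ip_closed assms simp: sectD(2)[OF s])
  then show ?thesis unfolding ell2_norm_def by (rule real_le_rsqrt)
qed

lemma nrm_ip_le:
  assumes "u \<in> E" "v \<in> E" "0 \<le> a" "0 \<le> b"
    "!!x F. x \<in> X ==> finite F ==> F \<subseteq> I ==> L u x F \<le> a" "!!x F. x \<in> X ==> finite F ==> F \<subseteq> I ==> L v x F \<le> b"
  shows "nrm A (ip u v) \<le> a * b"
  by (rule has_sum_in_nrm_le[OF has_sum_ip[OF assms(1,2)] prod_closed[OF assms(1,2)[THEN E_sect]]])
    (rule nrm_finsum_le, use assms E_sect in auto)

lemma N_leI:
  assumes "u \<in> E" "0 \<le> K" "!!x F. x \<in> X ==> finite F ==> F \<subseteq> I ==> L u x F \<le> K"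
  shows "N u \<le> K"
  using nrm_ip_le[OF assms(1,1,2,2,3,3)] assms(2) unfolding ell2_norm_def by (intro real_le_lsqrt) (auto simp: power2_eq_square)

lemma Cauchy_Schwarz: "u \<in> E ==> v \<in> E ==> nrm A (ip u v) \<le> N u * N v"
  by (rule nrm_ip_le) (auto intro: L_le_N)

lemma E_lincomb:
  assumes "u \<in> E" "v \<in> E" shows "(lc c u v) \<in> E"
  unfolding ell2_iff
proof
  note s = assms[THEN E_sect]
  show "sect (lc c u v)" by (rule sect_lincomb[OF s])
  show "tail (lc c u v)" unfolding tail_def
  proof (intro allI impI)
    fix e :: real assume "e > 0"
    \<comment> \<open>Divides \<open>e\<close> between the two summands:
      \<open>d + cmod c * d = e\<close>.\<close>
    define d where "d = e / (1 + cmod c)"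
    have "1 + cmod c > 0" by (simp add: add_pos_nonneg)
    then have "d > 0" "(1 + cmod c) * d = e" using \<open>e > 0\<close> by (simp_all add: d_def)
    then have d: "d > 0" "d + cmod c * d = e" by (simp_all add: distrib_right)
    obtain F1 where F1: "finite F1" "F1 \<subseteq> I" "!!F x. finite F ==> F \<subseteq> I - F1 ==> x \<in> X ==> L u x F \<le> d"
      using assms(1) d(1) unfolding ell2_iff tail_def by metis
    obtain F2 where F2: "finite F2" "F2 \<subseteq> I" "!!F x. finite F ==> F \<subseteq> I - F2 ==> x \<in> X ==> L v x F \<le> d"
      using assms(2) d(1) unfolding ell2_iff tail_def by metis
    have "L (lc c u v) x F \<le> e" if F: "finite F" "F \<subseteq> I - (F1 \<union> F2)" "x \<in> X" for F x
    proof -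
      have "F \<subseteq> I" "F \<subseteq> I - F1" "F \<subseteq> I - F2" using F by auto
      then show ?thesis using L_lincomb[OF s _ F(3), of F c] F1(3)[OF F(1) _ F(3)] mult_left_mono[OF F2(3)[OF F(1) _ F(3)], of "cmod c"] d(2) by fastforce
    qed
    then show "\<exists>F0. finite F0 \<and> F0 \<subseteq> I \<and> (\<forall>F. finite F --> F \<subseteq> I - F0 --> (\<forall>x\<in>X. L (lc c u v) x F \<le> e))"
      using F1(1,2) F2(1,2) by (intro exI[of _ "F1 \<union> F2"]) auto
  qed
qed

lemma N_lincomb:
  assumes "u \<in> E" "v \<in> E" shows "N (lc c u v) \<le> N u + cmod c * N v"
proof (rule N_leI[OF E_lincomb[OF assms]])
  fix x F assume F: "x \<in> X" "finite F" "F \<subseteq> I"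
  show "L (lc c u v) x F \<le> N u + cmod c * N v"
    using L_lincomb[OF assms[THEN E_sect] F(3,1), of c] L_le_N[OF assms(1) F(2,3,1)] mult_left_mono[OF L_le_N[OF assms(2) F(2,3,1)], of "cmod c"] by simp
qed (use assms in auto)

lemma E_zero [simp]: "(\<lambda>i. \<zero>) \<in> E"
proof -
  have "coeff x i \<zero> = 0" if "x \<in> X" "i \<in> I" for x i using coeff_smult[OF that B_zero[OF that(2)], of 0] by simp
  then have "L (\<lambda>i. \<zero>) x F = 0" if "x \<in> X" "F \<subseteq> I" for x F
    using that unfolding L_def L2_set_def by (simp add: subset_iff)
  then have "tail (\<lambda>i. \<zero>)" unfolding tail_def by (intro allI impI exI[of _ "{}"]) auto
  then show ?thesis by (simp add: ell2_iff sect_def B_zero)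
qed

lemma N_zero [simp]: "N (\<lambda>i. \<zero>) = 0"
proof -
  have "ip (\<lambda>i. \<zero>) (\<lambda>i. \<zero>) = \<zero>"
    by (rule ip_eqI) (auto simp: has_sum_in_def sect_def B_zero minus_zero)
  then show ?thesis by (simp add: ell2_norm_def)
qed

lemma E_closed: "u \<in> E ==> u i \<in> carrier A"
  using E_sect sectD(2) by blast

lemma E_add: "u \<in> E ==> v \<in> E ==> (\<lambda>i. u i \<oplus> v i) \<in> E"
  using E_lincomb[of u v 1] by (simp add: E_closed)

lemma E_smult: "u \<in> E ==> (\<lambda>i. c \<odot> u i) \<in> E"
  using E_lincomb[OF E_zero, of u c] by (simp add: E_closed)

lemma E_minus: "u \<in> E ==> v \<in> E ==> (\<lambda>i. u i \<ominus> v i) \<in> E"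
  using E_lincomb[of u v "-1"] by (simp add: E_closed minus_smult)

lemma N_add: "u \<in> E ==> v \<in> E ==> N (\<lambda>i. u i \<oplus> v i) \<le> N u + N v"
  using N_lincomb[of u v 1] by (simp add: E_closed)

lemma N_smult_le: "u \<in> E ==> N (\<lambda>i. c \<odot> u i) \<le> cmod c * N u"
  using N_lincomb[OF E_zero, of u c] by (simp add: E_closed)

lemma N_minus: "u \<in> E ==> v \<in> E ==> dN u v \<le> N u + N v"
  using N_lincomb[of u v "-1"] by (simp add: E_closed minus_smult)

lemma N_smult:
  assumes "u \<in> E" shows "N (\<lambda>i. c \<odot> u i) = cmod c * N u"
proof (cases "c = 0")
  case True
  then show ?thesis using assms by (simp add: E_closed)
next
  case False
  have "N u \<le> cmod (1/c) * N (\<lambda>i. c \<odot> u i)"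
    using N_smult_le[OF E_smult[OF assms], of "1/c" c] False assms by (simp add: E_closed)
  then have "cmod c * N u \<le> N (\<lambda>i. c \<odot> u i)" using False by (simp add: norm_divide field_simps)
  then show ?thesis using N_smult_le[OF assms, of c] by simp
qed

lemma nrm_le_N:
  assumes "u \<in> E" shows "nrm A (u i) \<le> N u"
proof (cases "i \<in> I")
  case True
  note s = E_sect[OF assms]
  have "nrm A (finsum A (pr u u) {i}) \<le> N u * N u"
    by (rule nrm_finsum_le[OF s s]) (use True assms L_le_N in auto)
  then have "(nrm A (u i))\<^sup>2 \<le> (N u)\<^sup>2" using assms by (simp add: p_star_mult E_closed power2_eq_square)
  then show ?thesis using N_nonneg[OF assms] by (simp add: power2_le_iff_abs_le E_closed assms)
next
  case False
  then show ?thesis using E_sect[OF assms] assms by (simp add: sect_def)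
qed

lemma N_definite: "u \<in> E ==> N u = 0 ==> u = (\<lambda>i. \<zero>)"
  using nrm_le_N[of u] definite E_closed by (intro ext) (metis antisym p_nonneg)

lemma ip_lincomb_r:
  assumes "u \<in> E" "v \<in> E" "v' \<in> E"
  shows "ip u (lc c v v') = ip u v \<oplus> c \<odot> ip u v'"
proof (rule ip_eqI)
  have "(\<lambda>i. star A (u i) \<otimes> (v i \<oplus> c \<odot> v' i)) = (\<lambda>i. star A (u i) \<otimes> v i \<oplus> c \<odot> (star A (u i) \<otimes> v' i))"
    using assms by (simp add: E_closed r_distr mult_smult_r)
  then show "has_sum_in A (\<lambda>i. star A (u i) \<otimes> (v i \<oplus> c \<odot> v' i)) I (ip u v \<oplus> c \<odot> ip u v')"
    using has_sum_in_lincomb[OF has_sum_ip[OF assms(1,2)] _ has_sum_ip[OF assms(1,3)]] assms[THEN E_sect] prod_closed by simp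
qed (use assms E_sect sect_lincomb in auto)

lemma ip_star:
  assumes u: "u \<in> E" and v: "v \<in> E" shows "star A (ip u v) = ip v u"
  using has_sum_in_star[OF has_sum_ip[OF u v] prod_closed[OF E_sect[OF u] E_sect[OF v]]]
  by (intro ip_eqI[symmetric]) (simp_all add: star_mult E_closed[OF u] E_closed[OF v] E_sect u v)

lemma ip_minus_r: "u \<in> E ==> v \<in> E ==> v' \<in> E ==> ip u (\<lambda>i. v i \<ominus> v' i) = ip u v \<ominus> ip u v'"
  using ip_lincomb_r[of u v v' "-1"] by (simp add: minus_smult E_closed ip_closed)

text \<open>The difference is tested against itself. This makes adjoints unique and every map with
  an adjoint linear.\<close>

lemma ip_ext:
  assumes "v \<in> E" "v' \<in> E" "!!u. u \<in> E ==> ip u v = ip u v'"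
  shows "v = v'"
proof -
  let ?z = "\<lambda>i. v i \<ominus> v' i"
  have z: "?z \<in> E" using assms E_minus by blast
  have "ip ?z ?z = \<zero>" using ip_minus_r[OF z assms(1,2)] assms(3)[OF z] by (simp add: minus_self ip_closed z assms)
  then have "N ?z = 0" by (simp add: ell2_norm_def)
  from N_definite[OF z this] have "v i \<ominus> v' i = \<zero>" for i by (rule fun_cong)
  then show ?thesis using assms E_closed eqI by (intro ext) (metis p_zero)
qed

text \<open>Coordinates are bounded by \<open>N\<close>, so they converge. For finite
  \<open>F\<close> the estimate between \<open>x n\<close> and \<open>x m\<close> passes to the
  limit in \<open>m\<close>; it is uniform in \<open>F\<close> and in the character, so the limit
  section has uniform tails and is a limit for \<open>N\<close>.\<close>

lemma E_complete:
  assumes x: "!!n. x n \<in> E" and C: "!!e. e > 0 ==> \<exists>M. \<forall>m\<ge>M. \<forall>n\<ge>M. dN (x m) (x n) < e"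
  obtains u where "u \<in> E" "(\<lambda>n. dN (x n) u) \<longlonglongrightarrow> 0"
proof -
  note xs = E_sect[OF x] and xc = E_closed[OF x]
  have "\<exists>l\<in>carrier A. converges A (\<lambda>n. x n i) l" for i
  proof (rule complete, rule cauchyI)
    fix e :: real assume "e > 0"
    then obtain M where M: "!!m n. m \<ge> M ==> n \<ge> M ==> dN (x m) (x n) < e" using C by blast
    have "nrm A (x m i \<ominus> x n i) < e" if "m \<ge> M" "n \<ge> M" for m n
      using nrm_le_N[OF E_minus[OF x[of m] x[of n]], of i] M[OF that] by simp
    then show "\<exists>M. \<forall>m\<ge>M. \<forall>n\<ge>M. nrm A (x m i \<ominus> x n i) < e" by blast
  qed (rule xc)
  then obtain l where l: "!!i. l i \<in> carrier A" "!!i. converges A (\<lambda>n. x n i) (l i)" by metis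
  have l0: "l i = \<zero>" if "i \<notin> I" for i
  proof (rule converges_unique[OF l(2)])
    show "converges A (\<lambda>n. x n i) \<zero>" using xs that by (simp add: sect_def converges_const)
  qed (use xc l in auto)
  have ls: "sect l" unfolding sect_def
    using l0 B_limit[OF _ sectD(1)[OF xs] l] by blast
  have ds: "sect (\<lambda>i. x n i \<ominus> l i)" for n
    using sect_lincomb[OF xs ls, of n "-1"] by (simp add: minus_smult xc l)
  have coeff_le: "cmod (coeff y i b) \<le> nrm A b" if "y \<in> X" "i \<in> I" "b \<in> B i" for y i b
  proof -
    have "(cmod (coeff y i b))\<^sup>2 = cmod (ch y (star A b \<otimes> b))"
      using ch_mult[OF that that(3)] by (simp add: norm_mult power2_eq_square)
    also have "\<dots> \<le> (nrm A b)\<^sup>2" using ch_le[OF that(1) D_mult[OF that(2,3,3)]] B_closed that by (simp add: p_star_mult)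
    finally show ?thesis using B_closed[OF that(2,3)] by (simp add: power2_le_iff_abs_le)
  qed
  have near: "\<exists>M. \<forall>n\<ge>M. \<forall>F y. finite F --> F \<subseteq> I --> y \<in> X --> L (\<lambda>i. x n i \<ominus> l i) y F \<le> e" if "e > 0" for e
  proof -
    obtain M where M: "!!m n. m \<ge> M ==> n \<ge> M ==> dN (x m) (x n) < e" using C \<open>e > 0\<close> by blast
    have "L (\<lambda>i. x n i \<ominus> l i) y F \<le> e" if n: "n \<ge> M" and F: "finite F" "F \<subseteq> I" "y \<in> X" for n F y
    proof (rule LIMSEQ_le_const)
      have "(\<lambda>m. \<Sum>i\<in>F. nrm A (x m i \<ominus> l i)) \<longlonglongrightarrow> (\<Sum>i\<in>F. 0)"
        using l(2) unfolding converges_def by (intro tendsto_sum)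
      then show "(\<lambda>m. e + (\<Sum>i\<in>F. nrm A (x m i \<ominus> l i))) \<longlonglongrightarrow> e" using tendsto_add[OF tendsto_const] by fastforce
      have "L (\<lambda>i. x n i \<ominus> l i) y F \<le> e + (\<Sum>i\<in>F. nrm A (x m i \<ominus> l i))" if m: "m \<ge> M" for m
      proof -
        have "(\<lambda>i. x n i \<ominus> l i) = (\<lambda>i. (x n i \<ominus> x m i) \<oplus> 1 \<odot> (x m i \<ominus> l i))"
          using xc l minus_trans by fastforce
        then have "L (\<lambda>i. x n i \<ominus> l i) y F \<le> L (\<lambda>i. x n i \<ominus> x m i) y F + L (\<lambda>i. x m i \<ominus> l i) y F"
          using L_lincomb[OF E_sect[OF E_minus[OF x[of n] x[of m]]] ds[of m] F(2,3), of 1] by simp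
        moreover have "L (\<lambda>i. x n i \<ominus> x m i) y F \<le> e"
          using L_le_N[OF E_minus[OF x[of n] x[of m]] F] M[OF n m] by simp
        moreover have "L (\<lambda>i. x m i \<ominus> l i) y F \<le> (\<Sum>i\<in>F. nrm A (x m i \<ominus> l i))"
        proof -
          have "L (\<lambda>i. x m i \<ominus> l i) y F \<le> (\<Sum>i\<in>F. cmod (coeff y i (x m i \<ominus> l i)))"
            unfolding L_def by (rule L2_set_le_sum) simp
          also have "\<dots> \<le> (\<Sum>i\<in>F. nrm A (x m i \<ominus> l i))"
            by (rule sum_mono, rule coeff_le) (use F sectD(1)[OF ds] in auto)
          finally show ?thesis .
        qed
        ultimately show ?thesis by simp
      qed
      then show "\<exists>M. \<forall>m\<ge>M. L (\<lambda>i. x n i \<ominus> l i) y F \<le> e + (\<Sum>i\<in>F. nrm A (x m i \<ominus> l i))" by blast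
    qed
    then show ?thesis by blast
  qed
  have "tail l" unfolding tail_def
  proof (intro allI impI)
    fix e :: real assume "e > 0"
    then obtain n where n: "\<forall>m\<ge>n. \<forall>F y. finite F --> F \<subseteq> I --> y \<in> X --> L (\<lambda>i. x m i \<ominus> l i) y F \<le> e/2"
      using near[OF half_gt_zero[OF \<open>e > 0\<close>]] by blast
    note n = n[rule_format, OF order_refl]
    have "e/2 > 0" using \<open>e > 0\<close> by simp
    then obtain F0 where F0: "finite F0" "F0 \<subseteq> I" "!!F y. finite F ==> F \<subseteq> I - F0 ==> y \<in> X ==> L (x n) y F \<le> e/2"
      using x[of n] unfolding ell2_iff tail_def by metis
    have "L l y F \<le> e" if F: "finite F" "F \<subseteq> I - F0" "y \<in> X" for F y
    proof -
      have FI: "F \<subseteq> I" using F by blast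
      have "l = (\<lambda>i. x n i \<oplus> (-1) \<odot> (x n i \<ominus> l i))"
        using xc l by (simp add: minus_smult smult_r_distr a_assoc[symmetric] r_neg flip: a_inv_smult)
      then have "L l y F \<le> L (x n) y F + L (\<lambda>i. x n i \<ominus> l i) y F"
        using L_lincomb[OF xs[of n] ds[of n] FI F(3), of "-1"] by simp
      then show ?thesis using n[OF F(1) FI F(3)] F0(3)[OF F] by simp
    qed
    then show "\<exists>F0. finite F0 \<and> F0 \<subseteq> I \<and> (\<forall>F. finite F --> F \<subseteq> I - F0 --> (\<forall>x\<in>X. L l x F \<le> e))" using F0(1,2) by blast
  qed
  then have lE: "l \<in> E" using ls by (simp add: ell2_iff)
  have "(\<lambda>n. dN (x n) l) \<longlonglongrightarrow> 0"
  proof (rule LIMSEQ_I)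
    fix e :: real assume "e > 0"
    then obtain M where M: "\<forall>n\<ge>M. \<forall>F y. finite F --> F \<subseteq> I --> y \<in> X --> L (\<lambda>i. x n i \<ominus> l i) y F \<le> e/2"
      using near[OF half_gt_zero[OF \<open>e > 0\<close>]] by blast
    have "norm (dN (x n) l - 0) < e" if "n \<ge> M" for n
    proof -
      have "dN (x n) l \<le> e/2"
        by (rule N_leI[OF E_minus[OF x lE]]) (use M that \<open>e > 0\<close> in auto)
      then show ?thesis using N_nonneg[OF E_minus[OF x lE], of n] \<open>e > 0\<close> by simp
    qed
    then show "\<exists>M. \<forall>n\<ge>M. norm (dN (x n) l - 0) < e" by blast
  qed
  with lE show ?thesis using that by blast
qed

end

section \<open>Adjointable operators on the module\<close>

context section_module
begin

abbreviation Ops where "Ops \<equiv> operators A I B"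

lemma Ops_simps:
  "mult Ops = (\<lambda>T U. \<lambda>u\<in>E. T (U u))" "one Ops = (\<lambda>u\<in>E. u)" "zero Ops = (\<lambda>u\<in>E. (\<lambda>i. \<zero>))"
  "add Ops = (\<lambda>T U. \<lambda>u\<in>E. (\<lambda>i. T u i \<oplus> U u i))" "smult Ops = (\<lambda>c T. \<lambda>u\<in>E. (\<lambda>i. c \<odot> T u i))"
  "star Ops = (\<lambda>T. THE T'. is_adjoint A I B T T')"
  "nrm Ops = (\<lambda>T. Sup {N (T u) |u. u \<in> E \<and> N u \<le> 1})"
  by (simp_all add: operators_def)

lemma ip_add_r: "u \<in> E ==> v \<in> E ==> v' \<in> E ==> ip u (\<lambda>i. v i \<oplus> v' i) = ip u v \<oplus> ip u v'"
  using ip_lincomb_r[of u v v' 1] by (simp add: E_closed ip_closed)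

lemma ip_zero_r: "u \<in> E ==> ip u (\<lambda>i. \<zero>) = \<zero>"
  by (rule ip_eqI) (auto simp: has_sum_in_def E_closed E_sect minus_zero)

lemma ip_smult_r: "u \<in> E ==> v \<in> E ==> ip u (\<lambda>i. c \<odot> v i) = c \<odot> ip u v"
  using ip_lincomb_r[of u "\<lambda>i. \<zero>" v c] by (simp add: E_closed ip_closed ip_zero_r)

lemma ip_add_l: "u \<in> E ==> v \<in> E ==> v' \<in> E ==> ip (\<lambda>i. v i \<oplus> v' i) u = ip v u \<oplus> ip v' u"
  using ip_star[of u "\<lambda>i. v i \<oplus> v' i"] by (simp add: E_add ip_add_r star_add ip_closed ip_star)

lemma ip_smult_l: "u \<in> E ==> v \<in> E ==> ip (\<lambda>i. c \<odot> v i) u = cnj c \<odot> ip v u"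
  using ip_star[of u "\<lambda>i. c \<odot> v i"] by (simp add: E_smult ip_smult_r star_smult ip_closed ip_star)

lemma ip_zero_l: "u \<in> E ==> ip (\<lambda>i. \<zero>) u = \<zero>"
  using ip_star[of u "\<lambda>i. \<zero>"] by (simp add: ip_zero_r)

lemma ip_minus_l: "u \<in> E ==> v \<in> E ==> v' \<in> E ==> ip (\<lambda>i. v i \<ominus> v' i) u = ip v u \<ominus> ip v' u"
  using ip_star[of u "\<lambda>i. v i \<ominus> v' i"] by (simp add: E_minus ip_minus_r star_minus ip_closed ip_star)

lemma N_triangle:
  assumes "u \<in> E" "v \<in> E" "\<zeta> \<in> E"
  shows "N (\<lambda>i. u i \<ominus> \<zeta> i) \<le> dN u v + N (\<lambda>i. v i \<ominus> \<zeta> i)"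
proof -
  have "(\<lambda>i. u i \<ominus> \<zeta> i) = (\<lambda>i. (u i \<ominus> v i) \<oplus> (v i \<ominus> \<zeta> i))"
    using assms minus_trans E_closed by blast
  then show ?thesis using N_add[OF E_minus[OF assms(1,2)] E_minus[OF assms(2,3)]] by simp
qed

text \<open>Speaks of functions on the whole type; the restriction to \<open>E\<close> that
  \<open>operators\<close> demands is added once, in \<open>op_mem\<close>. The bound is imposed on
  \<open>T\<close> and is inherited by \<open>S\<close>.\<close>

definition adjoint_pair where
  "adjoint_pair T S K \<longleftrightarrow> T \<in> E \<rightarrow> E \<and> S \<in> E \<rightarrow> E \<and> (\<forall>u\<in>E. \<forall>v\<in>E. ip (T u) v = ip u (S v)) \<and>
     0 \<le> K \<and> (\<forall>u\<in>E. N (T u) \<le> K * N u)"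

lemma adjoint_pairD:
  assumes "adjoint_pair T S K" "u \<in> E"
  shows "T u \<in> E" "S u \<in> E" "v \<in> E ==> ip (T u) v = ip u (S v)" "v \<in> E ==> ip v (T u) = ip (S v) u"
    "N (T u) \<le> K * N u" "0 \<le> K"
proof -
  show T: "T u \<in> E" "S u \<in> E" "N (T u) \<le> K * N u" "0 \<le> K" using assms by (auto simp: adjoint_pair_def)
  show *: "ip (T u) v = ip u (S v)" if "v \<in> E" for v using assms that by (auto simp: adjoint_pair_def)
  show "ip v (T u) = ip (S v) u" if "v \<in> E"
    using *[OF that] ip_star[OF T(1) that] ip_star[of u "S v"] assms that by (auto simp: adjoint_pair_def)
qed

text \<open>The square of \<open>N (S v)\<close> is the norm of \<open>ip (T (S v)) v\<close>, hence
  at most \<open>K * N (S v) * N v\<close>.\<close>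

lemma adjoint_pair_sym:
  assumes "adjoint_pair T S K" shows "adjoint_pair S T K"
proof -
  note D = adjoint_pairD[OF assms]
  have "N (S v) \<le> K * N v" if v: "v \<in> E" for v
  proof (cases "N (S v) = 0")
    case True then show ?thesis using D(6)[OF v] v by simp
  next
    case False
    have S: "S v \<in> E" by (rule D(2)[OF v])
    have "N (S v) * N (S v) = nrm A (ip (T (S v)) v)"
      using N_square[OF S] D(3)[OF S v] by (simp add: power2_eq_square)
    also have "\<dots> \<le> N (T (S v)) * N v" by (rule Cauchy_Schwarz[OF D(1)[OF S] v])
    also have "\<dots> \<le> (K * N (S v)) * N v" by (rule mult_right_mono[OF D(5)[OF S]]) (use v in simp)
    finally have "N (S v) * N (S v) \<le> N (S v) * (K * N v)" by (simp add: mult_ac)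
    then show ?thesis using False N_nonneg[OF S] by (simp add: mult_le_cancel_left)
  qed
  then show ?thesis using assms D(4) unfolding adjoint_pair_def by auto
qed

lemma is_adjoint_unique:
  assumes "is_adjoint A I B T S" "is_adjoint A I B T S'" shows "S = S'"
proof (rule PiE_ext)
  show SE: "S \<in> E \<rightarrow>\<^sub>E E" "S' \<in> E \<rightarrow>\<^sub>E E" using assms by (auto simp: is_adjoint_def)
  show "S v = S' v" if "v \<in> E" for v
    by (rule ip_ext) (use SE assms that in \<open>auto simp: is_adjoint_def\<close>)
qed

text \<open>Linearity comes from the adjoint: both sides of each linearity equation have the same
  inner product with every vector, once \<open>T\<close> is moved to the other side.\<close>

lemma op_mem:
  assumes "adjoint_pair T S K"
  shows "restrict T E \<in> carrier Ops" "star Ops (restrict T E) = restrict S E"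
proof -
  note D = adjoint_pairD[OF assms]
  have adj: "is_adjoint A I B (restrict T E) (restrict S E)"
    unfolding is_adjoint_def using D by auto
  have "T (\<lambda>i. u i \<oplus> v i) = (\<lambda>i. T u i \<oplus> T v i)" if "u \<in> E" "v \<in> E" for u v
    by (rule ip_ext) (use that D in \<open>auto simp: E_add ip_add_r\<close>)
  moreover have "T (\<lambda>i. c \<odot> u i) = (\<lambda>i. c \<odot> T u i)" if "u \<in> E" for u c
    by (rule ip_ext) (use that D in \<open>auto simp: E_smult ip_smult_r\<close>)
  ultimately have "bounded_linear_on A I B (restrict T E)"
    unfolding bounded_linear_on_def using D(5) by (auto simp: E_add E_smult intro!: exI[of _ K])
  then show "restrict T E \<in> carrier Ops"
    using adj D(1) by (auto simp: operators_def)
  show "star Ops (restrict T E) = restrict S E"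
    unfolding Ops_simps by (rule the_equality[where P = "is_adjoint A I B (restrict T E)", OF adj]) (rule is_adjoint_unique[OF _ adj])
qed

lemma Ops_ext: "T \<in> carrier Ops ==> T \<in> E \<rightarrow>\<^sub>E E"
  by (simp add: operators_def)

lemma Ops_mem_E: "T \<in> carrier Ops ==> u \<in> E ==> T u \<in> E"
  using Ops_ext by auto

lemma Ops_restrict: "T \<in> carrier Ops ==> restrict T E = T"
  using Ops_ext by (intro extensional_restrict) (auto simp: PiE_def)

lemma Ops_eqI: "T \<in> carrier Ops ==> U \<in> carrier Ops ==> (!!u. u \<in> E ==> T u = U u) ==> T = U"
  by (rule PiE_ext[OF Ops_ext Ops_ext])

lemma Ops_bdd:
  assumes "T \<in> carrier Ops" shows "bdd_above {N (T u) |u. u \<in> E \<and> N u \<le> 1}"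
proof -
  obtain K where "\<forall>u\<in>E. N (T u) \<le> K * N u"
    using assms by (auto simp: operators_def bounded_linear_on_def)
  then have K: "!!u. u \<in> E ==> N (T u) \<le> K * N u" by blast
  show ?thesis
  proof (rule bdd_aboveI)
    fix r assume "r \<in> {N (T u) |u. u \<in> E \<and> N u \<le> 1}"
    then obtain u where u: "r = N (T u)" "u \<in> E" "N u \<le> 1" by blast
    have "K * N u \<le> \<bar>K\<bar> * N u" using u by (intro mult_right_mono) auto
    also have "\<dots> \<le> \<bar>K\<bar> * 1" using u by (intro mult_left_mono) auto
    finally show "r \<le> \<bar>K\<bar>" using K[OF u(2)] u(1) by simp
  qed
qed

text \<open>The operator norm is a supremum over the unit ball, so \<open>u\<close> is scaled to
  norm one. If \<open>N u = 0\<close>, then \<open>u\<close> is zero and linearity applies.\<close>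

lemma Ops_bound:
  assumes T: "T \<in> carrier Ops" and u: "u \<in> E"
  shows "N (T u) \<le> nrm Ops T * N u"
proof -
  have lin: "T (\<lambda>i. c \<odot> v i) = (\<lambda>i. c \<odot> T v i)" if "v \<in> E" for c v
    using T that by (simp add: operators_def bounded_linear_on_def)
  show ?thesis
  proof (cases "N u = 0")
    case True
    then have "(\<lambda>i. 0 \<odot> u i) = u" using N_definite[OF u] u E_closed by (simp add: fun_eq_iff)
    then have "N (T u) = 0" using lin[OF u, of 0] N_smult[OF Ops_mem_E[OF T u], of 0] by simp
    then show ?thesis using True by simp
  next
    case False
    then have pos: "N u > 0" using N_nonneg[OF u] by simp
    define c where "c = complex_of_real (1 / N u)"
    have c: "cmod c = 1 / N u" using pos by (simp add: c_def norm_divide)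
    have "N (\<lambda>i. c \<odot> u i) = 1" using N_smult[OF u, of c] pos by (simp add: c)
    then have "N (T (\<lambda>i. c \<odot> u i)) \<le> nrm Ops T"
      unfolding Ops_simps using Ops_bdd[OF T] E_smult[OF u, of c] by (intro cSup_upper) auto
    then have "N (T u) / N u \<le> nrm Ops T"
      using lin[OF u] N_smult[OF Ops_mem_E[OF T u], of c] by (simp add: c)
    then show ?thesis using pos by (simp add: field_simps)
  qed
qed

lemma Ops_norm_le:
  assumes "0 \<le> K" "!!u. u \<in> E ==> N (T u) \<le> K * N u" shows "nrm Ops T \<le> K"
  unfolding Ops_simps
proof (rule cSup_least)
  show "{N (T u) |u. u \<in> E \<and> N u \<le> 1} \<noteq> {}" using E_zero by (auto intro!: exI[of _ "\<lambda>i. \<zero>"])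
  fix r assume "r \<in> {N (T u) |u. u \<in> E \<and> N u \<le> 1}"
  then obtain u where u: "r = N (T u)" "u \<in> E" "N u \<le> 1" by blast
  then show "r \<le> K" using assms(2)[OF u(2)] mult_left_mono[OF u(3) assms(1)] by simp
qed

lemma Ops_norm_nonneg:
  assumes T: "T \<in> carrier Ops" shows "0 \<le> nrm Ops T"
proof -
  have "N (T (\<lambda>i. \<zero>)) \<le> nrm Ops T"
    unfolding Ops_simps using Ops_bdd[OF T] by (intro cSup_upper) (auto intro!: exI[of _ "\<lambda>i. \<zero>"])
  then show ?thesis using N_nonneg[OF Ops_mem_E[OF T E_zero]] by simp
qed

lemma Ops_pair:
  assumes T: "T \<in> carrier Ops" shows "adjoint_pair T (star Ops T) (nrm Ops T)"
proof -
  obtain S where S: "is_adjoint A I B T S" using T by (auto simp: operators_def)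
  have "star Ops T = S"
    unfolding Ops_simps by (rule the_equality[where P = "is_adjoint A I B T", OF S]) (rule is_adjoint_unique[OF _ S])
  then show ?thesis
    using S Ops_ext[OF T] Ops_bound[OF T] Ops_norm_nonneg[OF T] by (auto simp: adjoint_pair_def is_adjoint_def)
qed

lemma Ops_star:
  assumes T: "T \<in> carrier Ops" shows "star Ops T \<in> carrier Ops" "star Ops (star Ops T) = T"
proof -
  obtain S where S: "is_adjoint A I B T S" using T by (auto simp: operators_def)
  have "star Ops T = S"
    unfolding Ops_simps by (rule the_equality[where P = "is_adjoint A I B T", OF S]) (rule is_adjoint_unique[OF _ S])
  then have r: "restrict (star Ops T) E = star Ops T" using S by (auto simp: is_adjoint_def PiE_def extensional_restrict)
  show "star Ops T \<in> carrier Ops" using op_mem(1)[OF adjoint_pair_sym[OF Ops_pair[OF T]]] r by simp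
  show "star Ops (star Ops T) = T" using op_mem(2)[OF adjoint_pair_sym[OF Ops_pair[OF T]]] r Ops_restrict[OF T] by simp
qed

lemma Ops_add:
  assumes T: "T \<in> carrier Ops" and U: "U \<in> carrier Ops"
  shows "T \<oplus>\<^bsub>Ops\<^esub> U \<in> carrier Ops" "star Ops (T \<oplus>\<^bsub>Ops\<^esub> U) = star Ops T \<oplus>\<^bsub>Ops\<^esub> star Ops U"
    "nrm Ops (T \<oplus>\<^bsub>Ops\<^esub> U) \<le> nrm Ops T + nrm Ops U"
proof -
  note D = adjoint_pairD[OF Ops_pair[OF T]] and D' = adjoint_pairD[OF Ops_pair[OF U]]
  have le: "N (\<lambda>i. T u i \<oplus> U u i) \<le> (nrm Ops T + nrm Ops U) * N u" if "u \<in> E" for u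
    using N_add[OF D(1)[OF that] D'(1)[OF that]] D(5)[OF that] D'(5)[OF that] by (simp add: distrib_right)
  have "adjoint_pair (\<lambda>u i. T u i \<oplus> U u i) (\<lambda>u i. star Ops T u i \<oplus> star Ops U u i) (nrm Ops T + nrm Ops U)"
    unfolding adjoint_pair_def using D(1-3) D'(1-3) le Ops_norm_nonneg[OF T] Ops_norm_nonneg[OF U]
    by (auto simp: E_add ip_add_l ip_add_r)
  from op_mem[OF this] show "T \<oplus>\<^bsub>Ops\<^esub> U \<in> carrier Ops" "star Ops (T \<oplus>\<^bsub>Ops\<^esub> U) = star Ops T \<oplus>\<^bsub>Ops\<^esub> star Ops U"
    by (simp_all add: Ops_simps(4))
  show "nrm Ops (T \<oplus>\<^bsub>Ops\<^esub> U) \<le> nrm Ops T + nrm Ops U"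
    by (rule Ops_norm_le) (use Ops_norm_nonneg[OF T] Ops_norm_nonneg[OF U] le in \<open>auto simp: Ops_simps(4)\<close>)
qed

lemma Ops_smult:
  assumes T: "T \<in> carrier Ops"
  shows "c \<odot>\<^bsub>Ops\<^esub> T \<in> carrier Ops" "star Ops (c \<odot>\<^bsub>Ops\<^esub> T) = cnj c \<odot>\<^bsub>Ops\<^esub> star Ops T"
    "nrm Ops (c \<odot>\<^bsub>Ops\<^esub> T) \<le> cmod c * nrm Ops T"
proof -
  note D = adjoint_pairD[OF Ops_pair[OF T]]
  have le: "N (\<lambda>i. c \<odot> T u i) \<le> (cmod c * nrm Ops T) * N u" if "u \<in> E" for u
    using N_smult[OF D(1)[OF that], of c] mult_left_mono[OF D(5)[OF that], of "cmod c"] by (simp add: mult_ac)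
  have "adjoint_pair (\<lambda>u i. c \<odot> T u i) (\<lambda>u i. cnj c \<odot> star Ops T u i) (cmod c * nrm Ops T)"
    unfolding adjoint_pair_def using D(1-3) le Ops_norm_nonneg[OF T]
    by (auto simp: E_smult ip_smult_l ip_smult_r)
  from op_mem[OF this] show "c \<odot>\<^bsub>Ops\<^esub> T \<in> carrier Ops" "star Ops (c \<odot>\<^bsub>Ops\<^esub> T) = cnj c \<odot>\<^bsub>Ops\<^esub> star Ops T"
    by (simp_all add: Ops_simps(5))
  show "nrm Ops (c \<odot>\<^bsub>Ops\<^esub> T) \<le> cmod c * nrm Ops T"
    by (rule Ops_norm_le) (use Ops_norm_nonneg[OF T] le in \<open>auto simp: Ops_simps(5)\<close>)
qed

lemma Ops_mult:
  assumes T: "T \<in> carrier Ops" and U: "U \<in> carrier Ops"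
  shows "T \<otimes>\<^bsub>Ops\<^esub> U \<in> carrier Ops" "star Ops (T \<otimes>\<^bsub>Ops\<^esub> U) = star Ops U \<otimes>\<^bsub>Ops\<^esub> star Ops T"
    "nrm Ops (T \<otimes>\<^bsub>Ops\<^esub> U) \<le> nrm Ops T * nrm Ops U"
proof -
  note D = adjoint_pairD[OF Ops_pair[OF T]] and D' = adjoint_pairD[OF Ops_pair[OF U]]
  have le: "N (T (U u)) \<le> (nrm Ops T * nrm Ops U) * N u" if "u \<in> E" for u
    using D(5)[OF D'(1)[OF that]] mult_left_mono[OF D'(5)[OF that] Ops_norm_nonneg[OF T]] by (simp add: mult_ac)
  have "adjoint_pair (\<lambda>u. T (U u)) (\<lambda>u. star Ops U (star Ops T u)) (nrm Ops T * nrm Ops U)"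
    unfolding adjoint_pair_def using D(1-3) D'(1-3) le Ops_norm_nonneg[OF T] Ops_norm_nonneg[OF U]
    by auto
  from op_mem[OF this] show "T \<otimes>\<^bsub>Ops\<^esub> U \<in> carrier Ops" "star Ops (T \<otimes>\<^bsub>Ops\<^esub> U) = star Ops U \<otimes>\<^bsub>Ops\<^esub> star Ops T"
    by (simp_all add: Ops_simps(1))
  show "nrm Ops (T \<otimes>\<^bsub>Ops\<^esub> U) \<le> nrm Ops T * nrm Ops U"
    by (rule Ops_norm_le) (use Ops_norm_nonneg[OF T] Ops_norm_nonneg[OF U] le in \<open>auto simp: Ops_simps(1)\<close>)
qed

lemma Ops_zero_one: "\<zero>\<^bsub>Ops\<^esub> \<in> carrier Ops" "\<one>\<^bsub>Ops\<^esub> \<in> carrier Ops"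
proof -
  have "adjoint_pair (\<lambda>u i. \<zero>) (\<lambda>u i. \<zero>) 0" by (auto simp: adjoint_pair_def ip_zero_l ip_zero_r)
  from op_mem(1)[OF this] show "\<zero>\<^bsub>Ops\<^esub> \<in> carrier Ops" by (simp add: Ops_simps(3))
  have "adjoint_pair (\<lambda>u. u) (\<lambda>u. u) 1" by (auto simp: adjoint_pair_def)
  from op_mem(1)[OF this] show "\<one>\<^bsub>Ops\<^esub> \<in> carrier Ops" by (simp add: Ops_simps(2))
qed

lemma Ops_apply:
  assumes "u \<in> E"
  shows "(T \<otimes>\<^bsub>Ops\<^esub> U) u = T (U u)" "(T \<oplus>\<^bsub>Ops\<^esub> U) u = (\<lambda>i. T u i \<oplus> U u i)" "(c \<odot>\<^bsub>Ops\<^esub> T) u = (\<lambda>i. c \<odot> T u i)"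
    "\<one>\<^bsub>Ops\<^esub> u = u" "\<zero>\<^bsub>Ops\<^esub> u = (\<lambda>i. \<zero>)"
  using assms by (simp_all add: Ops_simps)

lemma Ops_linear:
  assumes "T \<in> carrier Ops" "u \<in> E" "v \<in> E"
  shows "T (\<lambda>i. u i \<oplus> v i) = (\<lambda>i. T u i \<oplus> T v i)" "T (\<lambda>i. c \<odot> u i) = (\<lambda>i. c \<odot> T u i)"
  using assms by (simp_all add: operators_def bounded_linear_on_def)

lemma star_alg_Ops: "star_alg Ops"
proof (rule star_algI)
  fix T U V c d assume T: "T \<in> carrier Ops" and U: "U \<in> carrier Ops" and V: "V \<in> carrier Ops"
  note m = Ops_add(1) Ops_smult(1) Ops_mult(1) Ops_zero_one Ops_star(1) T U V
  note c = E_closed[OF Ops_mem_E]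
  show "T \<oplus>\<^bsub>Ops\<^esub> U \<oplus>\<^bsub>Ops\<^esub> V = T \<oplus>\<^bsub>Ops\<^esub> (U \<oplus>\<^bsub>Ops\<^esub> V)"
    by (rule Ops_eqI) (simp_all add: m Ops_apply a_assoc c)
  show "T \<oplus>\<^bsub>Ops\<^esub> U = U \<oplus>\<^bsub>Ops\<^esub> T"
    by (rule Ops_eqI) (simp_all add: m Ops_apply a_comm c)
  show "T \<otimes>\<^bsub>Ops\<^esub> U \<otimes>\<^bsub>Ops\<^esub> V = T \<otimes>\<^bsub>Ops\<^esub> (U \<otimes>\<^bsub>Ops\<^esub> V)"
    by (rule Ops_eqI) (simp_all add: m Ops_apply Ops_mem_E)
  show "(T \<oplus>\<^bsub>Ops\<^esub> U) \<otimes>\<^bsub>Ops\<^esub> V = T \<otimes>\<^bsub>Ops\<^esub> V \<oplus>\<^bsub>Ops\<^esub> U \<otimes>\<^bsub>Ops\<^esub> V"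
    by (rule Ops_eqI) (simp_all add: m Ops_apply Ops_mem_E)
  show "V \<otimes>\<^bsub>Ops\<^esub> (T \<oplus>\<^bsub>Ops\<^esub> U) = V \<otimes>\<^bsub>Ops\<^esub> T \<oplus>\<^bsub>Ops\<^esub> V \<otimes>\<^bsub>Ops\<^esub> U"
    by (rule Ops_eqI) (simp_all add: m Ops_apply Ops_mem_E Ops_linear)
  show "(c \<odot>\<^bsub>Ops\<^esub> T) \<otimes>\<^bsub>Ops\<^esub> U = c \<odot>\<^bsub>Ops\<^esub> (T \<otimes>\<^bsub>Ops\<^esub> U)"
    by (rule Ops_eqI) (simp_all add: m Ops_apply Ops_mem_E)
  show "T \<otimes>\<^bsub>Ops\<^esub> (c \<odot>\<^bsub>Ops\<^esub> U) = c \<odot>\<^bsub>Ops\<^esub> (T \<otimes>\<^bsub>Ops\<^esub> U)"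
    by (rule Ops_eqI) (simp_all add: m Ops_apply Ops_mem_E Ops_linear(2)[OF _ _ E_zero])
  show "c \<odot>\<^bsub>Ops\<^esub> (T \<oplus>\<^bsub>Ops\<^esub> U) = c \<odot>\<^bsub>Ops\<^esub> T \<oplus>\<^bsub>Ops\<^esub> c \<odot>\<^bsub>Ops\<^esub> U"
    by (rule Ops_eqI) (simp_all add: m Ops_apply c smult_r_distr)
next
  fix T c d assume T: "T \<in> carrier Ops"
  note m = Ops_add(1) Ops_smult(1) Ops_mult(1) Ops_zero_one Ops_star(1) T
  note c = E_closed[OF Ops_mem_E]
  show "(c + d) \<odot>\<^bsub>Ops\<^esub> T = c \<odot>\<^bsub>Ops\<^esub> T \<oplus>\<^bsub>Ops\<^esub> d \<odot>\<^bsub>Ops\<^esub> T"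
    by (rule Ops_eqI) (simp_all add: m Ops_apply c smult_l_distr)
  show "c \<odot>\<^bsub>Ops\<^esub> (d \<odot>\<^bsub>Ops\<^esub> T) = (c * d) \<odot>\<^bsub>Ops\<^esub> T"
    by (rule Ops_eqI) (simp_all add: m Ops_apply c)
  show "1 \<odot>\<^bsub>Ops\<^esub> T = T" by (rule Ops_eqI) (simp_all add: m Ops_apply c)
  show "\<zero>\<^bsub>Ops\<^esub> \<oplus>\<^bsub>Ops\<^esub> T = T" by (rule Ops_eqI) (simp_all add: m Ops_apply c)
  show "\<one>\<^bsub>Ops\<^esub> \<otimes>\<^bsub>Ops\<^esub> T = T" by (rule Ops_eqI) (simp_all add: m Ops_apply Ops_mem_E)
  show "T \<otimes>\<^bsub>Ops\<^esub> \<one>\<^bsub>Ops\<^esub> = T" by (rule Ops_eqI) (simp_all add: m Ops_apply Ops_mem_E)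
  show "(-1) \<odot>\<^bsub>Ops\<^esub> T \<oplus>\<^bsub>Ops\<^esub> T = \<zero>\<^bsub>Ops\<^esub>"
    by (rule Ops_eqI) (simp_all add: m Ops_apply c l_neg flip: a_inv_smult)
qed (simp_all add: Ops_add Ops_smult Ops_mult Ops_zero_one Ops_star)

lemma cstar_pre_Ops: "cstar_pre Ops"
proof -
  interpret o: star_alg Ops by (rule star_alg_Ops)
  have star_le: "nrm Ops (star Ops T) \<le> nrm Ops T" if T: "T \<in> carrier Ops" for T
    using adjoint_pairD(5,6)[OF adjoint_pair_sym[OF Ops_pair[OF T]]] Ops_norm_nonneg[OF T] by (intro Ops_norm_le) auto
  show ?thesis
  proof (unfold_locales, unfold cstar_seminorm_def, intro ballI allI conjI)
    fix T U c assume T: "T \<in> carrier Ops" and U: "U \<in> carrier Ops"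
    show "0 \<le> nrm Ops T" by (rule Ops_norm_nonneg[OF T])
    show "nrm Ops (T \<oplus>\<^bsub>Ops\<^esub> U) \<le> nrm Ops T + nrm Ops U" by (rule Ops_add[OF T U])
    show "nrm Ops (T \<otimes>\<^bsub>Ops\<^esub> U) \<le> nrm Ops T * nrm Ops U" by (rule Ops_mult[OF T U])
    show "nrm Ops (c \<odot>\<^bsub>Ops\<^esub> T) = cmod c * nrm Ops T"
    proof (cases "c = 0")
      case True
      then show ?thesis using Ops_smult(3)[OF T, of 0] Ops_norm_nonneg[OF Ops_smult(1)[OF T], of 0] by simp
    next
      case False
      have "nrm Ops T \<le> cmod (1/c) * nrm Ops (c \<odot>\<^bsub>Ops\<^esub> T)"
        using Ops_smult(3)[OF Ops_smult(1)[OF T], of "1/c" c] o.smult_smult[OF T, of "1/c" c] T False by simp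
      then have "cmod c * nrm Ops T \<le> nrm Ops (c \<odot>\<^bsub>Ops\<^esub> T)" using False by (simp add: norm_divide field_simps)
      then show ?thesis using Ops_smult(3)[OF T, of c] by simp
    qed
    let ?TT = "star Ops T \<otimes>\<^bsub>Ops\<^esub> T"
    have TT: "?TT \<in> carrier Ops" using T by simp
    show "nrm Ops ?TT = (nrm Ops T)\<^sup>2"
    proof (rule antisym)
      show "nrm Ops ?TT \<le> (nrm Ops T)\<^sup>2"
        using Ops_mult(3)[OF Ops_star(1)[OF T] T] mult_right_mono[OF star_le[OF T] Ops_norm_nonneg[OF T]] by (simp add: power2_eq_square)
      \<comment> \<open>The nontrivial half of the C*-identity: the square of \<open>N (T u)\<close>
        is the norm of \<open>ip u (?TT u)\<close>, to which Cauchy-Schwarz applies.\<close>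
      have "N (T u) \<le> sqrt (nrm Ops ?TT) * N u" if u: "u \<in> E" for u
      proof -
        have Tu: "T u \<in> E" by (rule Ops_mem_E[OF T u])
        have "(N (T u))\<^sup>2 = nrm A (ip u (?TT u))"
          using N_square[OF Tu] adjoint_pairD(3)[OF Ops_pair[OF T] u Tu] by (simp add: Ops_apply u)
        also have "\<dots> \<le> N u * N (?TT u)" by (rule Cauchy_Schwarz[OF u Ops_mem_E[OF TT u]])
        also have "\<dots> \<le> N u * (nrm Ops ?TT * N u)" using Ops_bound[OF TT u] u by (intro mult_left_mono) auto
        also have "\<dots> = (sqrt (nrm Ops ?TT) * N u)\<^sup>2"
          using Ops_norm_nonneg[OF TT] by (simp add: power_mult_distrib power2_eq_square)
        finally show ?thesis using Ops_norm_nonneg[OF TT] u by (simp add: power2_le_iff_abs_le)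
      qed
      then have "nrm Ops T \<le> sqrt (nrm Ops ?TT)" using Ops_norm_nonneg[OF TT] by (intro Ops_norm_le) auto
      then show "(nrm Ops T)\<^sup>2 \<le> nrm Ops ?TT"
        using Ops_norm_nonneg[OF T] Ops_norm_nonneg[OF TT] by (metis power_mono real_sqrt_pow2)
    qed
  qed
qed

lemma Ops_minus_apply:
  assumes "T \<in> carrier Ops" "U \<in> carrier Ops" "u \<in> E"
  shows "(T \<ominus>\<^bsub>Ops\<^esub> U) u = (\<lambda>i. T u i \<ominus> U u i)"
  using star_alg.minus_smult[OF star_alg_Ops assms(1,2)] assms by (simp add: Ops_apply minus_smult E_closed Ops_mem_E)

lemma converges_ip:
  assumes x: "!!n. x n \<in> E" "u \<in> E" "(\<lambda>n. dN (x n) u) \<longlonglongrightarrow> 0" and v: "v \<in> E"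
  shows "converges A (\<lambda>n. ip (x n) v) (ip u v)" "converges A (\<lambda>n. ip v (x n)) (ip v u)"
proof -
  have lim: "(\<lambda>n. dN (x n) u * N v) \<longlonglongrightarrow> 0" by (rule tendsto_mult_left_zero[OF x(3)])
  show "converges A (\<lambda>n. ip (x n) v) (ip u v)"
    by (rule converges_dominated[OF _ lim])
      (use Cauchy_Schwarz[OF E_minus[OF x(1,2)] v] ip_minus_l[OF v x(1,2)] ip_closed x v in auto)
  show "converges A (\<lambda>n. ip v (x n)) (ip v u)"
    by (rule converges_dominated[OF _ lim])
      (use Cauchy_Schwarz[OF v E_minus[OF x(1,2)]] ip_minus_r[OF v x(1,2)] ip_closed x v in \<open>auto simp: mult.commute\<close>)
qed

text \<open>A Cauchy sequence of operators converges at each vector, and so does the sequence of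
  adjoints. By continuity of the inner product the two pointwise limits are adjoint to each other,
  and the Cauchy estimate makes the convergence uniform on the unit ball.\<close>

lemma cstar_alg_Ops: "cstar_alg Ops"
proof -
  interpret o: cstar_pre Ops by (rule cstar_pre_Ops)
  show ?thesis
  proof
    fix T assume T: "T \<in> carrier Ops" "nrm Ops T = 0"
    show "T = \<zero>\<^bsub>Ops\<^esub>"
    proof (rule Ops_eqI[OF T(1) o.zero_closed])
      fix u assume u: "u \<in> E"
      have "N (T u) = 0" using Ops_bound[OF T(1) u] T(2) N_nonneg[OF Ops_mem_E[OF T(1) u]] by simp
      then show "T u = \<zero>\<^bsub>Ops\<^esub> u" using N_definite[OF Ops_mem_E[OF T(1) u]] u by (simp add: Ops_apply)
    qed
  next
    fix T assume T: "T \<in> carrier (cauchy_seqs Ops)"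
    note Tc = o.cauchyD(1)[OF T]
    have lim: "\<exists>l. \<forall>u\<in>E. l u \<in> E \<and> (\<lambda>n. dN (T n u) (l u)) \<longlonglongrightarrow> 0" if T: "T \<in> carrier (cauchy_seqs Ops)" for T
    proof -
      note Tc = o.cauchyD(1)[OF T]
      have "\<exists>l. l \<in> E \<and> (\<lambda>n. dN (T n u) l) \<longlonglongrightarrow> 0" if u: "u \<in> E" for u
      proof (rule E_complete[of "\<lambda>n. T n u"])
        show "T n u \<in> E" for n by (rule Ops_mem_E[OF Tc u])
        fix e :: real assume "e > 0"
        have pos: "N u + 1 > 0" using N_nonneg[OF u] by simp
        then have "e / (N u + 1) > 0" using \<open>e > 0\<close> by simp
        then obtain M where M: "!!m n. m \<ge> M ==> n \<ge> M ==> nrm Ops (T m \<ominus>\<^bsub>Ops\<^esub> T n) < e / (N u + 1)"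
          using o.cauchyD(2)[OF T] by blast
        have "dN (T m u) (T n u) < e" if "m \<ge> M" "n \<ge> M" for m n
        proof -
          have "dN (T m u) (T n u) \<le> nrm Ops (T m \<ominus>\<^bsub>Ops\<^esub> T n) * N u"
            using Ops_bound[OF o.minus_closed[OF Tc[of m] Tc[of n]] u] by (simp add: Ops_minus_apply Tc u)
          also have "\<dots> \<le> e / (N u + 1) * N u" using M[OF that] u by (intro mult_right_mono) auto
          also have "\<dots> < e" using pos \<open>e > 0\<close> by (simp add: field_simps)
          finally show ?thesis .
        qed
        then show "\<exists>M. \<forall>m\<ge>M. \<forall>n\<ge>M. dN (T m u) (T n u) < e" by blast
      qed blast
      then have "\<forall>u\<in>E. \<exists>l. l \<in> E \<and> (\<lambda>n. dN (T n u) l) \<longlonglongrightarrow> 0" by blast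
      then show ?thesis by (rule bchoice)
    qed
    obtain l where l: "!!u. u \<in> E ==> l u \<in> E" "!!u. u \<in> E ==> (\<lambda>n. dN (T n u) (l u)) \<longlonglongrightarrow> 0"
      using lim[OF T] by blast
    obtain k where k: "!!u. u \<in> E ==> k u \<in> E" "!!u. u \<in> E ==> (\<lambda>n. N (\<lambda>i. star Ops (T n) u i \<ominus> k u i)) \<longlonglongrightarrow> 0"
      using lim[OF o.cauchy_star[OF T]] by blast
    have adj: "ip (l u) v = ip u (k v)" if u: "u \<in> E" and v: "v \<in> E" for u v
    proof (rule converges_unique)
      show "converges A (\<lambda>n. ip (T n u) v) (ip (l u) v)"
        by (rule converges_ip(1)[OF Ops_mem_E[OF Tc u] l(1)[OF u] l(2)[OF u] v])
      have "converges A (\<lambda>n. ip u (star Ops (T n) v)) (ip u (k v))"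
        by (rule converges_ip(2)[OF Ops_mem_E[OF Ops_star(1)[OF Tc] v] k(1)[OF v] k(2)[OF v] u])
      then show "converges A (\<lambda>n. ip (T n u) v) (ip u (k v))"
        using adjoint_pairD(3)[OF Ops_pair[OF Tc] u v] by simp
    qed (use ip_closed u v l k Ops_mem_E[OF Tc] in auto)
    \<comment> \<open>\<open>m\<close> tends to infinity in the estimate between
      \<open>T n u\<close> and \<open>T m u\<close>; a bound linear in \<open>N u\<close> is what
      the operator norm asks for.\<close>
    have near: "dN (T n u) (l u) \<le> e * N u"
      if M: "!!m n. m \<ge> M ==> n \<ge> M ==> nrm Ops (T m \<ominus>\<^bsub>Ops\<^esub> T n) < e" and n: "n \<ge> M" and u: "u \<in> E" for M e n u
    proof (rule LIMSEQ_le_const)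
      show "(\<lambda>m. e * N u + dN (T m u) (l u)) \<longlonglongrightarrow> e * N u"
        using tendsto_add[OF tendsto_const l(2)[OF u]] by simp
      have "dN (T n u) (l u) \<le> e * N u + dN (T m u) (l u)" if "m \<ge> M" for m
      proof -
        have "dN (T n u) (T m u) \<le> nrm Ops (T n \<ominus>\<^bsub>Ops\<^esub> T m) * N u"
          using Ops_bound[OF o.minus_closed[OF Tc[of n] Tc[of m]] u] by (simp add: Ops_minus_apply Tc u)
        also have "\<dots> \<le> e * N u" using M[OF n that] u by (intro mult_right_mono) auto
        finally show ?thesis
          using N_triangle[OF Ops_mem_E[OF Tc[of n] u] Ops_mem_E[OF Tc[of m] u] l(1)[OF u]] by simp
      qed
      then show "\<exists>M. \<forall>m\<ge>M. dN (T n u) (l u) \<le> e * N u + dN (T m u) (l u)" by blast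
    qed
    obtain M where M: "!!m n. m \<ge> M ==> n \<ge> M ==> nrm Ops (T m \<ominus>\<^bsub>Ops\<^esub> T n) < 1"
      using o.cauchyD(2)[OF T zero_less_one] by blast
    have "N (l u) \<le> (1 + nrm Ops (T M)) * N u" if u: "u \<in> E" for u
    proof -
      have TE: "T M u \<in> E" by (rule Ops_mem_E[OF Tc u])
      have "l u = (\<lambda>i. T M u i \<ominus> (T M u i \<ominus> l u i))"
        using E_closed[OF TE] E_closed[OF l(1)[OF u]]
        by (simp add: minus_smult smult_r_distr a_assoc[symmetric] r_neg flip: a_inv_smult)
      then have "N (l u) \<le> N (T M u) + dN (T M u) (l u)"
        using N_minus[OF TE E_minus[OF TE l(1)[OF u]]] by simp
      then show ?thesis using near[of M 1 M u] M u Ops_bound[OF Tc u, of M] by (simp add: distrib_right)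
    qed
    then have "adjoint_pair l k (1 + nrm Ops (T M))"
      using l(1) k(1) adj Ops_norm_nonneg[OF Tc, of M] by (simp add: adjoint_pair_def)
    note lm = op_mem(1)[OF this]
    have "converges Ops T (restrict l E)"
      unfolding converges_def
    proof (rule LIMSEQ_I)
      fix e :: real assume "e > 0"
      then obtain M where M: "!!m n. m \<ge> M ==> n \<ge> M ==> nrm Ops (T m \<ominus>\<^bsub>Ops\<^esub> T n) < e/2"
        using o.cauchyD(2)[OF T half_gt_zero[OF \<open>e > 0\<close>]] by blast
      have "norm (nrm Ops (T n \<ominus>\<^bsub>Ops\<^esub> restrict l E) - 0) < e" if "n \<ge> M" for n
      proof -
        have "nrm Ops (T n \<ominus>\<^bsub>Ops\<^esub> restrict l E) \<le> e/2"
          by (rule Ops_norm_le) (use near[OF M that] \<open>e > 0\<close> in \<open>auto simp: Ops_minus_apply[OF Tc lm]\<close>)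
        then show ?thesis using \<open>e > 0\<close> Ops_norm_nonneg[OF o.minus_closed[OF Tc[of n] lm]] by simp
      qed
      then show "\<exists>M. \<forall>n\<ge>M. norm (nrm Ops (T n \<ominus>\<^bsub>Ops\<^esub> restrict l E) - 0) < e" by blast
    qed
    with lm show "\<exists>l\<in>carrier Ops. converges Ops T l" by blast
  qed
qed

end

section \<open>The convolution algebra of an inverse monoid\<close>

lemma abs_summable_times:
  fixes f :: "'a => complex" and h :: "'b => complex"
  assumes "f abs_summable_on A" "h abs_summable_on B"
  shows "(\<lambda>(p, q). f p * h q) abs_summable_on A \<times> B"
  unfolding abs_summable_on_Sigma_iff
  using assms by (auto simp: norm_mult abs_mult infsum_cmult_right' intro!: summable_on_cmult_right summable_on_cmult_left)

lemma abs_summable_bounded: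
  fixes f :: "'a => complex"
  assumes "f abs_summable_on A" "!!x. x \<in> A ==> cmod (k x) \<le> K"
  shows "(\<lambda>x. f x * k x) abs_summable_on A" "cmod (\<Sum>\<^sub>\<infinity>x\<in>A. f x * k x) \<le> K * (\<Sum>\<^sub>\<infinity>x\<in>A. cmod (f x))"
proof -
  have le: "cmod (f x * k x) \<le> K * cmod (f x)" if "x \<in> A" for x
    using mult_left_mono[OF assms(2)[OF that], of "cmod (f x)"] by (simp add: norm_mult mult.commute)
  have s: "(\<lambda>x. K * cmod (f x)) summable_on A" using assms(1) by (rule summable_on_cmult_right)
  show a: "(\<lambda>x. f x * k x) abs_summable_on A" by (rule abs_summable_on_comparison_test'[OF s le])
  have "cmod (\<Sum>\<^sub>\<infinity>x\<in>A. f x * k x) \<le> (\<Sum>\<^sub>\<infinity>x\<in>A. K * cmod (f x))"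
    by (rule norm_infsum_le[OF has_sum_infsum has_sum_infsum]) (use abs_summable_summable[OF a] s le in auto)
  then show "cmod (\<Sum>\<^sub>\<infinity>x\<in>A. f x * k x) \<le> K * (\<Sum>\<^sub>\<infinity>x\<in>A. cmod (f x))" by (simp add: infsum_cmult_right')
qed

text \<open>\<open>c\<close> is the image of the summable family \<open>F\<close> under
  \<open>m\<close>. For \<open>m\<close> the multiplication of a monoid and \<open>F\<close> a
  tensor product it is the convolution, and the last claim is the change of variables by which the
  algebra laws are verified.\<close>

lemma pushforward:
  fixes F :: "'z => complex" and k :: "'y => complex"
  assumes F: "F abs_summable_on Z" and m: "m \<in> Z \<rightarrow> Y"
  defines "c \<equiv> \<lambda>r. \<Sum>\<^sub>\<infinity>z\<in>{z \<in> Z. m z = r}. F z"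
  shows "c abs_summable_on Y" "(\<Sum>\<^sub>\<infinity>r\<in>Y. cmod (c r)) \<le> (\<Sum>\<^sub>\<infinity>z\<in>Z. cmod (F z))"
    "(!!r. r \<in> Y ==> cmod (k r) \<le> K) ==> (\<Sum>\<^sub>\<infinity>r\<in>Y. c r * k r) = (\<Sum>\<^sub>\<infinity>z\<in>Z. F z * k (m z))"
proof -
  \<comment> \<open>\<open>Z\<close> as the disjoint union of the fibres of \<open>m\<close>; it
    relates the iterated sum to the sum over \<open>Z\<close>.\<close>
  let ?S = "Sigma Y (\<lambda>r. {z \<in> Z. m z = r})"
  have bij: "bij_betw snd ?S Z"
    by (rule bij_betwI[of _ _ _ "\<lambda>z. (m z, z)"]) (use m in auto)
  have FS: "(\<lambda>x. F (snd x)) abs_summable_on ?S"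
    using summable_on_reindex_bij_betw[OF bij, of "\<lambda>z. cmod (F z)"] F by simp
  have fib: "F abs_summable_on {z \<in> Z. m z = r}" for r
    using F by (rule summable_on_subset_banach) auto
  have outer: "(\<lambda>r. \<Sum>\<^sub>\<infinity>z\<in>{z \<in> Z. m z = r}. cmod (F z)) summable_on Y"
    using summable_on_Sigma_banach[of "\<lambda>r z. cmod (F z)" Y] FS by (simp add: case_prod_unfold)
  have cle: "cmod (c r) \<le> (\<Sum>\<^sub>\<infinity>z\<in>{z \<in> Z. m z = r}. cmod (F z))" for r
    unfolding c_def by (rule norm_infsum_bound[OF fib])
  show ca: "c abs_summable_on Y" by (rule abs_summable_on_comparison_test'[OF outer cle])
  have "(\<Sum>\<^sub>\<infinity>r\<in>Y. cmod (c r)) \<le> (\<Sum>\<^sub>\<infinity>r\<in>Y. \<Sum>\<^sub>\<infinity>z\<in>{z \<in> Z. m z = r}. cmod (F z))"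
    by (rule infsum_mono[OF ca outer cle])
  also have "\<dots> = (\<Sum>\<^sub>\<infinity>x\<in>?S. cmod (F (snd x)))"
    using infsum_Sigma'_banach[of "\<lambda>r z. cmod (F z)" Y] FS by (simp add: case_prod_unfold)
  also have "\<dots> = (\<Sum>\<^sub>\<infinity>z\<in>Z. cmod (F z))" by (rule infsum_reindex_bij_betw[OF bij])
  finally show "(\<Sum>\<^sub>\<infinity>r\<in>Y. cmod (c r)) \<le> (\<Sum>\<^sub>\<infinity>z\<in>Z. cmod (F z))" .
  assume k: "!!r. r \<in> Y ==> cmod (k r) \<le> K"
  have FkS: "(\<lambda>x. F (snd x) * k (fst x)) summable_on ?S"
    by (rule abs_summable_summable, rule abs_summable_bounded(1)[OF FS, of _ K]) (use k in auto)
  have "(\<Sum>\<^sub>\<infinity>r\<in>Y. c r * k r) = (\<Sum>\<^sub>\<infinity>r\<in>Y. \<Sum>\<^sub>\<infinity>z\<in>{z \<in> Z. m z = r}. F z * k r)"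
    by (simp add: c_def infsum_cmult_left')
  also have "\<dots> = (\<Sum>\<^sub>\<infinity>x\<in>?S. F (snd x) * k (fst x))"
    using infsum_Sigma'_banach[of "\<lambda>r z. F z * k r" Y] FkS by (simp add: case_prod_unfold)
  also have "\<dots> = (\<Sum>\<^sub>\<infinity>x\<in>?S. F (snd x) * k (m (snd x)))" by (rule infsum_cong) auto
  also have "\<dots> = (\<Sum>\<^sub>\<infinity>z\<in>Z. F z * k (m z))" by (rule infsum_reindex_bij_betw[OF bij])
  finally show "(\<Sum>\<^sub>\<infinity>r\<in>Y. c r * k r) = (\<Sum>\<^sub>\<infinity>z\<in>Z. F z * k (m z))" .
qed

text \<open>Commutation of idempotents is stated for range projections, the form in which
  multiplicativity of the regular representation uses it.\<close>

locale inverse_monoid = monoid P for P :: "'p inverse_semigroup" (structure) +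
  assumes sinv_closed [simp, intro]: "p \<in> carrier P ==> sinv P p \<in> carrier P"
    and sinv_sinv [simp]: "p \<in> carrier P ==> sinv P (sinv P p) = p"
    and sinv_mult: "p \<in> carrier P ==> q \<in> carrier P ==> sinv P (p \<otimes> q) = sinv P q \<otimes> sinv P p"
    and sinv_regular: "p \<in> carrier P ==> p \<otimes> (sinv P p \<otimes> p) = p"
    and ranges_commute: "p \<in> carrier P ==> q \<in> carrier P ==>
      (p \<otimes> sinv P p) \<otimes> (q \<otimes> sinv P q) = (q \<otimes> sinv P q) \<otimes> (p \<otimes> sinv P p)"
begin

abbreviation M where "M \<equiv> ell1 P"

lemma sinv_one [simp]: "sinv P \<one> = \<one>"
  by (metis l_one one_closed r_one sinv_closed sinv_mult sinv_sinv)

lemma ell1_simps: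
  "one M = delta \<one>" "zero M = (\<lambda>p. 0)" "add M = (\<lambda>f h p. f p + h p)" "smult M = (\<lambda>c f p. c * f p)"
  "star M = (\<lambda>f p. if p \<in> carrier P then cnj (f (sinv P p)) else 0)"
  "nrm M = (\<lambda>f. \<Sum>\<^sub>\<infinity>p \<in> carrier P. cmod (f p))"
  by (simp_all add: ell1_def)

lemma ell1_carrier: "f \<in> carrier M \<longleftrightarrow> (\<forall>p. p \<notin> carrier P --> f p = 0) \<and> f abs_summable_on carrier P"
  by (simp add: ell1_def)

text \<open>
  The algebra laws of \<open>ell1 P\<close> are checked by pairing with bounded functions: the convolution is
  the pushforward of the tensor product along the multiplication.
\<close>

definition pair :: "('p => complex) => ('p => complex) => complex" where
  "pair f k = (\<Sum>\<^sub>\<infinity>p\<in>carrier P. f p * k p)"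

definition bdd :: "('p => complex) => bool" where
  "bdd k \<longleftrightarrow> (\<exists>K. \<forall>p\<in>carrier P. cmod (k p) \<le> K)"

lemma bddI: "(!!p. p \<in> carrier P ==> cmod (k p) \<le> K) ==> bdd k"
  by (auto simp: bdd_def)

lemma ell1_summable: "f \<in> carrier M ==> bdd k ==> (\<lambda>p. f p * k p) summable_on carrier P"
  by (rule abs_summable_summable) (auto simp: bdd_def ell1_carrier intro: abs_summable_bounded(1))

lemma pair_le: "f \<in> carrier M ==> (!!p. p \<in> carrier P ==> cmod (k p) \<le> K) ==> cmod (pair f k) \<le> K * nrm M f"
  unfolding pair_def ell1_simps by (rule abs_summable_bounded(2)) (auto simp: ell1_carrier)

lemma pair_cong: "(!!p. p \<in> carrier P ==> k p = l p) ==> pair f k = pair f l"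
  unfolding pair_def by (rule infsum_cong) simp

lemma pair_add: "f \<in> carrier M ==> h \<in> carrier M ==> bdd k ==> pair (f \<oplus>\<^bsub>M\<^esub> h) k = pair f k + pair h k"
  unfolding pair_def ell1_simps distrib_right by (rule infsum_add) (auto intro: ell1_summable)

lemma pair_smult: "pair (c \<odot>\<^bsub>M\<^esub> f) k = c * pair f k"
  unfolding pair_def ell1_simps by (simp add: mult.assoc infsum_cmult_right')

lemma pair_smult_r: "pair f (\<lambda>p. c * k p) = c * pair f k"
  unfolding pair_def by (simp add: mult.left_commute infsum_cmult_right')

lemma pair_add_r: "f \<in> carrier M ==> bdd k ==> bdd l ==> pair f (\<lambda>p. k p + l p) = pair f k + pair f l"
  unfolding pair_def distrib_left by (rule infsum_add) (auto intro: ell1_summable)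

lemma pair_cnj: "cnj (pair f k) = pair (\<lambda>p. cnj (f p)) (\<lambda>p. cnj (k p))"
  unfolding pair_def by (simp flip: infsum_cnj)

lemma pair_delta: "q \<in> carrier P ==> pair (delta q) k = k q"
proof -
  assume q: "q \<in> carrier P"
  have "pair (delta q) k = (\<Sum>\<^sub>\<infinity>p\<in>{q}. delta q p * k p)"
    unfolding pair_def by (rule infsum_cong_neutral) (use q in \<open>auto simp: delta_def\<close>)
  then show ?thesis by (simp add: delta_def)
qed

lemma pair_indicator: "q \<in> carrier P ==> pair f (delta q) = f q"
proof -
  assume q: "q \<in> carrier P"
  have "pair f (delta q) = (\<Sum>\<^sub>\<infinity>p\<in>{q}. f p * delta q p)"
    unfolding pair_def by (rule infsum_cong_neutral) (use q in \<open>auto simp: delta_def\<close>)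
  then show ?thesis by (simp add: delta_def)
qed

lemma bdd_delta: "bdd (delta q)"
  by (rule bddI[of _ 1]) (simp add: delta_def)

text \<open>Point masses are bounded functions, so the pairings separate.\<close>

lemma ell1_eqI:
  assumes "f \<in> carrier M" "h \<in> carrier M" "!!k. bdd k ==> pair f k = pair h k"
  shows "f = h"
proof
  fix q show "f q = h q"
    using assms(3)[OF bdd_delta, of q] pair_indicator[of q f] pair_indicator[of q h] assms(1,2)
    by (cases "q \<in> carrier P") (auto simp: ell1_carrier)
qed

lemma bdd_pair: "f \<in> carrier M ==> (!!p q. p \<in> carrier P ==> q \<in> carrier P ==> cmod (l p q) \<le> K) ==> bdd (\<lambda>p. pair f (l p))"
  by (rule bddI[of _ "K * nrm M f"]) (auto intro!: pair_le)

lemma conv_fibre: "{(p, q) \<in> carrier P \<times> carrier P. p \<otimes> q = r} = {z \<in> carrier P \<times> carrier P. (\<lambda>(p, q). p \<otimes> q) z = r}"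
  by auto

lemma ell1_mult_eq: "mult M f h r = (\<Sum>\<^sub>\<infinity>z\<in>{z \<in> carrier P \<times> carrier P. (\<lambda>(p, q). p \<otimes> q) z = r}. (\<lambda>(p, q). f p * h q) z)"
  unfolding ell1_def conv_fibre by simp

lemma
  assumes f: "f \<in> carrier M" and h: "h \<in> carrier M"
  shows ell1_mult_closed: "f \<otimes>\<^bsub>M\<^esub> h \<in> carrier M"
    and ell1_mult_norm: "nrm M (f \<otimes>\<^bsub>M\<^esub> h) \<le> nrm M f * nrm M h"
    and pair_mult: "bdd k ==> pair (f \<otimes>\<^bsub>M\<^esub> h) k = pair f (\<lambda>p. pair h (\<lambda>q. k (p \<otimes> q)))"
proof -
  have F: "(\<lambda>(p, q). f p * h q) abs_summable_on carrier P \<times> carrier P"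
    using f h by (intro abs_summable_times) (auto simp: ell1_carrier)
  have m: "(\<lambda>(p, q). p \<otimes> q) \<in> carrier P \<times> carrier P \<rightarrow> carrier P" by auto
  note pf = pushforward[OF F m, folded ell1_mult_eq]
  have "(f \<otimes>\<^bsub>M\<^esub> h) r = 0" if "r \<notin> carrier P" for r
  proof -
    have "{z \<in> carrier P \<times> carrier P. (\<lambda>(p, q). p \<otimes> q) z = r} = {}" using that by auto
    then show ?thesis unfolding ell1_mult_eq by (simp only: infsum_empty)
  qed
  with pf(1) show "f \<otimes>\<^bsub>M\<^esub> h \<in> carrier M" by (simp add: ell1_carrier)
  have "(\<Sum>\<^sub>\<infinity>z\<in>carrier P \<times> carrier P. cmod (case z of (p, q) => f p * h q)) = (\<Sum>\<^sub>\<infinity>p\<in>carrier P. \<Sum>\<^sub>\<infinity>q\<in>carrier P. cmod (f p) * cmod (h q))"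
    using infsum_Sigma'_banach[of "\<lambda>p q. cmod (f p) * cmod (h q)" "carrier P" "\<lambda>_. carrier P"] F
    by (simp add: case_prod_unfold norm_mult)
  also have "\<dots> = nrm M f * nrm M h" by (simp add: ell1_simps infsum_cmult_right' infsum_cmult_left')
  finally show "nrm M (f \<otimes>\<^bsub>M\<^esub> h) \<le> nrm M f * nrm M h" using pf(2) by (simp add: ell1_simps)
  assume "bdd k"
  then obtain K where K: "\<forall>p\<in>carrier P. cmod (k p) \<le> K" unfolding bdd_def by blast
  have "pair (f \<otimes>\<^bsub>M\<^esub> h) k = (\<Sum>\<^sub>\<infinity>z\<in>carrier P \<times> carrier P. (\<lambda>(p, q). f p * h q) z * k ((\<lambda>(p, q). p \<otimes> q) z))"
    unfolding pair_def by (rule pf(3)[OF K[rule_format]])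
  also have "\<dots> = (\<Sum>\<^sub>\<infinity>(p, q)\<in>carrier P \<times> carrier P. f p * (h q * k (p \<otimes> q)))"
    by (rule infsum_cong) (auto simp: mult.assoc)
  also have "\<dots> = (\<Sum>\<^sub>\<infinity>p\<in>carrier P. \<Sum>\<^sub>\<infinity>q\<in>carrier P. f p * (h q * k (p \<otimes> q)))"
  proof (rule infsum_Sigma'_banach[symmetric], rule abs_summable_summable)
    have "(\<lambda>z. (\<lambda>(p, q). f p * h q) z * k ((\<lambda>(p, q). p \<otimes> q) z)) abs_summable_on carrier P \<times> carrier P"
      by (rule abs_summable_bounded(1)[OF F, of _ K]) (use K in auto)
    then show "(\<lambda>(p, q). f p * (h q * k (p \<otimes> q))) abs_summable_on carrier P \<times> carrier P"
      by (simp add: case_prod_unfold mult.assoc)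
  qed
  finally show "pair (f \<otimes>\<^bsub>M\<^esub> h) k = pair f (\<lambda>p. pair h (\<lambda>q. k (p \<otimes> q)))"
    by (simp add: pair_def infsum_cmult_right')
qed

text \<open>Fubini for a bounded kernel. The involution reverses products, so the law for the
  adjoint of a convolution exchanges the order of the two sums.\<close>

lemma pair_swap:
  assumes f: "f \<in> carrier M" and h: "h \<in> carrier M"
    and l: "!!p q. p \<in> carrier P ==> q \<in> carrier P ==> cmod (l p q) \<le> K"
  shows "pair f (\<lambda>p. pair h (l p)) = pair h (\<lambda>q. pair f (\<lambda>p. l p q))"
proof -
  have F: "(\<lambda>(p, q). f p * h q) abs_summable_on carrier P \<times> carrier P"
    using f h by (intro abs_summable_times) (auto simp: ell1_carrier)
  have "(\<lambda>z. (\<lambda>(p, q). f p * h q) z * (\<lambda>(p, q). l p q) z) abs_summable_on carrier P \<times> carrier P"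
    by (rule abs_summable_bounded(1)[OF F, of _ K]) (use l in auto)
  then have "(\<lambda>z. case z of (p, q) => f p * (h q * l p q)) abs_summable_on carrier P \<times> carrier P"
    by (simp add: case_prod_unfold mult.assoc)
  from infsum_swap_banach[OF abs_summable_summable[OF this]]
  have "(\<Sum>\<^sub>\<infinity>p\<in>carrier P. \<Sum>\<^sub>\<infinity>q\<in>carrier P. f p * (h q * l p q)) = (\<Sum>\<^sub>\<infinity>q\<in>carrier P. \<Sum>\<^sub>\<infinity>p\<in>carrier P. h q * (f p * l p q))"
    by (simp only: mult.left_commute)
  then show ?thesis by (simp only: pair_def infsum_cmult_right')
qed

lemma sinv_bij: "bij_betw (sinv P) (carrier P) (carrier P)"
  by (rule bij_betwI[of _ _ _ "sinv P"]) auto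

lemma ell1_star_closed: "f \<in> carrier M ==> star M f \<in> carrier M"
  using summable_on_reindex_bij_betw[OF sinv_bij, of "\<lambda>p. cmod (f p)"]
  by (simp add: ell1_carrier ell1_simps cong: summable_on_cong)

lemma pair_star: "pair (star M f) k = cnj (pair f (\<lambda>p. cnj (k (sinv P p))))"
proof -
  have "pair (star M f) k = (\<Sum>\<^sub>\<infinity>p\<in>carrier P. cnj (f (sinv P p)) * k (sinv P (sinv P p)))"
    unfolding pair_def by (rule infsum_cong) (simp add: ell1_simps)
  also have "\<dots> = (\<Sum>\<^sub>\<infinity>p\<in>carrier P. cnj (f p) * k (sinv P p))"
    by (rule infsum_reindex_bij_betw[OF sinv_bij])
  finally show ?thesis by (simp add: pair_cnj) (simp add: pair_def)
qed

lemma ell1_delta: "q \<in> carrier P ==> delta q \<in> carrier M"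
proof -
  assume q: "q \<in> carrier P"
  have "(\<lambda>p. norm (delta q p)) summable_on {q}" by simp
  then have "(\<lambda>p. norm (delta q p)) summable_on carrier P"
    by (rule summable_on_cong_neutral[THEN iffD1, rotated -1]) (use q in \<open>auto simp: delta_def\<close>)
  then show ?thesis using q by (auto simp: ell1_carrier delta_def)
qed

lemma ell1_linear_closed:
  "f \<in> carrier M ==> h \<in> carrier M ==> f \<oplus>\<^bsub>M\<^esub> h \<in> carrier M" "f \<in> carrier M ==> c \<odot>\<^bsub>M\<^esub> f \<in> carrier M" "\<zero>\<^bsub>M\<^esub> \<in> carrier M"
proof -
  show "f \<in> carrier M ==> h \<in> carrier M ==> f \<oplus>\<^bsub>M\<^esub> h \<in> carrier M"
    using abs_summable_on_comparison_test'[of "\<lambda>p. cmod (f p) + cmod (h p)" "carrier P" "\<lambda>p. f p + h p"]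
    by (auto simp: ell1_carrier ell1_simps norm_triangle_ineq summable_on_add)
  show "f \<in> carrier M ==> c \<odot>\<^bsub>M\<^esub> f \<in> carrier M"
    by (auto simp: ell1_carrier ell1_simps norm_mult summable_on_cmult_right)
qed (simp add: ell1_carrier ell1_simps)

lemma star_alg_ell1: "star_alg M"
proof (rule star_algI)
  note cl = ell1_linear_closed ell1_mult_closed ell1_star_closed ell1_delta
  fix f h g c assume f: "f \<in> carrier M" and h: "h \<in> carrier M" and g: "g \<in> carrier M"
  show "f \<otimes>\<^bsub>M\<^esub> h \<otimes>\<^bsub>M\<^esub> g = f \<otimes>\<^bsub>M\<^esub> (h \<otimes>\<^bsub>M\<^esub> g)"
  proof (rule ell1_eqI)
    fix k assume k: "bdd k"
    then obtain K where K: "\<forall>p\<in>carrier P. cmod (k p) \<le> K" unfolding bdd_def by blast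
    have b1: "bdd (\<lambda>p. pair g (\<lambda>q. k (p \<otimes> q)))" by (rule bdd_pair[OF g, of _ K]) (use K in auto)
    have b2: "bdd (\<lambda>q. k (p \<otimes> q))" if "p \<in> carrier P" for p by (rule bddI[of _ K]) (use K that in auto)
    show "pair (f \<otimes>\<^bsub>M\<^esub> h \<otimes>\<^bsub>M\<^esub> g) k = pair (f \<otimes>\<^bsub>M\<^esub> (h \<otimes>\<^bsub>M\<^esub> g)) k"
      using f h g k by (simp add: pair_mult cl b1) (intro pair_cong, simp add: pair_mult b2 m_assoc cong: pair_cong)
  qed (use f h g cl in auto)
  show "(f \<oplus>\<^bsub>M\<^esub> h) \<otimes>\<^bsub>M\<^esub> g = f \<otimes>\<^bsub>M\<^esub> g \<oplus>\<^bsub>M\<^esub> h \<otimes>\<^bsub>M\<^esub> g"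
  proof (rule ell1_eqI)
    fix k assume k: "bdd k"
    then obtain K where K: "\<forall>p\<in>carrier P. cmod (k p) \<le> K" unfolding bdd_def by blast
    have b1: "bdd (\<lambda>p. pair g (\<lambda>q. k (p \<otimes> q)))" by (rule bdd_pair[OF g, of _ K]) (use K in auto)
    show "pair ((f \<oplus>\<^bsub>M\<^esub> h) \<otimes>\<^bsub>M\<^esub> g) k = pair (f \<otimes>\<^bsub>M\<^esub> g \<oplus>\<^bsub>M\<^esub> h \<otimes>\<^bsub>M\<^esub> g) k"
      using f h g k by (simp add: pair_mult pair_add cl b1)
  qed (use f h g cl in auto)
  show "g \<otimes>\<^bsub>M\<^esub> (f \<oplus>\<^bsub>M\<^esub> h) = g \<otimes>\<^bsub>M\<^esub> f \<oplus>\<^bsub>M\<^esub> g \<otimes>\<^bsub>M\<^esub> h"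
  proof (rule ell1_eqI)
    fix k assume k: "bdd k"
    then obtain K where K: "\<forall>p\<in>carrier P. cmod (k p) \<le> K" unfolding bdd_def by blast
    have b1: "bdd (\<lambda>p. pair f (\<lambda>q. k (p \<otimes> q)))" "bdd (\<lambda>p. pair h (\<lambda>q. k (p \<otimes> q)))"
      by (rule bdd_pair[OF f, of _ K], use K in simp) (rule bdd_pair[OF h, of _ K], use K in simp)
    have b2: "bdd (\<lambda>q. k (p \<otimes> q))" if "p \<in> carrier P" for p by (rule bddI[of _ K]) (use K that in auto)
    have "pair g (\<lambda>p. pair (f \<oplus>\<^bsub>M\<^esub> h) (\<lambda>q. k (p \<otimes> q))) = pair g (\<lambda>p. pair f (\<lambda>q. k (p \<otimes> q)) + pair h (\<lambda>q. k (p \<otimes> q)))"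
      by (rule pair_cong) (simp add: pair_add f h b2)
    then show "pair (g \<otimes>\<^bsub>M\<^esub> (f \<oplus>\<^bsub>M\<^esub> h)) k = pair (g \<otimes>\<^bsub>M\<^esub> f \<oplus>\<^bsub>M\<^esub> g \<otimes>\<^bsub>M\<^esub> h) k"
      using f h g k by (simp add: pair_mult pair_add pair_add_r cl b1)
  qed (use f h g cl in auto)
next
  note cl = ell1_linear_closed ell1_mult_closed ell1_star_closed ell1_delta
  fix f h c assume f: "f \<in> carrier M" and h: "h \<in> carrier M"
  show "(c \<odot>\<^bsub>M\<^esub> f) \<otimes>\<^bsub>M\<^esub> h = c \<odot>\<^bsub>M\<^esub> (f \<otimes>\<^bsub>M\<^esub> h)"
    by (rule ell1_eqI) (use f h cl in \<open>auto simp: pair_mult pair_smult\<close>)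
  show "f \<otimes>\<^bsub>M\<^esub> (c \<odot>\<^bsub>M\<^esub> h) = c \<odot>\<^bsub>M\<^esub> (f \<otimes>\<^bsub>M\<^esub> h)"
    by (rule ell1_eqI) (use f h cl in \<open>auto simp: pair_mult pair_smult pair_smult_r\<close>)
  show "star M (f \<otimes>\<^bsub>M\<^esub> h) = star M h \<otimes>\<^bsub>M\<^esub> star M f"
  proof (rule ell1_eqI)
    fix k assume k: "bdd k"
    then obtain K where K: "\<forall>p\<in>carrier P. cmod (k p) \<le> K" unfolding bdd_def by blast
    have b: "bdd (\<lambda>p. cnj (k (sinv P p)))" by (rule bddI[of _ K]) (use K in auto)
    have "pair (star M (f \<otimes>\<^bsub>M\<^esub> h)) k = cnj (pair f (\<lambda>p. pair h (\<lambda>q. cnj (k (sinv P q \<otimes> sinv P p)))))"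
      unfolding pair_star pair_mult[OF f h b] by (intro arg_cong[where f = cnj] pair_cong) (simp add: sinv_mult)
    also have "pair f (\<lambda>p. pair h (\<lambda>q. cnj (k (sinv P q \<otimes> sinv P p)))) = pair h (\<lambda>q. pair f (\<lambda>p. cnj (k (sinv P q \<otimes> sinv P p))))"
      by (rule pair_swap[OF f h, of _ K]) (use K in auto)
    also have "cnj \<dots> = pair (star M h \<otimes>\<^bsub>M\<^esub> star M f) k"
      unfolding pair_mult[OF ell1_star_closed[OF h] ell1_star_closed[OF f] k] pair_star[of h] pair_star[of f] by simp
    finally show "pair (star M (f \<otimes>\<^bsub>M\<^esub> h)) k = pair (star M h \<otimes>\<^bsub>M\<^esub> star M f) k" .
  qed (use f h cl in auto)
next
  note cl = ell1_linear_closed ell1_mult_closed ell1_star_closed ell1_delta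
  fix f assume f: "f \<in> carrier M"
  show "\<one>\<^bsub>M\<^esub> \<otimes>\<^bsub>M\<^esub> f = f"
    by (rule ell1_eqI) (use f cl in \<open>auto simp: ell1_simps(1) pair_mult pair_delta intro!: pair_cong\<close>)
  show "f \<otimes>\<^bsub>M\<^esub> \<one>\<^bsub>M\<^esub> = f"
    by (rule ell1_eqI) (use f cl in \<open>auto simp: ell1_simps(1) pair_mult pair_delta intro!: pair_cong\<close>)
  show "star M (star M f) = f" using f by (auto simp: ell1_simps ell1_carrier fun_eq_iff)
qed (auto simp: ell1_linear_closed ell1_mult_closed ell1_star_closed ell1_delta ell1_simps(1), auto simp: ell1_simps algebra_simps)

lemma nrm_ell1_nonneg: "0 \<le> nrm M f"
  by (simp add: ell1_simps infsum_nonneg)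

lemma prenormed_ell1: "prenormed_star_alg M"
  by (intro prenormed_star_alg.intro prenormed_star_alg_axioms.intro star_alg_ell1 nrm_ell1_nonneg)

lemma delta_mult: "p \<in> carrier P ==> q \<in> carrier P ==> delta p \<otimes>\<^bsub>M\<^esub> delta q = delta (p \<otimes> q)"
  by (rule ell1_eqI) (auto simp: ell1_mult_closed ell1_delta pair_mult pair_delta)

lemma delta_star: "p \<in> carrier P ==> star M (delta p) = delta (sinv P p)"
  by (rule ell1_eqI) (auto simp: ell1_star_closed ell1_delta pair_star pair_delta)

lemma nrm_delta: "p \<in> carrier P ==> nrm M (delta p) = 1"
proof -
  assume p: "p \<in> carrier P"
  have "nrm M (delta p) = (\<Sum>\<^sub>\<infinity>q\<in>{p}. cmod (delta p q))"
    unfolding ell1_simps by (rule infsum_cong_neutral) (use p in \<open>auto simp: delta_def\<close>)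
  then show ?thesis by (simp add: delta_def)
qed

lemma lin_span_delta: "lin_span M (delta ` carrier P) = {f. finite {p. f p \<noteq> 0} \<and> {p. f p \<noteq> 0} \<subseteq> carrier P}"
proof (intro equalityI subsetI)
  fix f assume "f \<in> lin_span M (delta ` carrier P)"
  then show "f \<in> {f. finite {p. f p \<noteq> 0} \<and> {p. f p \<noteq> 0} \<subseteq> carrier P}"
  proof induction
    case (add x y)
    have "{p. (x \<oplus>\<^bsub>M\<^esub> y) p \<noteq> 0} \<subseteq> {p. x p \<noteq> 0} \<union> {p. y p \<noteq> 0}" by (auto simp: ell1_simps)
    with add show ?case by (auto intro: finite_subset)
  next
    case (smult x c)
    have "{p. (c \<odot>\<^bsub>M\<^esub> x) p \<noteq> 0} \<subseteq> {p. x p \<noteq> 0}" by (auto simp: ell1_simps)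
    with smult show ?case by (auto intro: finite_subset)
  qed (auto simp: ell1_simps delta_def split: if_splits)
next
  fix f :: "'p => complex" assume "f \<in> {f. finite {p. f p \<noteq> 0} \<and> {p. f p \<noteq> 0} \<subseteq> carrier P}"
  then have "finite {p. f p \<noteq> 0}" "{p. f p \<noteq> 0} \<subseteq> carrier P" by auto
  moreover have "\<forall>f :: 'p => complex. {p. f p \<noteq> 0} = F --> f \<in> lin_span M (delta ` carrier P)" if "finite F" "F \<subseteq> carrier P" for F
    using that
  proof (induction F)
    case empty
    show ?case
    proof (intro allI impI)
      fix f :: "'p => complex" assume "{p. f p \<noteq> 0} = {}"
      then have "f = \<zero>\<^bsub>M\<^esub>" by (auto simp: ell1_simps)
      then show "f \<in> lin_span M (delta ` carrier P)" by (simp only: lin_span.zero)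
    qed
  next
    case (insert q F)
    show ?case
    proof (intro allI impI)
      fix f :: "'p => complex" assume f: "{p. f p \<noteq> 0} = insert q F"
      let ?g = "\<lambda>p. if p = q then 0 else f p"
      have IH: "\<forall>f :: 'p => complex. {p. f p \<noteq> 0} = F --> f \<in> lin_span M (delta ` carrier P)" using insert by simp
      have "{p. ?g p \<noteq> 0} = F" using f insert(2) by auto
      then have "?g \<in> lin_span M (delta ` carrier P)" by (rule IH[rule_format])
      moreover have "f q \<odot>\<^bsub>M\<^esub> delta q \<in> lin_span M (delta ` carrier P)"
        using insert by (intro lin_span.smult lin_span.base) auto
      moreover have "f = ?g \<oplus>\<^bsub>M\<^esub> (f q \<odot>\<^bsub>M\<^esub> delta q)" by (auto simp: ell1_simps delta_def)
      ultimately show "f \<in> lin_span M (delta ` carrier P)" using lin_span.add[of ?g M "delta ` carrier P"] by metis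
    qed
  qed
  ultimately show "f \<in> lin_span M (delta ` carrier P)" by blast
qed

lemma ell1_approx:
  assumes f: "f \<in> carrier M" and e: "e > 0"
  obtains h where "h \<in> lin_span M (delta ` carrier P)" "h \<in> carrier M" "nrm M (f \<ominus>\<^bsub>M\<^esub> h) < e"
proof -
  interpret M: star_alg M by (rule star_alg_ell1)
  have s: "(\<lambda>p. cmod (f p)) summable_on carrier P" using f by (simp add: ell1_carrier)
  obtain F where F: "finite F" "F \<subseteq> carrier P" "dist (\<Sum>p\<in>F. cmod (f p)) (\<Sum>\<^sub>\<infinity>p\<in>carrier P. cmod (f p)) \<le> e/2"
    using infsum_finite_approximation[OF s, of "e/2"] e by auto
  define h where "h p = (if p \<in> F then f p else 0)" for p
  have "finite {p. h p \<noteq> 0}" "{p. h p \<noteq> 0} \<subseteq> carrier P" using F by (auto simp: h_def)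
  then have h: "h \<in> lin_span M (delta ` carrier P)" by (simp add: lin_span_delta)
  have hc: "h \<in> carrier M" by (rule M.lin_span_closed[OF _ h]) (auto intro: ell1_delta)
  have "nrm M (f \<ominus>\<^bsub>M\<^esub> h) = (\<Sum>\<^sub>\<infinity>p\<in>carrier P. cmod (f p - h p))"
    using M.minus_smult[OF f hc] by (simp add: ell1_simps)
  also have "\<dots> = (\<Sum>\<^sub>\<infinity>p\<in>carrier P - F. cmod (f p))"
    by (rule infsum_cong_neutral) (auto simp: h_def)
  also have "\<dots> = (\<Sum>\<^sub>\<infinity>p\<in>carrier P. cmod (f p)) - (\<Sum>p\<in>F. cmod (f p))"
  proof -
    have "(\<Sum>\<^sub>\<infinity>p\<in>(carrier P - F) \<union> F. cmod (f p)) = (\<Sum>\<^sub>\<infinity>p\<in>carrier P - F. cmod (f p)) + (\<Sum>\<^sub>\<infinity>p\<in>F. cmod (f p))"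
      by (rule infsum_Un_disjoint) (use s F in \<open>auto intro: summable_on_subset_banach\<close>)
    moreover have "(carrier P - F) \<union> F = carrier P" using F by blast
    ultimately show ?thesis using F by simp
  qed
  also have "\<dots> < e" using F(3) e by (simp add: dist_real_def abs_if split: if_splits)
  finally show ?thesis using that h hc by blast
qed

end

section \<open>The regular representation of an inverse monoid\<close>

lemma complex_alg_simps:
  "carrier complex_alg = UNIV" "mult complex_alg = (*)" "one complex_alg = 1" "zero complex_alg = 0"
  "add complex_alg = (+)" "smult complex_alg = (*)" "star complex_alg = cnj" "nrm complex_alg = cmod"
  by (simp_all add: complex_alg_def)

lemma star_alg_complex: "star_alg complex_alg"
  by (rule star_algI) (auto simp: complex_alg_simps algebra_simps)

lemma cstar_pre_complex: "cstar_pre complex_alg"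
  by (intro cstar_pre.intro seminormed.intro seminormed_axioms.intro star_alg_complex)
    (auto simp: cstar_seminorm_def complex_alg_simps norm_triangle_ineq norm_mult power2_eq_square)

lemma minus_complex_alg: "x \<ominus>\<^bsub>complex_alg\<^esub> y = x - y"
  using star_alg.minus_smult[OF star_alg_complex, of x y] by (simp add: complex_alg_simps)

lemma finsum_complex_alg: "finsum complex_alg f F = sum f F"
proof -
  interpret star_alg complex_alg by (rule star_alg_complex)
  show ?thesis by (induction F rule: infinite_finite_induct) (simp_all add: complex_alg_simps)
qed

lemma converges_complex_alg: "converges complex_alg x l \<longleftrightarrow> x \<longlonglongrightarrow> l"
  by (simp add: converges_def minus_complex_alg complex_alg_simps tendsto_norm_zero_iff LIM_zero_iff)

lemma cstar_alg_complex: "cstar_alg complex_alg"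
proof -
  interpret cstar_pre complex_alg by (rule cstar_pre_complex)
  show ?thesis
  proof
    fix x assume "x \<in> carrier (cauchy_seqs complex_alg)"
    then have "Cauchy x" by (intro CauchyI) (auto simp: cauchy_seqs_def minus_complex_alg complex_alg_simps)
    then show "\<exists>l\<in>carrier complex_alg. converges complex_alg x l"
      by (auto simp: Cauchy_convergent_iff convergent_def converges_complex_alg complex_alg_simps)
  qed (simp add: complex_alg_simps)
qed

text \<open>There is one character, the identity of the complex numbers. The Hilbert space of an
  inverse monoid and the Hilbert module of a bundle thus share their operators and completeness
  proofs.\<close>

lemma section_module_complex:
  "section_module complex_alg I (\<lambda>_. UNIV) (UNIV :: unit set) (\<lambda>_ _ b. b) (\<lambda>_ d. d) UNIV"
  by (intro section_module.intro section_module_axioms.intro cstar_alg_complex) (auto simp: complex_alg_simps)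

lemma L2_set_sum_le:
  "L2_set (\<lambda>r. cmod (\<Sum>p\<in>G. v p r)) F \<le> (\<Sum>p\<in>G. L2_set (\<lambda>r. cmod (v p r)) F)"
proof (induction G rule: infinite_finite_induct)
  case (insert q G)
  have "L2_set (\<lambda>r. cmod (\<Sum>p\<in>insert q G. v p r)) F \<le> L2_set (\<lambda>r. cmod (v q r) + cmod (\<Sum>p\<in>G. v p r)) F"
    using insert by (intro L2_set_mono) (auto intro: norm_triangle_ineq)
  also have "\<dots> \<le> L2_set (\<lambda>r. cmod (v q r)) F + L2_set (\<lambda>r. cmod (\<Sum>p\<in>G. v p r)) F"
    by (rule L2_set_triangle_ineq)
  finally show ?case using insert by simp
qed (auto simp: L2_set_def)

section \<open>The left regular representation on square-summable functions\<close>

context inverse_monoid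
begin

sublocale H: section_module complex_alg "carrier P" "\<lambda>_. UNIV" "UNIV :: unit set" "\<lambda>_ _ b. b" "\<lambda>_ d. d" UNIV
  by (rule section_module_complex)

lemma hilb_E: "hilb P = H.E"
  by (simp add: hilb_def)

lemma B_hilb_Ops: "B_hilb P = H.Ops"
  by (simp add: B_hilb_def)

lemma H_L: "H.L u x F = L2_set (\<lambda>r. cmod (u r)) F"
  by (simp add: H.L_def)

lemma hilb_outside: "u \<in> H.E ==> r \<notin> carrier P ==> u r = 0"
  using H.E_sect by (auto simp: H.sect_def complex_alg_simps)

lemma hilb_L2_le: "u \<in> H.E ==> finite F ==> F \<subseteq> carrier P ==> L2_set (\<lambda>r. cmod (u r)) F \<le> H.N u"
  using H.L_le_N[of u F "()"] by (simp add: H_L)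

text \<open>The finite sums of squares have a supremum, and outside a finite set that nearly attains
  it only little mass is left; this is the tail condition for a single character.\<close>

lemma hilb_bounded:
  assumes out: "!!r. r \<notin> carrier P ==> u r = 0" and K: "0 \<le> K"
    and le: "!!F. finite F ==> F \<subseteq> carrier P ==> L2_set (\<lambda>r. cmod (u r)) F \<le> K"
  shows "u \<in> H.E" "H.N u \<le> K"
proof -
  let ?q = "\<lambda>F. \<Sum>r\<in>F. (cmod (u r))\<^sup>2"
  let ?S = "{?q F |F. finite F \<and> F \<subseteq> carrier P}"
  have bdd: "bdd_above ?S"
  proof (rule bdd_aboveI)
    fix y assume "y \<in> ?S"
    then obtain F where F: "y = ?q F" "finite F" "F \<subseteq> carrier P" by blast
    have "sqrt (?q F) \<le> K" using le[OF F(2,3)] by (simp add: L2_set_def)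
    then show "y \<le> K\<^sup>2" using F(1) sqrt_le_D by blast
  qed
  have ne: "?S \<noteq> {}" by blast
  have "H.tail u" unfolding H.tail_def
  proof (intro allI impI)
    fix e :: real assume "e > 0"
    then have "Sup ?S - e\<^sup>2 < Sup ?S" by simp
    then obtain F0 where F0: "finite F0" "F0 \<subseteq> carrier P" "Sup ?S - e\<^sup>2 < ?q F0"
      using less_cSup_iff[OF ne bdd] by blast
    have "H.L u x F \<le> e" if F: "finite F" "F \<subseteq> carrier P - F0" for F x
    proof -
      have "?q (F \<union> F0) = ?q F + ?q F0" using F F0 by (intro sum.union_disjoint) auto
      moreover have "?q (F \<union> F0) \<le> Sup ?S" using F F0 by (intro cSup_upper[OF _ bdd]) blast
      ultimately have "?q F \<le> e\<^sup>2" using F0(3) by simp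
      then show ?thesis unfolding H_L L2_set_def using \<open>e > 0\<close> by (intro real_le_lsqrt) (auto simp: sum_nonneg)
    qed
    then show "\<exists>F0. finite F0 \<and> F0 \<subseteq> carrier P \<and> (\<forall>F. finite F --> F \<subseteq> carrier P - F0 --> (\<forall>x\<in>UNIV. H.L u x F \<le> e))"
      using F0(1,2) by blast
  qed
  moreover have "H.sect u" using out by (auto simp: H.sect_def complex_alg_simps)
  ultimately show E: "u \<in> H.E" by (simp add: H.ell2_iff)
  show "H.N u \<le> K" by (rule H.N_leI[OF E K]) (use le in \<open>simp add: H_L\<close>)
qed

lemma hilb_nrm_le: "u \<in> H.E ==> cmod (u r) \<le> H.N u"
  using H.nrm_le_N[of u r] by (simp add: complex_alg_simps)

lemma has_sum_hilb_ip:
  assumes "u \<in> H.E" "v \<in> H.E" shows "((\<lambda>r. cnj (u r) * v r) has_sum H.ip u v) (carrier P)"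
  using H.has_sum_ip[OF assms]
  by (simp add: has_sum_in_def complex_alg_simps minus_complex_alg finsum_complex_alg has_sum_def tendsto_norm_zero_iff LIM_zero_iff)

lemma hilb_abs_summable:
  assumes "u \<in> H.E" "v \<in> H.E"
  shows "(\<lambda>r. cmod (u r) * cmod (v r)) summable_on carrier P"
    "(\<Sum>\<^sub>\<infinity>r\<in>carrier P. cmod (u r) * cmod (v r)) \<le> H.N u * H.N v"
proof -
  have le: "(\<Sum>r\<in>F. cmod (u r) * cmod (v r)) \<le> H.N u * H.N v" if F: "finite F" "F \<subseteq> carrier P" for F
  proof -
    have "(\<Sum>r\<in>F. cmod (u r) * cmod (v r)) \<le> L2_set (\<lambda>r. cmod (u r)) F * L2_set (\<lambda>r. cmod (v r)) F"
      using L2_set_mult_ineq[of "\<lambda>r. cmod (u r)" "\<lambda>r. cmod (v r)" F] by simp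
    also have "\<dots> \<le> H.N u * H.N v"
      using hilb_L2_le[OF assms(1) F] hilb_L2_le[OF assms(2) F] assms by (intro mult_mono) (auto simp: L2_set_nonneg)
    finally show ?thesis .
  qed
  show s: "(\<lambda>r. cmod (u r) * cmod (v r)) summable_on carrier P"
    by (rule nonneg_bounded_partial_sums_imp_summable_on[of _ _ "H.N u * H.N v"])
      (use le in \<open>auto intro!: eventually_finite_subsets_at_top_weakI\<close>)
  show "(\<Sum>\<^sub>\<infinity>r\<in>carrier P. cmod (u r) * cmod (v r)) \<le> H.N u * H.N v"
    by (rule infsum_le_finite_sums[OF s]) (use le in auto)
qed

lemma Lam_apply:
  assumes "p \<in> carrier P" "u \<in> H.E"
  shows "Lam P p u r = (if r \<in> carrier P \<and> p \<otimes> (sinv P p \<otimes> r) = r then u (sinv P p \<otimes> r) else 0)"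
proof -
  have "{q \<in> carrier P. sinv P p \<otimes> p \<otimes> q = q \<and> p \<otimes> q = r}
    = (if r \<in> carrier P \<and> p \<otimes> (sinv P p \<otimes> r) = r then {sinv P p \<otimes> r} else {})"
  proof -
    have "q = sinv P p \<otimes> r \<and> r \<in> carrier P \<and> p \<otimes> (sinv P p \<otimes> r) = r"
      if "q \<in> carrier P" "sinv P p \<otimes> p \<otimes> q = q" "p \<otimes> q = r" for q
      using that assms(1) by (metis m_assoc m_closed sinv_closed)
    moreover have "sinv P p \<otimes> p \<otimes> (sinv P p \<otimes> r) = sinv P p \<otimes> r"
      if "r \<in> carrier P" "p \<otimes> (sinv P p \<otimes> r) = r"
      using that assms(1) by (simp add: m_assoc)
    ultimately show ?thesis using assms(1) by auto
  qed
  then show ?thesis using assms by (simp add: Lam_def hilb_E)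
qed

text \<open>\<open>Lam P p\<close> only relabels coordinates: where
  \<open>p \<otimes> (sinv P p \<otimes> r) = r\<close>, the map from \<open>r\<close> to
  \<open>sinv P p \<otimes> r\<close> is injective, so the sum of squares becomes one over its
  image.\<close>

lemma Lam_L2_le:
  assumes p: "p \<in> carrier P" and u: "u \<in> H.E" and F: "finite F" "F \<subseteq> carrier P"
  shows "L2_set (\<lambda>r. cmod (Lam P p u r)) F \<le> H.N u"
proof -
  let ?F = "{r \<in> F. p \<otimes> (sinv P p \<otimes> r) = r}"
  let ?G = "(\<lambda>r. sinv P p \<otimes> r) ` ?F"
  have inj: "inj_on (\<lambda>r. sinv P p \<otimes> r) ?F" by (rule inj_onI) (metis (mono_tags, lifting) mem_Collect_eq)
  have "(\<Sum>r\<in>F. (cmod (Lam P p u r))\<^sup>2) = (\<Sum>r\<in>?F. (cmod (u (sinv P p \<otimes> r)))\<^sup>2)"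
    by (rule sum.mono_neutral_cong_right) (use F p u in \<open>auto simp: Lam_apply subset_iff\<close>)
  also have "\<dots> = (\<Sum>s\<in>?G. (cmod (u s))\<^sup>2)"
    by (simp add: sum.reindex[OF inj])
  finally have "L2_set (\<lambda>r. cmod (Lam P p u r)) F = L2_set (\<lambda>s. cmod (u s)) ?G"
    by (simp add: L2_set_def)
  also have "\<dots> \<le> H.N u" by (rule hilb_L2_le[OF u]) (use F p in auto)
  finally show ?thesis .
qed

lemma
  assumes "p \<in> carrier P" "u \<in> H.E"
  shows Lam_E: "Lam P p u \<in> H.E" and Lam_N: "H.N (Lam P p u) \<le> H.N u"
  using hilb_bounded[of "Lam P p u" "H.N u"] Lam_L2_le[OF assms] assms by (auto simp: Lam_apply)

text \<open>The point is that \<open>r\<close> is in the range of \<open>p \<otimes> q\<close> iff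
  it is in the range of \<open>p\<close> and \<open>sinv P p \<otimes> r\<close> is in the range of
  \<open>q\<close>.\<close>

lemma Lam_mult:
  assumes p: "p \<in> carrier P" and q: "q \<in> carrier P" and u: "u \<in> H.E"
  shows "Lam P (p \<otimes> q) u = Lam P p (Lam P q u)"
proof
  fix r
  let ?p = "sinv P p" and ?q = "sinv P q"
  have "p \<otimes> (q \<otimes> (?q \<otimes> (?p \<otimes> r))) = r \<longleftrightarrow> p \<otimes> (?p \<otimes> r) = r \<and> q \<otimes> (?q \<otimes> (?p \<otimes> r)) = ?p \<otimes> r" if r: "r \<in> carrier P"
  proof
    assume e: "p \<otimes> (q \<otimes> (?q \<otimes> (?p \<otimes> r))) = r"
    have "p \<otimes> (?p \<otimes> r) = (p \<otimes> (?p \<otimes> p)) \<otimes> (q \<otimes> (?q \<otimes> (?p \<otimes> r)))"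
      using p q r by (subst e[symmetric]) (simp add: m_assoc)
    also have "\<dots> = r" using p q r e by (simp add: sinv_regular)
    finally have 1: "p \<otimes> (?p \<otimes> r) = r" .
    \<comment> \<open>The source projection of \<open>p\<close> and the range projection of
      \<open>q\<close> are inserted and then exchanged; next to \<open>?p \<otimes> r\<close> the
      former is absorbed.\<close>
    have "?p \<otimes> r = ((?p \<otimes> sinv P ?p) \<otimes> (q \<otimes> ?q)) \<otimes> (?p \<otimes> r)"
      using p q r by (subst e[symmetric]) (simp add: m_assoc)
    also have "\<dots> = ((q \<otimes> ?q) \<otimes> (?p \<otimes> sinv P ?p)) \<otimes> (?p \<otimes> r)"
      using p q by (subst ranges_commute) auto
    also have "\<dots> = q \<otimes> (?q \<otimes> ((?p \<otimes> (sinv P ?p \<otimes> ?p)) \<otimes> r))"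
      using p q r by (simp add: m_assoc)
    also have "\<dots> = q \<otimes> (?q \<otimes> (?p \<otimes> r))" using sinv_regular[of ?p] p by simp
    finally show "p \<otimes> (?p \<otimes> r) = r \<and> q \<otimes> (?q \<otimes> (?p \<otimes> r)) = ?p \<otimes> r" using 1 by simp
  qed simp
  then show "Lam P (p \<otimes> q) u r = Lam P p (Lam P q u) r"
    using p q u by (cases "r \<in> carrier P") (simp_all add: Lam_apply Lam_E sinv_mult m_assoc)
qed

text \<open>The map from \<open>r\<close> to \<open>sinv P p \<otimes> r\<close> is a bijection from
  the range set of \<open>p\<close> to its source set, with inverse multiplication by
  \<open>p\<close>; the inner product is reindexed along it.\<close>

lemma Lam_adjoint:
  assumes p: "p \<in> carrier P" and u: "u \<in> H.E" and v: "v \<in> H.E"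
  shows "H.ip (Lam P p u) v = H.ip u (Lam P (sinv P p) v)"
proof -
  let ?p = "sinv P p"
  let ?R = "{r \<in> carrier P. p \<otimes> (?p \<otimes> r) = r}" and ?S = "{s \<in> carrier P. ?p \<otimes> (p \<otimes> s) = s}"
  have "H.ip (Lam P p u) v = (\<Sum>\<^sub>\<infinity>r\<in>carrier P. cnj (Lam P p u r) * v r)"
    using has_sum_hilb_ip[OF Lam_E[OF p u] v] by (simp add: infsumI)
  also have "\<dots> = (\<Sum>\<^sub>\<infinity>r\<in>?R. cnj (u (?p \<otimes> r)) * v (p \<otimes> (?p \<otimes> r)))"
    by (rule infsum_cong_neutral) (use p u in \<open>auto simp: Lam_apply\<close>)
  also have "\<dots> = (\<Sum>\<^sub>\<infinity>s\<in>?S. cnj (u s) * v (p \<otimes> s))"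
  proof (rule infsum_reindex_bij_betw)
    show "bij_betw (\<lambda>r. ?p \<otimes> r) ?R ?S"
      by (rule bij_betwI[of _ _ _ "\<lambda>s. p \<otimes> s"]) (use p in auto)
  qed
  also have "\<dots> = (\<Sum>\<^sub>\<infinity>s\<in>carrier P. cnj (u s) * Lam P ?p v s)"
    by (rule infsum_cong_neutral) (use p v in \<open>auto simp: Lam_apply\<close>)
  also have "\<dots> = H.ip u (Lam P ?p v)"
    using has_sum_hilb_ip[OF u Lam_E[OF _ v], of ?p] p by (simp add: infsumI)
  finally show ?thesis .
qed

text \<open>The integrated form of the regular representation, not yet restricted to the Hilbert
  space. As a pairing it makes \<open>pair_mult\<close> available for products.\<close>

definition Lraw :: "('p => complex) => ('p => complex) => ('p => complex)" where
  "Lraw f u = (\<lambda>r. pair f (\<lambda>p. Lam P p u r))"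

lemma Lam_ell1_restrict: "Lam_ell1 P f = restrict (Lraw f) H.E"
  by (simp add: Lam_ell1_def Lraw_def pair_def hilb_E fun_eq_iff restrict_def)

lemma cmod_Lam_le: "p \<in> carrier P ==> u \<in> H.E ==> cmod (Lam P p u r) \<le> H.N u"
  using hilb_nrm_le[OF Lam_E] Lam_N order_trans by blast

lemma bdd_Lam: "u \<in> H.E ==> bdd (\<lambda>p. Lam P p u r)"
  by (rule bddI[of _ "H.N u"]) (rule cmod_Lam_le)

text \<open>For finite \<open>F\<close> and a finite part \<open>G\<close> of the sum over
  \<open>p\<close> the bound is Minkowski's inequality; it survives the limit over \<open>G\<close>,
  and \<open>hilb_bounded\<close> then treats all \<open>F\<close> together.\<close>

lemma Lraw_bounded:
  assumes f: "f \<in> carrier M" and u: "u \<in> H.E"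
  shows "Lraw f u \<in> H.E" "H.N (Lraw f u) \<le> nrm M f * H.N u"
proof -
  have le: "L2_set (\<lambda>r. cmod (Lraw f u r)) F \<le> nrm M f * H.N u" if F: "finite F" "F \<subseteq> carrier P" for F
  proof (rule tendsto_le[OF finite_subsets_at_top_neq_bot tendsto_const])
    have "((\<lambda>G. \<Sum>p\<in>G. f p * Lam P p u r) \<longlongrightarrow> Lraw f u r) (finite_subsets_at_top (carrier P))" for r
      using has_sum_infsum[OF ell1_summable[OF f bdd_Lam[OF u]]] by (simp add: has_sum_def Lraw_def pair_def)
    then show "((\<lambda>G. L2_set (\<lambda>r. cmod (\<Sum>p\<in>G. f p * Lam P p u r)) F) \<longlongrightarrow> L2_set (\<lambda>r. cmod (Lraw f u r)) F)
      (finite_subsets_at_top (carrier P))"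
      unfolding L2_set_def by (intro tendsto_intros)
    have "L2_set (\<lambda>r. cmod (\<Sum>p\<in>G. f p * Lam P p u r)) F \<le> nrm M f * H.N u" if G: "finite G" "G \<subseteq> carrier P" for G
    proof -
      have "L2_set (\<lambda>r. cmod (\<Sum>p\<in>G. f p * Lam P p u r)) F \<le> (\<Sum>p\<in>G. L2_set (\<lambda>r. cmod (f p * Lam P p u r)) F)"
        by (rule L2_set_sum_le)
      also have "\<dots> = (\<Sum>p\<in>G. cmod (f p) * L2_set (\<lambda>r. cmod (Lam P p u r)) F)"
        by (simp add: norm_mult L2_set_right_distrib)
      also have "\<dots> \<le> (\<Sum>p\<in>G. cmod (f p) * H.N u)"
        using Lam_L2_le[OF _ u F] G by (intro sum_mono mult_left_mono) auto
      also have "\<dots> = (\<Sum>p\<in>G. cmod (f p)) * H.N u" by (simp add: sum_distrib_right)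
      also have "\<dots> \<le> nrm M f * H.N u"
        using f G u by (intro mult_right_mono) (auto simp: ell1_simps ell1_carrier intro: finite_sum_le_infsum)
      finally show ?thesis .
    qed
    then show "\<forall>\<^sub>F G in finite_subsets_at_top (carrier P). L2_set (\<lambda>r. cmod (\<Sum>p\<in>G. f p * Lam P p u r)) F \<le> nrm M f * H.N u"
      by (intro eventually_finite_subsets_at_top_weakI)
  qed
  have out: "Lraw f u r = 0" if "r \<notin> carrier P" for r
  proof -
    have "Lraw f u r = pair f (\<lambda>p. 0)" unfolding Lraw_def by (rule pair_cong) (use that u in \<open>simp add: Lam_apply\<close>)
    then show ?thesis by (simp add: pair_def)
  qed
  show "Lraw f u \<in> H.E" "H.N (Lraw f u) \<le> nrm M f * H.N u"
    using hilb_bounded[OF out _ le] u nrm_ell1_nonneg[of f] by auto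
qed

text \<open>Exchanges the sum over \<open>p\<close> with the sum over coordinates; for each
  \<open>p\<close> the inner sum of moduli is at most \<open>cmod (f p) * (H.N u * H.N v)\<close>,
  which is summable.\<close>

lemma ip_Lraw:
  assumes f: "f \<in> carrier M" and u: "u \<in> H.E" and v: "v \<in> H.E"
  shows "H.ip (Lraw f u) v = (\<Sum>\<^sub>\<infinity>p\<in>carrier P. cnj (f p) * H.ip (Lam P p u) v)"
proof -
  let ?C = "carrier P"
  have in1: "(\<lambda>r. cmod (cnj (f p) * (cnj (Lam P p u r) * v r))) summable_on ?C" if "p \<in> ?C" for p
    using hilb_abs_summable(1)[OF Lam_E[OF that u] v] by (simp add: norm_mult summable_on_cmult_right)
  have in2: "(\<Sum>\<^sub>\<infinity>r\<in>?C. cmod (cnj (f p) * (cnj (Lam P p u r) * v r))) \<le> cmod (f p) * (H.N u * H.N v)" if "p \<in> ?C" for p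
  proof -
    have "(\<Sum>\<^sub>\<infinity>r\<in>?C. cmod (Lam P p u r) * cmod (v r)) \<le> H.N u * H.N v"
      using hilb_abs_summable(2)[OF Lam_E[OF that u] v] mult_right_mono[OF Lam_N[OF that u], of "H.N v"] v by simp
    from mult_left_mono[OF this, of "cmod (f p)"] show ?thesis by (simp add: norm_mult infsum_cmult_right')
  qed
  have "(\<lambda>z. case z of (p, r) => cnj (f p) * (cnj (Lam P p u r) * v r)) abs_summable_on ?C \<times> ?C"
    unfolding abs_summable_on_Sigma_iff
  proof (intro conjI ballI)
    show "(\<lambda>p. \<Sum>\<^sub>\<infinity>r\<in>?C. norm (case (p, r) of (p, r) => cnj (f p) * (cnj (Lam P p u r) * v r))) abs_summable_on ?C"
    proof (rule abs_summable_on_comparison_test')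
      show "(\<lambda>p. cmod (f p) * (H.N u * H.N v)) summable_on ?C"
        using f by (intro summable_on_cmult_left) (simp add: ell1_carrier)
      show "norm (\<Sum>\<^sub>\<infinity>r\<in>?C. norm (case (p, r) of (p, r) => cnj (f p) * (cnj (Lam P p u r) * v r))) \<le> cmod (f p) * (H.N u * H.N v)"
        if "p \<in> ?C" for p
        using in2[OF that] by (simp add: infsum_nonneg)
    qed
  qed (use in1 in simp)
  note swap = infsum_swap_banach[OF abs_summable_summable[OF this]]
  have "H.ip (Lraw f u) v = (\<Sum>\<^sub>\<infinity>r\<in>?C. cnj (Lraw f u r) * v r)"
    using has_sum_hilb_ip[OF Lraw_bounded(1)[OF f u] v] by (simp add: infsumI)
  also have "\<dots> = (\<Sum>\<^sub>\<infinity>r\<in>?C. \<Sum>\<^sub>\<infinity>p\<in>?C. cnj (f p) * (cnj (Lam P p u r) * v r))"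
    unfolding Lraw_def pair_cnj by (simp add: pair_def mult.assoc flip: infsum_cmult_left')
  also have "\<dots> = (\<Sum>\<^sub>\<infinity>p\<in>?C. \<Sum>\<^sub>\<infinity>r\<in>?C. cnj (f p) * (cnj (Lam P p u r) * v r))"
    by (rule swap[symmetric])
  also have "\<dots> = (\<Sum>\<^sub>\<infinity>p\<in>?C. cnj (f p) * H.ip (Lam P p u) v)"
  proof (rule infsum_cong)
    fix p assume p: "p \<in> ?C"
    show "(\<Sum>\<^sub>\<infinity>r\<in>?C. cnj (f p) * (cnj (Lam P p u r) * v r)) = cnj (f p) * H.ip (Lam P p u) v"
      using has_sum_hilb_ip[OF Lam_E[OF p u] v] by (simp add: infsum_cmult_right' infsumI)
  qed
  finally show ?thesis .
qed

lemma Lraw_adjoint: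
  assumes f: "f \<in> carrier M" and u: "u \<in> H.E" and v: "v \<in> H.E"
  shows "H.ip (Lraw f u) v = H.ip u (Lraw (star M f) v)"
proof -
  have cnj_ip: "cnj (H.ip \<zeta> \<chi>) = H.ip \<chi> \<zeta>" if "\<zeta> \<in> H.E" "\<chi> \<in> H.E" for \<zeta> \<chi>
    using H.ip_star[OF that] by (simp add: complex_alg_simps)
  note sf = ell1_star_closed[OF f]
  have "H.ip u (Lraw (star M f) v) = cnj (H.ip (Lraw (star M f) v) u)"
    using cnj_ip[OF Lraw_bounded(1)[OF sf v] u] by simp
  also have "\<dots> = (\<Sum>\<^sub>\<infinity>p\<in>carrier P. cnj (cnj (star M f p) * H.ip (Lam P p v) u))"
    unfolding ip_Lraw[OF sf v u] by (rule infsum_cnj[symmetric])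
  also have "\<dots> = (\<Sum>\<^sub>\<infinity>p\<in>carrier P. cnj (f (sinv P p)) * H.ip (Lam P (sinv P p) u) v)"
  proof (rule infsum_cong)
    fix p assume p: "p \<in> carrier P"
    show "cnj (cnj (star M f p) * H.ip (Lam P p v) u) = cnj (f (sinv P p)) * H.ip (Lam P (sinv P p) u) v"
      using Lam_adjoint[of "sinv P p" u v] cnj_ip[OF Lam_E[OF p v] u] p u v by (simp add: ell1_simps)
  qed
  also have "\<dots> = (\<Sum>\<^sub>\<infinity>p\<in>carrier P. cnj (f p) * H.ip (Lam P p u) v)"
    by (rule infsum_reindex_bij_betw[OF sinv_bij])
  also have "\<dots> = H.ip (Lraw f u) v" by (rule ip_Lraw[OF f u v, symmetric])
  finally show ?thesis by simp
qed

lemma Lraw_mult: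
  assumes f: "f \<in> carrier M" and h: "h \<in> carrier M" and u: "u \<in> H.E"
  shows "Lraw (f \<otimes>\<^bsub>M\<^esub> h) u = Lraw f (Lraw h u)"
proof
  fix r
  note hE = Lraw_bounded(1)[OF h u]
  have "Lraw (f \<otimes>\<^bsub>M\<^esub> h) u r = pair f (\<lambda>p. pair h (\<lambda>q. Lam P (p \<otimes> q) u r))"
    unfolding Lraw_def by (rule pair_mult[OF f h bdd_Lam[OF u]])
  also have "\<dots> = pair f (\<lambda>p. Lam P p (Lraw h u) r)"
  proof (rule pair_cong)
    fix p assume p: "p \<in> carrier P"
    have "pair h (\<lambda>q. Lam P (p \<otimes> q) u r) = pair h (\<lambda>q. Lam P p (Lam P q u) r)"
      by (rule pair_cong) (simp add: Lam_mult p u)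
    also have "\<dots> = pair h (\<lambda>q. if r \<in> carrier P \<and> p \<otimes> (sinv P p \<otimes> r) = r then Lam P q u (sinv P p \<otimes> r) else 0)"
      by (rule pair_cong) (simp add: Lam_apply[OF p] Lam_E u)
    also have "\<dots> = Lam P p (Lraw h u) r"
      unfolding Lam_apply[OF p hE] by (cases "r \<in> carrier P \<and> p \<otimes> (sinv P p \<otimes> r) = r") (auto simp: Lraw_def pair_def)
    finally show "pair h (\<lambda>q. Lam P (p \<otimes> q) u r) = Lam P p (Lraw h u) r" .
  qed
  finally show "Lraw (f \<otimes>\<^bsub>M\<^esub> h) u r = Lraw f (Lraw h u) r" by (simp add: Lraw_def)
qed

lemma Lraw_pair: "f \<in> carrier M ==> H.adjoint_pair (Lraw f) (Lraw (star M f)) (nrm M f)"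
  unfolding H.adjoint_pair_def using Lraw_bounded Lraw_adjoint ell1_star_closed nrm_ell1_nonneg by auto

lemma Lam_ell1_hom: "star_hom M (B_hilb P) (Lam_ell1 P)"
  unfolding B_hilb_Ops
proof (rule star_homI)
  fix f h c assume f: "f \<in> carrier M"
  show "Lam_ell1 P f \<in> carrier H.Ops" "Lam_ell1 P (star M f) = star H.Ops (Lam_ell1 P f)"
    using H.op_mem[OF Lraw_pair[OF f]] by (simp_all add: Lam_ell1_restrict)
  have "Lraw (c \<odot>\<^bsub>M\<^esub> f) u = (\<lambda>r. c * Lraw f u r)" for u by (simp add: Lraw_def pair_smult)
  then show "Lam_ell1 P (c \<odot>\<^bsub>M\<^esub> f) = c \<odot>\<^bsub>H.Ops\<^esub> Lam_ell1 P f"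
    by (simp add: Lam_ell1_restrict H.Ops_simps complex_alg_simps cong: restrict_cong)
  assume h: "h \<in> carrier M"
  have "Lraw (f \<oplus>\<^bsub>M\<^esub> h) u = (\<lambda>r. Lraw f u r + Lraw h u r)" if "u \<in> H.E" for u
    using f h that by (simp add: Lraw_def pair_add bdd_Lam)
  then show "Lam_ell1 P (f \<oplus>\<^bsub>M\<^esub> h) = Lam_ell1 P f \<oplus>\<^bsub>H.Ops\<^esub> Lam_ell1 P h"
    by (simp add: Lam_ell1_restrict H.Ops_simps complex_alg_simps cong: restrict_cong)
  show "Lam_ell1 P (f \<otimes>\<^bsub>M\<^esub> h) = Lam_ell1 P f \<otimes>\<^bsub>H.Ops\<^esub> Lam_ell1 P h"
    by (simp add: Lam_ell1_restrict H.Ops_simps Lraw_mult f h Lraw_bounded cong: restrict_cong)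
next
  have "Lraw (delta \<one>) u r = u r" if "u \<in> H.E" for u r
    using that hilb_outside[OF that, of r] by (simp add: Lraw_def pair_delta Lam_apply)
  then have "Lraw (delta \<one>) u = u" if "u \<in> H.E" for u using that by blast
  then show "Lam_ell1 P \<one>\<^bsub>M\<^esub> = \<one>\<^bsub>H.Ops\<^esub>"
    by (simp add: Lam_ell1_restrict H.Ops_simps ell1_simps(1) cong: restrict_cong)
qed

lemma nrm_Lam_ell1: "f \<in> carrier M ==> nrm (B_hilb P) (Lam_ell1 P f) \<le> nrm M f"
  unfolding B_hilb_Ops
  by (rule H.Ops_norm_le) (auto simp: Lam_ell1_restrict nrm_ell1_nonneg Lraw_bounded)

lemma Lam_ell1_delta: "p \<in> carrier P ==> Lam_ell1 P (delta p) = Lam P p"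
  by (auto simp: Lam_ell1_restrict Lraw_def pair_delta Lam_def hilb_E fun_eq_iff)

lemma cstar_alg_B_hilb: "cstar_alg (B_hilb P)"
  unfolding B_hilb_Ops by (rule H.cstar_alg_Ops)

lemma Lam_closed: "p \<in> carrier P ==> Lam P p \<in> carrier (B_hilb P)"
  using star_homD(1)[OF Lam_ell1_hom ell1_delta] by (simp add: Lam_ell1_delta)

lemma Lam_ops:
  "p \<in> carrier P ==> q \<in> carrier P ==> Lam P p \<otimes>\<^bsub>B_hilb P\<^esub> Lam P q = Lam P (p \<otimes> q)"
  "p \<in> carrier P ==> star (B_hilb P) (Lam P p) = Lam P (sinv P p)"
  "\<one>\<^bsub>B_hilb P\<^esub> = Lam P \<one>"
  using star_homD(2)[OF Lam_ell1_hom, of "delta p" "delta q"] star_homD(6)[OF Lam_ell1_hom, of "delta p"]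
    star_homD(4)[OF Lam_ell1_hom]
  by (simp_all add: ell1_delta delta_mult delta_star Lam_ell1_delta ell1_simps(1))

lemma cstar_r_closure:
  defines "Y \<equiv> closed_span (B_hilb P) (Lam P ` carrier P)"
  shows "cstar_alg (cstar_r P)" "carrier (cstar_r P) = Y"
    "T \<in> Y ==> U \<in> Y ==> T \<ominus>\<^bsub>cstar_r P\<^esub> U = T \<ominus>\<^bsub>B_hilb P\<^esub> U"
proof -
  interpret B: cstar_alg "B_hilb P" by (rule cstar_alg_B_hilb)
  have X: "Lam P ` carrier P \<subseteq> carrier (B_hilb P)" "\<one>\<^bsub>B_hilb P\<^esub> \<in> Lam P ` carrier P"
    "!!T U. T \<in> Lam P ` carrier P ==> U \<in> Lam P ` carrier P ==> T \<otimes>\<^bsub>B_hilb P\<^esub> U \<in> Lam P ` carrier P"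
    "!!T. T \<in> Lam P ` carrier P ==> star (B_hilb P) T \<in> Lam P ` carrier P"
    using Lam_closed by (auto simp: Lam_ops)
  show "cstar_alg (cstar_r P)" "T \<in> Y ==> U \<in> Y ==> T \<ominus>\<^bsub>cstar_r P\<^esub> U = T \<ominus>\<^bsub>B_hilb P\<^esub> U"
    using B.closed_subalgebra[OF X] by (simp_all add: cstar_r_def Y_def)
  show "carrier (cstar_r P) = Y" by (simp add: cstar_r_def Y_def)
qed

end

section \<open>The left inverse hull and its C*-algebras\<close>

context one_dim_ideal
begin

text \<open>Any representative serves, since \<open>w\<close> removes the ideal. The lift is
  isometric, linear, multiplicative and compatible with adjoints, but sends the unit to
  \<open>w\<close>.\<close>

definition lift where "lift Y = w \<otimes> (SOME x. x \<in> Y)"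

lemma lift_coset: "x \<in> carrier A ==> lift (ideal +> x) = w \<otimes> x"
proof -
  assume x: "x \<in> carrier A"
  have "(SOME y. y \<in> ideal +> x) \<in> ideal +> x" using q.coset_self[OF x] by (rule someI)
  note m = q.coset_mem[OF this x]
  have "nrm A (w \<otimes> (SOME y. y \<in> ideal +> x) \<ominus> w \<otimes> x) = 0"
    using m(2) q.coset_eq_iff[OF m(1) x] m(1) x by (simp add: r_minus_distr)
  then show ?thesis unfolding lift_def by (rule eqI[rotated 2]) (use m(1) x in auto)
qed

lemma
  assumes "X \<in> carrier (quot A ideal)"
  shows lift_closed: "lift X \<in> carrier A"
    and nrm_lift: "nrm A (lift X) = nrm (quot A ideal) X"
    and lift_smult: "lift (c \<odot>\<^bsub>quot A ideal\<^esub> X) = c \<odot> lift X"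
    and lift_star: "lift (star (quot A ideal) X) = star A (lift X)"
    and lift_add: "Y \<in> carrier (quot A ideal) ==> lift (X \<oplus>\<^bsub>quot A ideal\<^esub> Y) = lift X \<oplus> lift Y"
    and lift_mult: "Y \<in> carrier (quot A ideal) ==> lift (X \<otimes>\<^bsub>quot A ideal\<^esub> Y) = lift X \<otimes> lift Y"
proof -
  obtain x where x: "x \<in> carrier A" "X = ideal +> x" using assms by (auto simp: q.carrier_quot)
  note h = star_homD[OF q.star_hom_coset]
  show "lift X \<in> carrier A" "nrm A (lift X) = nrm (quot A ideal) X"
    using x by (simp_all add: lift_coset q.nrm_quot)
  show "lift (c \<odot>\<^bsub>quot A ideal\<^esub> X) = c \<odot> lift X"
    using x by (simp add: h(5)[symmetric] lift_coset mult_smult_r)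
  show "lift (star (quot A ideal) X) = star A (lift X)"
    using x by (simp add: h(6)[symmetric] lift_coset star_mult w_central)
  assume "Y \<in> carrier (quot A ideal)"
  then obtain y where y: "y \<in> carrier A" "Y = ideal +> y" by (auto simp: q.carrier_quot)
  show "lift (X \<oplus>\<^bsub>quot A ideal\<^esub> Y) = lift X \<oplus> lift Y"
    using x y by (simp add: h(3)[symmetric] lift_coset r_distr)
  have "(w \<otimes> x) \<otimes> (w \<otimes> y) = (x \<otimes> w) \<otimes> (w \<otimes> y)" using w_central[OF x(1)] by simp
  also have "\<dots> = x \<otimes> ((w \<otimes> w) \<otimes> y)" using x y by (simp add: m_assoc del: w(3))
  also have "\<dots> = (x \<otimes> w) \<otimes> y" using x y by (simp add: m_assoc)
  also have "\<dots> = (w \<otimes> x) \<otimes> y" using w_central[OF x(1)] by simp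
  also have "\<dots> = w \<otimes> (x \<otimes> y)" using x y by (simp add: m_assoc)
  finally show "lift (X \<otimes>\<^bsub>quot A ideal\<^esub> Y) = lift X \<otimes> lift Y"
    using x y by (simp add: h(2)[symmetric] lift_coset)
qed

lemma contraction_coset: "contraction A (quot A ideal) (\<lambda>x. ideal +> x)"
  by (intro contraction.intro contraction_axioms.intro cstar_pre_axioms cstar_alg_quot q.star_hom_coset)
    (simp add: q.nrm_quot nrm_w_mult)

end

text \<open>\<open>h\<close> maps \<open>z\<close> to \<open>z'\<close>, hence one corner into the
  other, and so descends to the quotients without increasing the norm. \<open>hq\<close> is given
  the shape of \<open>Lambda0\<close>.\<close>

locale quot_contraction = a: one_dim_ideal A z + c: one_dim_ideal C z' + h: contraction A C h
  for A :: "'a star_algebra" and C :: "'b star_algebra" and z z' h +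
  assumes h_z: "h z = z'"
begin

definition hq where "hq X = (\<Union>x\<in>X. c.ideal +>\<^bsub>C\<^esub> h x)"

lemma h_w: "h a.w = c.w"
  using h.hom_minus[of "\<one>\<^bsub>A\<^esub>" z] star_homD(4)[OF h.hom] by (simp add: a.w_def c.w_def h_z)

lemma hq_coset:
  assumes x: "x \<in> carrier A" shows "hq (a.ideal +>\<^bsub>A\<^esub> x) = c.ideal +>\<^bsub>C\<^esub> h x"
proof -
  have "c.ideal +>\<^bsub>C\<^esub> h y = c.ideal +>\<^bsub>C\<^esub> h x" if "y \<in> a.ideal +>\<^bsub>A\<^esub> x" for y
  proof -
    note y = a.q.coset_mem[OF that x]
    have "nrm A (a.w \<otimes>\<^bsub>A\<^esub> (y \<ominus>\<^bsub>A\<^esub> x)) = 0" using y a.q.coset_eq_iff[OF y(1) x] by simp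
    then have "nrm C (h (a.w \<otimes>\<^bsub>A\<^esub> (y \<ominus>\<^bsub>A\<^esub> x))) = 0"
      using h.contractive[of "a.w \<otimes>\<^bsub>A\<^esub> (y \<ominus>\<^bsub>A\<^esub> x)"] h.hom_closed[of "a.w \<otimes>\<^bsub>A\<^esub> (y \<ominus>\<^bsub>A\<^esub> x)"] y(1) x
        by (intro antisym) simp_all
    then show ?thesis
      using y(1) x h.hom_closed by (simp add: c.q.coset_eq_iff star_homD(2)[OF h.hom] h.hom_minus h_w)
  qed
  then show ?thesis unfolding hq_def by (rule a.q.union_coset[OF x])
qed

lemma contraction_hq: "contraction (quot A a.ideal) (quot C c.ideal) hq"
proof (intro contraction.intro contraction_axioms.intro c.cstar_alg_quot a.q.cstar_pre_quot)
  note ha = star_homD[OF a.q.star_hom_coset] and hc = star_homD[OF c.q.star_hom_coset] and hh = star_homD[OF h.hom]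
  show "star_hom (quot A a.ideal) (quot C c.ideal) hq"
  proof (rule star_homI)
    fix X k assume "X \<in> carrier (quot A a.ideal)"
    then obtain x where x: "x \<in> carrier A" "X = a.ideal +>\<^bsub>A\<^esub> x" by (auto simp: a.q.carrier_quot)
    show "hq X \<in> carrier (quot C c.ideal)" using x hh(1) by (simp add: hq_coset c.q.carrier_quot)
    show "hq (k \<odot>\<^bsub>quot A a.ideal\<^esub> X) = k \<odot>\<^bsub>quot C c.ideal\<^esub> hq X"
      using x hh(1) by (simp add: hq_coset ha(5)[symmetric] hc(5)[symmetric] hh(5))
    show "hq (star (quot A a.ideal) X) = star (quot C c.ideal) (hq X)"
      using x hh(1) by (simp add: hq_coset ha(6)[symmetric] hc(6)[symmetric] hh(6))
    fix Y assume "Y \<in> carrier (quot A a.ideal)"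
    then obtain y where y: "y \<in> carrier A" "Y = a.ideal +>\<^bsub>A\<^esub> y" by (auto simp: a.q.carrier_quot)
    show "hq (X \<otimes>\<^bsub>quot A a.ideal\<^esub> Y) = hq X \<otimes>\<^bsub>quot C c.ideal\<^esub> hq Y"
      using x y hh(1) by (simp add: hq_coset ha(2)[symmetric] hc(2)[symmetric] hh(2))
    show "hq (X \<oplus>\<^bsub>quot A a.ideal\<^esub> Y) = hq X \<oplus>\<^bsub>quot C c.ideal\<^esub> hq Y"
      using x y hh(1) by (simp add: hq_coset ha(3)[symmetric] hc(3)[symmetric] hh(3))
  next
    show "hq \<one>\<^bsub>quot A a.ideal\<^esub> = \<one>\<^bsub>quot C c.ideal\<^esub>"
      using ha(4) hc(4) by (metis a.one_closed hh(4) hq_coset)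
  qed
  fix X assume "X \<in> carrier (quot A a.ideal)"
  then obtain x where x: "x \<in> carrier A" "X = a.ideal +>\<^bsub>A\<^esub> x" by (auto simp: a.q.carrier_quot)
  show "nrm (quot C c.ideal) (hq X) \<le> nrm (quot A a.ideal) X"
    using x hh(1) h.contractive[of "a.w \<otimes>\<^bsub>A\<^esub> x"] by (simp add: hq_coset c.q.nrm_quot a.q.nrm_quot hh(2) h_w)
qed

end

section \<open>Translations, degrees and words in the left inverse hull\<close>

locale semigroup_in_group = S: monoid S + G: group G
  for S :: "('a, 'm) monoid_scheme" and G :: "('g, 'n) monoid_scheme" +
  fixes \<phi> :: "'a => 'g"
  assumes phi_hom: "\<phi> \<in> hom S G" and phi_one: "\<phi> \<one>\<^bsub>S\<^esub> = \<one>\<^bsub>G\<^esub>" and phi_inj: "inj_on \<phi> (carrier S)"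
begin

abbreviation P where "P \<equiv> I_l S"
abbreviation mult_G (infixl "\<star>" 70) where "g \<star> h \<equiv> g \<otimes>\<^bsub>G\<^esub> h"
abbreviation gi where "gi \<equiv> m_inv G"
abbreviation unit where "unit \<equiv> \<one>\<^bsub>G\<^esub>"

lemma phi_closed [simp, intro]: "s \<in> carrier S ==> \<phi> s \<in> carrier G"
  using phi_hom by (auto simp: hom_def)

lemma phi_mult: "s \<in> carrier S ==> t \<in> carrier S ==> \<phi> (s \<otimes>\<^bsub>S\<^esub> t) = \<phi> s \<star> \<phi> t"
  using phi_hom by (auto simp: hom_def)

text \<open>\<open>f\<close> is left translation by \<open>g\<close> in the group, restricted to
  some subset of \<open>S\<close>. The empty map has this property for every \<open>g\<close> in
  \<open>G\<close>.\<close>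

definition transl :: "('a \<rightharpoonup> 'a) => 'g => bool" where
  "transl f g \<longleftrightarrow> g \<in> carrier G \<and> (\<forall>x y. f x = Some y --> x \<in> carrier S \<and> y \<in> carrier S \<and> \<phi> y = g \<star> \<phi> x)"

lemma translD:
  assumes "transl f g"
  shows "g \<in> carrier G" "f x = Some y ==> x \<in> carrier S" "f x = Some y ==> y \<in> carrier S" "f x = Some y ==> \<phi> y = g \<star> \<phi> x"
  using assms by (auto simp: transl_def)

lemma transl_inj:
  assumes "transl f g" "f x = Some y" "f x' = Some y" shows "x = x'"
proof -
  note t = translD[OF assms(1)]
  have "g \<star> \<phi> x = g \<star> \<phi> x'" using t(4)[OF assms(2)] t(4)[OF assms(3)] by simp
  then have "\<phi> x = \<phi> x'" using t(1) t(2)[OF assms(2)] t(2)[OF assms(3)] by simp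
  then show ?thesis using phi_inj t(2)[OF assms(2)] t(2)[OF assms(3)] by (auto dest: inj_onD)
qed

text \<open>Translations are injective by cancellation in the group, which makes the
  \<open>THE\<close> in \<open>inv_map\<close> meaningful.\<close>

lemma inv_map_transl:
  assumes "transl f g" shows "inv_map f y = Some x \<longleftrightarrow> f x = Some y"
proof
  assume "inv_map f y = Some x"
  then have y: "y \<in> ran f" "x = (THE x. f x = Some y)" by (auto simp: inv_map_def split: if_splits)
  then obtain x' where x': "f x' = Some y" by (auto simp: ran_def)
  then have "(THE x. f x = Some y) = x'" using transl_inj[OF assms] by (intro the_equality) auto
  then show "f x = Some y" using x' y by simp
next
  assume x: "f x = Some y"
  then have "(THE x. f x = Some y) = x" using transl_inj[OF assms] by (intro the_equality) auto
  then show "inv_map f y = Some x" using x by (auto simp: inv_map_def ran_def)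
qed

lemma transl_left_mult: "s \<in> carrier S ==> transl (left_mult S s) (\<phi> s)"
  by (auto simp: transl_def left_mult_def phi_mult split: if_splits)

lemma transl_comp: "transl f g ==> transl h k ==> transl (f \<circ>\<^sub>m h) (g \<star> k)"
  by (auto simp: transl_def map_comp_Some_iff G.m_assoc)

lemma transl_inv: "transl f g ==> transl (inv_map f) (gi g)"
proof -
  assume t: "transl f g"
  have "\<phi> x = gi g \<star> \<phi> y" if "f x = Some y" for x y
    using translD[OF t] that by (simp add: G.m_assoc[symmetric])
  then show ?thesis using t by (auto simp: transl_def inv_map_transl[OF t])
qed

lemma left_hull_transl: "f \<in> left_hull S ==> \<exists>g. transl f g"
  by (induction rule: left_hull.induct) (auto intro: transl_left_mult transl_comp transl_inv)

lemma inv_map_iff: "f \<in> left_hull S ==> inv_map f y = Some x \<longleftrightarrow> f x = Some y"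
  using left_hull_transl inv_map_transl by blast

lemma left_hull_carrier:
  assumes "f \<in> left_hull S" "f x = Some y" shows "x \<in> carrier S" "y \<in> carrier S"
  using left_hull_transl[OF assms(1)] translD assms(2) by blast+

lemma left_hull_inj: "f \<in> left_hull S ==> f x = Some y ==> f x' = Some y ==> x = x'"
  using left_hull_transl transl_inj by blast

lemma map_eqI: "(!!x y. f x = Some y \<longleftrightarrow> h x = Some y) ==> f = (h :: 'b \<rightharpoonup> 'c)"
  by (rule ext) (metis not_None_eq)

lemma I_l_simps: "carrier P = left_hull S" "mult P = (\<circ>\<^sub>m)" "one P = left_mult S \<one>\<^bsub>S\<^esub>" "sinv P = inv_map"
  by (simp_all add: I_l_def)

lemma one_Some: "left_mult S \<one>\<^bsub>S\<^esub> x = Some y \<longleftrightarrow> x \<in> carrier S \<and> y = x"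
  by (auto simp: left_mult_def)

lemma range_Some: "f \<in> left_hull S ==> (f \<circ>\<^sub>m inv_map f) x = Some y \<longleftrightarrow> y = x \<and> (\<exists>k. f k = Some x)"
  by (auto simp: map_comp_Some_iff inv_map_iff)

lemma map_comp_assoc': "(f \<circ>\<^sub>m h) \<circ>\<^sub>m k = f \<circ>\<^sub>m (h \<circ>\<^sub>m k)" for f :: "'d \<rightharpoonup> 'e"
  by (rule map_eqI) (auto simp: map_comp_Some_iff)

lemma inverse_monoid_I_l: "inverse_monoid P"
proof (intro inverse_monoid.intro inverse_monoid_axioms.intro monoidI, unfold I_l_simps)
  fix f h k assume f: "f \<in> left_hull S"
  note i = inv_map_iff left_hull.inv left_hull.prod
  show "left_mult S \<one>\<^bsub>S\<^esub> \<circ>\<^sub>m f = f" "f \<circ>\<^sub>m left_mult S \<one>\<^bsub>S\<^esub> = f"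
    by (rule map_eqI, use left_hull_carrier[OF f] in \<open>auto simp: map_comp_Some_iff one_Some\<close>)+
  show "inv_map (inv_map f) = f" by (rule map_eqI) (simp add: i f)
  show "f \<circ>\<^sub>m (inv_map f \<circ>\<^sub>m f) = f"
    by (rule map_eqI) (use left_hull_inj[OF f] in \<open>auto simp: map_comp_Some_iff i f\<close>)
  assume h: "h \<in> left_hull S"
  show "inv_map (f \<circ>\<^sub>m h) = inv_map h \<circ>\<^sub>m inv_map f"
    by (rule map_eqI) (auto simp: map_comp_Some_iff i f h)
  show "f \<circ>\<^sub>m inv_map f \<circ>\<^sub>m (h \<circ>\<^sub>m inv_map h) = h \<circ>\<^sub>m inv_map h \<circ>\<^sub>m (f \<circ>\<^sub>m inv_map f)"
    by (rule map_eqI) (auto simp: map_comp_Some_iff[of "_ \<circ>\<^sub>m _"] range_Some f h)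
  show "f \<circ>\<^sub>m h \<circ>\<^sub>m k = f \<circ>\<^sub>m (h \<circ>\<^sub>m k)" by (rule map_comp_assoc')
qed (auto intro: left_hull.intros)

text \<open>The value at the empty map is a convention, so degrees are multiplicative for nonempty
  products only.\<close>

definition deg :: "('a \<rightharpoonup> 'a) => 'g" where
  "deg f = (if f = Map.empty then unit else SOME g. transl f g)"

lemma transl_deg: "f \<in> left_hull S ==> transl f (deg f)"
  using left_hull_transl[of f] someI_ex[of "transl f"] by (auto simp: deg_def) (simp add: transl_def)

lemma deg_closed [simp, intro]: "f \<in> left_hull S ==> deg f \<in> carrier G"
  using transl_deg translD(1) by blast

lemma deg_eqI:
  assumes "f \<in> left_hull S" "f \<noteq> Map.empty" "transl f g" shows "deg f = g"
proof -
  obtain x y where xy: "f x = Some y" using assms(2) by (metis ext not_None_eq)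
  note t = translD[OF assms(3)] and d = translD[OF transl_deg[OF assms(1)]]
  have "deg f \<star> \<phi> x = g \<star> \<phi> x" using t(4)[OF xy] d(4)[OF xy] by simp
  then show ?thesis using t(1) d(1) t(2)[OF xy] by simp
qed

lemma deg_comp: "f \<in> left_hull S ==> h \<in> left_hull S ==> f \<circ>\<^sub>m h \<noteq> Map.empty ==> deg (f \<circ>\<^sub>m h) = deg f \<star> deg h"
  by (intro deg_eqI transl_comp transl_deg left_hull.prod)

lemma inv_map_empty_iff: "f \<in> left_hull S ==> inv_map f = Map.empty \<longleftrightarrow> f = Map.empty"
  by (auto simp: inv_map_def ran_def fun_eq_iff split: if_splits) (metis not_None_eq)

lemma deg_inv: "f \<in> left_hull S ==> f \<noteq> Map.empty ==> deg (inv_map f) = gi (deg f)"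
  using inv_map_empty_iff by (intro deg_eqI transl_inv transl_deg left_hull.inv) blast+

text \<open>The degree says where each point of the domain goes in the group, and
  \<open>\<phi>\<close> is injective.\<close>

lemma deg_determines:
  assumes f: "f \<in> left_hull S" and h: "h \<in> left_hull S" and "dom f = dom h" "deg f = deg h"
  shows "f = h"
proof (rule map_eqI)
  have *: "k x = Some y" if f: "f \<in> left_hull S" and h: "k \<in> left_hull S" and "dom f = dom k" "deg f = deg k" "f x = Some y" for f k x y
  proof -
    obtain y' where y': "k x = Some y'" using \<open>dom f = dom k\<close> \<open>f x = Some y\<close> by blast
    have "\<phi> y = \<phi> y'" using translD(4)[OF transl_deg[OF f] \<open>f x = Some y\<close>] translD(4)[OF transl_deg[OF h] y'] \<open>deg f = deg k\<close> by simp
    then have "y = y'" using phi_inj left_hull_carrier(2)[OF f \<open>f x = Some y\<close>] left_hull_carrier(2)[OF h y'] by (auto dest: inj_onD)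
    then show ?thesis using y' by simp
  qed
  show "f x = Some y \<longleftrightarrow> h x = Some y" for x y
    using *[OF f h assms(3,4)] *[OF h f assms(3,4)[symmetric]] by blast
qed

lemma word_map_simps:
  "word_map S [] = left_mult S \<one>\<^bsub>S\<^esub>"
  "word_map S ((t, s) # w) = (inv_map (left_mult S t) \<circ>\<^sub>m left_mult S s) \<circ>\<^sub>m word_map S w"
  by (simp_all add: word_map_def I_l_simps)

lemma word_value_simps:
  "word_value G \<phi> [] = unit"
  "word_value G \<phi> ((t, s) # w) = gi (\<phi> t) \<star> \<phi> s \<star> word_value G \<phi> w"
  by (simp_all add: word_value_def)

lemma word_map_transl:
  "w \<in> lists (carrier S \<times> carrier S) ==> word_map S w \<in> left_hull S \<and> transl (word_map S w) (word_value G \<phi> w)"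
proof (induction w)
  case Nil
  then show ?case using transl_left_mult[of "\<one>\<^bsub>S\<^esub>"] by (auto simp: word_map_simps word_value_simps phi_one intro: left_hull.gen)
next
  case (Cons a w)
  then show ?case
    by (cases a) (auto simp: word_map_simps word_value_simps intro!: transl_comp transl_inv transl_left_mult left_hull.intros)
qed

lemma word_map_append:
  assumes "w \<in> lists (carrier S \<times> carrier S)" "v \<in> lists (carrier S \<times> carrier S)"
  shows "word_map S (w @ v) = word_map S w \<circ>\<^sub>m word_map S v"
  using assms(1)
proof (induction w)
  case Nil
  have "word_map S v \<in> left_hull S" using word_map_transl[OF assms(2)] by blast
  then show ?case using left_hull_carrier by (intro map_eqI) (auto simp: word_map_simps map_comp_Some_iff one_Some)
next
  case (Cons a w)
  then have "word_map S (w @ v) = word_map S w \<circ>\<^sub>m word_map S v" by simp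
  then show ?case by (cases a) (simp add: word_map_simps map_comp_assoc')
qed

text \<open>The inverse of a composition reverses the factors, and the inverse of a quotient of two
  generators swaps them.\<close>

lemma word_map_inverse:
  "w \<in> lists (carrier S \<times> carrier S) ==> word_map S (rev (map prod.swap w)) = inv_map (word_map S w)"
proof (induction w)
  case Nil
  then show ?case by (intro map_eqI) (auto simp: word_map_simps inv_map_iff left_hull.gen one_Some)
next
  case (Cons a w)
  obtain t s where a: "a = (t, s)" by fastforce
  have ts: "t \<in> carrier S" "s \<in> carrier S" and w: "w \<in> lists (carrier S \<times> carrier S)" using Cons.prems a by auto
  have r: "rev (map prod.swap w) \<in> lists (carrier S \<times> carrier S)" using w by (auto simp: in_lists_conv_set)
  have wh: "word_map S w \<in> left_hull S" using word_map_transl[OF w] by blast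
  note i = inv_map_iff left_hull.inv left_hull.prod left_hull.gen
  have "word_map S (rev (map prod.swap (a # w))) = inv_map (word_map S w) \<circ>\<^sub>m word_map S [(s, t)]"
    using word_map_append[OF r, of "[(s, t)]"] ts Cons.IH[OF w] a by simp
  also have "\<dots> = inv_map (word_map S (a # w))"
    unfolding a using ts wh left_hull_carrier[OF left_hull.gen[OF ts(1)]]
    by (intro map_eqI) (auto simp: word_map_simps map_comp_Some_iff i one_Some)
  finally show ?case .
qed

lemma left_hull_word: "f \<in> left_hull S ==> \<exists>w\<in>lists (carrier S \<times> carrier S). word_map S w = f"
proof (induction rule: left_hull.induct)
  case (gen s)
  \<comment> \<open>Words alternate inverses and generators, so a single generator is preceded by
    the inverse of the identity.\<close>
  have "word_map S [(\<one>\<^bsub>S\<^esub>, s)] = left_mult S s"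
    using gen left_hull_carrier[OF left_hull.gen[OF gen]]
    by (intro map_eqI) (auto simp: word_map_simps map_comp_Some_iff inv_map_iff left_hull.gen one_Some)
  then show ?case using gen by (intro bexI[of _ "[(\<one>\<^bsub>S\<^esub>, s)]"]) auto
next
  case (prod f g)
  then obtain w v where "w \<in> lists (carrier S \<times> carrier S)" "word_map S w = f" "v \<in> lists (carrier S \<times> carrier S)" "word_map S v = g" by blast
  then show ?case using word_map_append[of w v] by (intro bexI[of _ "w @ v"]) auto
next
  case (inv f)
  then obtain w where w: "w \<in> lists (carrier S \<times> carrier S)" "word_map S w = f" by blast
  have "rev (map prod.swap w) \<in> lists (carrier S \<times> carrier S)" using w by (auto simp: in_lists_conv_set)
  then show ?case using word_map_inverse[OF w(1)] w(2) by blast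
qed

text \<open>The value of a word is the degree of its map, except that a word with empty map may have
  any value.\<close>

lemma word_set:
  assumes "x \<in> {F (word_map S w) |w. w \<in> lists (carrier S \<times> carrier S) \<and> word_value G \<phi> w = g}"
  obtains f where "f \<in> left_hull S" "x = F f" "f = Map.empty \<or> deg f = g"
proof -
  obtain w where w: "w \<in> lists (carrier S \<times> carrier S)" "word_value G \<phi> w = g" "x = F (word_map S w)" using assms by blast
  show ?thesis using that[of "word_map S w"] word_map_transl[OF w(1)] w deg_eqI by blast
qed

text \<open>All words for a nonempty map have the same value, so any one of them may be
  chosen.\<close>

lemma word_setI:
  assumes "f \<in> left_hull S" "f \<noteq> Map.empty" "deg f = g"
  shows "F f \<in> {F (word_map S w) |w. w \<in> lists (carrier S \<times> carrier S) \<and> word_value G \<phi> w = g}"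
proof -
  obtain w where w: "w \<in> lists (carrier S \<times> carrier S)" "word_map S w = f" using left_hull_word[OF assms(1)] by blast
  have "word_value G \<phi> w = g" using word_map_transl[OF w(1)] w(2) deg_eqI[OF assms(1,2)] assms(3) by metis
  then show ?thesis using w by blast
qed

end

lemma lin_span_nrm_update: "lin_span (A\<lparr>nrm := p\<rparr>) X = lin_span A X"
proof (intro equalityI subsetI)
  show "x \<in> lin_span A X" if "x \<in> lin_span (A\<lparr>nrm := p\<rparr>) X" for x
    using that by induction (auto intro: lin_span.intros)
  show "x \<in> lin_span (A\<lparr>nrm := p\<rparr>) X" if "x \<in> lin_span A X" for x
    using that
  proof induction
    case zero then show ?case using lin_span.zero[of "A\<lparr>nrm := p\<rparr>" X] by simp
  next
    case (base x) then show ?case by (rule lin_span.base)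
  next
    case (add x y) then show ?case using lin_span.add[of x "A\<lparr>nrm := p\<rparr>" X y] by simp
  next
    case (smult x c) then show ?case using lin_span.smult[of x "A\<lparr>nrm := p\<rparr>" X c] by simp
  qed
qed

section \<open>Generators of the full and the reduced C*-algebra\<close>

context inverse_monoid
begin

sublocale M: prenormed_star_alg "ell1 P"
  by (rule prenormed_ell1)

abbreviation MU where "MU \<equiv> M\<lparr>nrm := universal_norm M\<rparr>"

text \<open>The universal norm is dominated by the \<open>\<ell>\<^sup>1\<close>-norm, in which
  truncations converge.\<close>

lemma ell1_closed_span:
  assumes f: "f \<in> carrier M" shows "f \<in> closed_span MU (delta ` carrier P)"
proof -
  have "\<exists>h\<in>lin_span MU (delta ` carrier P). nrm MU (f \<ominus>\<^bsub>MU\<^esub> h) < e" if e: "e > 0" for e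
  proof -
    obtain h where h: "h \<in> lin_span M (delta ` carrier P)" "h \<in> carrier M" "nrm M (f \<ominus>\<^bsub>M\<^esub> h) < e"
      using ell1_approx[OF f e] by blast
    have "universal_norm M (f \<ominus>\<^bsub>M\<^esub> h) < e"
      using M.universal_norm_le[of "f \<ominus>\<^bsub>M\<^esub> h"] f h by simp
    then show ?thesis using h f by (intro bexI[of _ h]) (simp_all add: M.minus_nrm_update lin_span_nrm_update)
  qed
  then show ?thesis using f by (simp add: closed_span_def)
qed

lemma delta_subset: "delta ` carrier P \<subseteq> carrier MU"
  by (auto intro: ell1_delta)

definition iota :: "'p => (nat => 'p => complex) set" where
  "iota p = to_envelope M (delta p)"

lemma cstar_alg_cstar: "cstar_alg (cstar P)"
  unfolding cstar_def by (rule M.cstar_alg_envelope)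

lemma to_cstar_hom: "star_hom M (cstar P) (to_envelope M)"
  unfolding cstar_def by (rule M.to_envelope_hom)

lemma iota_ops:
  assumes p: "p \<in> carrier P"
  shows iota_closed: "iota p \<in> carrier (cstar P)"
    and iota_star: "star (cstar P) (iota p) = iota (sinv P p)"
    and iota_mult: "q \<in> carrier P ==> iota p \<otimes>\<^bsub>cstar P\<^esub> iota q = iota (p \<otimes> q)"
  using star_homD(1,6)[OF to_cstar_hom ell1_delta[OF p]] star_homD(2)[OF to_cstar_hom ell1_delta[OF p] ell1_delta, of q] p
  by (simp_all add: iota_def delta_star delta_mult)

lemma iota_one: "iota \<one> = \<one>\<^bsub>cstar P\<^esub>"
  using star_homD(4)[OF to_cstar_hom] by (simp add: iota_def ell1_simps(1))

lemma contraction_to_cstar: "contraction MU (cstar P) (to_envelope M)"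
proof (intro contraction.intro contraction_axioms.intro M.cstar_pre_universal cstar_alg_cstar)
  show "star_hom MU (cstar P) (to_envelope M)" using to_cstar_hom by (simp add: star_hom_def ring_hom_def)
qed (simp add: cstar_def M.nrm_to_envelope)

lemma cstar_generated: "X \<in> carrier (cstar P) ==> X \<in> closed_span (cstar P) (iota ` carrier P)"
proof -
  interpret C: cstar_alg "cstar P" by (rule cstar_alg_cstar)
  assume X: "X \<in> carrier (cstar P)"
  then obtain x where x: "!!n. x n \<in> carrier M" "converges (cstar P) (\<lambda>n. to_envelope M (x n)) X"
    using M.envelope_approx[of X] unfolding cstar_def by metis
  have "to_envelope M (x n) \<in> closed_span (cstar P) (to_envelope M ` delta ` carrier P)" for n
    by (rule contraction.closed_span_image[OF contraction_to_cstar ell1_closed_span[OF x(1)] delta_subset])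
  moreover have "to_envelope M ` delta ` carrier P = iota ` carrier P" by (simp add: iota_def image_image)
  moreover have "iota ` carrier P \<subseteq> carrier (cstar P)" by (auto intro: iota_closed)
  ultimately show ?thesis using C.closed_span_limit[OF _ x(2) X, of "iota ` carrier P"] by simp
qed

text \<open>The values lie in the reduced algebra by density: point masses go to the generators
  \<open>Lam P p\<close>, and a contraction maps closed spans into closed spans.\<close>

lemma Lam_ell1_cstar_r: "star_hom M (cstar_r P) (Lam_ell1 P)"
proof (rule star_homI)
  note h = star_homD[OF Lam_ell1_hom]
  show "Lam_ell1 P f \<in> carrier (cstar_r P)" if f: "f \<in> carrier M" for f
  proof -
    have "Lam_ell1 P f \<in> closed_span (B_hilb P) (Lam_ell1 P ` delta ` carrier P)"
      by (rule contraction.closed_span_image[OF M.contraction_universal[OF cstar_alg_B_hilb Lam_ell1_hom nrm_Lam_ell1] ell1_closed_span[OF f] delta_subset])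
    then show ?thesis by (simp add: cstar_r_closure(2) image_image Lam_ell1_delta cong: image_cong)
  qed
qed (simp_all add: star_homD[OF Lam_ell1_hom] cstar_r_def)

lemma cstar_alg_cstar_r: "cstar_alg (cstar_r P)"
  by (rule cstar_r_closure(1))

lemma nrm_Lam_ell1_cstar_r: "f \<in> carrier M ==> nrm (cstar_r P) (Lam_ell1 P f) \<le> nrm M f"
  using nrm_Lam_ell1 by (simp add: cstar_r_def)

lemma contraction_Lambda: "contraction (cstar P) (cstar_r P) (Lambda P)"
  unfolding cstar_def Lambda_def
  by (rule M.contraction_envelope[OF cstar_alg_cstar_r Lam_ell1_cstar_r nrm_Lam_ell1_cstar_r])

lemma Lambda_iota: "p \<in> carrier P ==> Lambda P (iota p) = Lam P p"
  unfolding Lambda_def iota_def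
  using M.extend_hom_to_envelope[OF cstar_alg_cstar_r Lam_ell1_cstar_r nrm_Lam_ell1_cstar_r ell1_delta]
  by (simp add: Lam_ell1_delta)

lemma delta_E: "p \<in> carrier P ==> delta p \<in> H.E" "p \<in> carrier P ==> H.N (delta p) \<le> 1"
proof -
  assume p: "p \<in> carrier P"
  have "L2_set (\<lambda>r. cmod (delta p r)) F \<le> 1" if F: "finite F" for F
  proof -
    have "(\<Sum>r\<in>F. (cmod (delta p r))\<^sup>2) = (\<Sum>r\<in>F. if r = p then 1 else 0)"
      by (rule sum.cong) (auto simp: delta_def)
    also have "\<dots> \<le> 1" using F by (simp add: sum.delta')
    finally show ?thesis unfolding L2_set_def by (simp add: real_sqrt_le_1_iff)
  qed
  note le = this
  have out: "delta p r = 0" if "r \<notin> carrier P" for r using that p by (auto simp: delta_def)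
  show "delta p \<in> H.E" "H.N (delta p) \<le> 1"
    using hilb_bounded[OF out zero_le_one le] by auto
qed

lemma ip_delta: "p \<in> carrier P ==> u \<in> H.E ==> H.ip (delta p) u = u p"
proof -
  assume p: "p \<in> carrier P" and u: "u \<in> H.E"
  have "H.ip (delta p) u = (\<Sum>\<^sub>\<infinity>r\<in>carrier P. cnj (delta p r) * u r)"
    using has_sum_hilb_ip[OF delta_E(1)[OF p] u] by (simp add: infsumI)
  also have "\<dots> = (\<Sum>\<^sub>\<infinity>r\<in>{p}. cnj (delta p r) * u r)"
    by (rule infsum_cong_neutral) (use p in \<open>auto simp: delta_def\<close>)
  finally show ?thesis by (simp add: delta_def)
qed

end

section \<open>The quotient algebras and the representation \<open>Phi\<close>\<close>

context semigroup_in_group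
begin

sublocale I: inverse_monoid "I_l S"
  by (rule inverse_monoid_I_l)

abbreviation C where "C \<equiv> cstar P"
abbreviation R where "R \<equiv> cstar_r P"

text \<open>One element for both branches of \<open>zero_ideal\<close>, so that a single quotient
  construction covers them.\<close>

definition zC where "zC = (if Map.empty \<in> left_hull S then I.iota Map.empty else \<zero>\<^bsub>C\<^esub>)"
definition zR where "zR = (if Map.empty \<in> left_hull S then Lam P Map.empty else \<zero>\<^bsub>R\<^esub>)"

lemma empty_comp [simp]: "Map.empty \<circ>\<^sub>m f = Map.empty" "f \<circ>\<^sub>m Map.empty = Map.empty"
  by (auto simp: map_comp_def split: option.split)

lemma inv_map_empty [simp]: "inv_map Map.empty = Map.empty"
  by (simp add: inv_map_def)

text \<open>The empty map absorbs every generator, so by \<open>absorb_closed_span\<close> every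
  element multiplies \<open>zC\<close> by a scalar.\<close>

lemma one_dim_zC: "one_dim_ideal C zC"
proof -
  interpret C: cstar_alg C by (rule I.cstar_alg_cstar)
  have z: "zC \<in> carrier C" by (auto simp: zC_def I_l_simps intro: I.iota_closed)
  have X: "I.iota ` carrier P \<subseteq> carrier C" by (auto intro: I.iota_closed)
  show ?thesis
  proof (intro one_dim_ideal.intro one_dim_ideal_axioms.intro I.cstar_alg_cstar z)
    show "star C zC = zC" "zC \<otimes>\<^bsub>C\<^esub> zC = zC"
      by (auto simp: zC_def I.iota_star I.iota_mult I_l_simps)
    show "\<exists>c. zC \<otimes>\<^bsub>C\<^esub> a = c \<odot>\<^bsub>C\<^esub> zC \<and> a \<otimes>\<^bsub>C\<^esub> zC = c \<odot>\<^bsub>C\<^esub> zC" if "a \<in> carrier C" for a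
    proof (rule C.absorb_closed_span[OF z X _ I.cstar_generated[OF that]])
      show "zC \<otimes>\<^bsub>C\<^esub> x = zC \<and> x \<otimes>\<^bsub>C\<^esub> zC = zC" if "x \<in> I.iota ` carrier P" for x
        using that X by (auto simp: zC_def I.iota_mult I_l_simps)
    qed
  qed
qed

lemma one_dim_zR: "one_dim_ideal R zR"
proof -
  interpret R: cstar_alg R by (rule I.cstar_alg_cstar_r)
  interpret B: cstar_alg "B_hilb P" by (rule I.cstar_alg_B_hilb)
  have ops: "mult R = mult (B_hilb P)" "smult R = smult (B_hilb P)" "star R = star (B_hilb P)" "zero R = zero (B_hilb P)"
    by (simp_all add: cstar_r_def)
  have X: "Lam P ` carrier P \<subseteq> carrier (B_hilb P)" by (auto intro: I.Lam_closed)
  have z: "zR \<in> carrier R" using B.closed_span_base[OF X] B.closed_span_zero[OF X]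
    by (auto simp: zR_def I.cstar_r_closure(2) I_l_simps ops)
  then have zB: "zR \<in> carrier (B_hilb P)" using B.closed_span_subset by (auto simp: I.cstar_r_closure(2))
  show ?thesis
  proof (intro one_dim_ideal.intro one_dim_ideal_axioms.intro I.cstar_alg_cstar_r z)
    show "star R zR = zR" "zR \<otimes>\<^bsub>R\<^esub> zR = zR"
      by (auto simp: zR_def I.Lam_ops I_l_simps ops)
    show "\<exists>c. zR \<otimes>\<^bsub>R\<^esub> a = c \<odot>\<^bsub>R\<^esub> zR \<and> a \<otimes>\<^bsub>R\<^esub> zR = c \<odot>\<^bsub>R\<^esub> zR" if "a \<in> carrier R" for a
      unfolding ops
    proof (rule B.absorb_closed_span[OF zB X])
      show "zR \<otimes>\<^bsub>B_hilb P\<^esub> x = zR \<and> x \<otimes>\<^bsub>B_hilb P\<^esub> zR = zR" if "x \<in> Lam P ` carrier P" for x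
        using that X by (auto simp: zR_def I.Lam_ops I_l_simps ops)
      show "a \<in> closed_span (B_hilb P) (Lam P ` carrier P)" using that by (simp add: I.cstar_r_closure(2))
    qed
  qed
qed

sublocale Q: quot_contraction "cstar (I_l S)" "cstar_r (I_l S)" zC zR "Lambda (I_l S)"
proof (intro quot_contraction.intro quot_contraction_axioms.intro one_dim_zC one_dim_zR I.contraction_Lambda)
  interpret c: contraction C R "Lambda P" by (rule I.contraction_Lambda)
  show "Lambda P zC = zR"
    using star_hom_zero[OF c.A.star_alg_axioms c.C.star_alg_axioms c.hom]
    by (simp add: zC_def zR_def I.Lambda_iota I_l_simps)
qed

lemma zero_ideal_eq: "zero_ideal P = Q.a.ideal"
  unfolding Q.a.ideal_def unfolding zero_ideal_def zC_def I.iota_def I_l_simps by simp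

lemma zero_ideal_r_eq: "zero_ideal_r P = Q.c.ideal"
  unfolding Q.c.ideal_def unfolding zero_ideal_r_def zR_def I_l_simps by simp

abbreviation A where "A \<equiv> cstar0 P"
abbreviation mult_A (infixl "\<cdot>" 70) where "a \<cdot> b \<equiv> a \<otimes>\<^bsub>A\<^esub> b"
abbreviation nul where "nul \<equiv> \<zero>\<^bsub>A\<^esub>"
abbreviation R0 where "R0 \<equiv> cstar_r0 P"

lemma A_eq: "A = quot C Q.a.ideal"
  by (simp add: cstar0_def zero_ideal_eq)

lemma R0_eq: "R0 = quot R Q.c.ideal"
  by (simp add: cstar_r0_def zero_ideal_r_eq)

lemma Lambda0_eq: "Lambda0 P = Q.hq"
  by (simp add: fun_eq_iff Lambda0_def Q.hq_def zero_ideal_r_eq)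

sublocale A: cstar_alg "cstar0 (I_l S)"
  unfolding A_eq by (rule Q.a.cstar_alg_quot)

lemma contraction_Lambda0: "contraction A R0 (Lambda0 P)"
  unfolding A_eq R0_eq Lambda0_eq by (rule Q.contraction_hq)

abbreviation pi where "pi \<equiv> to_cstar0 P"

lemma pi_eq: "pi p = Q.a.ideal +>\<^bsub>C\<^esub> I.iota p"
  by (simp add: to_cstar0_def zero_ideal_eq I.iota_def)

lemma pi_ops:
  assumes p: "p \<in> left_hull S"
  shows pi_closed: "pi p \<in> carrier A" and pi_star: "star A (pi p) = pi (inv_map p)"
    and pi_mult: "q \<in> left_hull S ==> pi p \<cdot> pi q = pi (p \<circ>\<^sub>m q)"
  using star_homD[OF Q.a.q.star_hom_coset] I.iota_ops[of p] I.iota_closed[of q] p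
  unfolding A_eq pi_eq by (simp_all add: I_l_simps flip: star_homD(2,6)[OF Q.a.q.star_hom_coset])

lemma pi_one: "pi (left_mult S \<one>\<^bsub>S\<^esub>) = \<one>\<^bsub>A\<^esub>"
  using star_homD(4)[OF Q.a.q.star_hom_coset] I.iota_one unfolding A_eq pi_eq by (simp add: I_l_simps)

lemma pi_empty: "Map.empty \<in> left_hull S ==> pi Map.empty = nul"
  unfolding A_eq pi_eq Q.a.q.zero_quot using Q.a.q.coset_eq_iff[of "I.iota Map.empty" "\<zero>\<^bsub>C\<^esub>"] I.iota_closed[of Map.empty] Q.a.w(4)
  by (simp add: I_l_simps zC_def Q.a.minus_zero)

lemma A_generated: "a \<in> carrier A ==> a \<in> closed_span A (pi ` left_hull S)"
proof -
  assume "a \<in> carrier A"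
  then obtain x where x: "x \<in> carrier C" "a = Q.a.ideal +>\<^bsub>C\<^esub> x" by (auto simp: A_eq Q.a.q.carrier_quot)
  have "I.iota ` carrier P \<subseteq> carrier C" by (auto intro: I.iota_closed)
  from contraction.closed_span_image[OF Q.a.contraction_coset I.cstar_generated[OF x(1)] this]
  show ?thesis unfolding x(2) A_eq pi_eq[abs_def] by (simp add: image_image I_l_simps)
qed

text \<open>\<open>Lambda0\<close> takes values in a quotient, which does not act on vectors. The
  lift to the corner gives operators on \<open>\<ell>\<^sup>2\<close> of the hull with the norm of
  \<open>Lambda0 P a\<close>; their values have no component at the empty map.\<close>

definition Phi where "Phi a = Q.c.lift (Lambda0 P a)"

lemma Lambda0_closed: "a \<in> carrier A ==> Lambda0 P a \<in> carrier (quot R Q.c.ideal)"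
  using contraction.hom_closed[OF contraction_Lambda0] by (simp add: R0_eq)

lemma R_closed: "T \<in> carrier R ==> T \<in> carrier I.H.Ops"
  using cstar_pre.closed_span_subset[OF cstar_alg.axioms(1)[OF I.cstar_alg_B_hilb]] by (auto simp: I.cstar_r_closure(2) I.B_hilb_Ops)

lemma R_ops: "mult R = mult I.H.Ops" "smult R = smult I.H.Ops" "star R = star I.H.Ops" "add R = add I.H.Ops" "nrm R = nrm I.H.Ops"
    "zero R = zero I.H.Ops" "one R = one I.H.Ops"
  by (simp_all add: cstar_r_def I.B_hilb_Ops)

lemma Phi_closed: "a \<in> carrier A ==> Phi a \<in> carrier I.H.Ops"
  unfolding Phi_def by (intro R_closed Q.c.lift_closed Lambda0_closed)

lemma Phi_E: "a \<in> carrier A ==> u \<in> I.H.E ==> Phi a u \<in> I.H.E"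
  by (rule I.H.Ops_mem_E[OF Phi_closed])

lemma nrm_Phi: "a \<in> carrier A ==> nrm I.H.Ops (Phi a) = nrm R0 (Lambda0 P a)"
  unfolding Phi_def using Q.c.nrm_lift[OF Lambda0_closed] by (simp add: R0_eq R_ops)

lemma nrm_Phi_le: "a \<in> carrier A ==> nrm I.H.Ops (Phi a) \<le> nrm A a"
  using contraction.contractive[OF contraction_Lambda0] nrm_Phi by simp

lemma
  assumes a: "a \<in> carrier A" and u: "u \<in> I.H.E"
  shows Phi_smult: "Phi (c \<odot>\<^bsub>A\<^esub> a) u r = c * Phi a u r"
    and Phi_add: "b \<in> carrier A ==> Phi (a \<oplus>\<^bsub>A\<^esub> b) u r = Phi a u r + Phi b u r"
    and Phi_mult: "b \<in> carrier A ==> Phi (a \<cdot> b) u = Phi a (Phi b u)"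
    and Phi_star: "v \<in> I.H.E ==> I.H.ip (Phi a u) v = I.H.ip u (Phi (star A a) v)"
proof -
  note h = star_homD[OF contraction.hom[OF contraction_Lambda0]]
  note L = Lambda0_closed[folded R0_eq]
  show "Phi (c \<odot>\<^bsub>A\<^esub> a) u r = c * Phi a u r"
    unfolding Phi_def h(5)[OF a] using Q.c.lift_smult[OF Lambda0_closed[OF a]] u
    by (simp add: R0_eq R_ops I.H.Ops_simps complex_alg_simps)
  show "v \<in> I.H.E ==> I.H.ip (Phi a u) v = I.H.ip u (Phi (star A a) v)"
    using I.H.adjoint_pairD(3)[OF I.H.Ops_pair[OF Phi_closed[OF a]] u] Q.c.lift_star[OF Lambda0_closed[OF a]]
    by (simp add: Phi_def h(6)[OF a] R0_eq R_ops)
  assume b: "b \<in> carrier A"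
  show "Phi (a \<oplus>\<^bsub>A\<^esub> b) u r = Phi a u r + Phi b u r"
    unfolding Phi_def h(3)[OF a b] using Q.c.lift_add[OF Lambda0_closed[OF a] Lambda0_closed[OF b]] u
    by (simp add: R0_eq R_ops I.H.Ops_simps complex_alg_simps)
  show "Phi (a \<cdot> b) u = Phi a (Phi b u)"
    unfolding Phi_def h(2)[OF a b] using Q.c.lift_mult[OF Lambda0_closed[OF a] Lambda0_closed[OF b]] u
    by (simp add: R0_eq R_ops I.H.Ops_simps)
qed

lemma Phi_linear:
  assumes "a \<in> carrier A" "u \<in> I.H.E" "v \<in> I.H.E"
  shows "Phi a (\<lambda>i. u i + c * v i) r = Phi a u r + c * Phi a v r"
  using I.H.Ops_linear[OF Phi_closed[OF assms(1)] assms(2) I.H.E_smult[OF assms(3), of c]]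
    I.H.Ops_linear(2)[OF Phi_closed[OF assms(1)] assms(3,3), of c]
  by (simp add: complex_alg_simps)

text \<open>The formula for \<open>Lam\<close>, with the coordinate at the empty map removed by the
  complementary projection.\<close>

lemma Phi_pi:
  assumes p: "p \<in> left_hull S" and u: "u \<in> I.H.E"
  shows "Phi (pi p) u r = (if r \<in> left_hull S \<and> r \<noteq> Map.empty \<and> p \<circ>\<^sub>m (inv_map p \<circ>\<^sub>m r) = r then u (inv_map p \<circ>\<^sub>m r) else 0)"
proof -
  have p': "p \<in> carrier P" using p by (simp add: I_l_simps)
  have LpE: "Lam P p u \<in> I.H.E" by (rule I.Lam_E[OF p' u])
  note Lp = I.Lam_apply[OF p' u]
  have zR: "zR \<in> carrier R" "zR \<in> carrier I.H.Ops" using Q.c.z(1) R_closed by auto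
  have one: "\<one>\<^bsub>R\<^esub> \<in> carrier R" "\<one>\<^bsub>R\<^esub> \<in> carrier I.H.Ops" using Q.c.one_closed R_closed by auto
  have LpR: "Lam P p \<in> carrier R"
    using contraction.hom_closed[OF I.contraction_Lambda I.iota_closed[OF p']] by (simp add: I.Lambda_iota p')
  have w: "Q.c.w v r = v r - zR v r" if "v \<in> I.H.E" for v
    using Q.c.minus_smult[OF one(1) zR(1)] that by (simp add: Q.c.w_def R_ops I.H.Ops_simps complex_alg_simps)
  have z: "zR v r = (if Map.empty \<in> left_hull S \<and> r = Map.empty then v Map.empty else 0)" if "v \<in> I.H.E" for v
  proof (cases "Map.empty \<in> left_hull S")
    case True
    then show ?thesis using I.Lam_apply[of Map.empty v r] that unfolding zR_def I_l_simps by auto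
  next
    case False
    then show ?thesis using that by (simp add: zR_def R_ops I.H.Ops_apply(5) complex_alg_simps)
  qed
  have "Phi (pi p) = Q.c.w \<otimes>\<^bsub>R\<^esub> Lam P p"
    unfolding Phi_def Lambda0_eq pi_eq Q.hq_coset[OF I.iota_closed[OF p']] I.Lambda_iota[OF p']
    by (rule Q.c.lift_coset[OF LpR])
  then have "Phi (pi p) u r = Q.c.w (Lam P p u) r" using u by (simp add: R_ops I.H.Ops_simps)
  also have "\<dots> = Lam P p u r - zR (Lam P p u) r" by (rule w[OF LpE])
  also have "\<dots> = (if r \<in> left_hull S \<and> r \<noteq> Map.empty \<and> p \<circ>\<^sub>m (inv_map p \<circ>\<^sub>m r) = r then u (inv_map p \<circ>\<^sub>m r) else 0)"
    unfolding z[OF LpE] Lp by (auto simp: I_l_simps)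
  finally show ?thesis .
qed

lemma cmod_Phi_le: "a \<in> carrier A ==> u \<in> I.H.E ==> cmod (Phi a u r) \<le> nrm A a * I.H.N u"
  using I.hilb_nrm_le[OF Phi_E, of a u r] I.H.Ops_bound[OF Phi_closed, of a u]
    mult_right_mono[OF nrm_Phi_le I.H.N_nonneg, of a u] by linarith

lemma Phi_limit:
  assumes "!!n. x n \<in> carrier A" "a \<in> carrier A" "converges A x a" "u \<in> I.H.E"
  shows "(\<lambda>n. Phi (x n) u r) \<longlonglongrightarrow> Phi a u r"
proof -
  have le: "norm (Phi (x n) u r - Phi a u r) \<le> nrm A (x n \<ominus>\<^bsub>A\<^esub> a) * I.H.N u" for n
    using cmod_Phi_le[of "x n \<ominus>\<^bsub>A\<^esub> a" u r] assms by (simp add: A.minus_smult Phi_add Phi_smult)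
  have lim: "(\<lambda>n. nrm A (x n \<ominus>\<^bsub>A\<^esub> a) * I.H.N u) \<longlonglongrightarrow> 0"
    using assms(3) unfolding converges_def by (rule tendsto_mult_left_zero)
  have "(\<lambda>n. norm (Phi (x n) u r - Phi a u r)) \<longlonglongrightarrow> 0"
    by (rule tendsto_sandwich[OF always_eventually always_eventually tendsto_const lim]) (simp_all add: le)
  then show ?thesis by (rule LIM_zero_cancel[OF tendsto_norm_zero_cancel])
qed

end

section \<open>The unit fibre and its characters\<close>

context cstar_pre
begin

text \<open>The square of \<open>s \<oplus> t\<close> is
  \<open>s \<otimes> s \<oplus> t \<otimes> t\<close>, again a sum of orthogonal self-adjoint
  elements, and its norm is the square of the norm. The factor 2 of the triangle inequality enters
  only at the end of the recursion, so it disappears under roots of order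
  \<open>2 ^ n\<close>.\<close>

lemma orth_power:
  assumes "s \<in> carrier A" "t \<in> carrier A" "star A s = s" "star A t = t" "s \<otimes> t = \<zero>" "t \<otimes> s = \<zero>"
    "nrm A s \<le> L" "nrm A t \<le> L" "0 \<le> L"
  shows "nrm A (s \<oplus> t) ^ (2 ^ n) \<le> 2 * L ^ (2 ^ n)"
  using assms
proof (induction n arbitrary: s t L)
  case 0
  then show ?case using p_add[of s t] by simp
next
  case (Suc n)
  note s = Suc.prems
  have sq: "nrm A (s \<otimes> s) \<le> L\<^sup>2" "nrm A (t \<otimes> t) \<le> L\<^sup>2"
    using p_mult[of s s] p_mult[of t t] s mult_mono[of "nrm A s" L "nrm A s" L] mult_mono[of "nrm A t" L "nrm A t" L]
    by (simp_all add: power2_eq_square)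
  have st: "(s \<otimes> s) \<otimes> (t \<otimes> t) = s \<otimes> ((s \<otimes> t) \<otimes> t)" "(t \<otimes> t) \<otimes> (s \<otimes> s) = t \<otimes> ((t \<otimes> s) \<otimes> s)"
    using s(1,2) by (simp_all add: m_assoc)
  have IH: "nrm A (s \<otimes> s \<oplus> t \<otimes> t) ^ (2 ^ n) \<le> 2 * (L\<^sup>2) ^ (2 ^ n)"
    by (rule Suc.IH) (use s sq st in \<open>simp_all add: star_mult\<close>)
  have "(nrm A (s \<oplus> t))\<^sup>2 = nrm A ((s \<oplus> t) \<otimes> (s \<oplus> t))"
    using p_star_mult[of "s \<oplus> t"] s by (simp add: star_add)
  also have "(s \<oplus> t) \<otimes> (s \<oplus> t) = s \<otimes> s \<oplus> t \<otimes> t" using s by (simp add: l_distr r_distr)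
  finally show ?case using IH by (simp add: power_mult)
qed

lemma orth_self_adjoint:
  assumes "s \<in> carrier A" "t \<in> carrier A" "star A s = s" "star A t = t" "s \<otimes> t = \<zero>" "t \<otimes> s = \<zero>"
    "nrm A s \<le> L" "nrm A t \<le> L" "0 \<le> L"
  shows "nrm A (s \<oplus> t) \<le> L"
proof (rule ccontr)
  let ?x = "nrm A (s \<oplus> t)"
  assume "\<not> ?x \<le> L"
  then have x: "?x > L" by simp
  note pow = orth_power[OF assms]
  show False
  proof (cases "L = 0")
    case True
    then show ?thesis using pow[of 0] x by simp
  next
    case False
    then have L: "L > 0" using assms(9) by simp
    then have y: "?x / L > 1" using x by simp
    \<comment> \<open>The powers of a ratio above one would exceed the fixed bound 2.\<close>
    obtain n where n: "2 < (?x / L) ^ n" using real_arch_pow[OF y] by blast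
    have "n \<le> 2 ^ n" by (rule less_imp_le) (rule less_exp)
    then have "(?x / L) ^ n \<le> (?x / L) ^ (2 ^ n)" using y by (intro power_increasing) auto
    moreover have "(?x / L) ^ (2 ^ n) \<le> 2" using pow[of n] L by (simp add: power_divide divide_le_eq)
    ultimately show ?thesis using n by simp
  qed
qed

text \<open>Reduced to the self-adjoint elements \<open>star A a \<otimes> a\<close> and
  \<open>star A b \<otimes> b\<close>. The first orthogonality relation removes the cross terms of
  \<open>star A (a \<oplus> b) \<otimes> (a \<oplus> b)\<close>, the second makes the two remaining
  terms orthogonal.\<close>

lemma orth_norm:
  assumes a: "a \<in> carrier A" and b: "b \<in> carrier A" and orth: "star A a \<otimes> b = \<zero>" "a \<otimes> star A b = \<zero>"
    and K: "nrm A a \<le> K" "nrm A b \<le> K"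
  shows "nrm A (a \<oplus> b) \<le> K"
proof -
  have K0: "0 \<le> K" using p_nonneg[OF a] K by simp
  have o: "star A b \<otimes> a = \<zero>" "b \<otimes> star A a = \<zero>"
  proof -
    have "star A b \<otimes> a = star A (star A a \<otimes> b)" "b \<otimes> star A a = star A (a \<otimes> star A b)"
      using a b by (simp_all add: star_mult)
    then show "star A b \<otimes> a = \<zero>" "b \<otimes> star A a = \<zero>" by (simp_all only: orth star_zero)
  qed
  let ?s = "star A a \<otimes> a" and ?t = "star A b \<otimes> b"
  have st: "?s \<otimes> ?t = star A a \<otimes> ((a \<otimes> star A b) \<otimes> b)" "?t \<otimes> ?s = star A b \<otimes> ((b \<otimes> star A a) \<otimes> a)"
    using a b by (simp_all add: m_assoc)
  have "nrm A (?s \<oplus> ?t) \<le> K\<^sup>2"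
    by (rule orth_self_adjoint) (use a b st o orth K in \<open>simp_all add: star_mult p_star_mult power_mono\<close>)
  moreover have "star A (a \<oplus> b) \<otimes> (a \<oplus> b) = ?s \<oplus> ?t"
    using a b o orth by (simp add: star_add l_distr r_distr)
  ultimately have "(nrm A (a \<oplus> b))\<^sup>2 \<le> K\<^sup>2" using p_star_mult[of "a \<oplus> b"] a b by simp
  then show ?thesis using K0 a b by (simp add: power2_le_iff_abs_le)
qed

lemma nrm_projection: "q \<in> carrier A ==> star A q = q ==> q \<otimes> q = q ==> nrm A q \<le> 1"
  using p_star_mult[of q] by (auto simp: power2_eq_square)

end

section \<open>The fibres of the hull bundle and their action on basis vectors\<close>

context semigroup_in_group
begin

abbreviation Bd where "Bd \<equiv> hull_bundle S G \<phi>"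

definition Xs where "Xs g = {pi (word_map S w) |w. w \<in> lists (carrier S \<times> carrier S) \<and> word_value G \<phi> w = g}"

lemma Bd_eq: "Bd g = closed_span A (Xs g)"
  by (simp add: hull_bundle_def Xs_def)

lemma Xs_cases:
  assumes "x \<in> Xs g" obtains f where "f \<in> left_hull S" "x = pi f" "f = Map.empty \<or> deg f = g"
  using word_set[of x pi g] assms unfolding Xs_def by blast

lemma Xs_I: "f \<in> left_hull S ==> f \<noteq> Map.empty ==> deg f = g ==> pi f \<in> Xs g"
  unfolding Xs_def by (rule word_setI)

lemma Xs_subset: "Xs g \<subseteq> carrier A"
  by (auto elim!: Xs_cases intro: pi_closed)

lemma pi_Bd: "f \<in> left_hull S ==> f = Map.empty \<or> deg f = g ==> pi f \<in> Bd g"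
  unfolding Bd_eq using A.closed_span_zero[OF Xs_subset] A.closed_span_base[OF Xs_subset Xs_I] pi_empty by metis

lemma Bd_closed: "b \<in> Bd g ==> b \<in> carrier A"
  unfolding Bd_eq using A.closed_span_subset by blast

lemma Bd_mult:
  assumes "b \<in> Bd g" "b' \<in> Bd h"
  shows "b \<cdot> b' \<in> Bd (g \<star> h)"
  unfolding Bd_eq
proof (rule A.closed_span_mult[OF assms[unfolded Bd_eq] Xs_subset Xs_subset Xs_subset])
  fix x y assume "x \<in> Xs g" "y \<in> Xs h"
  then obtain f k where f: "f \<in> left_hull S" "x = pi f" "f = Map.empty \<or> deg f = g"
    and k: "k \<in> left_hull S" "y = pi k" "k = Map.empty \<or> deg k = h" by (elim Xs_cases) blast
  have "f \<circ>\<^sub>m k = Map.empty \<or> deg (f \<circ>\<^sub>m k) = g \<star> h"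
    using deg_comp[OF f(1) k(1)] f(3) k(3) empty_comp by metis
  then show "x \<cdot> y \<in> closed_span A (Xs (g \<star> h))"
    using pi_Bd[OF left_hull.prod[OF f(1) k(1)]] f k by (simp add: pi_mult Bd_eq)
qed

lemma Bd_star: "b \<in> Bd g ==> star A b \<in> Bd (gi g)"
  unfolding Bd_eq
proof (erule A.closed_span_star[OF _ Xs_subset Xs_subset])
  fix x assume "x \<in> Xs g"
  then obtain f where f: "f \<in> left_hull S" "x = pi f" "f = Map.empty \<or> deg f = g" by (rule Xs_cases)
  have "inv_map f = Map.empty \<or> deg (inv_map f) = gi g"
    using deg_inv[OF f(1)] f(3) inv_map_empty by metis
  then show "star A x \<in> closed_span A (Xs (gi g))"
    using pi_Bd[OF left_hull.inv[OF f(1)]] f by (simp add: pi_star Bd_eq)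
qed

lemma Bd_linear: "nul \<in> Bd g" "b \<in> Bd g ==> b' \<in> Bd g ==> b \<oplus>\<^bsub>A\<^esub> b' \<in> Bd g" "b \<in> Bd g ==> c \<odot>\<^bsub>A\<^esub> b \<in> Bd g"
  unfolding Bd_eq by (rule A.closed_span_zero[OF Xs_subset] A.closed_span_add[OF _ _ Xs_subset] A.closed_span_smult[OF _ Xs_subset]; assumption)+

lemma Bd_limit: "(!!n. x n \<in> Bd g) ==> l \<in> carrier A ==> converges A x l ==> l \<in> Bd g"
  unfolding Bd_eq by (rule A.closed_span_limit[OF _ _ _ Xs_subset])

lemma deg_one: "left_mult S \<one>\<^bsub>S\<^esub> \<in> left_hull S" "left_mult S \<one>\<^bsub>S\<^esub> \<noteq> Map.empty" "deg (left_mult S \<one>\<^bsub>S\<^esub>) = unit"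
proof -
  show l: "left_mult S \<one>\<^bsub>S\<^esub> \<in> left_hull S" by (rule left_hull.gen) simp
  have "left_mult S \<one>\<^bsub>S\<^esub> \<one>\<^bsub>S\<^esub> = Some \<one>\<^bsub>S\<^esub>" by (simp add: one_Some)
  then show n: "left_mult S \<one>\<^bsub>S\<^esub> \<noteq> Map.empty" by auto
  show "deg (left_mult S \<one>\<^bsub>S\<^esub>) = unit" using deg_eqI[OF l n transl_left_mult] by (simp add: phi_one)
qed

lemma one_Bd: "\<one>\<^bsub>A\<^esub> \<in> Bd unit"
  using pi_Bd[OF deg_one(1)] deg_one(3) by (simp add: pi_one)

text \<open>\<open>r\<close> is the only basis vector to which the fibre over \<open>g\<close> can
  send \<open>q\<close>. A map of degree \<open>g\<close> composed with \<open>q\<close> either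
  keeps the domain of \<open>q\<close>, and then multiplies the degree by \<open>g\<close>, or
  shrinks it, and then its operator annihilates the basis vector.\<close>

definition link where
  "link g q r \<longleftrightarrow> q \<in> left_hull S \<and> q \<noteq> Map.empty \<and> r \<in> left_hull S \<and> r \<noteq> Map.empty \<and> dom q = dom r \<and>
     deg r = g \<star> deg q"

lemma link_unique_r: "link g q r ==> link g q r' ==> r = r'"
  unfolding link_def by (intro deg_determines) auto

lemma Phi_zero: "u \<in> I.H.E ==> Phi nul u r = 0"
  using Phi_smult[of "nul" u 0 r] by simp

text \<open>Composition on the left can only shrink a domain, so passing from \<open>r\<close> to
  \<open>h \<circ>\<^sub>m r\<close> and back leaves it unchanged.\<close>

lemma dom_comp_factor: fixes f h r :: "'a \<rightharpoonup> 'a" shows "f \<circ>\<^sub>m (h \<circ>\<^sub>m r) = r ==> dom (h \<circ>\<^sub>m r) = dom r"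
proof -
  have le: "dom (f \<circ>\<^sub>m k) \<subseteq> dom k" for f k :: "'a \<rightharpoonup> 'a" by (auto simp: dom_def map_comp_Some_iff)
  assume "f \<circ>\<^sub>m (h \<circ>\<^sub>m r) = r"
  then have "dom r \<subseteq> dom (h \<circ>\<^sub>m r)" using le[of f "h \<circ>\<^sub>m r"] by simp
  then show ?thesis using le[of h r] by blast
qed

text \<open>For a generator the one coordinate of \<open>u\<close> that contributes at
  \<open>r\<close> is linked to \<open>r\<close>; the claim is linear and passes to limits.\<close>

lemma Phi_support:
  assumes b: "b \<in> Bd g" and u: "u \<in> I.H.E" and z: "!!q. link g q r ==> u q = 0"
  shows "Phi b u r = 0"
  using b[unfolded Bd_eq] Xs_subset
proof (induction rule: A.closed_span_induct)
  case zero show ?case by (rule Phi_zero[OF u])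
next
  case (base x)
  then obtain f where f: "f \<in> left_hull S" "x = pi f" "f = Map.empty \<or> deg f = g" by (rule Xs_cases)
  have "u (inv_map f \<circ>\<^sub>m r) = 0" if r: "r \<in> left_hull S" "r \<noteq> Map.empty" "f \<circ>\<^sub>m (inv_map f \<circ>\<^sub>m r) = r"
  proof (rule z)
    have q: "inv_map f \<circ>\<^sub>m r \<in> left_hull S" by (intro left_hull.intros f r)
    have fn: "f \<noteq> Map.empty" and qn: "inv_map f \<circ>\<^sub>m r \<noteq> Map.empty"
      using r(2,3) empty_comp by metis+
    have "deg r = deg f \<star> deg (inv_map f \<circ>\<^sub>m r)" using deg_comp[OF f(1) q] r(2,3) by simp
    then show "link g (inv_map f \<circ>\<^sub>m r) r" using r f(3) fn q qn dom_comp_factor[OF r(3)] by (simp add: link_def)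
  qed
  then show ?case unfolding f(2) Phi_pi[OF f(1) u] by auto
next
  case (limit y l)
  have "(\<lambda>n. Phi (y n) u r) \<longlonglongrightarrow> Phi l u r" using limit by (intro Phi_limit u)
  then show ?case using limit.IH by (simp add: LIMSEQ_const_iff)
qed (simp_all add: Phi_add Phi_smult u)

text \<open>A map of degree \<open>unit\<close> is the identity of its domain, so these are the
  nonempty idempotents. \<open>Es0\<close> adds the empty map when it occurs, which makes the set
  closed under products.\<close>

definition Es where "Es = {e \<in> left_hull S. e \<noteq> Map.empty \<and> deg e = unit}"
definition Es0 where "Es0 = {e \<in> left_hull S. e = Map.empty \<or> deg e = unit}"

lemma Es0_Some: "e \<in> Es0 ==> e x = Some y ==> y = x"
proof -
  assume e: "e \<in> Es0" and xy: "e x = Some y"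
  then have eh: "e \<in> left_hull S" and d: "deg e = unit" by (auto simp: Es0_def)
  note t = translD[OF transl_deg[OF eh]]
  have "\<phi> y = \<phi> x" using t(2,4)[OF xy] d by simp
  then show "y = x" using phi_inj t(2,3)[OF xy] by (auto dest: inj_onD)
qed

lemma Es0_hull: "e \<in> Es0 ==> e \<in> left_hull S"
  by (simp add: Es0_def)

lemma Es_P: "e \<in> Es ==> e \<in> carrier P"
  by (simp add: Es_def I_l_simps)

lemma Es0_laws:
  assumes e: "e \<in> Es0" and f: "f \<in> Es0"
  shows "e \<circ>\<^sub>m f \<in> Es0" "e \<circ>\<^sub>m f = f \<circ>\<^sub>m e" "e \<circ>\<^sub>m e = e" "inv_map e = e"
proof -
  have "e \<circ>\<^sub>m f = Map.empty \<or> deg (e \<circ>\<^sub>m f) = unit"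
  proof (cases "e \<circ>\<^sub>m f = Map.empty")
    case False
    then have "e \<noteq> Map.empty" "f \<noteq> Map.empty" using empty_comp by metis+
    then have "deg e = unit" "deg f = unit" using e f by (auto simp: Es0_def)
    then show ?thesis using deg_comp[OF Es0_hull[OF e] Es0_hull[OF f] False] by simp
  qed simp
  then show "e \<circ>\<^sub>m f \<in> Es0" using left_hull.prod[OF Es0_hull[OF e] Es0_hull[OF f]] by (simp add: Es0_def)
  note s = Es0_Some[OF e] Es0_Some[OF f]
  show "e \<circ>\<^sub>m f = f \<circ>\<^sub>m e" by (rule map_eqI) (auto simp: map_comp_Some_iff dest: s)
  show "e \<circ>\<^sub>m e = e" by (rule map_eqI) (auto simp: map_comp_Some_iff dest: s)
  show "inv_map e = e" by (rule map_eqI) (auto simp: inv_map_iff Es0_hull[OF e] dest: s)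
qed

lemma Phi_delta_link: "x \<in> Es ==> b \<in> Bd g ==> \<not> link g x r ==> Phi b (delta x) r = 0"
  by (rule Phi_support[OF _ I.delta_E(1)[OF Es_P]]) (auto simp: delta_def)

text \<open>The matrix coefficient of \<open>b\<close> from \<open>delta x\<close> to the basis
  vector that \<open>g\<close> links to it. This vector is unique; if there is none, the fibre over
  \<open>g\<close> annihilates \<open>delta x\<close>.\<close>

definition coeff where
  "coeff x g b = (if \<exists>r. link g x r then Phi b (delta x) (SOME r. link g x r) else 0)"

definition ch where "ch x d = Phi d (delta x) x"

lemma coeff_link: "link g x r ==> coeff x g b = Phi b (delta x) r"
proof -
  assume l: "link g x r"
  then have "link g x (SOME r. link g x r)" by (rule someI[of "link g x"])
  then have "(SOME r. link g x r) = r" using link_unique_r l by blast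
  then show ?thesis using l by (auto simp: coeff_def)
qed

text \<open>\<open>b\<close> and \<open>b'\<close> send \<open>delta x\<close> to multiples of one
  and the same basis vector, so the inner product of the two images has a single term.\<close>

lemma ch_mult:
  assumes x: "x \<in> Es" and b: "b \<in> Bd g" and b': "b' \<in> Bd g"
  shows "ch x (star A b \<cdot> b') = cnj (coeff x g b) * coeff x g b'"
proof -
  note dE = I.delta_E(1)[OF Es_P[OF x]] and bc = Bd_closed[OF b] Bd_closed[OF b']
  have "ch x (star A b \<cdot> b') = I.H.ip (delta x) (Phi (star A b) (Phi b' (delta x)))"
    unfolding ch_def using bc dE by (simp add: Phi_mult I.ip_delta[OF Es_P[OF x]] Phi_E)
  also have "\<dots> = I.H.ip (Phi b (delta x)) (Phi b' (delta x))"
    using Phi_star[OF bc(1) dE Phi_E[OF bc(2) dE]] by simp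
  also have "\<dots> = (\<Sum>\<^sub>\<infinity>r\<in>carrier P. cnj (Phi b (delta x) r) * Phi b' (delta x) r)"
    using I.has_sum_hilb_ip[OF Phi_E[OF bc(1) dE] Phi_E[OF bc(2) dE]] by (simp add: infsumI)
  also have "\<dots> = cnj (coeff x g b) * coeff x g b'"
  proof (cases "\<exists>r. link g x r")
    case True
    then obtain r where r: "link g x r" by blast
    have "(\<Sum>\<^sub>\<infinity>r\<in>carrier P. cnj (Phi b (delta x) r) * Phi b' (delta x) r)
      = (\<Sum>\<^sub>\<infinity>r\<in>{r}. cnj (Phi b (delta x) r) * Phi b' (delta x) r)"
    proof (rule infsum_cong_neutral)
      show "cnj (Phi b (delta x) i) * Phi b' (delta x) i = 0" if "i \<in> carrier P - {r}" for i
        using Phi_delta_link[OF x b, of i] link_unique_r[OF r, of i] that by auto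
    qed (use r in \<open>auto simp: link_def I_l_simps\<close>)
    then show ?thesis using coeff_link[OF r] by simp
  next
    case False
    have "(\<Sum>\<^sub>\<infinity>r\<in>carrier P. cnj (Phi b (delta x) r) * Phi b' (delta x) r) = 0"
      by (rule infsum_0) (use Phi_delta_link[OF x b] False in auto)
    then show ?thesis using False by (simp add: coeff_def)
  qed
  finally show ?thesis .
qed

lemma ch_linear: "x \<in> Es ==> d \<in> carrier A ==> d' \<in> carrier A ==> ch x (d \<oplus>\<^bsub>A\<^esub> d') = ch x d + ch x d'"
  "x \<in> Es ==> d \<in> carrier A ==> ch x (c \<odot>\<^bsub>A\<^esub> d) = c * ch x d"
  unfolding ch_def using I.delta_E(1)[OF Es_P] by (simp_all add: Phi_add Phi_smult)

lemma ch_le: "x \<in> Es ==> d \<in> carrier A ==> cmod (ch x d) \<le> nrm A d"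
  unfolding ch_def using cmod_Phi_le[of d "delta x" x] I.delta_E[OF Es_P] mult_left_mono[of "I.H.N (delta x)" 1 "nrm A d"]
  by fastforce

lemma coeff_linear:
  assumes "x \<in> Es" "b \<in> carrier A"
  shows "b' \<in> carrier A ==> coeff x g (b \<oplus>\<^bsub>A\<^esub> b') = coeff x g b + coeff x g b'"
    "coeff x g (c \<odot>\<^bsub>A\<^esub> b) = c * coeff x g b"
  using I.delta_E(1)[OF Es_P[OF assms(1)]] assms(2)
  by (cases "\<exists>r. link g x r"; auto simp: coeff_def Phi_add Phi_smult)+

text \<open>
  On the unit fibre the norm is the supremum of the characters \<open>ch x\<close>. For a linear combination \<open>d\<close>
  of idempotents \<open>e \<in> F\<close>, splitting repeatedly along \<open>pi e\<close> and its complement decomposes \<open>d\<close>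
  orthogonally into pieces \<open>d q\<close>, with \<open>(u, q)\<close> a cell, on which \<open>d\<close> acts as the scalar \<open>ch u d\<close>.
\<close>

definition cell where
  "cell F u q \<longleftrightarrow> F \<subseteq> Es0 \<and> u \<in> Es0 \<and> q \<in> carrier A \<and> star A q = q \<and> q \<cdot> q = q \<and>
     (\<forall>e\<in>Es0. pi e \<cdot> q = q \<cdot> pi e) \<and> pi u \<cdot> q = q \<and>
     (\<forall>e\<in>F. e \<circ>\<^sub>m u = u \<and> pi e \<cdot> q = q \<or> pi e \<cdot> q = nul)"

lemma pi_Es0:
  assumes e: "e \<in> Es0" and f: "f \<in> Es0"
  shows "pi e \<in> carrier A" "star A (pi e) = pi e" "pi e \<cdot> pi e = pi e" "pi e \<cdot> pi f = pi (e \<circ>\<^sub>m f)"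
    "pi e \<cdot> pi f = pi f \<cdot> pi e"
  using Es0_hull[OF e] Es0_hull[OF f] Es0_laws[OF e f] by (simp_all add: pi_closed pi_star pi_mult)

text \<open>On \<open>pi e \<cdot> q\<close> the idempotent \<open>e\<close> acts as the identity,
  which is recorded by multiplying \<open>u\<close> with \<open>e\<close>; on the complement it acts
  as zero and \<open>u\<close> stays. All elements involved commute, so decisions about earlier
  idempotents persist in both pieces.\<close>

lemma cell_split:
  assumes c: "cell F u q" and e: "e \<in> Es0"
  shows "cell (insert e F) (e \<circ>\<^sub>m u) (pi e \<cdot> q)" "cell (insert e F) u (q \<ominus>\<^bsub>A\<^esub> pi e \<cdot> q)"
proof -
  from c have u: "u \<in> Es0" and q: "q \<in> carrier A" "star A q = q" "q \<cdot> q = q"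
    and comm: "!!f. f \<in> Es0 ==> pi f \<cdot> q = q \<cdot> pi f" and uq: "pi u \<cdot> q = q"
    and F: "!!f. f \<in> F ==> f \<circ>\<^sub>m u = u \<and> pi f \<cdot> q = q \<or> pi f \<cdot> q = nul"
    and FE0: "F \<subseteq> Es0"
    by (auto simp: cell_def)
  let ?e = "pi e" and ?q = "pi e \<cdot> q"
  note ec = pi_Es0(1)[OF e e]
  have qc: "?q \<in> carrier A" using ec q by simp
  have ee: "?e \<cdot> ?q = ?q" using ec q(1) pi_Es0(3)[OF e e] by (simp add: A.m_assoc[symmetric])
  have sq: "star A ?q = ?q" using ec q comm[OF e] pi_Es0(2)[OF e e] by (simp add: A.star_mult)
  have qq1: "q \<cdot> ?q = ?q" using ec q(1,3) comm[OF e] by (metis A.m_assoc)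
  have q1q: "?q \<cdot> q = ?q" using ec q by (simp add: A.m_assoc)
  have qq: "?q \<cdot> ?q = ?q" using ec q(1) qq1 ee by (simp add: A.m_assoc)
  have cm: "pi f \<cdot> ?q = ?e \<cdot> (pi f \<cdot> q)" if "f \<in> left_hull S" "f \<circ>\<^sub>m e = e \<circ>\<^sub>m f" for f
    using ec q(1) pi_closed[OF that(1)] pi_mult[OF that(1) Es0_hull[OF e]] pi_mult[OF Es0_hull[OF e] that(1)] that(2)
    by (simp add: A.m_assoc[symmetric])
  have cmE: "pi f \<cdot> ?q = ?e \<cdot> (pi f \<cdot> q)" if "f \<in> Es0" for f
    by (rule cm[OF Es0_hull[OF that] Es0_laws(2)[OF that e]])
  have comm1: "pi f \<cdot> ?q = ?q \<cdot> pi f" if "f \<in> Es0" for f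
    using cmE[OF that] comm[OF that] ec q(1) pi_Es0(1)[OF that that] by (simp add: A.m_assoc)
  have uq1: "pi u \<cdot> ?q = ?q" using cmE[OF u] uq by simp
  have u1q: "pi (e \<circ>\<^sub>m u) \<cdot> ?q = ?q"
    using pi_Es0(4)[OF e u] uq1 ee ec pi_Es0(1)[OF u u] qc by (simp add: A.m_assoc flip: pi_Es0(4)[OF e u])
  have FE: "f \<circ>\<^sub>m (e \<circ>\<^sub>m u) = e \<circ>\<^sub>m u \<and> pi f \<cdot> ?q = ?q \<or> pi f \<cdot> ?q = nul" if f: "f \<in> F" for f
  proof -
    have fE: "f \<in> Es0" using f FE0 by blast
    show ?thesis using F[OF f]
    proof
      assume "f \<circ>\<^sub>m u = u \<and> pi f \<cdot> q = q"
      moreover have "f \<circ>\<^sub>m (e \<circ>\<^sub>m u) = e \<circ>\<^sub>m (f \<circ>\<^sub>m u)"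
        using Es0_laws(2)[OF fE e] by (simp flip: map_comp_assoc')
      ultimately show ?thesis using cmE[OF fE] by simp
    next
      assume "pi f \<cdot> q = nul"
      then show ?thesis using cmE[OF fE] ec by simp
    qed
  qed
  have eeu: "e \<circ>\<^sub>m (e \<circ>\<^sub>m u) = e \<circ>\<^sub>m u" using Es0_laws(3)[OF e e] by (simp flip: map_comp_assoc')
  show "cell (insert e F) (e \<circ>\<^sub>m u) ?q"
    unfolding cell_def using FE0 e Es0_laws(1)[OF e u] qc sq qq comm1 u1q FE ee eeu by blast
  let ?r = "q \<ominus>\<^bsub>A\<^esub> ?q"
  have r1: "?r \<in> carrier A" "star A ?r = ?r" using q(1,2) qc sq by (simp_all add: A.star_minus)
  have r2: "?r \<cdot> ?r = ?r"
    using q(1,3) qc qq1 q1q qq by (simp add: A.r_minus_distr A.l_minus_distr A.minus_self A.minus_zero)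
  have r3: "pi f \<cdot> ?r = ?r \<cdot> pi f" if "f \<in> Es0" for f
    using comm[OF that] comm1[OF that] q(1) qc pi_Es0(1)[OF that that] by (simp add: A.r_minus_distr A.l_minus_distr)
  have r4: "pi u \<cdot> ?r = ?r" using uq uq1 q(1) qc pi_Es0(1)[OF u u] by (simp add: A.r_minus_distr)
  have r5: "pi e \<cdot> ?r = nul" using ee q(1) qc ec by (simp add: A.r_minus_distr A.minus_self)
  have r6: "f \<circ>\<^sub>m u = u \<and> pi f \<cdot> ?r = ?r \<or> pi f \<cdot> ?r = nul" if f: "f \<in> F" for f
  proof -
    have fE: "f \<in> Es0" using f FE0 by blast
    show ?thesis using F[OF f] cmE[OF fE] q(1) qc ec pi_Es0(1)[OF fE fE]
      by (auto simp: A.r_minus_distr A.minus_self)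
  qed
  show "cell (insert e F) u ?r"
    unfolding cell_def using FE0 e u r1 r2 r3 r4 r5 r6 by blast
qed

lemma cell_Es: "cell F u q ==> q \<noteq> nul ==> u \<in> Es"
proof -
  assume c: "cell F u q" "q \<noteq> nul"
  then have u: "u \<in> Es0" "pi u \<cdot> q = q" "q \<in> carrier A" by (auto simp: cell_def)
  have "u \<noteq> Map.empty" using c(2) u pi_empty Es0_hull by (metis A.l_null)
  then show "u \<in> Es" using u(1) by (auto simp: Es_def Es0_def)
qed

lemma cell_mono: "cell F u q ==> F' \<subseteq> F ==> cell F' u q"
  unfolding cell_def by blast

lemma ch_pi: "u \<in> Es ==> e \<in> Es0 ==> ch u (pi e) = (if e \<circ>\<^sub>m u = u then 1 else 0)"
proof -
  assume u: "u \<in> Es" and e: "e \<in> Es0"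
  have eeu: "e \<circ>\<^sub>m (e \<circ>\<^sub>m u) = e \<circ>\<^sub>m u" using Es0_laws(3)[OF e e] by (simp flip: map_comp_assoc')
  have uh: "u \<in> left_hull S" "u \<noteq> Map.empty" using u by (auto simp: Es_def)
  have "ch u (pi e) = (if e \<circ>\<^sub>m (e \<circ>\<^sub>m u) = u then delta u (e \<circ>\<^sub>m u) else 0)"
    unfolding ch_def Phi_pi[OF Es0_hull[OF e] I.delta_E(1)[OF Es_P[OF u]]] Es0_laws(4)[OF e e] using uh by simp
  then show ?thesis unfolding eeu by (simp add: delta_def)
qed

text \<open>Shaped for induction over linear combinations: enlarging \<open>F\<close> only
  strengthens the cell condition, so two witnesses can be united. For \<open>q \<noteq> nul\<close>
  the idempotent \<open>u\<close> is in \<open>Es\<close>, where \<open>ch u\<close> is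
  linear.\<close>

definition cellular where
  "cellular d \<longleftrightarrow> d \<in> carrier A \<and>
     (\<forall>q\<in>carrier A. (\<forall>e\<in>Es0. pi e \<cdot> q = q \<cdot> pi e) --> d \<cdot> q = q \<cdot> d) \<and>
     (\<exists>F. finite F \<and> F \<subseteq> Es0 \<and> (\<forall>u q. cell F u q --> q \<noteq> nul --> d \<cdot> q = ch u d \<odot>\<^bsub>A\<^esub> q))"

lemma cellularI:
  assumes "d \<in> carrier A" "!!q. q \<in> carrier A ==> \<forall>e\<in>Es0. pi e \<cdot> q = q \<cdot> pi e ==> d \<cdot> q = q \<cdot> d"
    "finite F" "F \<subseteq> Es0" "!!u q. cell F u q ==> q \<noteq> nul ==> d \<cdot> q = ch u d \<odot>\<^bsub>A\<^esub> q"
  shows "cellular d"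
  using assms unfolding cellular_def by blast

lemma cellularD:
  assumes "cellular d"
  shows "d \<in> carrier A" "!!q. q \<in> carrier A ==> \<forall>e\<in>Es0. pi e \<cdot> q = q \<cdot> pi e ==> d \<cdot> q = q \<cdot> d"
    "\<exists>F. finite F \<and> F \<subseteq> Es0 \<and> (\<forall>u q. cell F u q --> q \<noteq> nul --> d \<cdot> q = ch u d \<odot>\<^bsub>A\<^esub> q)"
  using assms unfolding cellular_def by blast+

lemma lin_span_cellular: "d \<in> lin_span A (Xs unit) ==> cellular d"
proof (induction rule: lin_span.induct)
  case zero
  have "ch u nul = 0" if "u \<in> Es" for u using ch_linear(2)[OF that, of "nul" 0] by simp
  then have "nul \<cdot> q = ch u nul \<odot>\<^bsub>A\<^esub> q" if c: "cell {} u q" "q \<noteq> nul" for u q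
    using cell_Es[OF c] c(1) by (simp add: cell_def)
  then show ?case by (intro cellularI[where F = "{}"]) auto
next
  case (base x)
  then obtain e where e0: "e \<in> left_hull S" "x = pi e" "e = Map.empty \<or> deg e = unit" by (rule Xs_cases)
  then have e: "e \<in> Es0" by (simp add: Es0_def)
  have "pi e \<cdot> q = ch u (pi e) \<odot>\<^bsub>A\<^esub> q" if c: "cell {e} u q" and q0: "q \<noteq> nul" for u q
  proof -
    have u: "u \<in> Es0" and q: "q \<in> carrier A" and uq: "pi u \<cdot> q = q"
      and eq: "e \<circ>\<^sub>m u = u \<and> pi e \<cdot> q = q \<or> pi e \<cdot> q = nul"
      using c by (auto simp: cell_def)
    \<comment> \<open>If \<open>e\<close> fixed \<open>u\<close>, then \<open>pi e\<close> would act
      as the identity on \<open>q = pi u \<cdot> q\<close>, which is not zero.\<close>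
    have "e \<circ>\<^sub>m u \<noteq> u" if z: "pi e \<cdot> q = nul"
    proof
      assume "e \<circ>\<^sub>m u = u"
      then have "pi e \<cdot> q = q"
        using A.m_assoc[OF pi_Es0(1)[OF e u] pi_Es0(1)[OF u u] q] pi_Es0(4)[OF e u] uq by simp
      then show False using z uq q0 by simp
    qed
    then show ?thesis using eq ch_pi[OF cell_Es[OF c q0] e] q by auto
  qed
  then show ?case using e e0(2) pi_Es0(1)[OF e e] by (intro cellularI[where F = "{e}"]) auto
next
  case (add x y)
  note x = cellularD[OF add.IH(1)] and y = cellularD[OF add.IH(2)]
  obtain F where F: "finite F" "F \<subseteq> Es0" "!!u q. cell F u q ==> q \<noteq> nul ==> x \<cdot> q = ch u x \<odot>\<^bsub>A\<^esub> q" using x(3) by blast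
  obtain F' where F': "finite F'" "F' \<subseteq> Es0" "!!u q. cell F' u q ==> q \<noteq> nul ==> y \<cdot> q = ch u y \<odot>\<^bsub>A\<^esub> q" using y(3) by blast
  have "(x \<oplus>\<^bsub>A\<^esub> y) \<cdot> q = ch u (x \<oplus>\<^bsub>A\<^esub> y) \<odot>\<^bsub>A\<^esub> q" if c: "cell (F \<union> F') u q" "q \<noteq> nul" for u q
  proof -
    have q: "q \<in> carrier A" using c by (simp add: cell_def)
    show ?thesis using F(3)[OF cell_mono[OF c(1)] c(2)] F'(3)[OF cell_mono[OF c(1)] c(2)] x(1) y(1) q
      by (simp add: A.l_distr ch_linear(1)[OF cell_Es[OF c]] A.smult_l_distr)
  qed
  then show ?case
    using F(1,2) F'(1,2) x(1,2) y(1,2) by (intro cellularI[where F = "F \<union> F'"]) (auto simp: A.l_distr A.r_distr)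
next
  case (smult x c)
  note x = cellularD[OF smult.IH]
  obtain F where F: "finite F" "F \<subseteq> Es0" "!!u q. cell F u q ==> q \<noteq> nul ==> x \<cdot> q = ch u x \<odot>\<^bsub>A\<^esub> q" using x(3) by blast
  have "(c \<odot>\<^bsub>A\<^esub> x) \<cdot> q = ch u (c \<odot>\<^bsub>A\<^esub> x) \<odot>\<^bsub>A\<^esub> q" if cl: "cell F u q" "q \<noteq> nul" for u q
  proof -
    have q: "q \<in> carrier A" using cl by (simp add: cell_def)
    show ?thesis using F(3)[OF cl] x(1) q by (simp add: A.mult_smult_l ch_linear(2)[OF cell_Es[OF cl]])
  qed
  then show ?case
    using F(1,2) x(1,2) by (intro cellularI[where F = F]) (auto simp: A.mult_smult_l A.mult_smult_r)
qed

lemmas lin_span_cells = cellularD[OF lin_span_cellular]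

text \<open>Every further idempotent splits \<open>q\<close> into two orthogonal projections that
  commute with \<open>d\<close>, and an orthogonal sum is bounded by the larger norm.
  \<open>F0\<close> holds the idempotents already decided on \<open>q\<close>.\<close>

lemma nrm_cells:
  assumes d: "d \<in> lin_span A (Xs unit)" and "finite F" "F \<subseteq> Es0"
  shows "(!!u q. cell (F0 \<union> F) u q ==> nrm A (d \<cdot> q) \<le> K) ==> cell F0 u q ==> nrm A (d \<cdot> q) \<le> K"
  using assms(2,3)
proof (induction F arbitrary: F0 u q)
  case empty
  then show ?case by simp
next
  case (insert e F)
  have e: "e \<in> Es0" using insert by simp
  have bound: "nrm A (d \<cdot> p) \<le> K" if "cell (insert e F0) v p" for v p
    by (rule insert.IH[OF _ that]) (use insert in auto)
  note dc = lin_span_cells(1,2)[OF d]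
  have q: "q \<in> carrier A" "star A q = q" "q \<cdot> q = q" and comm: "!!f. f \<in> Es0 ==> pi f \<cdot> q = q \<cdot> pi f"
    using insert.prems(2) by (auto simp: cell_def)
  let ?p = "pi e \<cdot> q" and ?r = "q \<ominus>\<^bsub>A\<^esub> pi e \<cdot> q"
  note cp = cell_split(1)[OF insert.prems(2) e] and cr = cell_split(2)[OF insert.prems(2) e]
  have p: "?p \<in> carrier A" "star A ?p = ?p" "?p \<cdot> ?p = ?p" "d \<cdot> ?p = ?p \<cdot> d"
    using cp dc(2) unfolding cell_def by blast+
  have r: "?r \<in> carrier A" "star A ?r = ?r" "d \<cdot> ?r = ?r \<cdot> d"
    using cr dc(2) unfolding cell_def by blast+
  have qp: "q \<cdot> ?p = ?p" using q comm[OF e] pi_Es0(1)[OF e e] by (metis A.m_assoc)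
  have rp: "?r \<cdot> ?p = nul" using q(1) p(1,3) qp by (simp add: A.l_minus_distr A.minus_self)
  then have pr: "?p \<cdot> ?r = nul" using A.star_mult[OF r(1) p(1)] p(2) r(2) by simp
  have "nrm A ((d \<cdot> ?p) \<oplus>\<^bsub>A\<^esub> (d \<cdot> ?r)) \<le> K"
  proof (rule A.orth_norm)
    \<comment> \<open>As \<open>d\<close> commutes with both pieces, each of the two products can be
      arranged to contain \<open>?p \<cdot> ?r\<close>, which vanishes.\<close>
    have "star A (d \<cdot> ?p) \<cdot> (d \<cdot> ?r) = star A (?p \<cdot> d) \<cdot> (?r \<cdot> d)"
      using p(4) r(3) by simp
    also have "\<dots> = star A d \<cdot> ((?p \<cdot> ?r) \<cdot> d)"
      unfolding A.star_mult[OF p(1) dc(1)] p(2) using p(1) r(1) dc(1) by (simp only: A.m_assoc A.m_closed A.star_closed)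
    finally show "star A (d \<cdot> ?p) \<cdot> (d \<cdot> ?r) = nul" using pr dc(1) by simp
    have "(d \<cdot> ?p) \<cdot> star A (d \<cdot> ?r) = d \<cdot> ((?p \<cdot> ?r) \<cdot> star A d)"
      unfolding A.star_mult[OF dc(1) r(1)] r(2) using p(1) r(1) dc(1) by (simp only: A.m_assoc A.m_closed A.star_closed)
    then show "(d \<cdot> ?p) \<cdot> star A (d \<cdot> ?r) = nul" using pr dc(1) by simp
  qed (use bound[OF cp] bound[OF cr] dc(1) p(1) r(1) in auto)
  moreover have "(d \<cdot> ?p) \<oplus>\<^bsub>A\<^esub> (d \<cdot> ?r) = d \<cdot> (?r \<oplus>\<^bsub>A\<^esub> ?p)"
    using dc(1) p(1) r(1) A.r_distr[of ?r ?p d] A.a_comm[of "d \<cdot> ?p" "d \<cdot> ?r"] by simp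
  moreover have "?r \<oplus>\<^bsub>A\<^esub> ?p = q" by (rule A.minus_add_cancel[OF q(1) p(1)])
  ultimately show ?case by simp
qed

lemma nrm_lin_span_le:
  assumes d: "d \<in> lin_span A (Xs unit)" and K: "0 \<le> K" "!!x. x \<in> Es ==> cmod (ch x d) \<le> K"
  shows "nrm A d \<le> K"
proof -
  obtain F where F: "finite F" "F \<subseteq> Es0" "!!u q. cell F u q ==> q \<noteq> nul ==> d \<cdot> q = ch u d \<odot>\<^bsub>A\<^esub> q"
    using lin_span_cells(3)[OF d] by blast
  note dc = lin_span_cells(1)[OF d]
  have "nrm A (d \<cdot> q) \<le> K" if c: "cell F u q" for u q
  proof (cases "q = nul")
    case True then show ?thesis using K dc by simp
  next
    case False
    have q: "q \<in> carrier A" "nrm A q \<le> 1" using c A.nrm_projection[of q] by (auto simp: cell_def)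
    have "nrm A (d \<cdot> q) = cmod (ch u d) * nrm A q" using F(3)[OF c False] A.p_smult[OF q(1)] by simp
    also have "\<dots> \<le> K * 1" using K(2)[OF cell_Es[OF c False]] q K(1) by (intro mult_mono) auto
    finally show ?thesis by simp
  qed
  \<comment> \<open>The splitting starts with nothing decided: the identity as idempotent and the
    unit as projection.\<close>
  moreover have "cell {} (left_mult S \<one>\<^bsub>S\<^esub>) \<one>\<^bsub>A\<^esub>"
    using deg_one pi_Es0(1) by (auto simp: cell_def Es0_def pi_one)
  ultimately have "nrm A (d \<cdot> \<one>\<^bsub>A\<^esub>) \<le> K" using nrm_cells[OF d F(1,2), of "{}" K] by simp
  then show ?thesis using dc by simp
qed

text \<open>Characters are contractive, so on an approximant \<open>y n\<close> they exceed
  \<open>K\<close> by at most its distance from \<open>d\<close>, which tends to zero.\<close>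

lemma nrm_unit_fibre_le:
  assumes d: "d \<in> Bd unit" and K: "0 \<le> K" "!!x. x \<in> Es ==> cmod (ch x d) \<le> K"
  shows "nrm A d \<le> K"
proof -
  note dc = Bd_closed[OF d]
  obtain y where y: "!!n. y n \<in> lin_span A (Xs unit)" "converges A y d"
    using A.closed_span_approx[OF d[unfolded Bd_eq] Xs_subset] by metis
  note yc = lin_span_cells(1)[OF y(1)]
  have "nrm A (y n) \<le> K + nrm A (y n \<ominus>\<^bsub>A\<^esub> d)" for n
  proof (rule nrm_lin_span_le[OF y(1)])
    fix x assume x: "x \<in> Es"
    have "y n = (y n \<ominus>\<^bsub>A\<^esub> d) \<oplus>\<^bsub>A\<^esub> d" using yc dc by simp
    then have "ch x (y n) = ch x (y n \<ominus>\<^bsub>A\<^esub> d) + ch x d" using ch_linear(1)[OF x, of "y n \<ominus>\<^bsub>A\<^esub> d" d] yc dc by simp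
    then have "cmod (ch x (y n)) \<le> cmod (ch x (y n \<ominus>\<^bsub>A\<^esub> d)) + cmod (ch x d)" using norm_triangle_ineq by simp
    then show "cmod (ch x (y n)) \<le> K + nrm A (y n \<ominus>\<^bsub>A\<^esub> d)"
      using ch_le[OF x, of "y n \<ominus>\<^bsub>A\<^esub> d"] K(2)[OF x] yc dc by simp
  qed (use K yc dc in auto)
  moreover have "(\<lambda>n. K + nrm A (y n \<ominus>\<^bsub>A\<^esub> d)) \<longlonglongrightarrow> K"
    using tendsto_add[OF tendsto_const y(2)[unfolded converges_def]] by simp
  ultimately show ?thesis using LIMSEQ_le[OF A.converges_nrm[OF y(2) yc dc]] by blast
qed

text \<open>Makes the abstract localisation available for the bundle: \<open>ch_mult\<close>
  factorises the characters, and \<open>nrm_unit_fibre_le\<close> says that they determine the norm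
  of the unit fibre.\<close>

lemma section_module_hull: "section_module A (carrier G) Bd Es coeff ch (Bd unit)"
proof (intro section_module.intro section_module_axioms.intro A.cstar_alg_axioms)
  show "star A b \<cdot> b' \<in> Bd unit" if "g \<in> carrier G" "b \<in> Bd g" "b' \<in> Bd g" for g b b'
    using Bd_mult[OF Bd_star[OF that(2)] that(3)] that(1) by simp
  show "l \<in> Bd g" if "!!n. y n \<in> Bd g" "l \<in> carrier A" "converges A y l" for g y l by (rule Bd_limit[OF that])
  show "nrm A d \<le> K" if "d \<in> Bd unit" "0 \<le> K" "!!x. x \<in> Es ==> cmod (ch x d) \<le> K" for d K by (rule nrm_unit_fibre_le[OF that])
qed (simp_all add: Bd_linear Bd_closed ch_linear ch_mult coeff_linear ch_le)

end

section \<open>Finite sections of a Fell bundle\<close>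

locale fell_bundle = A: cstar_alg A + G: group G
  for A :: "'a star_algebra" (structure) and G :: "('g, 'n) monoid_scheme" +
  fixes B :: "'g => 'a set"
  assumes B_closed: "b \<in> B g ==> b \<in> carrier A"
    and B_zero: "\<zero> \<in> B g"
    and B_add: "b \<in> B g ==> b' \<in> B g ==> b \<oplus> b' \<in> B g"
    and B_smult: "b \<in> B g ==> c \<odot> b \<in> B g"
    and B_mult: "b \<in> B g ==> b' \<in> B h ==> b \<otimes> b' \<in> B (g \<otimes>\<^bsub>G\<^esub> h)"
    and B_star: "b \<in> B g ==> star A b \<in> B (inv\<^bsub>G\<^esub> g)"
    and B_one: "\<one> \<in> B \<one>\<^bsub>G\<^esub>"
begin

abbreviation gi where "gi \<equiv> m_inv G"
abbreviation FS where "FS \<equiv> finite_sections A G B"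

definition supp :: "('g => 'a) => 'g set" where
  "supp f = {g. f g \<noteq> \<zero>}"

definition single :: "'g => 'a => 'g => 'a" where
  "single g a = (\<lambda>h. if h = g then a else \<zero>)"

definition total :: "('g => 'a) => 'a" where
  "total f = finsum A f (supp f)"

lemma FS_simps:
  "mult FS = conv A G" "one FS = single \<one>\<^bsub>G\<^esub> \<one>" "zero FS = (\<lambda>g. \<zero>)" "add FS = (\<lambda>f h g. f g \<oplus> h g)"
  "smult FS = (\<lambda>c f g. c \<odot> f g)"
  "star FS = (\<lambda>f g. if g \<in> carrier G then star A (f (gi g)) else \<zero>)"
  "nrm FS = (\<lambda>f. \<Sum>g\<in>supp f. nrm A (f g))"
  by (auto simp: finite_sections_def single_def supp_def)

lemma FS_iff: "f \<in> carrier FS \<longleftrightarrow> (\<forall>g\<in>carrier G. f g \<in> B g) \<and> (\<forall>g. g \<notin> carrier G --> f g = \<zero>) \<and> finite (supp f)"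
  by (simp add: finite_sections_def supp_def)

lemma FS_D:
  assumes "f \<in> carrier FS"
  shows "g \<in> carrier G ==> f g \<in> B g" "f g \<in> carrier A" "g \<notin> carrier G ==> f g = \<zero>" "finite (supp f)" "supp f \<subseteq> carrier G"
  using assms B_closed by (auto simp: FS_iff supp_def) (metis A.zero_closed)

text \<open>With the sum taken over a common finite set, sections of different supports can be
  compared term by term.\<close>

lemma conv_superset:
  assumes "f \<in> carrier FS" "finite K" "supp f \<subseteq> K" "K \<subseteq> carrier G" "g \<in> carrier G" "!!g. u g \<in> carrier A"
  shows "conv A G f u g = finsum A (\<lambda>k. f k \<otimes> u (gi k \<otimes>\<^bsub>G\<^esub> g)) K"
proof -
  have "{k \<in> carrier G. f k \<noteq> \<zero>} = supp f" using FS_D(5)[OF assms(1)] by (auto simp: supp_def)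
  then have "conv A G f u g = finsum A (\<lambda>k. f k \<otimes> u (gi k \<otimes>\<^bsub>G\<^esub> g)) (supp f)" using assms(5) by (simp add: conv_def)
  also have "\<dots> = finsum A (\<lambda>k. f k \<otimes> u (gi k \<otimes>\<^bsub>G\<^esub> g)) K"
    by (rule A.finsum_eq_superset[OF assms(2,3)]) (use FS_D(2)[OF assms(1)] assms(6) in \<open>auto simp: supp_def\<close>)
  finally show ?thesis .
qed

lemma conv_supp:
  assumes "f \<in> carrier FS" "g \<in> carrier G" "!!g. u g \<in> carrier A"
  shows "conv A G f u g = finsum A (\<lambda>k. f k \<otimes> u (gi k \<otimes>\<^bsub>G\<^esub> g)) (supp f)"
  by (rule conv_superset) (use assms FS_D in auto)

lemma conv_closed: "f \<in> carrier FS ==> (!!g. u g \<in> carrier A) ==> conv A G f u g \<in> carrier A"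
  using FS_D(2) by (auto simp: conv_def intro!: A.finsum_closed)

lemma B_finsum: "(!!i. i \<in> F ==> f i \<in> B g) ==> finsum A f F \<in> B g"
proof (induction F rule: infinite_finite_induct)
  case (insert x F)
  have "finsum A f (insert x F) = f x \<oplus> finsum A f F"
    by (rule A.finsum_insert) (use insert B_closed in auto)
  then show ?case using insert by (simp add: B_add)
qed (simp_all add: B_zero)

lemma conv_fibre:
  assumes "f \<in> carrier FS" "g \<in> carrier G" "!!g. g \<in> carrier G ==> u g \<in> B g"
  shows "conv A G f u g \<in> B g"
proof -
  have "f k \<otimes> u (gi k \<otimes>\<^bsub>G\<^esub> g) \<in> B g" if "k \<in> carrier G" for k
    using B_mult[OF FS_D(1)[OF assms(1) that] assms(3), of "gi k \<otimes>\<^bsub>G\<^esub> g"] that assms(2)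
    by (simp add: G.m_assoc[symmetric])
  then show ?thesis using assms(2) by (auto simp: conv_def intro!: B_finsum)
qed

definition prods :: "'g set => 'g set => 'g set" where
  "prods X Y = (\<lambda>(a, b). a \<otimes>\<^bsub>G\<^esub> b) ` (X \<times> Y)"

lemma conv_supp_subset:
  assumes f: "f \<in> carrier FS" and h: "h \<in> carrier FS"
  shows "supp (conv A G f h) \<subseteq> prods (supp f) (supp h)"
proof
  fix c assume "c \<in> supp (conv A G f h)"
  then have nz: "conv A G f h c \<noteq> \<zero>" by (simp add: supp_def)
  then have c: "c \<in> carrier G" by (auto simp: conv_def split: if_splits)
  have "\<exists>a\<in>supp f. f a \<otimes> h (gi a \<otimes>\<^bsub>G\<^esub> c) \<noteq> \<zero>"
  proof (rule ccontr)
    assume "\<not> ?thesis"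
    then have "finsum A (\<lambda>a. f a \<otimes> h (gi a \<otimes>\<^bsub>G\<^esub> c)) (supp f) = finsum A (\<lambda>a. \<zero>) (supp f)"
      by (intro A.finsum_cong') auto
    then show False using nz conv_supp[OF f c, of h] FS_D(2)[OF h] by simp
  qed
  then obtain a where a: "a \<in> supp f" "f a \<otimes> h (gi a \<otimes>\<^bsub>G\<^esub> c) \<noteq> \<zero>" by blast
  have aG: "a \<in> carrier G" using a FS_D(5)[OF f] by blast
  have "gi a \<otimes>\<^bsub>G\<^esub> c \<in> supp h" using a FS_D(2)[OF f, of a] by (auto simp: supp_def)
  moreover have "c = a \<otimes>\<^bsub>G\<^esub> (gi a \<otimes>\<^bsub>G\<^esub> c)" using aG c by (simp add: G.m_assoc[symmetric])
  ultimately show "c \<in> prods (supp f) (supp h)" using a(1) by (force simp: prods_def)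
qed

lemma prods_finite: "f \<in> carrier FS ==> h \<in> carrier FS ==> finite (prods (supp f) (supp h))"
  "f \<in> carrier FS ==> h \<in> carrier FS ==> prods (supp f) (supp h) \<subseteq> carrier G"
  using FS_D(4,5) by (auto simp: prods_def dest!: subsetD)

lemma FS_mult_closed: "f \<in> carrier FS ==> h \<in> carrier FS ==> conv A G f h \<in> carrier FS"
  using conv_fibre[of f _ h] FS_D(1)[of h] finite_subset[OF conv_supp_subset prods_finite(1), of f h]
  by (auto simp: FS_iff) (simp add: conv_def)

text \<open>\<open>u\<close> is an arbitrary function into \<open>A\<close>: the same law gives
  associativity for finite sections, multiplicativity of the operators on square-summable sections,
  and multiplicativity of \<open>total\<close>.\<close>

lemma conv_assoc:
  assumes f: "f \<in> carrier FS" and h: "h \<in> carrier FS" and u: "!!g. u g \<in> carrier A"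
  shows "conv A G (conv A G f h) u = conv A G f (conv A G h u)"
proof
  fix g show "conv A G (conv A G f h) u g = conv A G f (conv A G h u) g"
  proof (cases "g \<in> carrier G")
    case g: True
    let ?X = "supp f" and ?Y = "supp h" and ?Z = "prods (supp f) (supp h)"
    note fc = FS_D(2)[OF f] and hc = FS_D(2)[OF h]
    have X: "finite ?X" "?X \<subseteq> carrier G" and Y: "finite ?Y" "?Y \<subseteq> carrier G" using FS_D(4,5) f h by auto
    note Z = prods_finite[OF f h]
    let ?t = "\<lambda>a c. f a \<otimes> h (gi a \<otimes>\<^bsub>G\<^esub> c) \<otimes> u (gi c \<otimes>\<^bsub>G\<^esub> g)"
    have "conv A G (conv A G f h) u g = finsum A (\<lambda>c. conv A G f h c \<otimes> u (gi c \<otimes>\<^bsub>G\<^esub> g)) ?Z"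
      by (rule conv_superset[OF FS_mult_closed[OF f h] Z(1) conv_supp_subset[OF f h] Z(2) g u])
    also have "\<dots> = finsum A (\<lambda>c. finsum A (\<lambda>a. ?t a c) ?X) ?Z"
    proof (rule A.finsum_cong')
      fix c assume "c \<in> ?Z"
      then have c: "c \<in> carrier G" using Z by blast
      show "conv A G f h c \<otimes> u (gi c \<otimes>\<^bsub>G\<^esub> g) = finsum A (\<lambda>a. ?t a c) ?X"
        unfolding conv_supp[OF f c hc] by (rule A.finsum_mult_r) (use fc hc u in auto)
    qed (use fc hc u in \<open>auto intro!: A.finsum_closed\<close>)
    also have "\<dots> = finsum A (\<lambda>a. finsum A (\<lambda>c. ?t a c) ?Z) ?X"
      by (rule A.finsum_swap) (use X Z fc hc u in auto)
    also have "\<dots> = finsum A (\<lambda>a. f a \<otimes> conv A G h u (gi a \<otimes>\<^bsub>G\<^esub> g)) ?X"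
    proof (rule A.finsum_cong')
      fix a assume aX: "a \<in> ?X"
      then have a: "a \<in> carrier G" using X by blast
      let ?aY = "(\<lambda>b. a \<otimes>\<^bsub>G\<^esub> b) ` ?Y"
      have inj: "inj_on (\<lambda>b. a \<otimes>\<^bsub>G\<^esub> b) ?Y" using a Y(2) by (metis G.inj_on_cmult inj_on_subset)
      have "finsum A (\<lambda>c. ?t a c) ?Z = finsum A (\<lambda>c. ?t a c) ?aY"
      proof (rule A.finsum_eq_superset[symmetric])
        show "?aY \<subseteq> ?Z" using aX by (auto simp: prods_def)
        show "?t a c = \<zero>" if "c \<in> ?Z - ?aY" for c
        proof -
          have c: "c \<in> carrier G" using that Z by blast
          have "gi a \<otimes>\<^bsub>G\<^esub> c \<notin> ?Y"
          proof
            assume "gi a \<otimes>\<^bsub>G\<^esub> c \<in> ?Y"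
            moreover have "c = a \<otimes>\<^bsub>G\<^esub> (gi a \<otimes>\<^bsub>G\<^esub> c)" using a c by (simp add: G.m_assoc[symmetric])
            ultimately show False using that by blast
          qed
          then show ?thesis using fc u by (simp add: supp_def)
        qed
      qed (use Z fc hc u in auto)
      also have "\<dots> = finsum A (\<lambda>b. ?t a (a \<otimes>\<^bsub>G\<^esub> b)) ?Y"
        by (rule A.finsum_reindex[OF _ inj]) (use fc hc u in auto)
      also have "\<dots> = finsum A (\<lambda>b. f a \<otimes> (h b \<otimes> u (gi b \<otimes>\<^bsub>G\<^esub> (gi a \<otimes>\<^bsub>G\<^esub> g)))) ?Y"
      proof (rule A.finsum_cong')
        fix b assume "b \<in> ?Y"
        then have b: "b \<in> carrier G" using Y by blast
        have "gi a \<otimes>\<^bsub>G\<^esub> (a \<otimes>\<^bsub>G\<^esub> b) = b" using a b by (simp add: G.m_assoc[symmetric])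
        then show "?t a (a \<otimes>\<^bsub>G\<^esub> b) = f a \<otimes> (h b \<otimes> u (gi b \<otimes>\<^bsub>G\<^esub> (gi a \<otimes>\<^bsub>G\<^esub> g)))"
          using a b g fc hc u by (simp add: A.m_assoc G.m_assoc G.inv_mult_group)
      qed (use fc hc u in auto)
      also have "\<dots> = f a \<otimes> conv A G h u (gi a \<otimes>\<^bsub>G\<^esub> g)"
      proof -
        have ag: "gi a \<otimes>\<^bsub>G\<^esub> g \<in> carrier G" using a g by simp
        show ?thesis unfolding conv_supp[OF h ag u] by (rule A.finsum_mult_l[symmetric]) (use fc hc u in auto)
      qed
      finally show "finsum A (\<lambda>c. ?t a c) ?Z = f a \<otimes> conv A G h u (gi a \<otimes>\<^bsub>G\<^esub> g)" .
    qed (use fc hc u conv_closed[OF h u] in auto)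
    also have "\<dots> = conv A G f (conv A G h u) g" by (rule conv_supp[OF f g conv_closed[OF h u], symmetric])
    finally show ?thesis .
  qed (simp add: conv_def)
qed

lemma supp_linear: "f \<in> carrier FS ==> h \<in> carrier FS ==> supp (\<lambda>g. f g \<oplus> h g) \<subseteq> supp f \<union> supp h"
  "f \<in> carrier FS ==> supp (\<lambda>g. c \<odot> f g) \<subseteq> supp f"
  by (auto simp: supp_def)

lemma FS_linear_closed:
  "f \<in> carrier FS ==> h \<in> carrier FS ==> f \<oplus>\<^bsub>FS\<^esub> h \<in> carrier FS" "f \<in> carrier FS ==> c \<odot>\<^bsub>FS\<^esub> f \<in> carrier FS"
proof -
  show "f \<in> carrier FS ==> h \<in> carrier FS ==> f \<oplus>\<^bsub>FS\<^esub> h \<in> carrier FS"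
    using finite_subset[OF supp_linear(1), of f h] by (auto simp: FS_simps FS_iff B_add)
  show "f \<in> carrier FS ==> c \<odot>\<^bsub>FS\<^esub> f \<in> carrier FS"
    using finite_subset[OF supp_linear(2), of f c] by (auto simp: FS_simps FS_iff B_smult)
qed

lemma single_supp: "supp (single g a) \<subseteq> {g}"
  by (auto simp: supp_def single_def)

lemma single_FS: "g \<in> carrier G ==> a \<in> B g ==> single g a \<in> carrier FS"
  using finite_subset[OF single_supp, of g a] by (auto simp: FS_iff single_def B_zero)

lemma conv_single:
  assumes g: "g \<in> carrier G" and a: "a \<in> B g" and u: "!!g. u g \<in> carrier A"
  shows "conv A G (single g a) u = (\<lambda>h. if h \<in> carrier G then a \<otimes> u (gi g \<otimes>\<^bsub>G\<^esub> h) else \<zero>)"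
proof
  fix h
  show "conv A G (single g a) u h = (if h \<in> carrier G then a \<otimes> u (gi g \<otimes>\<^bsub>G\<^esub> h) else \<zero>)"
  proof (cases "h \<in> carrier G")
    case True
    then have "conv A G (single g a) u h = finsum A (\<lambda>k. single g a k \<otimes> u (gi k \<otimes>\<^bsub>G\<^esub> h)) {g}"
      using g single_supp[of g a] by (intro conv_superset single_FS a u) auto
    then show ?thesis using True B_closed[OF a] u by (simp add: single_def)
  qed (simp add: conv_def)
qed

lemma supp_star: "f \<in> carrier FS ==> supp (star FS f) \<subseteq> (\<lambda>g. gi g) ` supp f"
proof
  fix g assume f: "f \<in> carrier FS" and "g \<in> supp (star FS f)"
  then have "g \<in> carrier G" "gi g \<in> supp f" by (auto simp: supp_def FS_simps split: if_splits)
  then show "g \<in> (\<lambda>g. gi g) ` supp f" by (intro image_eqI[of _ _ "gi g"]) auto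
qed

lemma FS_star_closed: "f \<in> carrier FS ==> star FS f \<in> carrier FS"
proof -
  assume f: "f \<in> carrier FS"
  have "star A (f (gi g)) \<in> B g" if "g \<in> carrier G" for g
    using B_star[OF FS_D(1)[OF f], of "gi g"] that by simp
  moreover have "finite (supp (star FS f))" by (rule finite_subset[OF supp_star[OF f]]) (use FS_D(4)[OF f] in simp)
  ultimately show ?thesis unfolding FS_iff by (simp add: FS_simps)
qed

lemma FS_star_mult:
  assumes f: "f \<in> carrier FS" and h: "h \<in> carrier FS"
  shows "star FS (conv A G f h) = conv A G (star FS h) (star FS f)"
proof
  fix g show "star FS (conv A G f h) g = conv A G (star FS h) (star FS f) g"
  proof (cases "g \<in> carrier G")
    case g: True
    note fc = FS_D(2)[OF f] and hc = FS_D(2)[OF h] and sh = FS_star_closed[OF h] and sf = FS_star_closed[OF f]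
    note shc = FS_D(2)[OF sh] and sfc = FS_D(2)[OF sf]
    let ?X = "supp f" and ?gX = "(\<lambda>a. g \<otimes>\<^bsub>G\<^esub> a) ` supp f"
    have X: "finite ?X" "?X \<subseteq> carrier G" using FS_D(4,5) f by auto
    let ?K = "supp (star FS h) \<union> ?gX"
    have K: "finite ?K" "?K \<subseteq> carrier G" using FS_D(4,5)[OF sh] X g by auto
    have inj: "inj_on (\<lambda>a. g \<otimes>\<^bsub>G\<^esub> a) ?X" using g X(2) by (metis G.inj_on_cmult inj_on_subset)
    have ig: "gi g \<in> carrier G" using g by simp
    let ?t = "\<lambda>k. star FS h k \<otimes> star FS f (gi k \<otimes>\<^bsub>G\<^esub> g)"
    have "conv A G (star FS h) (star FS f) g = finsum A ?t ?K"
      by (rule conv_superset[OF sh K(1) _ K(2) g sfc]) auto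
    also have "\<dots> = finsum A ?t ?gX"
    proof (rule A.finsum_eq_superset[symmetric, OF K(1)])
      show "?t k = \<zero>" if "k \<in> ?K - ?gX" for k
      proof -
        have k: "k \<in> carrier G" using that K by blast
        have "gi g \<otimes>\<^bsub>G\<^esub> k \<notin> ?X"
        proof
          assume "gi g \<otimes>\<^bsub>G\<^esub> k \<in> ?X"
          moreover have "k = g \<otimes>\<^bsub>G\<^esub> (gi g \<otimes>\<^bsub>G\<^esub> k)" using g k by (simp add: G.m_assoc[symmetric])
          ultimately show False using that by blast
        qed
        then have "star FS f (gi k \<otimes>\<^bsub>G\<^esub> g) = \<zero>" using g k by (simp add: FS_simps supp_def G.inv_mult_group)
        then show ?thesis using shc by simp
      qed
    qed (use shc sfc in auto)
    also have "\<dots> = finsum A (\<lambda>a. ?t (g \<otimes>\<^bsub>G\<^esub> a)) ?X"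
      by (rule A.finsum_reindex[OF _ inj]) (use shc sfc in auto)
    also have "\<dots> = finsum A (\<lambda>a. star A (f a \<otimes> h (gi a \<otimes>\<^bsub>G\<^esub> gi g))) ?X"
    proof (rule A.finsum_cong')
      fix a assume "a \<in> ?X"
      then have a: "a \<in> carrier G" using X by blast
      have e: "gi (gi (g \<otimes>\<^bsub>G\<^esub> a) \<otimes>\<^bsub>G\<^esub> g) = a"
        using a g by (simp add: G.inv_mult_group G.m_assoc)
      show "?t (g \<otimes>\<^bsub>G\<^esub> a) = star A (f a \<otimes> h (gi a \<otimes>\<^bsub>G\<^esub> gi g))"
        using a g fc hc e by (simp add: FS_simps A.star_mult) (simp add: G.inv_mult_group)
    qed (use fc hc in auto)
    also have "\<dots> = star A (conv A G f h (gi g))"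
      unfolding conv_supp[OF f ig hc] by (rule A.finsum_star) (use fc hc in auto)
    finally show ?thesis using g by (simp add: FS_simps)
  qed (simp add: conv_def FS_simps)
qed

lemma conv_add_l:
  assumes f: "f \<in> carrier FS" and h: "h \<in> carrier FS" and u: "!!g. u g \<in> carrier A"
  shows "conv A G (f \<oplus>\<^bsub>FS\<^esub> h) u = (\<lambda>g. conv A G f u g \<oplus> conv A G h u g)"
proof
  fix g show "conv A G (f \<oplus>\<^bsub>FS\<^esub> h) u g = conv A G f u g \<oplus> conv A G h u g"
  proof (cases "g \<in> carrier G")
    case g: True
    let ?K = "supp f \<union> supp h"
    have K: "finite ?K" "?K \<subseteq> carrier G" using FS_D(4,5) f h by auto
    have s: "supp (f \<oplus>\<^bsub>FS\<^esub> h) \<subseteq> ?K" using supp_linear(1)[OF f h] by (simp add: FS_simps)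
    show ?thesis
      unfolding conv_superset[OF f K(1) Un_upper1 K(2) g u] conv_superset[OF h K(1) Un_upper2 K(2) g u]
        conv_superset[OF FS_linear_closed(1)[OF f h] K(1) s K(2) g u]
      by (subst A.finsum_addf[symmetric])
        (use FS_D(2)[OF f] FS_D(2)[OF h] u in \<open>auto intro!: A.finsum_cong' simp: FS_simps A.l_distr\<close>)
  qed (simp add: conv_def)
qed

lemma conv_smult_l:
  assumes f: "f \<in> carrier FS" and u: "!!g. u g \<in> carrier A"
  shows "conv A G (c \<odot>\<^bsub>FS\<^esub> f) u = (\<lambda>g. c \<odot> conv A G f u g)"
proof
  fix g show "conv A G (c \<odot>\<^bsub>FS\<^esub> f) u g = c \<odot> conv A G f u g"
  proof (cases "g \<in> carrier G")
    case g: True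
    have s: "supp (c \<odot>\<^bsub>FS\<^esub> f) \<subseteq> supp f" using supp_linear(2)[OF f] by (simp add: FS_simps)
    show ?thesis
      unfolding conv_supp[OF f g u] conv_superset[OF FS_linear_closed(2)[OF f] FS_D(4)[OF f] s FS_D(5)[OF f] g u]
      by (subst A.finsum_smult[symmetric])
        (use FS_D(2)[OF f] u in \<open>auto intro!: A.finsum_cong' simp: FS_simps A.mult_smult_l\<close>)
  qed (simp add: conv_def)
qed

lemma conv_add_r:
  assumes f: "f \<in> carrier FS" and u: "!!g. u g \<in> carrier A" and v: "!!g. v g \<in> carrier A"
  shows "conv A G f (\<lambda>g. u g \<oplus> v g) = (\<lambda>g. conv A G f u g \<oplus> conv A G f v g)"
proof
  fix g show "conv A G f (\<lambda>g. u g \<oplus> v g) g = conv A G f u g \<oplus> conv A G f v g"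
  proof (cases "g \<in> carrier G")
    case g: True
    have s: "!!g. u g \<oplus> v g \<in> carrier A" using u v by simp
    show ?thesis
      unfolding conv_supp[OF f g u] conv_supp[OF f g v] conv_supp[OF f g s]
      by (subst A.finsum_addf[symmetric])
        (use FS_D(2)[OF f] u v in \<open>auto intro!: A.finsum_cong' simp: A.r_distr\<close>)
  qed (simp add: conv_def)
qed

lemma conv_smult_r:
  assumes f: "f \<in> carrier FS" and u: "!!g. u g \<in> carrier A"
  shows "conv A G f (\<lambda>g. c \<odot> u g) = (\<lambda>g. c \<odot> conv A G f u g)"
proof
  fix g show "conv A G f (\<lambda>g. c \<odot> u g) g = c \<odot> conv A G f u g"
  proof (cases "g \<in> carrier G")
    case g: True
    have s: "!!g. c \<odot> u g \<in> carrier A" using u by simp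
    show ?thesis
      unfolding conv_supp[OF f g u] conv_supp[OF f g s]
      by (subst A.finsum_smult[symmetric])
        (use FS_D(2)[OF f] u in \<open>auto intro!: A.finsum_cong' simp: A.mult_smult_r\<close>)
  qed (simp add: conv_def)
qed

lemma conv_one_r:
  assumes f: "f \<in> carrier FS" shows "conv A G f (single \<one>\<^bsub>G\<^esub> \<one>) = f"
proof
  have oc: "!!g. single \<one>\<^bsub>G\<^esub> \<one> g \<in> carrier A" by (simp add: single_def)
  fix g show "conv A G f (single \<one>\<^bsub>G\<^esub> \<one>) g = f g"
  proof (cases "g \<in> carrier G")
    case g: True
    let ?K = "insert g (supp f)"
    have K: "finite ?K" "?K \<subseteq> carrier G" "supp f \<subseteq> ?K" using FS_D(4,5) f g by auto
    let ?t = "\<lambda>k. f k \<otimes> single \<one>\<^bsub>G\<^esub> \<one> (gi k \<otimes>\<^bsub>G\<^esub> g)"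
    have "conv A G f (single \<one>\<^bsub>G\<^esub> \<one>) g = finsum A ?t ?K" by (rule conv_superset[OF f K(1,3,2) g oc])
    also have "\<dots> = finsum A ?t {g}"
    proof (rule A.finsum_eq_superset[symmetric, OF K(1)])
      show "?t k = \<zero>" if "k \<in> ?K - {g}" for k
      proof -
        have k: "k \<in> carrier G" "k \<noteq> g" using that K by auto
        then have "gi k \<otimes>\<^bsub>G\<^esub> g \<noteq> \<one>\<^bsub>G\<^esub>" using g by (metis G.inv_closed G.inv_equality G.inv_inv)
        then show ?thesis using FS_D(2)[OF f] by (simp add: single_def)
      qed
    qed (use FS_D(2)[OF f] oc in auto)
    also have "\<dots> = f g" using FS_D(2)[OF f] g by (simp add: single_def)
    finally show ?thesis .
  qed (simp add: conv_def FS_D(3)[OF f])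
qed

lemma star_alg_FS: "star_alg FS"
proof (rule star_algI)
  fix f h k c d assume f: "f \<in> carrier FS" and h: "h \<in> carrier FS" and k: "k \<in> carrier FS"
  note fc = FS_D(2)[OF f] and hc = FS_D(2)[OF h] and kc = FS_D(2)[OF k]
  show "f \<oplus>\<^bsub>FS\<^esub> h \<oplus>\<^bsub>FS\<^esub> k = f \<oplus>\<^bsub>FS\<^esub> (h \<oplus>\<^bsub>FS\<^esub> k)" using fc hc kc by (simp add: FS_simps A.a_assoc)
  show "f \<oplus>\<^bsub>FS\<^esub> h = h \<oplus>\<^bsub>FS\<^esub> f" using fc hc by (simp add: FS_simps A.a_comm)
  show "f \<otimes>\<^bsub>FS\<^esub> h \<otimes>\<^bsub>FS\<^esub> k = f \<otimes>\<^bsub>FS\<^esub> (h \<otimes>\<^bsub>FS\<^esub> k)" using conv_assoc[OF f h kc] by (simp add: FS_simps)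
  show "(f \<oplus>\<^bsub>FS\<^esub> h) \<otimes>\<^bsub>FS\<^esub> k = f \<otimes>\<^bsub>FS\<^esub> k \<oplus>\<^bsub>FS\<^esub> h \<otimes>\<^bsub>FS\<^esub> k" using conv_add_l[OF f h kc] by (simp add: FS_simps)
  show "k \<otimes>\<^bsub>FS\<^esub> (f \<oplus>\<^bsub>FS\<^esub> h) = k \<otimes>\<^bsub>FS\<^esub> f \<oplus>\<^bsub>FS\<^esub> k \<otimes>\<^bsub>FS\<^esub> h" using conv_add_r[OF k fc hc] by (simp add: FS_simps)
  show "(c \<odot>\<^bsub>FS\<^esub> f) \<otimes>\<^bsub>FS\<^esub> h = c \<odot>\<^bsub>FS\<^esub> (f \<otimes>\<^bsub>FS\<^esub> h)" using conv_smult_l[OF f hc] by (simp add: FS_simps)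
  show "f \<otimes>\<^bsub>FS\<^esub> (c \<odot>\<^bsub>FS\<^esub> h) = c \<odot>\<^bsub>FS\<^esub> (f \<otimes>\<^bsub>FS\<^esub> h)" using conv_smult_r[OF f hc] by (simp add: FS_simps)
  show "c \<odot>\<^bsub>FS\<^esub> (f \<oplus>\<^bsub>FS\<^esub> h) = c \<odot>\<^bsub>FS\<^esub> f \<oplus>\<^bsub>FS\<^esub> c \<odot>\<^bsub>FS\<^esub> h" using fc hc by (simp add: FS_simps A.smult_r_distr)
  show "star FS (f \<oplus>\<^bsub>FS\<^esub> h) = star FS f \<oplus>\<^bsub>FS\<^esub> star FS h" using fc hc by (auto simp: FS_simps A.star_add)
  show "star FS (f \<otimes>\<^bsub>FS\<^esub> h) = star FS h \<otimes>\<^bsub>FS\<^esub> star FS f" using FS_star_mult[OF f h] by (simp add: FS_simps(1))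
next
  fix f c d assume f: "f \<in> carrier FS"
  note fc = FS_D(2)[OF f]
  show "\<zero>\<^bsub>FS\<^esub> \<oplus>\<^bsub>FS\<^esub> f = f" using fc by (simp add: FS_simps)
  show "(-1) \<odot>\<^bsub>FS\<^esub> f \<oplus>\<^bsub>FS\<^esub> f = \<zero>\<^bsub>FS\<^esub>" using fc by (simp add: FS_simps A.l_neg flip: A.a_inv_smult)
  show "\<one>\<^bsub>FS\<^esub> \<otimes>\<^bsub>FS\<^esub> f = f"
    using conv_single[OF G.one_closed B_one fc] fc FS_D(3)[OF f] by (auto simp: FS_simps)
  show "f \<otimes>\<^bsub>FS\<^esub> \<one>\<^bsub>FS\<^esub> = f" using conv_one_r[OF f] by (simp add: FS_simps)
  show "(c + d) \<odot>\<^bsub>FS\<^esub> f = c \<odot>\<^bsub>FS\<^esub> f \<oplus>\<^bsub>FS\<^esub> d \<odot>\<^bsub>FS\<^esub> f" using fc by (simp add: FS_simps A.smult_l_distr)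
  show "c \<odot>\<^bsub>FS\<^esub> (d \<odot>\<^bsub>FS\<^esub> f) = (c * d) \<odot>\<^bsub>FS\<^esub> f" "1 \<odot>\<^bsub>FS\<^esub> f = f" using fc by (simp_all add: FS_simps)
  show "star FS (c \<odot>\<^bsub>FS\<^esub> f) = cnj c \<odot>\<^bsub>FS\<^esub> star FS f" using fc by (auto simp: FS_simps A.star_smult)
  show "star FS (star FS f) = f" using fc FS_D(3)[OF f] by (auto simp: FS_simps)
next
  show "\<zero>\<^bsub>FS\<^esub> \<in> carrier FS" by (simp add: FS_simps FS_iff B_zero supp_def)
  show "\<one>\<^bsub>FS\<^esub> \<in> carrier FS" using single_FS[OF G.one_closed B_one] by (simp add: FS_simps)
qed (simp_all add: FS_linear_closed FS_mult_closed FS_star_closed FS_simps(1))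

sublocale FS: star_alg "finite_sections A G B"
  by (rule star_alg_FS)

lemma nrm_FS_superset:
  assumes "f \<in> carrier FS" "finite K" "supp f \<subseteq> K" shows "nrm FS f = (\<Sum>g\<in>K. nrm A (f g))"
  unfolding FS_simps by (rule sum.mono_neutral_left) (use assms in \<open>auto simp: supp_def\<close>)

lemma nrm_FS_nonneg: "f \<in> carrier FS ==> 0 \<le> nrm FS f"
  unfolding FS_simps using FS_D(2) by (auto intro: sum_nonneg)

sublocale FS: prenormed_star_alg "finite_sections A G B"
  by unfold_locales (rule nrm_FS_nonneg)

section \<open>The sum of a finite section\<close>

lemma total_superset:
  assumes "f \<in> carrier FS" "finite K" "supp f \<subseteq> K" shows "total f = finsum A f K"
  unfolding total_def by (rule A.finsum_eq_superset) (use assms FS_D(2) in \<open>auto simp: supp_def\<close>)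

lemma total_closed: "f \<in> carrier FS ==> total f \<in> carrier A"
  unfolding total_def using FS_D(2) by (auto intro!: A.finsum_closed)

text \<open>Convolving with a constant section reduces multiplicativity of \<open>total\<close> to associativity.\<close>

lemma conv_const:
  assumes f: "f \<in> carrier FS" and a: "a \<in> carrier A"
  shows "conv A G f (\<lambda>g. if g \<in> carrier G then a else \<zero>) = (\<lambda>g. if g \<in> carrier G then total f \<otimes> a else \<zero>)"
proof
  fix g show "conv A G f (\<lambda>g. if g \<in> carrier G then a else \<zero>) g = (if g \<in> carrier G then total f \<otimes> a else \<zero>)"
  proof (cases "g \<in> carrier G")
    case g: True
    have "conv A G f (\<lambda>g. if g \<in> carrier G then a else \<zero>) g
      = finsum A (\<lambda>k. f k \<otimes> (if gi k \<otimes>\<^bsub>G\<^esub> g \<in> carrier G then a else \<zero>)) (supp f)"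
      by (rule conv_supp[OF f g]) (use a in auto)
    also have "\<dots> = finsum A (\<lambda>k. f k \<otimes> a) (supp f)"
      by (rule A.finsum_cong') (use g FS_D(2,5)[OF f] a in auto)
    also have "\<dots> = total f \<otimes> a"
      unfolding total_def by (rule A.finsum_mult_r[symmetric]) (use FS_D(2)[OF f] a in auto)
    finally show ?thesis using g by simp
  qed (simp add: conv_def)
qed

lemma total_mult:
  assumes f: "f \<in> carrier FS" and h: "h \<in> carrier FS"
  shows "total (f \<otimes>\<^bsub>FS\<^esub> h) = total f \<otimes> total h"
proof -
  let ?c = "\<lambda>a g. if g \<in> carrier G then a else \<zero>"
  have "conv A G (conv A G f h) (?c \<one>) \<one>\<^bsub>G\<^esub> = conv A G f (conv A G h (?c \<one>)) \<one>\<^bsub>G\<^esub>"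
    using conv_assoc[OF f h, of "?c \<one>"] by simp
  then show ?thesis
    unfolding conv_const[OF FS_mult_closed[OF f h] A.one_closed] conv_const[OF h A.one_closed] A.r_one[OF total_closed[OF h]]
      A.r_one[OF total_closed[OF FS_mult_closed[OF f h]]] conv_const[OF f total_closed[OF h]]
    by (simp add: FS_simps(1))
qed

lemma total_single: "g \<in> carrier G ==> a \<in> B g ==> total (single g a) = a"
  using total_superset[OF single_FS _ single_supp, of g a] B_closed[of a g] by (simp add: single_def)

lemma total_hom: "star_hom FS A total"
proof (rule star_homI)
  fix f h c assume f: "f \<in> carrier FS"
  note fc = FS_D(2)[OF f]
  show "total f \<in> carrier A" by (rule total_closed[OF f])
  have s: "supp (c \<odot>\<^bsub>FS\<^esub> f) \<subseteq> supp f" using supp_linear(2)[OF f] by (simp add: FS_simps)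
  have "total (c \<odot>\<^bsub>FS\<^esub> f) = finsum A (c \<odot>\<^bsub>FS\<^esub> f) (supp f)"
    by (rule total_superset[OF FS_linear_closed(2)[OF f] FS_D(4)[OF f] s])
  also have "\<dots> = c \<odot> finsum A f (supp f)"
    unfolding FS_simps by (rule A.finsum_smult) (use fc in auto)
  finally show "total (c \<odot>\<^bsub>FS\<^esub> f) = c \<odot> total f" by (simp add: total_def)
  let ?I = "(\<lambda>g. gi g) ` supp f"
  have I: "finite ?I" using FS_D(4)[OF f] by simp
  have inj: "inj_on (\<lambda>g. gi g) (supp f)" using FS_D(5)[OF f] by (intro inj_onI) (metis G.inv_inv subsetD)
  have "total (star FS f) = finsum A (star FS f) ?I" by (rule total_superset[OF FS_star_closed[OF f] I supp_star[OF f]])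
  also have "\<dots> = finsum A (\<lambda>g. star FS f (gi g)) (supp f)"
    by (rule A.finsum_reindex[OF _ inj]) (use FS_D(2)[OF FS_star_closed[OF f]] in auto)
  also have "\<dots> = finsum A (\<lambda>g. star A (f g)) (supp f)"
    by (rule A.finsum_cong') (use FS_D(5)[OF f] fc in \<open>auto simp: FS_simps\<close>)
  also have "\<dots> = star A (total f)" unfolding total_def by (rule A.finsum_star) (use fc in auto)
  finally show "total (star FS f) = star A (total f)" .
  assume h: "h \<in> carrier FS"
  note hc = FS_D(2)[OF h]
  show "total (f \<otimes>\<^bsub>FS\<^esub> h) = total f \<otimes> total h" by (rule total_mult[OF f h])
  let ?K = "supp f \<union> supp h"
  have K: "finite ?K" using FS_D(4) f h by auto
  have s: "supp (f \<oplus>\<^bsub>FS\<^esub> h) \<subseteq> ?K" using supp_linear(1)[OF f h] by (simp add: FS_simps)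
  show "total (f \<oplus>\<^bsub>FS\<^esub> h) = total f \<oplus> total h"
    unfolding total_superset[OF f K Un_upper1] total_superset[OF h K Un_upper2] total_superset[OF FS_linear_closed(1)[OF f h] K s]
    using fc hc by (simp add: FS_simps A.finsum_addf)
next
  show "total \<one>\<^bsub>FS\<^esub> = \<one>" using total_single[OF G.one_closed B_one] by (simp add: FS_simps)
qed

lemma nrm_total_le: "f \<in> carrier FS ==> nrm A (total f) \<le> nrm FS f"
  unfolding total_def FS_simps by (rule A.p_finsum) (use FS_D(2) in auto)

lemma nrm_FS_add: "f \<in> carrier FS ==> h \<in> carrier FS ==> nrm FS (f \<oplus>\<^bsub>FS\<^esub> h) \<le> nrm FS f + nrm FS h"
proof -
  assume f: "f \<in> carrier FS" and h: "h \<in> carrier FS"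
  let ?K = "supp f \<union> supp h"
  have K: "finite ?K" using FS_D(4) f h by auto
  have s: "supp (f \<oplus>\<^bsub>FS\<^esub> h) \<subseteq> ?K" using supp_linear(1)[OF f h] by (simp add: FS_simps)
  have "nrm FS (f \<oplus>\<^bsub>FS\<^esub> h) \<le> (\<Sum>g\<in>?K. nrm A (f g) + nrm A (h g))"
    unfolding nrm_FS_superset[OF FS_linear_closed(1)[OF f h] K s]
    by (rule sum_mono) (use FS_D(2)[OF f] FS_D(2)[OF h] in \<open>auto simp: FS_simps intro: A.p_add\<close>)
  then show ?thesis
    unfolding nrm_FS_superset[OF f K Un_upper1] nrm_FS_superset[OF h K Un_upper2] by (simp add: sum.distrib)
qed

lemma conv_single_single:
  assumes "g \<in> carrier G" "a \<in> B g" "h \<in> carrier G" "b \<in> B h"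
  shows "single g a \<otimes>\<^bsub>FS\<^esub> single h b = single (g \<otimes>\<^bsub>G\<^esub> h) (a \<otimes> b)"
proof -
  have bc: "!!k. single h b k \<in> carrier A" using B_closed[OF assms(4)] by (simp add: single_def)
  have "gi g \<otimes>\<^bsub>G\<^esub> k = h \<longleftrightarrow> k = g \<otimes>\<^bsub>G\<^esub> h" if "k \<in> carrier G" for k
    using assms(1,3) that by (metis G.inv_solve_left)
  then show ?thesis
    unfolding FS_simps(1) conv_single[OF assms(1,2) bc]
    using assms(1,3) B_closed[OF assms(2)] by (auto simp: single_def fun_eq_iff)
qed

lemma star_single: "g \<in> carrier G ==> a \<in> B g ==> star FS (single g a) = single (gi g) (star A a)"
  by (auto simp: FS_simps single_def fun_eq_iff)

lemma single_linear:
  "a \<in> carrier A ==> b \<in> carrier A ==> single g (a \<oplus> b) = single g a \<oplus>\<^bsub>FS\<^esub> single g b" "single g (c \<odot> a) = c \<odot>\<^bsub>FS\<^esub> single g a" "single g \<zero> = \<zero>\<^bsub>FS\<^esub>"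
  by (auto simp: FS_simps single_def fun_eq_iff)

lemma FS_decompose:
  assumes f: "f \<in> carrier FS" shows "f = finsum FS (\<lambda>g. single g (f g)) (supp f)"
proof -
  have sf: "single g (f g) \<in> carrier FS" if "g \<in> supp f" for g
    using FS_D(1,5)[OF f] that by (auto intro!: single_FS)
  have fin: "finsum FS (\<lambda>g. single g (f g)) K h = (if h \<in> K then f h else \<zero>)" if "finite K" "K \<subseteq> supp f" for K h
    using that
  proof (induction K)
    case empty then show ?case by (simp add: FS_simps)
  next
    case (insert g K)
    have "finsum FS (\<lambda>g. single g (f g)) (insert g K) = single g (f g) \<oplus>\<^bsub>FS\<^esub> finsum FS (\<lambda>g. single g (f g)) K"
      by (rule FS.finsum_insert) (use insert sf in auto)
    then show ?case using insert FS_D(2)[OF f] by (auto simp: FS_simps single_def)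
  qed
  show ?thesis using fin[OF FS_D(4)[OF f] order_refl] by (auto simp: fun_eq_iff supp_def)
qed

end

section \<open>Comparison of the regular representations\<close>

lemma (in cstar_alg) has_sum_in_reindex:
  assumes inj: "inj_on \<pi> I" and f: "f \<in> \<pi> ` I \<rightarrow> carrier A" and s: "has_sum_in A f (\<pi> ` I) s"
    and g: "!!i. i \<in> I ==> g i = f (\<pi> i)"
  shows "has_sum_in A g I s"
proof -
  have "((\<lambda>F. nrm A (finsum A f (\<pi> ` F) \<ominus> s)) \<longlongrightarrow> 0) (finite_subsets_at_top I)"
    using s unfolding has_sum_in_def filtermap_image_finite_subsets_at_top[OF inj, symmetric]
    by (simp add: filterlim_filtermap)
  moreover have "finsum A f (\<pi> ` F) = finsum A g F" if F: "finite F" "F \<subseteq> I" for F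
  proof -
    have "finsum A f (\<pi> ` F) = finsum A (\<lambda>i. f (\<pi> i)) F"
      using inj_on_subset[OF inj F(2)] f F by (intro finsum_reindex) auto
    also have "\<dots> = finsum A g F" by (rule finsum_cong') (use F f g in \<open>auto simp: Pi_def subset_iff\<close>)
    finally show ?thesis .
  qed
  ultimately have "((\<lambda>F. nrm A (finsum A g F \<ominus> s)) \<longlongrightarrow> 0) (finite_subsets_at_top I)"
    by (elim Lim_transform_eventually) (auto intro!: eventually_finite_subsets_at_top_weakI)
  then show ?thesis using s by (simp add: has_sum_in_def)
qed

text \<open>The zero section falls under the first case, as \<open>single\<close> of zero over the
  unit.\<close>

lemma (in fell_bundle) FS_induct [consumes 1, case_names single add]:
  assumes f: "f \<in> carrier FS" and single: "!!g a. g \<in> carrier G ==> a \<in> B g ==> Q (single g a)"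
    and add: "!!f h. f \<in> carrier FS ==> h \<in> carrier FS ==> Q f ==> Q h ==> Q (f \<oplus>\<^bsub>FS\<^esub> h)"
  shows "Q f"
proof -
  have "finsum FS (\<lambda>g. single g (f g)) K \<in> carrier FS \<and> Q (finsum FS (\<lambda>g. single g (f g)) K)"
    if "finite K" "K \<subseteq> carrier G" for K using that
  proof (induction K)
    case empty
    then show ?case using single[OF G.one_closed B_zero] by (simp add: single_linear(3))
  next
    case (insert g K)
    have s: "!!h. h \<in> insert g K ==> single h (f h) \<in> carrier FS" using insert FS_D(1)[OF f] by (auto intro!: single_FS)
    have "finsum FS (\<lambda>g. single g (f g)) (insert g K) = single g (f g) \<oplus>\<^bsub>FS\<^esub> finsum FS (\<lambda>g. single g (f g)) K"
      by (rule FS.finsum_insert) (use insert s in auto)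
    then show ?case using insert s add single[OF _ FS_D(1)[OF f]] by simp
  qed
  then show ?thesis using FS_decompose[OF f] FS_D(4,5)[OF f] by metis
qed

section \<open>Convolution operators on the Hilbert module\<close>

context semigroup_in_group
begin

sublocale FB: fell_bundle "cstar0 (I_l S)" G Bd
  by (intro fell_bundle.intro fell_bundle_axioms.intro A.cstar_alg_axioms G.group_axioms Bd_closed Bd_linear Bd_mult Bd_star one_Bd)

abbreviation FS where "FS \<equiv> FB.FS"
abbreviation total where "total \<equiv> FB.total"
abbreviation single where "single \<equiv> FB.single"

sublocale K: section_module "cstar0 (I_l S)" "carrier G" Bd Es coeff ch "Bd unit"
  by (rule section_module_hull)

lemma Phi_local:
  assumes b: "b \<in> Bd g" and u: "u \<in> I.H.E" and v: "v \<in> I.H.E" and eq: "!!q. link g q r ==> u q = v q"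
  shows "Phi b u r = Phi b v r"
proof -
  have "(\<lambda>i. u i + (-1) * v i) \<in> I.H.E" using I.H.E_lincomb[OF u v, of "-1"] by (simp add: complex_alg_simps)
  from Phi_support[OF b this, of r] eq have "Phi b (\<lambda>i. u i + (-1) * v i) r = 0" by simp
  then show ?thesis using Phi_linear[OF Bd_closed[OF b] u v, of "-1" r] by simp
qed

text \<open>\<open>Phi b (delta x)\<close> has at most one nonzero coordinate, and by
  \<open>ch_mult\<close> its square norm is the square modulus of the coefficient.\<close>

lemma N_Phi_delta:
  assumes x: "x \<in> Es" and b: "b \<in> Bd g"
  shows "I.H.N (Phi b (delta x)) = cmod (coeff x g b)"
proof -
  note dE = I.delta_E(1)[OF Es_P[OF x]] and bc = Bd_closed[OF b]
  let ?u = "Phi b (delta x)"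
  have uE: "?u \<in> I.H.E" by (rule Phi_E[OF bc dE])
  have "I.H.ip ?u ?u = I.H.ip (delta x) (Phi (star A b) ?u)" by (rule Phi_star[OF bc dE uE])
  also have "\<dots> = ch x (star A b \<cdot> b)"
    unfolding ch_def using bc dE by (simp add: Phi_mult I.ip_delta[OF Es_P[OF x]] Phi_E)
  also have "\<dots> = cnj (coeff x g b) * coeff x g b" by (rule ch_mult[OF x b b])
  finally have "(I.H.N ?u)\<^sup>2 = (cmod (coeff x g b))\<^sup>2"
    using I.H.N_square[OF uE] by (simp add: complex_alg_simps norm_mult power2_eq_square)
  then show ?thesis using I.H.N_nonneg[OF uE] by simp
qed

lemma link_iff: "x \<in> Es ==> g \<in> carrier G ==> link g x r \<longleftrightarrow> r \<in> left_hull S \<and> r \<noteq> Map.empty \<and> dom r = dom x \<and> deg r = g"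
  by (auto simp: link_def Es_def)

text \<open>The coefficient of a product is a coordinate of \<open>Phi b\<close> applied to
  \<open>Phi b' (delta x)\<close>, a vector whose norm is the modulus of
  \<open>coeff x h b'\<close>.\<close>

lemma coeff_mult_le:
  assumes x: "x \<in> Es" and k: "k \<in> carrier G" and h: "h \<in> carrier G" and b: "b \<in> Bd k" and b': "b' \<in> Bd h"
  shows "cmod (coeff x (k \<star> h) (b \<cdot> b')) \<le> nrm A b * cmod (coeff x h b')"
proof -
  note dE = I.delta_E(1)[OF Es_P[OF x]] and bc = Bd_closed[OF b] Bd_closed[OF b']
  show ?thesis
  proof (cases "\<exists>r. link (k \<star> h) x r")
    case True
    then obtain r where r: "link (k \<star> h) x r" by blast
    have "cmod (coeff x (k \<star> h) (b \<cdot> b')) = cmod (Phi b (Phi b' (delta x)) r)"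
      using coeff_link[OF r] Phi_mult[OF bc(1) dE bc(2)] by simp
    also have "\<dots> \<le> nrm A b * I.H.N (Phi b' (delta x))" by (rule cmod_Phi_le[OF bc(1) Phi_E[OF bc(2) dE]])
    finally show ?thesis using N_Phi_delta[OF x b'] by simp
  next
    case False
    then show ?thesis using bc by (simp add: coeff_def)
  qed
qed

abbreviation cv where "cv \<equiv> conv A G"

lemma cv_single:
  assumes "k \<in> carrier G" "b \<in> Bd k" "u \<in> K.E"
  shows "cv (single k b) u = (\<lambda>h. if h \<in> carrier G then b \<cdot> u (gi k \<star> h) else nul)"
  using FB.conv_single[OF assms(1,2) K.E_closed[OF assms(3)]] .

text \<open>Convolution with \<open>single k b\<close> shifts by \<open>k\<close> and costs at most
  a factor \<open>nrm A b\<close> at every character, so uniform tails outside \<open>F0\<close>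
  become uniform tails outside its translate by \<open>k\<close>.\<close>

lemma translate_E:
  assumes k: "k \<in> carrier G" and b: "b \<in> Bd k" and u: "u \<in> K.E"
  shows "cv (single k b) u \<in> K.E"
  unfolding K.ell2_iff
proof
  note bc = Bd_closed[OF b]
  have sB: "!!g. g \<in> carrier G ==> u g \<in> Bd g" using K.sectD(1)[OF K.E_sect[OF u]] .
  let ?v = "cv (single k b) u"
  have "?v g \<in> Bd g" if "g \<in> carrier G" for g
    by (rule FB.conv_fibre[OF FB.single_FS[OF k b] that sB])
  then show "K.sect ?v" by (simp add: K.sect_def conv_def)
  have Lle: "K.L ?v x F \<le> nrm A b * K.L u x ((\<lambda>g. gi k \<star> g) ` F)" if x: "x \<in> Es" and F: "F \<subseteq> carrier G" for x F
  proof -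
    have inj: "inj_on (\<lambda>g. gi k \<star> g) F" using k F by (metis G.inj_on_cmult G.inv_closed inj_on_subset)
    have le: "cmod (coeff x g (?v g)) \<le> nrm A b * cmod (coeff x (gi k \<star> g) (u (gi k \<star> g)))" if "g \<in> F" for g
    proof -
      have g: "g \<in> carrier G" "gi k \<star> g \<in> carrier G" using that F k by auto
      have "k \<star> (gi k \<star> g) = g" using g k by (simp add: G.m_assoc[symmetric])
      then show ?thesis using coeff_mult_le[OF x k g(2) b sB[OF g(2)]] g(1) by (simp add: cv_single[OF k b u])
    qed
    have "K.L ?v x F \<le> L2_set (\<lambda>g. nrm A b * cmod (coeff x (gi k \<star> g) (u (gi k \<star> g)))) F"
      unfolding K.L_def by (rule L2_set_mono) (use le in auto)
    also have "\<dots> = nrm A b * K.L u x ((\<lambda>g. gi k \<star> g) ` F)"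
      using A.p_nonneg[OF bc] inj by (simp add: K.L_def L2_set_right_distrib) (simp add: L2_set_def sum.reindex)
    finally show ?thesis .
  qed
  show "K.tail ?v" unfolding K.tail_def
  proof (intro allI impI)
    fix e :: real assume e: "e > 0"
    \<comment> \<open>The summand 1 keeps the denominator positive when \<open>b\<close>
      vanishes.\<close>
    define d where "d = e / (1 + nrm A b)"
    have pos: "1 + nrm A b > 0" using A.p_nonneg[OF bc] by simp
    then have d: "d > 0" "nrm A b * d \<le> e" using e by (simp_all add: d_def field_simps)
    obtain F0 where F0: "finite F0" "F0 \<subseteq> carrier G" "!!F x. finite F ==> F \<subseteq> carrier G - F0 ==> x \<in> Es ==> K.L u x F \<le> d"
      using u d(1) unfolding K.ell2_iff K.tail_def by metis
    let ?F0 = "(\<lambda>g. k \<star> g) ` F0"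
    have "K.L ?v x F \<le> e" if F: "finite F" "F \<subseteq> carrier G - ?F0" and x: "x \<in> Es" for F x
    proof -
      have "gi k \<star> g \<in> carrier G - F0" if g: "g \<in> F" for g
      proof -
        have gG: "g \<in> carrier G" using g F by blast
        have "k \<star> (gi k \<star> g) = g" using gG k by (simp add: G.m_assoc[symmetric])
        then have "gi k \<star> g \<notin> F0" using g F by (metis DiffD2 image_eqI subsetD)
        then show ?thesis using gG k by simp
      qed
      then have "K.L u x ((\<lambda>g. gi k \<star> g) ` F) \<le> d" using F(1) by (intro F0(3) x) auto
      then have "nrm A b * K.L u x ((\<lambda>g. gi k \<star> g) ` F) \<le> nrm A b * d" using A.p_nonneg[OF bc] by (rule mult_left_mono)
      moreover have "F \<subseteq> carrier G" using F by blast
      ultimately show ?thesis using Lle[OF x, of F] d(2) by linarith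
    qed
    moreover have "finite ?F0" "?F0 \<subseteq> carrier G" using F0(1,2) k by auto
    ultimately show "\<exists>F0. finite F0 \<and> F0 \<subseteq> carrier G \<and> (\<forall>F. finite F --> F \<subseteq> carrier G - F0 --> (\<forall>x\<in>Es. K.L ?v x F \<le> e))"
      by blast
  qed
qed

lemma cv_add:
  "f \<in> carrier FS ==> h \<in> carrier FS ==> u \<in> K.E ==> cv (f \<oplus>\<^bsub>FS\<^esub> h) u = (\<lambda>g. cv f u g \<oplus>\<^bsub>A\<^esub> cv h u g)"
  by (rule FB.conv_add_l) (simp_all add: K.E_closed)

lemma cv_E: "f \<in> carrier FS ==> u \<in> K.E ==> cv f u \<in> K.E"
  by (induction f rule: FB.FS_induct) (simp_all add: translate_E cv_add K.E_add)

text \<open>Replacing \<open>g\<close> by \<open>k \<star> g\<close> in the sum moves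
  \<open>b\<close> to the other side of the inner product as \<open>star A b\<close>.\<close>

lemma translate_adjoint:
  assumes k: "k \<in> carrier G" and b: "b \<in> Bd k" and u: "u \<in> K.E" and v: "v \<in> K.E"
  shows "K.ip (cv (single k b) u) v = K.ip u (cv (star FS (single k b)) v)"
proof -
  note bc = Bd_closed[OF b] and uc = K.E_closed[OF u] and vc = K.E_closed[OF v]
  note sE = translate_E[OF k b u]
  have ik: "gi k \<in> carrier G" using k by simp
  have star: "star FS (single k b) = single (gi k) (star A b)" by (rule FB.star_single[OF k b])
  note tE = translate_E[OF ik Bd_star[OF b] v]
  let ?f = "\<lambda>g. star A (cv (single k b) u g) \<cdot> v g"
  let ?g = "\<lambda>g. star A (u g) \<cdot> cv (single (gi k) (star A b)) v g"
  have img: "(\<lambda>g. k \<star> g) ` carrier G = carrier G" by (rule G.surj_const_mult[OF k])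
  have "has_sum_in A ?g (carrier G) (K.ip (cv (single k b) u) v)"
  proof (rule A.has_sum_in_reindex[of "\<lambda>g. k \<star> g" _ ?f])
    show "inj_on (\<lambda>g. k \<star> g) (carrier G)" by (rule G.inj_on_cmult[OF k])
    show "?f \<in> (\<lambda>g. k \<star> g) ` carrier G \<rightarrow> carrier A" using K.E_closed[OF sE] vc by simp
    show "has_sum_in A ?f ((\<lambda>g. k \<star> g) ` carrier G) (K.ip (cv (single k b) u) v)"
      unfolding img by (rule K.has_sum_ip[OF sE v])
    show "?g g = ?f (k \<star> g)" if g: "g \<in> carrier G" for g
    proof -
      have "gi k \<star> (k \<star> g) = g" using g k by (simp add: G.m_assoc[symmetric])
      then show ?thesis unfolding cv_single[OF k b u] cv_single[OF ik Bd_star[OF b] v]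
        using g k bc uc vc by (simp add: A.star_mult A.m_assoc)
    qed
  qed
  then show ?thesis unfolding star by (rule K.ip_eqI[OF _ K.E_sect[OF u] K.E_sect[OF tE], symmetric])
qed

lemma cv_adjoint:
  assumes "f \<in> carrier FS" and u: "u \<in> K.E" and v: "v \<in> K.E"
  shows "K.ip (cv f u) v = K.ip u (cv (star FS f) v)"
  using assms(1)
proof (induction f rule: FB.FS_induct)
  case (single g a)
  then show ?case by (rule translate_adjoint[OF _ _ u v])
next
  case (add f h)
  note sf = FB.FS_star_closed[OF add.hyps(1)] and sh = FB.FS_star_closed[OF add.hyps(2)]
  show ?case
    using add K.ip_add_l[OF v cv_E[OF add.hyps(1) u] cv_E[OF add.hyps(2) u]]
      K.ip_add_r[OF u cv_E[OF sf v] cv_E[OF sh v]]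
    by (simp add: cv_add[OF _ _ u] cv_add[OF sf sh v] FB.FS.star_add)
qed

text \<open>
  The functions supported on the partial maps with the domain of \<open>x\<close> form an invariant subspace of
  \<open>\<ell>\<^sup>2(I\<^sub>l(S))\<close>; \<open>slice x\<close> is the localisation of the Hilbert module at the character \<open>ch x\<close>, with
  values in this subspace.
\<close>

definition dclass :: "('a \<rightharpoonup> 'a) => ('a \<rightharpoonup> 'a) set" where
  "dclass x = {r \<in> left_hull S. r \<noteq> Map.empty \<and> dom r = dom x}"

definition slice where
  "slice x u r = (if r \<in> dclass x then coeff x (deg r) (u (deg r)) else 0)"

lemma dclass_link: "x \<in> Es ==> r \<in> dclass x ==> link (deg r) x r"
  by (auto simp: link_iff dclass_def)

lemma link_dclass: "x \<in> Es ==> g \<in> carrier G ==> link g x r \<longleftrightarrow> r \<in> dclass x \<and> deg r = g"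
  by (auto simp: link_iff dclass_def)

lemma dclass_P: "dclass x \<subseteq> carrier P"
  by (auto simp: dclass_def I_l_simps)

lemma deg_dclass: "r \<in> dclass x ==> deg r \<in> carrier G"
  by (auto simp: dclass_def)

lemma inj_deg_dclass: "inj_on deg (dclass x)"
proof (rule inj_onI)
  fix q r assume "q \<in> dclass x" "r \<in> dclass x" "deg q = deg r"
  then show "q = r" using deg_determines[of q r] by (simp add: dclass_def)
qed

lemma link_dclass_iff: "link g q r ==> q \<in> dclass x \<longleftrightarrow> r \<in> dclass x"
  by (auto simp: link_def dclass_def)

lemma L2_slice:
  assumes "F \<subseteq> dclass x"
  shows "L2_set (\<lambda>r. cmod (slice x u r)) F = K.L u x (deg ` F)"
proof -
  have inj: "inj_on deg F" by (rule inj_on_subset[OF inj_deg_dclass assms])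
  have "(\<Sum>r\<in>F. (cmod (slice x u r))\<^sup>2) = (\<Sum>r\<in>F. (cmod (coeff x (deg r) (u (deg r))))\<^sup>2)"
    by (rule sum.cong[OF refl]) (use assms in \<open>auto simp: slice_def\<close>)
  then show ?thesis using inj by (simp add: K.L_def L2_set_def sum.reindex)
qed

lemma slice_E:
  assumes x: "x \<in> Es" and u: "u \<in> K.E"
  shows "slice x u \<in> I.H.E" "I.H.N (slice x u) \<le> K.N u"
proof -
  have le: "L2_set (\<lambda>r. cmod (slice x u r)) F \<le> K.N u" if F: "finite F" "F \<subseteq> carrier P" for F
  proof -
    have "(\<Sum>r\<in>F. (cmod (slice x u r))\<^sup>2) = (\<Sum>r\<in>F \<inter> dclass x. (cmod (slice x u r))\<^sup>2)"
      by (rule sum.mono_neutral_right) (use F in \<open>auto simp: slice_def\<close>)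
    then have "L2_set (\<lambda>r. cmod (slice x u r)) F = L2_set (\<lambda>r. cmod (slice x u r)) (F \<inter> dclass x)"
      by (simp add: L2_set_def)
    also have "\<dots> = K.L u x (deg ` (F \<inter> dclass x))" by (rule L2_slice) simp
    also have "\<dots> \<le> K.N u" by (rule K.L_le_N[OF u _ _ x]) (use F deg_dclass in auto)
    finally show ?thesis .
  qed
  have out: "slice x u r = 0" if "r \<notin> carrier P" for r using that dclass_P[of x] by (auto simp: slice_def)
  show "slice x u \<in> I.H.E" by (rule I.hilb_bounded(1)[OF out K.N_nonneg[OF u] le])
  show "I.H.N (slice x u) \<le> K.N u" by (rule I.hilb_bounded(2)[OF out K.N_nonneg[OF u] le])
qed

text \<open>Within the class of \<open>x\<close> the degree is injective, and it reaches every group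
  element at which \<open>coeff x\<close> can be nonzero; so a partial norm of \<open>u\<close> at
  \<open>x\<close> is a partial norm of its slice. With \<open>slice_E\<close>, the norm of
  \<open>u\<close> is the supremum of the norms of its slices.\<close>

lemma L_le_slice:
  assumes x: "x \<in> Es" and u: "u \<in> K.E" and F: "finite F" "F \<subseteq> carrier G"
  shows "K.L u x F \<le> I.H.N (slice x u)"
proof -
  let ?R = "{r \<in> dclass x. deg r \<in> F}"
  have img: "deg ` ?R \<subseteq> F" by auto
  have fin: "finite ?R" by (rule inj_on_finite[OF inj_on_subset[OF inj_deg_dclass] img F(1)]) auto
  have "coeff x g (u g) = 0" if "g \<in> F - deg ` ?R" for g
    using that F link_dclass[OF x, of g] by (force simp: coeff_def)
  then have "(\<Sum>g\<in>F. (cmod (coeff x g (u g)))\<^sup>2) = (\<Sum>g\<in>deg ` ?R. (cmod (coeff x g (u g)))\<^sup>2)"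
    by (intro sum.mono_neutral_right) (use F img in auto)
  then have "K.L u x F = K.L u x (deg ` ?R)" by (simp add: K.L_def L2_set_def)
  also have "\<dots> = L2_set (\<lambda>r. cmod (slice x u r)) ?R" by (rule L2_slice[symmetric]) auto
  also have "\<dots> \<le> I.H.N (slice x u)"
    by (rule I.hilb_L2_le[OF slice_E(1)[OF x u] fin]) (use dclass_P in auto)
  finally show ?thesis .
qed

text \<open>At \<open>r\<close> both sides see only the degree \<open>gi k \<star> deg r\<close>
  within the same domain class: the left side through the coefficient of a product, the right side
  because \<open>b\<close> can reach \<open>r\<close> only from the one \<open>q\<close> linked to
  it.\<close>

lemma slice_translate:
  assumes x: "x \<in> Es" and k: "k \<in> carrier G" and b: "b \<in> Bd k" and u: "u \<in> K.E"
  shows "slice x (cv (single k b) u) = Phi b (slice x u)"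
proof
  fix r
  note dE = I.delta_E(1)[OF Es_P[OF x]] and bc = Bd_closed[OF b] and WE = slice_E(1)[OF x u]
  show "slice x (cv (single k b) u) r = Phi b (slice x u) r"
  proof (cases "r \<in> dclass x")
    case True
    let ?h = "gi k \<star> deg r"
    have r: "deg r \<in> carrier G" and h: "?h \<in> carrier G" using deg_dclass[OF True] k by auto
    have hB: "u ?h \<in> Bd ?h" by (rule K.sectD(1)[OF K.E_sect[OF u] h])
    have "slice x (cv (single k b) u) r = Phi (b \<cdot> u ?h) (delta x) r"
      using True r coeff_link[OF dclass_link[OF x True]] by (simp add: slice_def cv_single[OF k b u])
    also have "\<dots> = Phi b (Phi (u ?h) (delta x)) r" by (simp add: Phi_mult[OF bc dE] Bd_closed[OF hB])
    also have "\<dots> = Phi b (slice x u) r"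
    proof (rule Phi_local[OF b Phi_E[OF Bd_closed[OF hB] dE] WE])
      fix q assume l: "link k q r"
      then have q: "q \<in> dclass x" using link_dclass_iff True by blast
      have "deg r = k \<star> deg q" using l by (simp add: link_def)
      then have "?h = deg q" using k deg_dclass[OF q] by (simp add: G.m_assoc[symmetric])
      then show "Phi (u ?h) (delta x) q = slice x u q"
        using q coeff_link[OF dclass_link[OF x q]] by (simp add: slice_def)
    qed
    finally show ?thesis .
  next
    case False
    have "slice x u q = 0" if "link k q r" for q
      using link_dclass_iff[OF that, of x] False by (simp add: slice_def)
    then have "Phi b (slice x u) r = 0" by (rule Phi_support[OF b WE])
    then show ?thesis using False by (simp add: slice_def)
  qed
qed

lemma total_closed: "f \<in> carrier FS ==> total f \<in> carrier A"
  by (rule FB.total_closed)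

lemma total_add:
  "f \<in> carrier FS ==> h \<in> carrier FS ==> total (f \<oplus>\<^bsub>FS\<^esub> h) = total f \<oplus>\<^bsub>A\<^esub> total h"
  using star_homD(3)[OF FB.total_hom] .

lemma slice_cv:
  assumes "f \<in> carrier FS" and x: "x \<in> Es" and u: "u \<in> K.E"
  shows "slice x (cv f u) = Phi (total f) (slice x u)"
  using assms(1)
proof (induction f rule: FB.FS_induct)
  case (single g a)
  then show ?case by (simp add: FB.total_single slice_translate[OF x _ _ u])
next
  case (add f h)
  have "slice x (cv (f \<oplus>\<^bsub>FS\<^esub> h) u) r = slice x (cv f u) r + slice x (cv h u) r" for r
    unfolding cv_add[OF add.hyps u] slice_def
    using K.E_closed[OF cv_E[OF add.hyps(1) u]] K.E_closed[OF cv_E[OF add.hyps(2) u]] by (simp add: coeff_linear(1)[OF x])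
  then show ?case
    using add Phi_add[OF total_closed[OF add.hyps(1)] slice_E(1)[OF x u] total_closed[OF add.hyps(2)]]
    by (simp add: fun_eq_iff total_add)
qed

text \<open>Each slice of \<open>cv f u\<close> is \<open>Phi (total f)\<close> applied to the same
  slice of \<open>u\<close>, so this operator bounds the convolution.\<close>

lemma N_cv_le:
  assumes f: "f \<in> carrier FS" and u: "u \<in> K.E"
  shows "K.N (cv f u) \<le> nrm I.H.Ops (Phi (total f)) * K.N u"
proof -
  note T = Phi_closed[OF total_closed[OF f]]
  have n: "0 \<le> nrm I.H.Ops (Phi (total f))" by (rule I.H.Ops_norm_nonneg[OF T])
  show ?thesis
  proof (rule K.N_leI[OF cv_E[OF f u]])
    fix x F assume x: "x \<in> Es" and F: "finite F" "F \<subseteq> carrier G"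
    have "K.L (cv f u) x F \<le> I.H.N (Phi (total f) (slice x u))"
      using L_le_slice[OF x cv_E[OF f u] F] by (simp add: slice_cv[OF f x u])
    also have "\<dots> \<le> nrm I.H.Ops (Phi (total f)) * I.H.N (slice x u)"
      by (rule I.H.Ops_bound[OF T slice_E(1)[OF x u]])
    also have "\<dots> \<le> nrm I.H.Ops (Phi (total f)) * K.N u"
      by (rule mult_left_mono[OF slice_E(2)[OF x u] n])
    finally show "K.L (cv f u) x F \<le> nrm I.H.Ops (Phi (total f)) * K.N u" .
  qed (use n u in auto)
qed

abbreviation reg where "reg \<equiv> left_regular A G Bd"

lemma reg_restrict: "reg f = restrict (cv f) K.E"
  by (simp add: left_regular_def)

lemma reg_pair: "f \<in> carrier FS ==> K.adjoint_pair (cv f) (cv (star FS f)) (nrm I.H.Ops (Phi (total f)))"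
  unfolding K.adjoint_pair_def using cv_E cv_adjoint N_cv_le FB.FS_star_closed I.H.Ops_norm_nonneg[OF Phi_closed[OF total_closed]]
  by (auto simp del: FB.FS.star_closed)

lemma reg_closed: "f \<in> carrier FS ==> reg f \<in> carrier K.Ops"
  and reg_star: "f \<in> carrier FS ==> star K.Ops (reg f) = reg (star FS f)"
  unfolding reg_restrict using K.op_mem[OF reg_pair] by blast+

lemma reg_hom: "star_hom FS K.Ops reg"
proof (rule star_homI)
  fix f h c assume f: "f \<in> carrier FS"
  show "reg f \<in> carrier K.Ops" by (rule reg_closed[OF f])
  show "reg (star FS f) = star K.Ops (reg f)" by (rule reg_star[OF f, symmetric])
  show "reg (c \<odot>\<^bsub>FS\<^esub> f) = c \<odot>\<^bsub>K.Ops\<^esub> reg f"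
    unfolding K.Ops_simps using FB.conv_smult_l[OF f] K.E_closed by (simp add: reg_restrict restrict_def cong: if_cong)
  assume h: "h \<in> carrier FS"
  show "reg (f \<oplus>\<^bsub>FS\<^esub> h) = reg f \<oplus>\<^bsub>K.Ops\<^esub> reg h"
    unfolding K.Ops_simps using cv_add[OF f h] by (simp add: reg_restrict restrict_def cong: if_cong)
  show "reg (f \<otimes>\<^bsub>FS\<^esub> h) = reg f \<otimes>\<^bsub>K.Ops\<^esub> reg h"
    unfolding K.Ops_simps using FB.conv_assoc[OF f h] K.E_closed cv_E[OF h] by (simp add: reg_restrict restrict_def FB.FS_simps cong: if_cong)
next
  have "cv (single unit \<one>\<^bsub>A\<^esub>) u = u" if u: "u \<in> K.E" for u
    unfolding cv_single[OF G.one_closed one_Bd u] using K.E_sect[OF u] K.E_closed[OF u] by (simp add: K.sect_def fun_eq_iff)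
  then show "reg \<one>\<^bsub>FS\<^esub> = \<one>\<^bsub>K.Ops\<^esub>"
    unfolding K.Ops_simps by (simp add: reg_restrict fun_eq_iff restrict_def FB.FS_simps)
qed

lemma nrm_reg_le: "f \<in> carrier FS ==> nrm K.Ops (reg f) \<le> nrm I.H.Ops (Phi (total f))"
  by (rule K.Ops_norm_le) (use N_cv_le I.H.Ops_norm_nonneg[OF Phi_closed[OF total_closed]] in \<open>auto simp: reg_restrict\<close>)

text \<open>The source idempotent of \<open>r\<close> belongs to \<open>Es\<close> and has the
  domain of \<open>r\<close>, so the classes \<open>dclass x\<close> with \<open>x\<close> in
  \<open>Es\<close> exhaust the nonempty maps.\<close>

lemma domain_idempotent:
  assumes r: "r \<in> left_hull S" "r \<noteq> Map.empty"
  shows "inv_map r \<circ>\<^sub>m r \<in> Es" "dom (inv_map r \<circ>\<^sub>m r) = dom r" "r \<circ>\<^sub>m (inv_map r \<circ>\<^sub>m r) = r"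
proof -
  let ?e = "inv_map r \<circ>\<^sub>m r"
  have e: "?e z = Some z" if "r z = Some w" for z w
    using that by (auto simp: map_comp_Some_iff inv_map_iff[OF r(1)])
  have dom: "dom ?e \<subseteq> dom r" by (auto simp: dom_def map_comp_Some_iff)
  then show d: "dom ?e = dom r" using e by (fastforce simp: dom_def)
  have inv: "inv_map r \<in> left_hull S" "?e \<in> left_hull S" using r(1) by (auto intro: left_hull.intros)
  have ne: "?e \<noteq> Map.empty" using d r(2) by (metis dom_eq_empty_conv)
  have "deg ?e = unit" using deg_comp[OF inv(1) r(1) ne] deg_inv[OF r] deg_closed[OF r(1)] by simp
  then show "?e \<in> Es" using inv ne by (simp add: Es_def)
  show "r \<circ>\<^sub>m ?e = r"
  proof
    fix z show "(r \<circ>\<^sub>m ?e) z = r z"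
    proof (cases "r z")
      case None
      then have "?e z = None" using dom by (metis domIff subsetD)
      then show ?thesis using None by (simp add: map_comp_def)
    next
      case (Some w)
      then show ?thesis using e[OF Some] by (simp add: map_comp_def)
    qed
  qed
qed

lemma coeff_pi_le: "y \<in> Es ==> r \<in> left_hull S ==> cmod (coeff y g (pi r)) \<le> 1"
  using Phi_pi[OF _ I.delta_E(1)[OF Es_P]] by (auto simp: coeff_def delta_def)

text \<open>\<open>x\<close> is the source idempotent of \<open>r\<close>, so \<open>pi r\<close>
  sends \<open>delta x\<close> to the basis vector \<open>r\<close>.\<close>

lemma coeff_pi:
  assumes x: "x \<in> Es" and r: "r \<in> dclass x"
  shows "coeff x (deg r) (pi r) = 1"
proof -
  have rh: "r \<in> left_hull S" "r \<noteq> Map.empty" and d: "dom r = dom x" using r by (auto simp: dclass_def)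
  note e = domain_idempotent[OF rh]
  have "inv_map r \<circ>\<^sub>m r = x"
    by (rule deg_determines) (use e d x in \<open>auto simp: Es_def\<close>)
  then show ?thesis
    unfolding coeff_link[OF dclass_link[OF x r]] Phi_pi[OF rh(1) I.delta_E(1)[OF Es_P[OF x]]]
    using rh e(3) by (simp add: delta_def)
qed

section \<open>Splitting vectors by domain, and the reverse norm estimate\<close>

definition cut :: "('a \<rightharpoonup> 'a) => (('a \<rightharpoonup> 'a) => complex) => ('a \<rightharpoonup> 'a) => complex" where
  "cut x v r = (if r \<in> dclass x then v r else 0)"

text \<open>A section with slice \<open>cut x v\<close> at \<open>x\<close>: the coordinate at
  \<open>r\<close> becomes a multiple of \<open>pi r\<close> in the fibre over \<open>deg r\<close>.
  It lifts a vector of one invariant subspace to the Hilbert module without increasing the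
  norm.\<close>

definition spread where
  "spread x v g = (if g \<in> deg ` dclass x
     then v (inv_into (dclass x) deg g) \<odot>\<^bsub>A\<^esub> pi (inv_into (dclass x) deg g) else nul)"

lemma spread_deg: "r \<in> dclass x ==> spread x v (deg r) = v r \<odot>\<^bsub>A\<^esub> pi r"
  by (simp add: spread_def inj_deg_dclass)

lemma dclass_hull: "r \<in> dclass x ==> r \<in> left_hull S"
  by (simp add: dclass_def)

lemma slice_spread: "x \<in> Es ==> slice x (spread x v) = cut x v"
  using coeff_pi[of x] dclass_hull
  by (auto simp: fun_eq_iff slice_def cut_def spread_deg coeff_linear(2) pi_closed)

lemma cut_E:
  assumes v: "v \<in> I.H.E" shows "cut x v \<in> I.H.E"
proof (rule I.hilb_bounded(1)[OF _ I.H.N_nonneg[OF v]])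
  show "L2_set (\<lambda>r. cmod (cut x v r)) F \<le> I.H.N v" if F: "finite F" "F \<subseteq> carrier P" for F
    by (rule order_trans[OF L2_set_mono I.hilb_L2_le[OF v F]]) (simp_all add: cut_def)
qed (use I.hilb_outside[OF v] in \<open>simp add: cut_def\<close>)

text \<open>All coefficients of \<open>pi r\<close> have modulus at most one, so the characters at
  other domains see no more of the section than the one at \<open>x\<close>.\<close>

lemma L_spread_le:
  assumes y: "y \<in> Es" and F: "finite F" "F \<subseteq> carrier G"
  shows "K.L (spread x v) y F \<le> L2_set (\<lambda>r. cmod (cut x v r)) {r \<in> dclass x. deg r \<in> F}"
    and "finite {r \<in> dclass x. deg r \<in> F}"
proof -
  let ?R = "{r \<in> dclass x. deg r \<in> F}"
  have img: "deg ` ?R \<subseteq> F" by auto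
  have inj: "inj_on deg ?R" by (rule inj_on_subset[OF inj_deg_dclass]) auto
  show fin: "finite ?R" by (rule inj_on_finite[OF inj img F(1)])
  have z: "coeff y g nul = 0" for g using coeff_linear(2)[OF y A.zero_closed, of g 0] by simp
  have "(\<Sum>g\<in>F. (cmod (coeff y g (spread x v g)))\<^sup>2) = (\<Sum>g\<in>deg ` ?R. (cmod (coeff y g (spread x v g)))\<^sup>2)"
    by (rule sum.mono_neutral_right) (use F img in \<open>auto simp: spread_def z\<close>)
  also have "\<dots> = (\<Sum>r\<in>?R. (cmod (coeff y (deg r) (spread x v (deg r))))\<^sup>2)"
    by (simp add: sum.reindex[OF inj])
  finally have "K.L (spread x v) y F = L2_set (\<lambda>r. cmod (coeff y (deg r) (spread x v (deg r)))) ?R"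
    by (simp add: K.L_def L2_set_def)
  also have "\<dots> \<le> L2_set (\<lambda>r. cmod (cut x v r)) ?R"
  proof (rule L2_set_mono)
    fix r assume "r \<in> ?R"
    then have r: "r \<in> dclass x" by simp
    have "cmod (v r) * cmod (coeff y (deg r) (pi r)) \<le> cmod (v r) * 1"
      by (rule mult_left_mono[OF coeff_pi_le[OF y dclass_hull[OF r]]]) simp
    then show "cmod (coeff y (deg r) (spread x v (deg r))) \<le> cmod (cut x v r)"
      using r by (simp add: spread_deg cut_def coeff_linear(2)[OF y] pi_closed[OF dclass_hull] norm_mult)
  qed simp
  finally show "K.L (spread x v) y F \<le> L2_set (\<lambda>r. cmod (cut x v r)) ?R" .
qed

lemma spread_E:
  assumes v: "v \<in> I.H.E"
  shows "spread x v \<in> K.E" "K.N (spread x v) \<le> I.H.N (cut x v)"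
proof -
  note cE = cut_E[OF v, of x]
  have "spread x v g \<in> Bd g" for g
  proof (cases "g \<in> deg ` dclass x")
    case True
    then obtain r where r: "r \<in> dclass x" "g = deg r" by blast
    show ?thesis unfolding r(2) spread_deg[OF r(1)] by (intro Bd_linear(3) pi_Bd dclass_hull[OF r(1)]) simp
  qed (simp add: spread_def Bd_linear(1))
  then have "K.sect (spread x v)" using deg_dclass by (auto simp: K.sect_def spread_def)
  moreover have "K.tail (spread x v)" unfolding K.tail_def
  proof (intro allI impI)
    fix e :: real assume "e > 0"
    then obtain F0 where F0: "finite F0" "F0 \<subseteq> carrier P"
      "!!F. finite F ==> F \<subseteq> carrier P - F0 ==> I.H.L (cut x v) () F \<le> e"
      using cE unfolding I.H.ell2_iff I.H.tail_def by (metis UNIV_I)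
    have "K.L (spread x v) y F \<le> e" if F: "finite F" "F \<subseteq> carrier G - deg ` (F0 \<inter> dclass x)" and y: "y \<in> Es" for F y
    proof -
      have "F \<subseteq> carrier G" using F by blast
      note le = L_spread_le(1)[OF y F(1) this, of x v] L_spread_le(2)[OF y F(1) this, of x]
      have "{r \<in> dclass x. deg r \<in> F} \<subseteq> carrier P - F0" using F(2) dclass_P by blast
      then show ?thesis using le(1) F0(3)[OF le(2)] by (simp add: I.H_L)
    qed
    then show "\<exists>F0. finite F0 \<and> F0 \<subseteq> carrier G \<and> (\<forall>F. finite F --> F \<subseteq> carrier G - F0 --> (\<forall>y\<in>Es. K.L (spread x v) y F \<le> e))"
      using F0(1) deg_dclass by (intro exI[of _ "deg ` (F0 \<inter> dclass x)"]) auto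
  qed
  ultimately show E: "spread x v \<in> K.E" by (simp add: K.ell2_iff)
  show "K.N (spread x v) \<le> I.H.N (cut x v)"
  proof (rule K.N_leI[OF E I.H.N_nonneg[OF cE]])
    fix y F assume y: "y \<in> Es" and F: "finite F" "F \<subseteq> carrier G"
    note le = L_spread_le(1)[OF y F, of x v] L_spread_le(2)[OF y F, of x]
    have "{r \<in> dclass x. deg r \<in> F} \<subseteq> carrier P" using dclass_P by blast
    then show "K.L (spread x v) y F \<le> I.H.N (cut x v)" using le(1) I.hilb_L2_le[OF cE le(2)] by linarith
  qed
qed

lemma has_sum_N: "v \<in> I.H.E ==> ((\<lambda>r. (cmod (v r))\<^sup>2) has_sum (I.H.N v)\<^sup>2) (carrier P)"
proof -
  assume v: "v \<in> I.H.E"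
  have sq: "cnj z * z = complex_of_real ((cmod z)\<^sup>2)" for z by (metis complex_norm_square mult.commute of_real_power)
  have hs: "((\<lambda>r. (cmod (v r))\<^sup>2) has_sum Re (I.H.ip v v)) (carrier P)"
    using has_sum_Re[OF I.has_sum_hilb_ip[OF v v]] unfolding sq Re_complex_of_real .
  have hc: "((\<lambda>r. complex_of_real ((cmod (v r))\<^sup>2)) has_sum I.H.ip v v) (carrier P)"
    using I.has_sum_hilb_ip[OF v v] unfolding sq .
  have ip: "I.H.ip v v = complex_of_real (Re (I.H.ip v v))"
    by (rule has_sum_unique[OF hc has_sum_of_real[OF hs]])
  have "0 \<le> Re (I.H.ip v v)" by (rule has_sum_nonneg[OF hs]) simp
  then have "cmod (I.H.ip v v) = Re (I.H.ip v v)" by (subst ip) (simp only: norm_of_real abs_of_nonneg)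
  then show ?thesis using hs I.H.N_square[OF v] by (simp add: complex_alg_simps)
qed

text \<open>Bessel's inequality: the classes of distinct members of \<open>Es\<close> are disjoint,
  so each coordinate is counted at most once.\<close>

lemma sum_cut_le:
  assumes v: "v \<in> I.H.E" and X: "finite X" "X \<subseteq> Es"
  shows "(\<Sum>x\<in>X. (I.H.N (cut x v))\<^sup>2) \<le> (I.H.N v)\<^sup>2"
proof -
  have "((\<lambda>r. \<Sum>x\<in>X. (cmod (cut x v r))\<^sup>2) has_sum (\<Sum>x\<in>X. (I.H.N (cut x v))\<^sup>2)) (carrier P)"
    using X(1) by (induction X) (auto intro!: has_sum_add has_sum_N cut_E v)
  moreover have "(\<Sum>x\<in>X. (cmod (cut x v r))\<^sup>2) \<le> (cmod (v r))\<^sup>2" for r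
  proof (cases "\<exists>x\<in>X. r \<in> dclass x")
    case True
    then obtain x where x: "x \<in> X" "r \<in> dclass x" by blast
    have "y = x" if "y \<in> X" "r \<in> dclass y" for y
    proof -
      have "x \<in> Es" "y \<in> Es" using that x X(2) by auto
      then show ?thesis using that x by (intro deg_determines) (simp_all add: Es_def dclass_def)
    qed
    then have "cut y v r = 0" if "y \<in> X - {x}" for y using that by (auto simp: cut_def)
    then have "(\<Sum>y\<in>X - {x}. (cmod (cut y v r))\<^sup>2) = 0" by (intro sum.neutral) simp
    then show ?thesis using sum.remove[OF X(1) x(1), of "\<lambda>y. (cmod (cut y v r))\<^sup>2"] by (simp add: cut_def)
  next
    case False
    then have "(\<Sum>x\<in>X. (cmod (cut x v r))\<^sup>2) = 0" by (intro sum.neutral) (auto simp: cut_def)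
    then show ?thesis by simp
  qed
  ultimately show ?thesis by (intro has_sum_mono[OF _ has_sum_N[OF v]])
qed

lemma Phi_total_local:
  assumes "f \<in> carrier FS" and u: "u \<in> I.H.E" and v: "v \<in> I.H.E" and eq: "!!g q. link g q r ==> u q = v q"
  shows "Phi (total f) u r = Phi (total f) v r"
  using assms(1)
proof (induction f rule: FB.FS_induct)
  case (single g a)
  show ?case unfolding FB.total_single[OF single] by (rule Phi_local[OF single(2) u v eq])
next
  case (add f h)
  then show ?case by (simp add: total_add Phi_add[OF total_closed] u v total_closed)
qed

text \<open>\<open>Phi (total f)\<close> respects the decomposition by domains. On one summand it is
  a slice of \<open>cv f\<close> applied to \<open>spread\<close>, hence bounded by
  \<open>nrm K.Ops (reg f)\<close>; orthogonality of the summands gives the same bound for the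
  whole.\<close>

lemma nrm_reg_ge:
  assumes f: "f \<in> carrier FS" shows "nrm I.H.Ops (Phi (total f)) \<le> nrm K.Ops (reg f)"
proof (rule I.H.Ops_norm_le)
  let ?a = "total f" and ?K = "nrm K.Ops (reg f)"
  show K0: "0 \<le> ?K" by (rule K.Ops_norm_nonneg[OF reg_closed[OF f]])
  fix v assume v: "v \<in> I.H.E"
  have aE: "Phi ?a u \<in> I.H.E" if "u \<in> I.H.E" for u by (rule Phi_E[OF total_closed[OF f] that])
  have cutN: "I.H.N (Phi ?a (cut x v)) \<le> ?K * I.H.N (cut x v)" if x: "x \<in> Es" for x
  proof -
    note sE = spread_E[OF v, of x]
    have "I.H.N (Phi ?a (cut x v)) = I.H.N (slice x (cv f (spread x v)))"
      by (simp add: slice_cv[OF f x sE(1)] slice_spread[OF x])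
    also have "\<dots> \<le> K.N (cv f (spread x v))" by (rule slice_E(2)[OF x cv_E[OF f sE(1)]])
    also have "\<dots> \<le> ?K * K.N (spread x v)"
      using K.Ops_bound[OF reg_closed[OF f] sE(1)] sE(1) by (simp add: reg_restrict)
    also have "\<dots> \<le> ?K * I.H.N (cut x v)" by (rule mult_left_mono[OF sE(2) K0])
    finally show ?thesis .
  qed
  have "L2_set (\<lambda>r. cmod (Phi ?a v r)) R \<le> ?K * I.H.N v" if R: "finite R" "R \<subseteq> carrier P" for R
  proof -
    let ?R = "R - {Map.empty}" and ?e = "\<lambda>r. inv_map r \<circ>\<^sub>m r"
    let ?X = "?e ` ?R"
    have Rh: "r \<in> left_hull S" "r \<noteq> Map.empty" if "r \<in> ?R" for r using that R by (auto simp: I_l_simps)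
    have X: "finite ?X" "?X \<subseteq> Es" using R domain_idempotent(1)[OF Rh] by auto
    \<comment> \<open>Nothing is linked to the empty map, so this coordinate vanishes; the others
      are grouped by their source idempotent.\<close>
    have emp: "Phi ?a v Map.empty = 0"
    proof -
      have "Phi ?a v Map.empty = Phi ?a (\<lambda>_. 0) Map.empty"
        using I.H.E_zero by (intro Phi_total_local[OF f v]) (simp_all add: complex_alg_simps link_def)
      then show ?thesis using Phi_linear[OF total_closed[OF f] v v, of "-1" Map.empty] by simp
    qed
    have fibre: "(\<Sum>r\<in>{r \<in> ?R. ?e r = x}. (cmod (Phi ?a v r))\<^sup>2) \<le> (?K * I.H.N (cut x v))\<^sup>2" if x: "x \<in> ?X" for x
    proof -
      have xE: "x \<in> Es" using x X by blast
      have "Phi ?a v r = Phi ?a (cut x v) r" if r: "r \<in> ?R" "?e r = x" for r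
      proof (rule Phi_total_local[OF f v cut_E[OF v]])
        fix g q assume "link g q r"
        moreover have "r \<in> dclass x" using domain_idempotent(2)[OF Rh[OF r(1)]] Rh[OF r(1)] r(2) by (simp add: dclass_def)
        ultimately show "v q = cut x v q" using link_dclass_iff by (auto simp: cut_def)
      qed
      then have "(\<Sum>r\<in>{r \<in> ?R. ?e r = x}. (cmod (Phi ?a v r))\<^sup>2) = (L2_set (\<lambda>r. cmod (Phi ?a (cut x v) r)) {r \<in> ?R. ?e r = x})\<^sup>2"
        by (simp add: L2_set_def sum_nonneg)
      also have "\<dots> \<le> (I.H.N (Phi ?a (cut x v)))\<^sup>2"
        by (rule power_mono[OF I.hilb_L2_le[OF aE[OF cut_E[OF v]]]]) (use R in \<open>auto simp: L2_set_nonneg\<close>)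
      also have "\<dots> \<le> (?K * I.H.N (cut x v))\<^sup>2"
        by (rule power_mono[OF cutN[OF xE] I.H.N_nonneg[OF aE[OF cut_E[OF v]]]])
      finally show ?thesis .
    qed
    have "(\<Sum>r\<in>R. (cmod (Phi ?a v r))\<^sup>2) = (\<Sum>r\<in>?R. (cmod (Phi ?a v r))\<^sup>2)"
      by (rule sum.mono_neutral_right) (use R emp in auto)
    also have "\<dots> = (\<Sum>x\<in>?X. \<Sum>r\<in>{r \<in> ?R. ?e r = x}. (cmod (Phi ?a v r))\<^sup>2)"
      by (rule sum.group[symmetric]) (use R in auto)
    also have "\<dots> \<le> (\<Sum>x\<in>?X. ?K\<^sup>2 * (I.H.N (cut x v))\<^sup>2)"
      by (rule sum_mono) (use fibre in \<open>simp add: power_mult_distrib\<close>)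
    also have "\<dots> \<le> ?K\<^sup>2 * (I.H.N v)\<^sup>2"
      unfolding sum_distrib_left[symmetric] by (rule mult_left_mono[OF sum_cut_le[OF v X]]) simp
    finally show ?thesis
      unfolding L2_set_def using K0 I.H.N_nonneg[OF v] by (intro real_le_lsqrt) (simp_all add: power_mult_distrib sum_nonneg)
  qed
  then show "I.H.N (Phi ?a v) \<le> ?K * I.H.N v"
    by (intro I.hilb_bounded(2)) (use I.hilb_outside[OF aE[OF v]] K0 I.H.N_nonneg[OF v] in auto)
qed

lemma nrm_reg: "f \<in> carrier FS ==> nrm K.Ops (reg f) = nrm R0 (Lambda0 P (total f))"
  using nrm_reg_le nrm_reg_ge nrm_Phi[OF total_closed] by (metis order_antisym)

end

section \<open>Comparison of the universal norms\<close>

lemma real_null_comparison: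
  fixes f g :: "nat => real"
  assumes "!!n. norm (f n) \<le> g n" "g \<longlonglongrightarrow> 0" shows "f \<longlonglongrightarrow> 0"
  using assms(2) by (rule tendsto_0_le[where K = 1]) (use assms(1) in \<open>auto intro!: always_eventually order_trans[OF _ abs_ge_self]\<close>)

section \<open>Extension of C*-seminorms from a dense subalgebra\<close>

locale dense_seminorm = star_alg A for A :: "'a star_algebra" (structure) +
  fixes D :: "'a set" and p :: "'a => real"
  assumes n_nonneg: "a \<in> carrier A ==> 0 \<le> nrm A a"
    and n_add: "a \<in> carrier A ==> b \<in> carrier A ==> nrm A (a \<oplus> b) \<le> nrm A a + nrm A b"
    and n_smult: "a \<in> carrier A ==> nrm A (c \<odot> a) = cmod c * nrm A a"
    and n_mult: "a \<in> carrier A ==> b \<in> carrier A ==> nrm A (a \<otimes> b) \<le> nrm A a * nrm A b"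
    and n_star: "a \<in> carrier A ==> nrm A (star A a) \<le> nrm A a"
    and D_closed: "a \<in> D ==> a \<in> carrier A"
    and D_add: "a \<in> D ==> b \<in> D ==> a \<oplus> b \<in> D"
    and D_smult: "a \<in> D ==> c \<odot> a \<in> D"
    and D_mult: "a \<in> D ==> b \<in> D ==> a \<otimes> b \<in> D"
    and D_star: "a \<in> D ==> star A a \<in> D"
    and D_dense: "a \<in> carrier A ==> 0 < e ==> \<exists>x\<in>D. nrm A (a \<ominus> x) < e"
    and p_cstar: "cstar_seminorm (A\<lparr>carrier := D\<rparr>) p"
    and p_le: "a \<in> D ==> p a \<le> nrm A a"
begin

definition approx :: "(nat => 'a) => 'a => bool" where
  "approx x a \<longleftrightarrow> (\<forall>n. x n \<in> D) \<and> (\<lambda>n. nrm A (x n \<ominus> a)) \<longlonglongrightarrow> 0"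

text \<open>The limit is the same along all approximating sequences; the choice only selects one of
  them.\<close>

definition extension :: "'a => real" where
  "extension a = lim (\<lambda>n. p ((SOME x. approx x a) n))"

lemma p_laws:
  "a \<in> D ==> 0 \<le> p a" "a \<in> D ==> b \<in> D ==> p (a \<oplus> b) \<le> p a + p b" "a \<in> D ==> p (c \<odot> a) = cmod c * p a"
  "a \<in> D ==> b \<in> D ==> p (a \<otimes> b) \<le> p a * p b" "a \<in> D ==> p (star A a \<otimes> a) = (p a)\<^sup>2"
  using p_cstar by (simp_all add: cstar_seminorm_def)

lemma n_minus_commute: "a \<in> carrier A ==> b \<in> carrier A ==> nrm A (a \<ominus> b) = nrm A (b \<ominus> a)"
  using n_smult[of "b \<ominus> a" "-1"] by (simp add: minus_smult smult_r_distr a_comm)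

lemma n_le: "a \<in> carrier A ==> b \<in> carrier A ==> nrm A a \<le> nrm A (a \<ominus> b) + nrm A b"
  using n_add[of "a \<ominus> b" b] by simp

lemma n_triangle: "a \<in> carrier A ==> b \<in> carrier A ==> c \<in> carrier A ==> nrm A (a \<ominus> c) \<le> nrm A (a \<ominus> b) + nrm A (b \<ominus> c)"
  using n_add[of "a \<ominus> b" "b \<ominus> c"] minus_trans[of a b c] by simp

lemma n_zero: "nrm A \<zero> = 0"
  using n_smult[of \<zero> 0] by simp

text \<open>Being dominated by the norm on \<open>D\<close>, the seminorm is Lipschitz there, so its
  values converge along every approximating sequence.\<close>

lemma p_dist: "a \<in> D ==> b \<in> D ==> \<bar>p a - p b\<bar> \<le> nrm A (a \<ominus> b)"
proof -
  have "p a - p b \<le> nrm A (a \<ominus> b)" if "a \<in> D" "b \<in> D" for a b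
  proof -
    have d: "a \<ominus> b \<in> D" using that D_add[of a "(-1) \<odot> b"] D_smult[of b "-1"] by (simp add: minus_smult D_closed)
    then show ?thesis using p_laws(2)[OF d that(2)] p_le[OF d] that D_closed by simp
  qed
  then show "a \<in> D ==> b \<in> D ==> ?thesis"
    using n_minus_commute[of a b] by (fastforce simp: D_closed abs_le_iff)
qed

lemma approx_ex: "a \<in> carrier A ==> \<exists>x. approx x a"
proof -
  assume a: "a \<in> carrier A"
  have "\<exists>x\<in>D. nrm A (a \<ominus> x) < 1 / real (Suc n)" for n by (rule D_dense[OF a]) simp
  then obtain x where x: "!!n. x n \<in> D" "!!n. nrm A (a \<ominus> x n) < 1 / real (Suc n)" by metis
  have "(\<lambda>n. nrm A (x n \<ominus> a)) \<longlonglongrightarrow> 0"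
  proof (rule tendsto_sandwich[OF _ _ tendsto_const lim_1_over_n[THEN LIMSEQ_Suc]])
    show "\<forall>\<^sub>F n in sequentially. 0 \<le> nrm A (x n \<ominus> a)" using a x D_closed n_nonneg by simp
    show "\<forall>\<^sub>F n in sequentially. nrm A (x n \<ominus> a) \<le> 1 / real (Suc n)"
      using x(2) n_minus_commute[OF a D_closed[OF x(1)]] by (simp add: less_imp_le)
  qed
  then show ?thesis using x(1) by (auto simp: approx_def)
qed

lemma approx_unique:
  assumes a: "a \<in> carrier A" and x: "approx x a" and y: "approx y a"
  shows "(\<lambda>n. p (x n) - p (y n)) \<longlonglongrightarrow> 0"
proof (rule real_null_comparison)
  show "norm (p (x n) - p (y n)) \<le> nrm A (x n \<ominus> a) + nrm A (y n \<ominus> a)" for n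
  proof -
    have D: "x n \<in> D" "y n \<in> D" using x y by (auto simp: approx_def)
    show ?thesis
      using p_dist[OF D] n_triangle[OF D_closed[OF D(1)] a D_closed[OF D(2)]] n_minus_commute[OF a D_closed[OF D(2)]] by simp
  qed
  show "(\<lambda>n. nrm A (x n \<ominus> a) + nrm A (y n \<ominus> a)) \<longlonglongrightarrow> 0"
    using tendsto_add[of "\<lambda>n. nrm A (x n \<ominus> a)" 0 _ "\<lambda>n. nrm A (y n \<ominus> a)" 0] x y by (simp add: approx_def)
qed

lemma approx_convergent:
  assumes a: "a \<in> carrier A" and x: "approx x a" shows "convergent (\<lambda>n. p (x n))"
proof -
  have xD: "!!n. x n \<in> D" and lim: "(\<lambda>n. nrm A (x n \<ominus> a)) \<longlonglongrightarrow> 0" using x by (auto simp: approx_def)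
  have "Cauchy (\<lambda>n. p (x n))"
  proof (rule CauchyI)
    fix e :: real assume "e > 0"
    then have "\<forall>\<^sub>F n in sequentially. nrm A (x n \<ominus> a) < e / 2" using lim by (intro order_tendstoD(2)) auto
    then obtain M where M: "!!n. n \<ge> M ==> nrm A (x n \<ominus> a) < e / 2" by (auto simp: eventually_sequentially)
    have "norm (p (x m) - p (x n)) < e" if "m \<ge> M" "n \<ge> M" for m n
      using p_dist[OF xD xD, of m n] n_triangle[OF D_closed[OF xD] a D_closed[OF xD], of m n]
        n_minus_commute[OF a D_closed[OF xD], of n] M[OF that(1)] M[OF that(2)] by simp
    then show "\<exists>M. \<forall>m\<ge>M. \<forall>n\<ge>M. norm (p (x m) - p (x n)) < e" by blast
  qed
  then show ?thesis by (simp add: Cauchy_convergent_iff)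
qed

lemma extension_limit:
  assumes a: "a \<in> carrier A" and x: "approx x a" shows "(\<lambda>n. p (x n)) \<longlonglongrightarrow> extension a"
proof -
  have s: "approx (SOME x. approx x a) a" using approx_ex[OF a] by (rule someI_ex)
  have "(\<lambda>n. p ((SOME x. approx x a) n)) \<longlonglongrightarrow> extension a"
    unfolding extension_def using approx_convergent[OF a s] by (simp add: convergent_LIMSEQ_iff)
  from tendsto_add[OF approx_unique[OF a x s] this] show ?thesis by simp
qed

lemma approx_const: "a \<in> D ==> approx (\<lambda>n. a) a"
  using minus_self[of a] D_closed[of a] by (simp add: approx_def n_zero)

lemma extension_eq: "a \<in> D ==> extension a = p a"
  using extension_limit[OF D_closed approx_const] by (simp add: LIMSEQ_const_iff)

lemma approx_nrm: "a \<in> carrier A ==> approx x a ==> (\<lambda>n. nrm A (x n)) \<longlonglongrightarrow> nrm A a"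
proof -
  assume a: "a \<in> carrier A" and x: "approx x a"
  have xD: "!!n. x n \<in> carrier A" and lim: "(\<lambda>n. nrm A (x n \<ominus> a)) \<longlonglongrightarrow> 0" using x D_closed by (auto simp: approx_def)
  have "norm (nrm A (x n) - nrm A a) \<le> nrm A (x n \<ominus> a)" for n
    using n_le[OF xD a, of n] n_le[OF a xD, of n] n_minus_commute[OF a xD, of n] by simp
  then have "(\<lambda>n. nrm A (x n) - nrm A a) \<longlonglongrightarrow> 0" by (intro real_null_comparison[OF _ lim]) simp
  then show ?thesis by (simp add: LIM_zero_iff)
qed

lemma approx_add:
  assumes a: "a \<in> carrier A" "approx x a" and b: "b \<in> carrier A" "approx y b"
  shows "approx (\<lambda>n. x n \<oplus> y n) (a \<oplus> b)"
proof -
  have D: "!!n. x n \<in> D" "!!n. y n \<in> D" using a b by (auto simp: approx_def)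
  note c = D_closed[OF D(1)] D_closed[OF D(2)]
  have lim: "(\<lambda>n. nrm A (x n \<ominus> a) + nrm A (y n \<ominus> b)) \<longlonglongrightarrow> 0"
    using tendsto_add[of "\<lambda>n. nrm A (x n \<ominus> a)" 0 _ "\<lambda>n. nrm A (y n \<ominus> b)" 0] a b by (simp add: approx_def)
  have "norm (nrm A ((x n \<oplus> y n) \<ominus> (a \<oplus> b))) \<le> nrm A (x n \<ominus> a) + nrm A (y n \<ominus> b)" for n
  proof -
    have "(x n \<oplus> y n) \<ominus> (a \<oplus> b) = (x n \<ominus> a) \<oplus> (y n \<ominus> b)"
      using c a b by (simp add: minus_smult smult_r_distr a_ac)
    then show ?thesis using n_add[of "x n \<ominus> a" "y n \<ominus> b"] n_nonneg[of "(x n \<ominus> a) \<oplus> (y n \<ominus> b)"] c a b by simp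
  qed
  then have "(\<lambda>n. nrm A ((x n \<oplus> y n) \<ominus> (a \<oplus> b))) \<longlonglongrightarrow> 0" by (intro real_null_comparison[OF _ lim]) simp
  then show ?thesis using D D_add by (simp add: approx_def)
qed

lemma approx_smult:
  assumes a: "a \<in> carrier A" "approx x a" shows "approx (\<lambda>n. c \<odot> x n) (c \<odot> a)"
proof -
  have D: "!!n. x n \<in> D" using a by (auto simp: approx_def)
  have "c \<odot> x n \<ominus> c \<odot> a = c \<odot> (x n \<ominus> a)" for n
    using D_closed[OF D] a by (simp add: minus_smult smult_r_distr mult.commute)
  then have "(\<lambda>n. nrm A (c \<odot> x n \<ominus> c \<odot> a)) \<longlonglongrightarrow> 0"
    using D_closed[OF D] a tendsto_mult_right_zero[of "\<lambda>n. nrm A (x n \<ominus> a)" _ "cmod c"] by (simp add: n_smult approx_def)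
  then show ?thesis using D D_smult by (simp add: approx_def)
qed

lemma approx_star:
  assumes a: "a \<in> carrier A" "approx x a" shows "approx (\<lambda>n. star A (x n)) (star A a)"
proof -
  have D: "!!n. x n \<in> D" and lim: "(\<lambda>n. nrm A (x n \<ominus> a)) \<longlonglongrightarrow> 0" using a by (auto simp: approx_def)
  have "norm (nrm A (star A (x n) \<ominus> star A a)) \<le> nrm A (x n \<ominus> a)" for n
    using D_closed[OF D] a n_star[of "x n \<ominus> a"] n_nonneg[of "star A (x n) \<ominus> star A a"] by (simp add: star_minus)
  then have "(\<lambda>n. nrm A (star A (x n) \<ominus> star A a)) \<longlonglongrightarrow> 0" by (intro real_null_comparison[OF _ lim]) simp
  then show ?thesis using D D_star by (simp add: approx_def)
qed

lemma approx_mult: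
  assumes a: "a \<in> carrier A" "approx x a" and b: "b \<in> carrier A" "approx y b"
  shows "approx (\<lambda>n. x n \<otimes> y n) (a \<otimes> b)"
proof -
  have D: "!!n. x n \<in> D" "!!n. y n \<in> D" and lx: "(\<lambda>n. nrm A (x n \<ominus> a)) \<longlonglongrightarrow> 0" and ly: "(\<lambda>n. nrm A (y n \<ominus> b)) \<longlonglongrightarrow> 0"
    using a b by (auto simp: approx_def)
  note c = D_closed[OF D(1)] D_closed[OF D(2)]
  have lim: "(\<lambda>n. nrm A (x n \<ominus> a) * nrm A (y n) + nrm A a * nrm A (y n \<ominus> b)) \<longlonglongrightarrow> 0"
    using tendsto_add[OF tendsto_mult[OF lx approx_nrm[OF b]] tendsto_mult_right_zero[OF ly]] by simp
  have "norm (nrm A (x n \<otimes> y n \<ominus> a \<otimes> b)) \<le> nrm A (x n \<ominus> a) * nrm A (y n) + nrm A a * nrm A (y n \<ominus> b)" for n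
  proof -
    have "x n \<otimes> y n \<ominus> a \<otimes> b = (x n \<ominus> a) \<otimes> y n \<oplus> a \<otimes> (y n \<ominus> b)"
      using c a b minus_trans[of "x n \<otimes> y n" "a \<otimes> y n" "a \<otimes> b"] by (simp add: r_minus_distr l_minus_distr)
    then show ?thesis
      using n_add[of "(x n \<ominus> a) \<otimes> y n" "a \<otimes> (y n \<ominus> b)"] n_mult[of "x n \<ominus> a" "y n"] n_mult[of a "y n \<ominus> b"]
        n_nonneg[of "(x n \<ominus> a) \<otimes> y n \<oplus> a \<otimes> (y n \<ominus> b)"] c a b by simp
  qed
  then have "(\<lambda>n. nrm A (x n \<otimes> y n \<ominus> a \<otimes> b)) \<longlonglongrightarrow> 0" by (intro real_null_comparison[OF _ lim]) simp
  then show ?thesis using D D_mult by (simp add: approx_def)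
qed

lemma extension_le: "a \<in> carrier A ==> extension a \<le> nrm A a"
proof -
  assume a: "a \<in> carrier A"
  obtain x where x: "approx x a" using approx_ex[OF a] by blast
  then have "p (x n) \<le> nrm A (x n)" for n using p_le by (simp add: approx_def)
  then show ?thesis using LIMSEQ_le[OF extension_limit[OF a x] approx_nrm[OF a x]] by blast
qed

text \<open>Each law holds along approximating sequences in \<open>D\<close>, and sums, products and
  adjoints of such sequences approximate the corresponding elements.\<close>

lemma extension_cstar: "cstar_seminorm A extension"
  unfolding cstar_seminorm_def
proof (intro ballI allI conjI)
  fix a b c assume a: "a \<in> carrier A" and b: "b \<in> carrier A"
  obtain x where x: "approx x a" using approx_ex[OF a] by blast
  obtain y where y: "approx y b" using approx_ex[OF b] by blast
  have D: "!!n. x n \<in> D" "!!n. y n \<in> D" using x y by (auto simp: approx_def)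
  note lx = extension_limit[OF a x] and ly = extension_limit[OF b y]
  show "0 \<le> extension a" using LIMSEQ_le_const[OF lx, of 0] p_laws(1)[OF D(1)] by blast
  have ab: "a \<oplus> b \<in> carrier A" "c \<odot> a \<in> carrier A" "a \<otimes> b \<in> carrier A" "star A a \<in> carrier A" using a b by auto
  show "extension (a \<oplus> b) \<le> extension a + extension b"
    using LIMSEQ_le[OF extension_limit[OF ab(1) approx_add[OF a x b y]] tendsto_add[OF lx ly]] p_laws(2)[OF D] by blast
  show "extension (c \<odot> a) = cmod c * extension a"
    using LIMSEQ_unique[OF extension_limit[OF ab(2) approx_smult[OF a x]]] tendsto_mult_left[OF lx, of "cmod c"] p_laws(3)[OF D(1)] by simp
  show "extension (a \<otimes> b) \<le> extension a * extension b"
    using LIMSEQ_le[OF extension_limit[OF ab(3) approx_mult[OF a x b y]] tendsto_mult[OF lx ly]] p_laws(4)[OF D] by blast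
  have "(\<lambda>n. p (star A (x n) \<otimes> x n)) \<longlonglongrightarrow> extension (star A a \<otimes> a)"
    using extension_limit[OF _ approx_mult[OF ab(4) approx_star[OF a x] a x]] a by simp
  then show "extension (star A a \<otimes> a) = (extension a)\<^sup>2"
    using LIMSEQ_unique tendsto_power[OF lx, of 2] p_laws(5)[OF D(1)] by simp
qed

end

lemma (in star_alg) lin_span_image:
  assumes F: "star_alg F" and h: "star_hom F A h" and X: "X \<subseteq> h ` carrier F" and a: "a \<in> lin_span A X"
  shows "a \<in> h ` carrier F"
proof -
  interpret F: star_alg F by fact
  note hD = star_homD[OF h]
  from a show ?thesis
  proof induction
    case zero
    then show ?case using star_hom_zero[OF F star_alg_axioms h] F.zero_closed by (metis image_eqI)
  next
    case (base x) then show ?case using X by blast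
  next
    case (add x y)
    then obtain f k where "f \<in> carrier F" "k \<in> carrier F" "x = h f" "y = h k" by blast
    then show ?case by (intro image_eqI[of _ _ "f \<oplus>\<^bsub>F\<^esub> k"]) (simp_all add: hD(3))
  next
    case (smult x c)
    then obtain f where "f \<in> carrier F" "x = h f" by blast
    then show ?case by (intro image_eqI[of _ _ "c \<odot>\<^bsub>F\<^esub> f"]) (simp_all add: hD(5))
  qed
qed

lemma (in cstar_pre) closed_span_image_approx:
  assumes F: "star_alg F" and h: "star_hom F A h" and X: "X \<subseteq> h ` carrier F" and a: "a \<in> closed_span A X"
  shows "\<exists>x. (\<forall>n. x n \<in> carrier F) \<and> converges A (\<lambda>n. h (x n)) a"
proof -
  have "X \<subseteq> carrier A" using X star_homD(1)[OF h] by blast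
  then obtain y where y: "!!n. y n \<in> lin_span A X" "converges A y a" using closed_span_approx[OF a] by blast
  have "\<exists>f\<in>carrier F. y n = h f" for n using lin_span_image[OF F h X y(1)] by blast
  then obtain x where x: "!!n. x n \<in> carrier F" "!!n. y n = h (x n)" by metis
  then have "y = (\<lambda>n. h (x n))" by auto
  then show ?thesis using x(1) y(2) by blast
qed

section \<open>Sections generated by the hull, and their universal norm\<close>

context semigroup_in_group
begin

abbreviation M where "M \<equiv> ell1 P"

definition gen where "gen q = single (deg q) (pi q)"

definition D where "D = lin_span M (delta ` carrier P)"

text \<open>The support is meant to be finite: the image of a general element of
  \<open>\<ell>\<^sup>1\<close> could be nonzero over infinitely many group elements.\<close>

definition rho where
  "rho c = finsum FS (\<lambda>q. c q \<odot>\<^bsub>FS\<^esub> gen q) {q. c q \<noteq> 0}"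

lemma gen_FS: "q \<in> carrier P ==> gen q \<in> carrier FS"
  unfolding gen_def by (intro FB.single_FS pi_Bd) (auto simp: I_l_simps)

lemma nrm_single: "nrm FS (single g a) = (if a = nul then 0 else nrm A a)"
proof -
  have "FB.supp (single g a) = (if a = nul then {} else {g})" by (auto simp: FB.supp_def FB.single_def)
  then show ?thesis by (simp add: FB.FS_simps FB.single_def)
qed

lemma nrm_pi_le: "q \<in> carrier P ==> nrm A (pi q) \<le> 1"
proof -
  assume q: "q \<in> carrier P"
  have "nrm A (pi q) \<le> nrm C (I.iota q)"
    using contraction.contractive[OF Q.a.contraction_coset I.iota_closed[OF q]] by (simp add: A_eq pi_eq)
  also have "\<dots> \<le> nrm M (delta q)"
    unfolding I.iota_def cstar_def I.M.nrm_to_envelope[OF I.ell1_delta[OF q]] by (rule I.M.universal_norm_le[OF I.ell1_delta[OF q]])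
  finally show ?thesis by (simp add: I.nrm_delta[OF q])
qed

lemma D_iff: "c \<in> D \<longleftrightarrow> finite {q. c q \<noteq> 0} \<and> {q. c q \<noteq> 0} \<subseteq> carrier P"
  unfolding D_def I.lin_span_delta by simp

lemma rho_superset:
  assumes K: "finite K" "{q. c q \<noteq> 0} \<subseteq> K" "K \<subseteq> carrier P"
  shows "rho c = finsum FS (\<lambda>q. c q \<odot>\<^bsub>FS\<^esub> gen q) K"
  unfolding rho_def
  by (rule FB.FS.finsum_eq_superset[OF K(1,2)]) (use K gen_FS in \<open>auto simp: Pi_def subset_iff\<close>)

lemma D_closed: "c \<in> D ==> c \<in> carrier M"
  unfolding D_def by (rule I.M.lin_span_closed) (use I.ell1_delta in auto)

lemma rho_closed: "c \<in> D ==> rho c \<in> carrier FS"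
  unfolding rho_def D_iff by (intro FB.FS.finsum_closed) (auto intro!: FB.FS.smult_closed gen_FS)

lemma rho_add: "c \<in> D ==> d \<in> D ==> rho (c \<oplus>\<^bsub>M\<^esub> d) = rho c \<oplus>\<^bsub>FS\<^esub> rho d"
proof -
  assume c: "c \<in> D" and d: "d \<in> D"
  let ?K = "{q. c q \<noteq> 0} \<union> {q. d q \<noteq> 0}"
  have K: "finite ?K" "?K \<subseteq> carrier P" using c d by (auto simp: D_iff)
  have s: "{q. (c \<oplus>\<^bsub>M\<^esub> d) q \<noteq> 0} \<subseteq> ?K" by (auto simp: I.ell1_simps)
  have gen: "!!q. q \<in> ?K ==> gen q \<in> carrier FS" using K gen_FS by blast
  have "rho (c \<oplus>\<^bsub>M\<^esub> d) = finsum FS (\<lambda>q. c q \<odot>\<^bsub>FS\<^esub> gen q \<oplus>\<^bsub>FS\<^esub> d q \<odot>\<^bsub>FS\<^esub> gen q) ?K"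
    unfolding rho_superset[OF K(1) s K(2)]
    by (rule FB.FS.finsum_cong') (use gen in \<open>auto simp: I.ell1_simps FB.FS.smult_l_distr\<close>)
  also have "\<dots> = rho c \<oplus>\<^bsub>FS\<^esub> rho d"
    unfolding rho_superset[OF K(1) Un_upper1 K(2)] rho_superset[OF K(1) Un_upper2 K(2)]
    by (rule FB.FS.finsum_addf) (use gen in auto)
  finally show ?thesis .
qed

lemma rho_smult: "c \<in> D ==> rho (k \<odot>\<^bsub>M\<^esub> c) = k \<odot>\<^bsub>FS\<^esub> rho c"
proof -
  assume c: "c \<in> D"
  let ?K = "{q. c q \<noteq> 0}"
  have K: "finite ?K" "?K \<subseteq> carrier P" using c by (auto simp: D_iff)
  have s: "{q. (k \<odot>\<^bsub>M\<^esub> c) q \<noteq> 0} \<subseteq> ?K" by (auto simp: I.ell1_simps)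
  have gen: "!!q. q \<in> ?K ==> gen q \<in> carrier FS" using K gen_FS by blast
  have "rho (k \<odot>\<^bsub>M\<^esub> c) = finsum FS (\<lambda>q. k \<odot>\<^bsub>FS\<^esub> (c q \<odot>\<^bsub>FS\<^esub> gen q)) ?K"
    unfolding rho_superset[OF K(1) s K(2)]
    by (rule FB.FS.finsum_cong') (use gen in \<open>auto simp: I.ell1_simps\<close>)
  also have "\<dots> = k \<odot>\<^bsub>FS\<^esub> rho c"
    unfolding rho_def by (rule FB.FS.finsum_smult) (use gen in auto)
  finally show ?thesis .
qed

lemma rho_delta: "q \<in> carrier P ==> rho (delta q) = gen q"
proof -
  assume q: "q \<in> carrier P"
  have s: "{p. delta q p \<noteq> (0::complex)} \<subseteq> {q}" by (auto simp: delta_def)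
  show ?thesis using rho_superset[OF _ s] q gen_FS[OF q] by (simp add: delta_def)
qed

lemma single_zero: "single g nul = \<zero>\<^bsub>FS\<^esub>"
  by (simp add: FB.single_def FB.FS_simps)

lemma gen_mult: "p \<in> carrier P ==> q \<in> carrier P ==> gen p \<otimes>\<^bsub>FS\<^esub> gen q = gen (p \<circ>\<^sub>m q)"
proof -
  assume "p \<in> carrier P" "q \<in> carrier P"
  then have p: "p \<in> left_hull S" and q: "q \<in> left_hull S" by (simp_all add: I_l_simps)
  have "gen p \<otimes>\<^bsub>FS\<^esub> gen q = single (deg p \<star> deg q) (pi (p \<circ>\<^sub>m q))"
    unfolding gen_def using p q by (subst FB.conv_single_single) (auto intro: pi_Bd simp: pi_mult)
  also have "\<dots> = gen (p \<circ>\<^sub>m q)"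
  \<comment> \<open>For an empty product the degrees need not multiply, but then its image in
    \<open>A\<close> is zero and it does not matter over which group element it is placed.\<close>
  proof (cases "p \<circ>\<^sub>m q = Map.empty")
    case True
    then have "Map.empty \<in> left_hull S" using left_hull.prod[OF p q] by simp
    then show ?thesis by (simp add: gen_def True pi_empty single_zero)
  next
    case False
    then show ?thesis by (simp add: gen_def deg_comp[OF p q])
  qed
  finally show ?thesis .
qed

lemma gen_star: "p \<in> carrier P ==> star FS (gen p) = gen (inv_map p)"
proof -
  assume "p \<in> carrier P"
  then have p: "p \<in> left_hull S" by (simp add: I_l_simps)
  have "star FS (gen p) = single (gi (deg p)) (pi (inv_map p))"
    unfolding gen_def using p by (subst FB.star_single) (auto intro: pi_Bd simp: pi_star)
  also have "\<dots> = gen (inv_map p)"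
  proof (cases "p = Map.empty")
    case True
    then show ?thesis using p by (simp add: gen_def pi_empty single_zero)
  next
    case False
    then show ?thesis by (simp add: gen_def deg_inv[OF p])
  qed
  finally show ?thesis .
qed

lemma D_ops:
  "\<zero>\<^bsub>M\<^esub> \<in> D" "q \<in> carrier P ==> delta q \<in> D" "c \<in> D ==> d \<in> D ==> c \<oplus>\<^bsub>M\<^esub> d \<in> D" "c \<in> D ==> k \<odot>\<^bsub>M\<^esub> c \<in> D"
  unfolding D_def by (auto intro: lin_span.intros)

lemma D_induct [consumes 1, case_names zero delta add smult]:
  assumes "c \<in> D" "Q \<zero>\<^bsub>M\<^esub>" "!!q. q \<in> carrier P ==> Q (delta q)"
    "!!c d. c \<in> D ==> d \<in> D ==> Q c ==> Q d ==> Q (c \<oplus>\<^bsub>M\<^esub> d)" "!!c k. c \<in> D ==> Q c ==> Q (k \<odot>\<^bsub>M\<^esub> c)"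
  shows "Q c"
  using assms(1) unfolding D_def
proof (induction rule: lin_span.induct)
  case zero show ?case by (rule assms(2))
next
  case (base x) then show ?case using assms(3) by blast
next
  case (add x y) then show ?case by (intro assms(4)) (simp_all add: D_def)
next
  case (smult x k) then show ?case by (intro assms(5)) (simp_all add: D_def)
qed

lemma rho_zero: "rho \<zero>\<^bsub>M\<^esub> = \<zero>\<^bsub>FS\<^esub>"
  by (simp add: rho_def I.ell1_simps)

lemma P_mult: "p \<in> carrier P ==> q \<in> carrier P ==> delta p \<otimes>\<^bsub>M\<^esub> delta q = delta (p \<circ>\<^sub>m q)"
  "p \<in> carrier P ==> q \<in> carrier P ==> p \<circ>\<^sub>m q \<in> carrier P"
  "p \<in> carrier P ==> star M (delta p) = delta (inv_map p)" "p \<in> carrier P ==> inv_map p \<in> carrier P"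
  using I.delta_mult[of p q] I.delta_star[of p] by (simp_all add: I_l_simps left_hull.intros)

lemma rho_mult_delta:
  assumes p: "p \<in> carrier P" and d: "d \<in> D"
  shows "delta p \<otimes>\<^bsub>M\<^esub> d \<in> D \<and> rho (delta p \<otimes>\<^bsub>M\<^esub> d) = gen p \<otimes>\<^bsub>FS\<^esub> rho d"
  using d
proof (induction d rule: D_induct)
  case zero
  then show ?case using I.ell1_delta[OF p] gen_FS[OF p] by (simp add: rho_zero D_ops(1))
next
  case (delta q)
  then show ?case using p by (simp add: P_mult D_ops(2) rho_delta gen_mult)
next
  case (add c d)
  note cd = D_closed[OF add.hyps(1)] D_closed[OF add.hyps(2)] rho_closed[OF add.hyps(1)] rho_closed[OF add.hyps(2)]
  show ?case using add cd I.ell1_delta[OF p] gen_FS[OF p]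
    by (simp add: I.M.r_distr FB.FS.r_distr D_ops(3) rho_add)
next
  case (smult c k)
  note c = D_closed[OF smult.hyps(1)] rho_closed[OF smult.hyps(1)]
  show ?case using smult c I.ell1_delta[OF p] gen_FS[OF p]
    by (simp add: I.M.mult_smult_r FB.FS.mult_smult_r D_ops(4) rho_smult)
qed

lemma rho_mult:
  assumes c: "c \<in> D" and d: "d \<in> D"
  shows "c \<otimes>\<^bsub>M\<^esub> d \<in> D \<and> rho (c \<otimes>\<^bsub>M\<^esub> d) = rho c \<otimes>\<^bsub>FS\<^esub> rho d"
  using c
proof (induction c rule: D_induct)
  case zero
  then show ?case using D_closed[OF d] rho_closed[OF d] by (simp add: rho_zero D_ops(1))
next
  case (delta q)
  then show ?case using rho_mult_delta[OF _ d] by (simp add: rho_delta)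
next
  case (add b c)
  note cd = D_closed[OF add.hyps(1)] D_closed[OF add.hyps(2)] rho_closed[OF add.hyps(1)] rho_closed[OF add.hyps(2)]
  show ?case using add cd D_closed[OF d] rho_closed[OF d]
    by (simp add: I.M.l_distr FB.FS.l_distr D_ops(3) rho_add)
next
  case (smult c k)
  note c = D_closed[OF smult.hyps(1)] rho_closed[OF smult.hyps(1)]
  show ?case using smult c D_closed[OF d] rho_closed[OF d]
    by (simp add: I.M.mult_smult_l FB.FS.mult_smult_l D_ops(4) rho_smult)
qed

lemma rho_star:
  assumes c: "c \<in> D" shows "star M c \<in> D \<and> rho (star M c) = star FS (rho c)"
  using c
proof (induction c rule: D_induct)
  case zero
  then show ?case by (simp add: rho_zero D_ops(1) I.M.star_zero FB.FS.star_zero)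
next
  case (delta q)
  then show ?case by (simp add: P_mult D_ops(2) rho_delta gen_star)
next
  case (add b c)
  note cd = D_closed[OF add.hyps(1)] D_closed[OF add.hyps(2)] rho_closed[OF add.hyps(1)] rho_closed[OF add.hyps(2)]
  show ?case using add cd by (simp add: I.M.star_add FB.FS.star_add D_ops(3) rho_add)
next
  case (smult c k)
  note c = D_closed[OF smult.hyps(1)] rho_closed[OF smult.hyps(1)]
  show ?case using smult c by (simp add: I.M.star_smult FB.FS.star_smult D_ops(4) rho_smult)
qed

sublocale U: seminormed "finite_sections (cstar0 (I_l S)) G Bd" "universal_norm (finite_sections (cstar0 (I_l S)) G Bd)"
  by (rule FB.FS.seminormed_universal_norm)

abbreviation U where "U \<equiv> universal_norm FS"

text \<open>Each generator has norm at most one in its fibre, so the triangle inequality leaves the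
  sum of the moduli of the coefficients.\<close>

lemma nrm_rho_le: "c \<in> D ==> U (rho c) \<le> nrm M c"
proof -
  assume c: "c \<in> D"
  let ?K = "{q. c q \<noteq> 0}"
  have K: "finite ?K" "?K \<subseteq> carrier P" using c by (auto simp: D_iff)
  have gen: "!!q. q \<in> ?K ==> gen q \<in> carrier FS" using K gen_FS by blast
  have "U (rho c) \<le> (\<Sum>q\<in>?K. U (c q \<odot>\<^bsub>FS\<^esub> gen q))"
    unfolding rho_def by (rule U.p_finsum) (use gen in auto)
  also have "\<dots> \<le> (\<Sum>q\<in>?K. cmod (c q))"
  proof (rule sum_mono)
    fix q assume q: "q \<in> ?K"
    have "U (gen q) \<le> nrm FS (gen q)" by (rule FB.FS.universal_norm_le[OF gen[OF q]])
    also have "\<dots> \<le> 1" using nrm_pi_le[of q] q K by (auto simp: gen_def nrm_single)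
    finally show "U (c q \<odot>\<^bsub>FS\<^esub> gen q) \<le> cmod (c q)"
      using gen[OF q] by (simp add: U.p_smult mult_left_le)
  qed
  also have "\<dots> = (\<Sum>\<^sub>\<infinity>q\<in>?K. cmod (c q))" using K by simp
  also have "\<dots> = nrm M c" unfolding I.ell1_simps by (rule infsum_cong_neutral) (use K in auto)
  finally show ?thesis .
qed

lemma dense_seminorm_rho: "dense_seminorm M D (\<lambda>c. U (rho c))"
proof (intro dense_seminorm.intro dense_seminorm_axioms.intro I.star_alg_ell1)
  show "0 \<le> nrm M a" for a by (rule I.nrm_ell1_nonneg)
  show "nrm M (a \<oplus>\<^bsub>M\<^esub> b) \<le> nrm M a + nrm M b" if "a \<in> carrier M" "b \<in> carrier M" for a b
  proof -
    have s: "(\<lambda>q. cmod (a q)) summable_on carrier P" "(\<lambda>q. cmod (b q)) summable_on carrier P" "(\<lambda>q. cmod (a q + b q)) summable_on carrier P"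
      using that I.M.add.m_closed[OF that] by (simp_all add: I.ell1_carrier) (simp add: I.ell1_simps)
    have "(\<Sum>\<^sub>\<infinity>q\<in>carrier P. cmod (a q + b q)) \<le> (\<Sum>\<^sub>\<infinity>q\<in>carrier P. cmod (a q) + cmod (b q))"
      by (rule infsum_mono[OF s(3) summable_on_add[OF s(1,2)]]) (rule norm_triangle_ineq)
    also have "\<dots> = (\<Sum>\<^sub>\<infinity>q\<in>carrier P. cmod (a q)) + (\<Sum>\<^sub>\<infinity>q\<in>carrier P. cmod (b q))" by (rule infsum_add[OF s(1,2)])
    finally show ?thesis by (simp add: I.ell1_simps)
  qed
  show "nrm M (c \<odot>\<^bsub>M\<^esub> a) = cmod c * nrm M a" if "a \<in> carrier M" for a c
    by (simp add: I.ell1_simps norm_mult infsum_cmult_right')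
  show "nrm M (a \<otimes>\<^bsub>M\<^esub> b) \<le> nrm M a * nrm M b" if "a \<in> carrier M" "b \<in> carrier M" for a b
    by (rule I.ell1_mult_norm[OF that])
  show "nrm M (star M a) \<le> nrm M a" if a: "a \<in> carrier M" for a
  proof -
    have "nrm M (star M a) = (\<Sum>\<^sub>\<infinity>q\<in>carrier P. cmod (a (inv_map q)))"
      unfolding I.ell1_simps by (rule infsum_cong) (simp add: I_l_simps)
    also have "\<dots> = nrm M a" unfolding I.ell1_simps
    proof (rule infsum_reindex_bij_betw)
      show "bij_betw inv_map (carrier P) (carrier P)"
        by (rule bij_betwI[of _ _ _ inv_map]) (use I.sinv_closed I.sinv_sinv in \<open>auto simp: I_l_simps\<close>)
    qed
    finally show ?thesis by simp
  qed
  show "a \<in> carrier M" "k \<odot>\<^bsub>M\<^esub> a \<in> D" "star M a \<in> D" if "a \<in> D" for a k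
    using that rho_star by (simp_all add: D_closed D_ops)
  show "a \<oplus>\<^bsub>M\<^esub> b \<in> D" "a \<otimes>\<^bsub>M\<^esub> b \<in> D" if "a \<in> D" "b \<in> D" for a b
    using that rho_mult by (simp_all add: D_ops)
  show "\<exists>x\<in>D. nrm M (a \<ominus>\<^bsub>M\<^esub> x) < e" if "a \<in> carrier M" "0 < e" for a e
    using I.ell1_approx[OF that] unfolding D_def by metis
  show "U (rho a) \<le> nrm M a" if "a \<in> D" for a by (rule nrm_rho_le[OF that])
  show "cstar_seminorm (M\<lparr>carrier := D\<rparr>) (\<lambda>c. U (rho c))"
    using rho_closed rho_mult rho_star D_ops
    by (simp add: cstar_seminorm_def rho_add rho_smult U.p_add U.p_smult U.p_mult U.p_star_mult)
qed

text \<open>The pulled-back seminorm, extended from \<open>D\<close> to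
  \<open>\<ell>\<^sup>1\<close>, is a competitor in the supremum that defines the universal norm
  there.\<close>

lemma U_rho_le: "c \<in> D ==> U (rho c) \<le> universal_norm M c"
proof -
  interpret E: dense_seminorm M D "\<lambda>c. U (rho c)" by (rule dense_seminorm_rho)
  assume c: "c \<in> D"
  show ?thesis
    using I.M.universal_norm_upper[OF E.extension_cstar _ D_closed[OF c]] E.extension_le E.extension_eq[OF c] by simp
qed

lemma total_rho:
  assumes "c \<in> D" shows "total (rho c) = Q.a.ideal +>\<^bsub>C\<^esub> to_envelope M c"
proof -
  have h: "star_hom M A (\<lambda>c. Q.a.ideal +>\<^bsub>C\<^esub> to_envelope M c)"
    unfolding A_eq by (rule star_hom_compose[OF I.to_cstar_hom Q.a.q.star_hom_coset, unfolded comp_def])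
  note hD = star_homD[OF h] and tD = star_homD[OF FB.total_hom]
  from assms show ?thesis
  proof (induction c rule: D_induct)
    case zero
    show ?case unfolding rho_zero star_hom_zero[OF FB.star_alg_FS A.star_alg_axioms FB.total_hom]
      star_hom_zero[OF I.star_alg_ell1 A.star_alg_axioms h] ..
  next
    case (delta q)
    then have q: "q \<in> left_hull S" by (simp add: I_l_simps)
    have "total (gen q) = pi q" unfolding gen_def by (rule FB.total_single) (use q in \<open>auto intro: pi_Bd\<close>)
    then show ?case by (simp add: rho_delta[OF delta] pi_eq I.iota_def)
  next
    case (add c d)
    show ?case using add by (simp add: rho_add tD(3) rho_closed hD(3) D_closed)
  next
    case (smult c k)
    then show ?case by (simp add: rho_smult tD(5) rho_closed hD(5) D_closed)
  qed
qed

text \<open>\<open>rho\<close> annihilates the empty map, so \<open>c\<close> may be multiplied by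
  \<open>1 - z\<close> first. The universal norm of the product is the norm of the corner component
  in \<open>C\<close>, which is the quotient norm in \<open>A\<close>.\<close>

lemma U_rho: "c \<in> D ==> U (rho c) \<le> nrm A (total (rho c))"
proof -
  assume c: "c \<in> D"
  note cM = D_closed[OF c]
  note te = star_homD[OF I.to_cstar_hom]
  have one: "\<one>\<^bsub>M\<^esub> = delta (left_mult S \<one>\<^bsub>S\<^esub>)" by (simp add: I.ell1_simps I_l_simps)
  have l1: "left_mult S \<one>\<^bsub>S\<^esub> \<in> carrier P" using deg_one(1) by (simp add: I_l_simps)
  define z where "z = (if Map.empty \<in> left_hull S then delta Map.empty else \<zero>\<^bsub>M\<^esub>)"
  have z: "z \<in> D" "to_envelope M z = zC"
    using D_ops(1,2) star_hom_zero[OF I.star_alg_ell1 Q.a.star_alg_axioms I.to_cstar_hom]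
    by (auto simp: z_def zC_def I_l_simps I.iota_def)
  have rz: "rho z = \<zero>\<^bsub>FS\<^esub>"
    by (auto simp: z_def rho_zero rho_delta I_l_simps gen_def pi_empty single_zero)
  define w where "w = \<one>\<^bsub>M\<^esub> \<oplus>\<^bsub>M\<^esub> (-1) \<odot>\<^bsub>M\<^esub> z"
  have wD: "w \<in> D" unfolding w_def one by (intro D_ops l1 z)
  have "rho w = gen (left_mult S \<one>\<^bsub>S\<^esub>)"
    unfolding w_def one using z(1) l1 gen_FS[OF l1] by (simp add: rho_add rho_smult rho_delta D_ops rz)
  then have "rho w = \<one>\<^bsub>FS\<^esub>" by (simp add: gen_def deg_one(3) pi_one FB.FS_simps)
  then have "rho c = rho (w \<otimes>\<^bsub>M\<^esub> c)" using rho_mult[OF wD c] rho_closed[OF c] by simp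
  moreover have "U (rho (w \<otimes>\<^bsub>M\<^esub> c)) \<le> universal_norm M (w \<otimes>\<^bsub>M\<^esub> c)" using rho_mult[OF wD c] by (intro U_rho_le) simp
  moreover have "universal_norm M (w \<otimes>\<^bsub>M\<^esub> c) = nrm C (to_envelope M (w \<otimes>\<^bsub>M\<^esub> c))"
    using I.M.nrm_to_envelope[of "w \<otimes>\<^bsub>M\<^esub> c"] D_closed[OF wD] cM by (simp add: cstar_def)
  moreover have "to_envelope M w = Q.a.w"
    unfolding w_def Q.a.w_def using z D_closed[OF z(1)] te(1,4) by (simp add: te(3,5) Q.a.minus_smult)
  then have "to_envelope M (w \<otimes>\<^bsub>M\<^esub> c) = Q.a.w \<otimes>\<^bsub>C\<^esub> to_envelope M c" by (simp add: te(2) D_closed[OF wD] cM)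
  moreover have "nrm C (Q.a.w \<otimes>\<^bsub>C\<^esub> to_envelope M c) = nrm A (total (rho c))"
    unfolding total_rho[OF c] using Q.a.q.nrm_quot[OF te(1)[OF cM]] by (simp add: A_eq)
  ultimately show ?thesis by simp
qed

text \<open>A word of value \<open>g\<close> gives a map of degree \<open>g\<close>, which
  \<open>rho\<close> places over \<open>g\<close>, or the empty map, whose image is zero.\<close>

lemma single_rho:
  assumes "g \<in> carrier G" "y \<in> lin_span A (Xs g)" shows "\<exists>c\<in>D. rho c = single g y"
  using assms(2)
proof (induction rule: lin_span.induct)
  case zero
  show ?case using D_ops(1) rho_zero single_zero by metis
next
  case (base x)
  then obtain f where f: "f \<in> left_hull S" "x = pi f" "f = Map.empty \<or> deg f = g" by (rule Xs_cases)
  then have fP: "f \<in> carrier P" by (simp add: I_l_simps)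
  have "gen f = single g x" using f by (auto simp: gen_def pi_empty single_zero)
  then show ?case using rho_delta[OF fP] D_ops(2)[OF fP] by metis
next
  case (add x y)
  then obtain c d where "c \<in> D" "rho c = single g x" "d \<in> D" "rho d = single g y" by blast
  then show ?case using A.lin_span_closed[OF Xs_subset add.hyps(1)] A.lin_span_closed[OF Xs_subset add.hyps(2)]
    by (intro bexI[of _ "c \<oplus>\<^bsub>M\<^esub> d"]) (simp_all add: rho_add D_ops FB.single_linear(1))
next
  case (smult x k)
  then obtain c where "c \<in> D" "rho c = single g x" by blast
  then show ?case using A.lin_span_closed[OF Xs_subset smult.hyps(1)]
    by (intro bexI[of _ "k \<odot>\<^bsub>M\<^esub> c"]) (simp_all add: rho_smult D_ops FB.single_linear(2))
qed

text \<open>Over one group element the fibre is the closed span of elements that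
  \<open>single_rho\<close> lifts; errors over several group elements add up in the norm of
  \<open>FS\<close>.\<close>

lemma rho_dense: "f \<in> carrier FS ==> \<forall>e>0. \<exists>c\<in>D. nrm FS (f \<ominus>\<^bsub>FS\<^esub> rho c) < e"
proof (induction f rule: FB.FS_induct)
  case (single g a)
  show ?case
  proof (intro allI impI)
    fix e :: real assume "e > 0"
    then obtain y where y: "y \<in> lin_span A (Xs g)" "nrm A (a \<ominus>\<^bsub>A\<^esub> y) < e"
      using single(2) by (auto simp: Bd_eq closed_span_def)
    obtain c where c: "c \<in> D" "rho c = single g y" using single_rho[OF single(1) y(1)] by blast
    note ac = Bd_closed[OF single(2)] and yc = A.lin_span_closed[OF Xs_subset y(1)]
    have "single g y \<in> carrier FS" using rho_closed[OF c(1)] c(2) by simp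
    then have "single g a \<ominus>\<^bsub>FS\<^esub> single g y = single g (a \<ominus>\<^bsub>A\<^esub> y)"
      using FB.single_FS[OF single] ac yc
      by (simp add: FB.FS.minus_smult A.minus_smult FB.single_linear)
    then show "\<exists>c\<in>D. nrm FS (single g a \<ominus>\<^bsub>FS\<^esub> rho c) < e"
      using c y(2) \<open>e > 0\<close> by (intro bexI[of _ c]) (simp_all add: nrm_single)
  qed
next
  case (add f h)
  show ?case
  proof (intro allI impI)
    fix e :: real assume "e > 0"
    then have "e / 2 > 0" by simp
    then obtain c d where c: "c \<in> D" "nrm FS (f \<ominus>\<^bsub>FS\<^esub> rho c) < e / 2" and d: "d \<in> D" "nrm FS (h \<ominus>\<^bsub>FS\<^esub> rho d) < e / 2"
      using add.IH by meson
    note cl = rho_closed[OF c(1)] rho_closed[OF d(1)] add.hyps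
    have "(f \<oplus>\<^bsub>FS\<^esub> h) \<ominus>\<^bsub>FS\<^esub> (rho c \<oplus>\<^bsub>FS\<^esub> rho d) = (f \<ominus>\<^bsub>FS\<^esub> rho c) \<oplus>\<^bsub>FS\<^esub> (h \<ominus>\<^bsub>FS\<^esub> rho d)"
      using cl by (simp add: FB.FS.minus_smult FB.FS.smult_r_distr FB.FS.a_ac)
    then show "\<exists>c\<in>D. nrm FS (f \<oplus>\<^bsub>FS\<^esub> h \<ominus>\<^bsub>FS\<^esub> rho c) < e"
      using c d FB.nrm_FS_add[of "f \<ominus>\<^bsub>FS\<^esub> rho c" "h \<ominus>\<^bsub>FS\<^esub> rho d"] cl
      by (intro bexI[of _ "c \<oplus>\<^bsub>M\<^esub> d"]) (simp_all add: rho_add D_ops)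
  qed
qed

text \<open>The norm pulled back along \<open>total\<close> is a competitor for the universal norm,
  which gives one inequality. The other is \<open>U_rho\<close> on the image of \<open>rho\<close>;
  both norms are bounded by that of \<open>FS\<close>, in which this image is dense.\<close>

lemma nrm_total:
  assumes f: "f \<in> carrier FS" shows "nrm A (total f) = U f"
proof (rule antisym)
  interpret T: seminormed FS "\<lambda>f. nrm A (total f)"
    by (rule seminormedI_pullback[OF FB.star_alg_FS A.seminormed_axioms FB.total_hom])
  show "nrm A (total f) \<le> U f"
    by (rule FB.FS.universal_norm_upper[OF T.seminorm _ f]) (simp add: FB.nrm_total_le)
  show "U f \<le> nrm A (total f)"
  proof (rule field_le_epsilon)
    fix e :: real assume "e > 0"
    then have "e / 2 > 0" by simp
    then obtain c where c: "c \<in> D" "nrm FS (f \<ominus>\<^bsub>FS\<^esub> rho c) < e / 2" using rho_dense[OF f] by blast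
    note rc = rho_closed[OF c(1)]
    have m: "f \<ominus>\<^bsub>FS\<^esub> rho c \<in> carrier FS" using f rc by simp
    have "U f \<le> U (f \<ominus>\<^bsub>FS\<^esub> rho c) + U (rho c)" using U.p_add[OF m rc] f rc by simp
    moreover have "U (rho c) \<le> nrm A (total (rho c))" by (rule U_rho[OF c(1)])
    moreover have "nrm A (total (rho c)) \<le> nrm A (total (f \<ominus>\<^bsub>FS\<^esub> rho c)) + nrm A (total f)"
      using T.p_add[of "rho c \<ominus>\<^bsub>FS\<^esub> f" f] T.p_minus_commute[OF rc f] f rc by simp
    moreover have "nrm A (total (f \<ominus>\<^bsub>FS\<^esub> rho c)) \<le> nrm FS (f \<ominus>\<^bsub>FS\<^esub> rho c)" "U (f \<ominus>\<^bsub>FS\<^esub> rho c) \<le> nrm FS (f \<ominus>\<^bsub>FS\<^esub> rho c)"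
      by (rule FB.nrm_total_le[OF m], rule FB.FS.universal_norm_le[OF m])
    ultimately show "U f \<le> nrm A (total f) + e" using c(2) by linarith
  qed
qed

section \<open>The two canonical maps as completions of one map\<close>

abbreviation Full where "Full \<equiv> full_cross_sectional A G Bd"
abbreviation Red where "Red \<equiv> reduced_cross_sectional A G Bd"

lemma Red_closure:
  "cstar_alg Red" "carrier Red = closed_span K.Ops (reg ` carrier FS)"
  "T \<in> carrier Red ==> T' \<in> carrier Red ==> T \<ominus>\<^bsub>Red\<^esub> T' = T \<ominus>\<^bsub>K.Ops\<^esub> T'"
proof -
  interpret O: cstar_alg K.Ops by (rule K.cstar_alg_Ops)
  note h = star_homD[OF reg_hom]
  have X: "reg ` carrier FS \<subseteq> carrier K.Ops" "\<one>\<^bsub>K.Ops\<^esub> \<in> reg ` carrier FS"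
    "!!T U. T \<in> reg ` carrier FS ==> U \<in> reg ` carrier FS ==> T \<otimes>\<^bsub>K.Ops\<^esub> U \<in> reg ` carrier FS"
    "!!T. T \<in> reg ` carrier FS ==> star K.Ops T \<in> reg ` carrier FS"
    using reg_closed by (auto simp flip: h(2,4,6))
  show "cstar_alg Red" "carrier Red = closed_span K.Ops (reg ` carrier FS)"
    "T \<in> carrier Red ==> T' \<in> carrier Red ==> T \<ominus>\<^bsub>Red\<^esub> T' = T \<ominus>\<^bsub>K.Ops\<^esub> T'"
    using O.closed_subalgebra[OF X] by (simp_all add: reduced_cross_sectional_def)
qed

lemma reg_Red: "star_hom FS Red reg"
proof -
  interpret O: cstar_alg K.Ops by (rule K.cstar_alg_Ops)
  note h = star_homD[OF reg_hom]
  have X: "reg ` carrier FS \<subseteq> carrier K.Ops" using reg_closed by auto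
  have ops: "mult Red = mult K.Ops" "one Red = one K.Ops" "add Red = add K.Ops" "smult Red = smult K.Ops" "star Red = star K.Ops"
    by (simp_all add: reduced_cross_sectional_def)
  show ?thesis
    by (rule star_homI) (use h O.closed_span_base[OF X] in \<open>simp_all add: ops Red_closure(2)\<close>)
qed

lemma nrm_Red: "f \<in> carrier FS ==> nrm Red (reg f) = nrm R0 (Lambda0 P (total f))"
  using nrm_reg by (simp add: reduced_cross_sectional_def)

lemma nrm_Red_le: "f \<in> carrier FS ==> nrm Red (reg f) \<le> nrm FS f"
  using contraction.contractive[OF contraction_Lambda0 total_closed] FB.nrm_total_le nrm_Red by fastforce

lemma contraction_ext: "contraction Full Red (extend_hom Red reg)"
  unfolding full_cross_sectional_def by (rule FB.FS.contraction_envelope[OF Red_closure(1) reg_Red nrm_Red_le])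

lemma ext_to_envelope: "f \<in> carrier FS ==> extend_hom Red reg (to_envelope FS f) = reg f"
  by (rule FB.FS.extend_hom_to_envelope[OF Red_closure(1) reg_Red nrm_Red_le])

lemma pi_total: "pi ` left_hull S \<subseteq> total ` carrier FS"
proof
  fix x assume "x \<in> pi ` left_hull S"
  then obtain q where q: "q \<in> left_hull S" "x = pi q" by blast
  have "total (gen q) = pi q" unfolding gen_def by (rule FB.total_single) (use q in \<open>auto intro: pi_Bd\<close>)
  then show "x \<in> total ` carrier FS" using gen_FS[of q] q by (intro image_eqI[of _ _ "gen q"]) (auto simp: I_l_simps)
qed

lemma dense_A: "a \<in> carrier A ==> \<exists>x. (\<forall>n. x n \<in> carrier FS) \<and> converges A (\<lambda>n. total (x n)) a"
  by (rule A.closed_span_image_approx[OF FB.star_alg_FS FB.total_hom pi_total A_generated])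

text \<open>The reduced algebra is the closed span of the operators \<open>Lam P p\<close>, and each
  of their cosets is \<open>Lambda0\<close> of the sum of a finite section.\<close>

lemma dense_R0: "T \<in> carrier R0 ==> \<exists>x. (\<forall>n. x n \<in> carrier FS) \<and> converges R0 (\<lambda>n. Lambda0 P (total (x n))) T"
proof -
  interpret h: contraction A R0 "Lambda0 P" by (rule contraction_Lambda0)
  assume "T \<in> carrier R0"
  then obtain t where t: "t \<in> carrier R" "T = Q.c.ideal +>\<^bsub>R\<^esub> t" by (auto simp: R0_eq Q.c.q.carrier_quot)
  have LR: "Lam P ` carrier P \<subseteq> carrier R"
    using contraction.hom_closed[OF I.contraction_Lambda I.iota_closed] I.Lambda_iota by fastforce
  have "t \<in> closed_span R (Lam P ` carrier P)"
  proof -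
    interpret B: cstar_alg "B_hilb P" by (rule I.cstar_alg_B_hilb)
    have tB: "t \<in> closed_span (B_hilb P) (Lam P ` carrier P)" using t(1) by (simp add: I.cstar_r_closure(2))
    have XB: "Lam P ` carrier P \<subseteq> carrier (B_hilb P)" using I.Lam_closed by auto
    obtain y where y: "!!n. y n \<in> lin_span (B_hilb P) (Lam P ` carrier P)" "converges (B_hilb P) y t"
      using B.closed_span_approx[OF tB XB] by blast
    \<comment> \<open>The two records have the same operations and differ only in the carrier, so
      linear combinations are the same.\<close>
    have yR: "y n \<in> lin_span R (Lam P ` carrier P)" for n
      using y(1)[of n]
    proof (induction)
      case zero then show ?case using lin_span.zero[of R] by (simp add: cstar_r_def)
    next
      case (base x) then show ?case by (rule lin_span.base)
    next
      case (add x y) then show ?case using lin_span.add[of x R _ y] by (simp add: cstar_r_def)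
    next
      case (smult x c) then show ?case using lin_span.smult[of x R _ c] by (simp add: cstar_r_def)
    qed
    have yc: "y n \<in> carrier R" for n by (rule Q.c.lin_span_closed[OF LR yR])
    have "converges R y t"
      using y(2) I.cstar_r_closure(3)[OF yc[unfolded I.cstar_r_closure(2)] tB] unfolding converges_def
      by (simp add: R_ops I.B_hilb_Ops)
    then show ?thesis by (rule Q.c.closed_span_limit[OF Q.c.closed_span_lin_span[OF LR yR] _ t(1) LR])
  qed
  from contraction.closed_span_image[OF Q.c.contraction_coset this LR]
  have T: "T \<in> closed_span R0 ((\<lambda>x. Q.c.ideal +>\<^bsub>R\<^esub> x) ` Lam P ` carrier P)" by (simp add: t(2) R0_eq)
  have "(\<lambda>x. Q.c.ideal +>\<^bsub>R\<^esub> x) ` Lam P ` carrier P \<subseteq> (\<lambda>f. Lambda0 P (total f)) ` carrier FS"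
  proof (safe)
    fix p assume p: "p \<in> carrier P"
    then obtain f where f: "f \<in> carrier FS" "pi p = total f" using pi_total by (force simp: I_l_simps)
    have "Lambda0 P (pi p) = Q.c.ideal +>\<^bsub>R\<^esub> Lam P p"
      unfolding Lambda0_eq pi_eq Q.hq_coset[OF I.iota_closed[OF p]] I.Lambda_iota[OF p] ..
    then show "Q.c.ideal +>\<^bsub>R\<^esub> Lam P p \<in> (\<lambda>f. Lambda0 P (total f)) ` carrier FS" using f by (metis image_eqI)
  qed
  then show ?thesis
    by (rule h.C.closed_span_image_approx[OF FB.star_alg_FS star_hom_compose[OF FB.total_hom h.hom, unfolded comp_def] _ T])
qed

lemma dense_Full: "X \<in> carrier Full ==> \<exists>x. (\<forall>n. x n \<in> carrier FS) \<and> converges Full (\<lambda>n. to_envelope FS (x n)) X"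
  unfolding full_cross_sectional_def by (metis FB.FS.envelope_approx)

lemma dense_Red: "T \<in> carrier Red ==> \<exists>x. (\<forall>n. x n \<in> carrier FS) \<and> converges Red (\<lambda>n. extend_hom Red reg (to_envelope FS (x n))) T"
proof -
  interpret O: cstar_alg K.Ops by (rule K.cstar_alg_Ops)
  assume T: "T \<in> carrier Red"
  obtain x where x: "!!n. x n \<in> carrier FS" "converges K.Ops (\<lambda>n. reg (x n)) T"
    using O.closed_span_image_approx[OF FB.star_alg_FS reg_hom order_refl, of T] T by (auto simp: Red_closure(2))
  have "reg (x n) \<in> carrier Red" for n by (rule star_homD(1)[OF reg_Red x(1)])
  then have "converges Red (\<lambda>n. reg (x n)) T"
    using x(2) T by (simp add: converges_def Red_closure(3)) (simp add: reduced_cross_sectional_def)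
  then show ?thesis using x(1) by (intro exI[of _ x]) (simp add: ext_to_envelope[OF x(1)])
qed

text \<open>Both maps are star-homomorphisms in any case, so the equivalence concerns bijectivity
  only, and \<open>bij_transfer\<close> is applied in each direction.\<close>

theorem Lambda0_iso_iff_amenable: "star_iso A R0 (Lambda0 P) \<longleftrightarrow> amenable A G Bd"
proof -
  have cF: "cstar_alg Full" unfolding full_cross_sectional_def by (rule FB.FS.cstar_alg_envelope)
  have hF: "star_hom FS Full (to_envelope FS)" unfolding full_cross_sectional_def by (rule FB.FS.to_envelope_hom)
  have nF: "nrm A (total x) = nrm Full (to_envelope FS x)" if "x \<in> carrier FS" for x
    using nrm_total[OF that] FB.FS.nrm_to_envelope[OF that] by (simp add: full_cross_sectional_def)
  have nR: "nrm R0 (Lambda0 P (total x)) = nrm Red (extend_hom Red reg (to_envelope FS x))" if "x \<in> carrier FS" for x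
    using nrm_Red[OF that] ext_to_envelope[OF that] by simp
  let ?h = "extend_hom Red reg"
  have "bij_betw (Lambda0 P) (carrier A) (carrier R0) \<longleftrightarrow> bij_betw ?h (carrier Full) (carrier Red)"
  proof
    assume b: "bij_betw (Lambda0 P) (carrier A) (carrier R0)"
    show "bij_betw ?h (carrier Full) (carrier Red)"
      by (rule bij_transfer[OF FB.star_alg_FS contraction_Lambda0 contraction_ext A.cstar_alg_axioms cF FB.total_hom hF])
        (fact nF nR dense_A dense_Full dense_Red b)+
  next
    assume b: "bij_betw ?h (carrier Full) (carrier Red)"
    show "bij_betw (Lambda0 P) (carrier A) (carrier R0)"
      by (rule bij_transfer[OF FB.star_alg_FS contraction_ext contraction_Lambda0 cF A.cstar_alg_axioms hF FB.total_hom])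
        (fact nF[symmetric] nR[symmetric] dense_Full dense_A dense_R0 b)+
  qed
  then show ?thesis
    unfolding amenable_def star_iso_iff using contraction.hom[OF contraction_Lambda0] contraction.hom[OF contraction_ext] by simp
qed

end

theorem theorem3p5p5:
  fixes S :: "('a, 'm) monoid_scheme" and G :: "('g, 'n) monoid_scheme" and \<phi> :: "'a \<Rightarrow> 'g"
  assumes "monoid S" and "group G"
    and "\<phi> \<in> hom S G" and "\<phi> \<one>\<^bsub>S\<^esub> = \<one>\<^bsub>G\<^esub>" and "inj_on \<phi> (carrier S)"
  shows "star_iso (cstar0 (I_l S)) (cstar_r0 (I_l S)) (Lambda0 (I_l S)) \<longleftrightarrow>
    amenable (cstar0 (I_l S)) G (hull_bundle S G \<phi>)"
proof -
  interpret semigroup_in_group S G \<phi>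
    by (intro semigroup_in_group.intro semigroup_in_group_axioms.intro assms)
  show ?thesis by (rule Lambda0_iso_iff_amenable)
qed

end
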